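(* Let $d\in\{1,2,3\}$ and let $(\vec F_n)_{n\in\mathbb N}$, $\vec F_n=(F_{n,i})_{i\in\mathbb N}$, be a $d$-admissible sequence of random infinite vectors that converges in law (in the sense of finite-dimensional marginals) to some random infinite vector $\vec F_\infty$. Then there exists a sequence $\vec Y=(Y_i)_{i\in\mathbb N}$ of elements of $\mathcal W_{\le d}$ such that $\vec F_\infty$ and $\vec Y$ have the same law.
   Context: Let $\vec G=(G_i)_{i\in\mathbb N}$ be independent standard Gaussian variables and $H_k$ the Hermite polynomial of degree $k$. The Wiener chaos $\mathcal W_p$ of order $p$ is the closed linear span in $L^2(\mathbf P)$ of $\{\prod_{i}H_{k_i}(G_i):\sum_i k_i=p\}$, and $\mathcal W_{\le d}=\bigoplus_{p=0}^d\mathcal W_p$. A sequence $(\vec F_n)$ of random infinite vectors is $d$-admissible ($d\in\mathbb N^*$) if: there is $K\in\mathbb N^*$ such that for every $i$ there is $p_i\in\{0,\dots,K\}$ with $F_{n,i}\in\mathcal W_{p_i}$ and $\mathbf E[F_{n,i}^2]=1$ for all $n$; and for every $i$, either $p_i\le d$ or $F_{n,i}$ converges in law to $\mathcal N(0,1)$ as $n\to\infty$. *)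

theory Defs
  imports "HOL-Probability.Probability" "HOL-Computational_Algebra.Polynomial"
begin

text \<open>Probabilists' Hermite polynomials; see \<open>hermite_rodrigues\<close> for the Rodrigues formula.
  A normalisation such as \<open>1 / k!\<close> would not change the linear spans below.\<close>

fun hermite :: "nat \<Rightarrow> real poly" where
  "hermite 0 = 1"
| "hermite (Suc k) = [:0, 1:] * hermite k - pderiv (hermite k)"

lemma hermite_rodrigues:
  "(deriv ^^ k) (\<lambda>x. exp (- x\<^sup>2 / 2)) = (\<lambda>x. (-1) ^ k * poly (hermite k) x * exp (- x\<^sup>2 / 2))"
proof (induction k)
  case 0
  show ?case by simp
next
  case (Suc k)
  have "((\<lambda>x. (-1) ^ k * poly (hermite k) x * exp (- x\<^sup>2 / 2)) has_field_derivative
      (-1) ^ Suc k * poly (hermite (Suc k)) x * exp (- x\<^sup>2 / 2)) (at x)" for x :: real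
    by (auto intro!: derivative_eq_intros simp: algebra_simps)
  then show ?case
    by (simp only: funpow.simps o_apply Suc.IH) (blast intro: DERIV_imp_deriv ext)
qed

text \<open>Elements of $L^2$ are represented by functions rather than by classes modulo almost sure
  equality.\<close>

definition L2 :: "'a measure \<Rightarrow> ('a \<Rightarrow> real) set" where
  "L2 M = {f \<in> borel_measurable M. integrable M (\<lambda>\<omega>. (f \<omega>)\<^sup>2)}"

definition fun_span :: "('a \<Rightarrow> real) set \<Rightarrow> ('a \<Rightarrow> real) set" where
  "fun_span B = {\<lambda>\<omega>. \<Sum>b\<in>S. c b * b \<omega> | S c. finite S \<and> S \<subseteq> B}"

definition L2_closed_span :: "'a measure \<Rightarrow> ('a \<Rightarrow> real) set \<Rightarrow> ('a \<Rightarrow> real) set" where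
  "L2_closed_span M B =
    {f \<in> L2 M. \<forall>\<epsilon>>0. \<exists>g \<in> fun_span B \<inter> L2 M. sqrt (\<integral>\<omega>. (f \<omega> - g \<omega>)\<^sup>2 \<partial>M) < \<epsilon>}"

text \<open>Since \<open>hermite 0 = 1\<close>, the product over all indices is the product over the support.\<close>

definition hermite_products :: "(nat \<Rightarrow> 'a \<Rightarrow> real) \<Rightarrow> nat \<Rightarrow> ('a \<Rightarrow> real) set" where
  "hermite_products G p =
    {\<lambda>\<omega>. \<Prod>i | k i \<noteq> 0. poly (hermite (k i)) (G i \<omega>) | k :: nat \<Rightarrow> nat.
      finite {i. k i \<noteq> 0} \<and> (\<Sum>i | k i \<noteq> 0. k i) = p}"

definition wiener_chaos :: "'a measure \<Rightarrow> (nat \<Rightarrow> 'a \<Rightarrow> real) \<Rightarrow> nat \<Rightarrow> ('a \<Rightarrow> real) set" where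
  "wiener_chaos M G p = L2_closed_span M (hermite_products G p)"

definition wiener_chaos_upto :: "'a measure \<Rightarrow> (nat \<Rightarrow> 'a \<Rightarrow> real) \<Rightarrow> nat \<Rightarrow> ('a \<Rightarrow> real) set" where
  "wiener_chaos_upto M G d =
    {\<lambda>\<omega>. \<Sum>p\<le>d. f p \<omega> | f. \<forall>p\<le>d. f p \<in> wiener_chaos M G p}"

definition admissible ::
    "'a measure \<Rightarrow> (nat \<Rightarrow> 'a \<Rightarrow> real) \<Rightarrow> nat \<Rightarrow> (nat \<Rightarrow> nat \<Rightarrow> 'a \<Rightarrow> real) \<Rightarrow> bool" where
  "admissible M G d F \<longleftrightarrow>
    (\<exists>K\<ge>1. \<exists>p :: nat \<Rightarrow> nat. \<forall>i.
      p i \<le> K \<and>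
      (\<forall>n. F n i \<in> wiener_chaos M G (p i) \<and> (\<integral>\<omega>. (F n i \<omega>)\<^sup>2 \<partial>M) = 1) \<and>
      (p i \<le> d \<or> weak_conv_m (\<lambda>n. distr M borel (F n i)) std_normal_distribution))"

text \<open>Convergence in law of all finite-dimensional marginals, tested against bounded continuous
  functions on $\mathbb{R}^I$ for finite \<open>I\<close>.\<close>

definition fdd_converges ::
    "'a measure \<Rightarrow> (nat \<Rightarrow> nat \<Rightarrow> 'a \<Rightarrow> real) \<Rightarrow> 'b measure \<Rightarrow> (nat \<Rightarrow> 'b \<Rightarrow> real) \<Rightarrow> bool" where
  "fdd_converges M X N Y \<longleftrightarrow>
    (\<forall>I \<phi>. finite I \<and> continuous_map (powertop_real I) euclideanreal \<phi> \<and>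
        bounded (\<phi> ` topspace (powertop_real I)) \<longrightarrow>
      (\<lambda>n. \<integral>\<omega>. \<phi> (\<lambda>i\<in>I. X n i \<omega>) \<partial>M) \<longlonglongrightarrow> (\<integral>\<omega>. \<phi> (\<lambda>i\<in>I. Y i \<omega>) \<partial>N))"

definition law :: "'a measure \<Rightarrow> (nat \<Rightarrow> 'a \<Rightarrow> real) \<Rightarrow> (nat \<Rightarrow> real) measure" where
  "law M X = distr M (\<Pi>\<^sub>M i\<in>UNIV. borel) (\<lambda>\<omega> i. X i \<omega>)"

end

theory Submission
  imports Defs
begin

text \<open>Chaos elements are approximated by finite sums $I_p(f) = \sum_k c_k {:}v_k^p{:}$ of Wick powers
  over finitely supported vectors. For each $n$ an orthonormal system of directions with large influence
  on the components is chosen greedily and rotated to the first coordinates. Expanding along these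
  coordinates, $F_{n,i}$ becomes a sum over $r \<le> p_i$ of Hermite polynomials of degree $r$ in the
  leading coordinates, times remainders of order $p_i - r$ in the others, in which all directions have
  vanishing influence. A chaos element of order at most 3 with vanishing influences has vanishing
  contractions: this is where $d \<le> 3$ enters, since contractions of type $(1, q - 1)$ are bounded by
  influences, but those of type $(2, 2)$ are not. By the quantitative fourth moment theorem the
  remainders of positive order are asymptotically jointly Gaussian. Components with $p_i > d$ are
  themselves asymptotically Gaussian, and the fourth moment theorem also makes all their influences
  vanish, so they need no expansion. The limit thus replaces every remainder of positive order by a
  Gaussian variable (built from the odd coordinates, the leading ones being placed on the even
  coordinates), which lowers the order from $p_i$ to $r + 1 \<le> p_i$, and stays in $\mathcal W_{\<le> d}$.\<close>

section \<open>Finitely supported vectors and Wick powers\<close>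

text \<open>All computations take place on finite weighted lists of vectors: mixed moments of Wick
  powers are polynomials in inner products, so contraction norms are finite sums and positivity
  means being a finite sum of squares. Laws are tested by \<open>cos (X v _ + \<theta>)\<close>: the
  free phase supplies the sine and absorbs constants, and \<open>X v\<close> forms linear
  combinations, so joint laws need no separate treatment. The obstacle is that no fixed number of
  leading coordinates makes the remaining influences vanish in the limit, whereas the central limit
  theorem wants finitely many fixed coefficients. Two cutoffs reconcile this. Remainders live beyond
  a growing bound \<open>m n\<close>, the expansion uses only coordinates below a fixed M, and the
  coordinates in between are discarded at the cost of their influences. These influences have
  summable limits, so the cost disappears when n and afterwards M tends to infinity. For fixed M the
  expansion is linear in the remainders once the leading coordinates are frozen, and the limit in M
  exists in L2 because the Cauchy estimate is inherited from finite n.\<close>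

typedef fvec = "{v::nat \<Rightarrow> real. finite {k. v k \<noteq> 0}}" morphisms coord Abs_fvec
  by (rule exI[of _ "\<lambda>_. 0"]) simp

setup_lifting type_definition_fvec

instantiation fvec :: real_vector
begin
lift_definition zero_fvec :: fvec is "\<lambda>_. 0" by simp
lift_definition plus_fvec :: "fvec \<Rightarrow> fvec \<Rightarrow> fvec" is "\<lambda>v w k. v k + w k"
  subgoal for v w by (rule finite_subset[of _ "{k. v k \<noteq> 0} \<union> {k. w k \<noteq> 0}"]) auto done
lift_definition minus_fvec :: "fvec \<Rightarrow> fvec \<Rightarrow> fvec" is "\<lambda>v w k. v k - w k"
  subgoal for v w by (rule finite_subset[of _ "{k. v k \<noteq> 0} \<union> {k. w k \<noteq> 0}"]) auto done
lift_definition uminus_fvec :: "fvec \<Rightarrow> fvec" is "\<lambda>v k. - v k" by simp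
lift_definition scaleR_fvec :: "real \<Rightarrow> fvec \<Rightarrow> fvec" is "\<lambda>r v k. r * v k"
  subgoal for r v by (rule finite_subset[of _ "{k. v k \<noteq> 0}"]) auto done
instance
  by standard (transfer; simp add: algebra_simps fun_eq_iff)+
end

abbreviation supp :: "fvec \<Rightarrow> nat set" where "supp v \<equiv> {k. coord v k \<noteq> 0}"

lemma finite_supp[simp]: "finite (supp v)"
  using coord[of v] by simp

lemma coord_simps[simp]:
  "coord 0 k = 0" "coord (v + w) k = coord v k + coord w k" "coord (v - w) k = coord v k - coord w k"
  "coord (- v) k = - coord v k" "coord (r *\<^sub>R v) k = r * coord v k"
  by (transfer; simp)+

lemma fvec_eqI: "(\<And>k. coord v k = coord w k) \<Longrightarrow> v = w"
  by transfer auto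

lemma coord_sum[simp]: "coord (\<Sum>i\<in>A. g i) k = (\<Sum>i\<in>A. coord (g i) k)"
  by (induction A rule: infinite_finite_induct) auto

instantiation fvec :: real_inner
begin
definition inner_fvec :: "fvec \<Rightarrow> fvec \<Rightarrow> real" where
  "inner_fvec v w = (\<Sum>k\<in>supp v. coord v k * coord w k)"
definition norm_fvec :: "fvec \<Rightarrow> real" where "norm_fvec v = sqrt (inner v v)"
definition dist_fvec :: "fvec \<Rightarrow> fvec \<Rightarrow> real" where "dist_fvec v w = norm (v - w)"
definition sgn_fvec :: "fvec \<Rightarrow> fvec" where "sgn_fvec v = v /\<^sub>R norm v"
definition uniformity_fvec :: "(fvec \<times> fvec) filter" where
  "uniformity_fvec = (INF e\<in>{0 <..}. principal {(x, y). dist x y < e})"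
definition open_fvec :: "fvec set \<Rightarrow> bool" where
  "open_fvec U = (\<forall>x\<in>U. eventually (\<lambda>(x', y). x' = x \<longrightarrow> y \<in> U) uniformity)"

lemma inner_fvec_superset:
  assumes "finite A" "supp v \<subseteq> A"
  shows "inner v w = (\<Sum>k\<in>A. coord v k * coord w k)"
  unfolding inner_fvec_def using assms by (intro sum.mono_neutral_left) auto

instance
proof
  fix x y z :: fvec and r :: real
  have U: "finite (supp x \<union> supp y)" "supp (x + y) \<subseteq> supp x \<union> supp y" by auto
  show "inner x y = inner y x"
    using U by (simp add: inner_fvec_superset[of "supp x \<union> supp y"] mult.commute)
  show "inner (x + y) z = inner x z + inner y z"
    using U by (simp add: inner_fvec_superset[of "supp x \<union> supp y"] algebra_simps sum.distrib)
  show "inner (r *\<^sub>R x) y = r * inner x y"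
    using inner_fvec_superset[of "supp x" "r *\<^sub>R x" y]
    by (auto simp: inner_fvec_superset[of "supp x" x] algebra_simps sum_distrib_left)
  show "0 \<le> inner x x" by (auto simp: inner_fvec_def intro!: sum_nonneg)
  show "(inner x x = 0) = (x = 0)"
  proof
    assume "inner x x = 0"
    then have "\<forall>k\<in>supp x. coord x k * coord x k = 0"
      unfolding inner_fvec_def by (subst (asm) sum_nonneg_eq_0_iff) auto
    then show "x = 0" by (intro fvec_eqI) auto
  qed (simp add: inner_fvec_def)
qed (simp_all add: norm_fvec_def dist_fvec_def sgn_fvec_def uniformity_fvec_def open_fvec_def)
end

lift_definition ev :: "nat \<Rightarrow> fvec" is "\<lambda>j k. if k = j then 1 else 0" by simp

lemma coord_ev[simp]: "coord (ev j) k = (if k = j then 1 else 0)"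
  by transfer simp

lemma supp_ev[simp]: "{k. coord (ev j) k \<noteq> 0} = {j}" by auto

lemma inner_ev[simp]: "inner (ev j) v = coord v j" "inner v (ev j) = coord v j"
  by (simp_all add: inner_fvec_def[of "ev j"] inner_commute[of v])

lemma fvec_expand': "finite A \<Longrightarrow> supp v \<subseteq> A \<Longrightarrow> v = (\<Sum>k\<in>A. coord v k *\<^sub>R ev k)"
  by (rule fvec_eqI) (auto simp: if_distrib[of "(*) _"] sum.delta' cong: if_cong)

lemma fvec_expand: "v = (\<Sum>k\<in>supp v. coord v k *\<^sub>R ev k)"
  by (rule fvec_expand') auto

section \<open>Gaussian variables, Hermite polynomials with a variance parameter, Wick
  powers\<close>

definition X :: "fvec \<Rightarrow> (nat \<Rightarrow> real) \<Rightarrow> real" where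
  "X v x = (\<Sum>k\<in>supp v. coord v k * x k)"

lemma X_superset:
  assumes "finite A" "supp v \<subseteq> A"
  shows "X v x = (\<Sum>k\<in>A. coord v k * x k)"
  unfolding X_def using assms by (intro sum.mono_neutral_left) auto

lemma X_add: "X (v + w) x = X v x + X w x"
  using X_superset[of "supp v \<union> supp w" v] X_superset[of "supp v \<union> supp w" w]
    X_superset[of "supp v \<union> supp w" "v + w"]
  by (auto simp: algebra_simps sum.distrib subset_iff)

lemma X_scale: "X (r *\<^sub>R v) x = r * X v x"
  using X_superset[of "supp v" "r *\<^sub>R v"] by (auto simp: X_superset[of "supp v" v] algebra_simps sum_distrib_left)

lemma X_zero[simp]: "X 0 x = 0" by (simp add: X_def)
lemma X_ev[simp]: "X (ev k) x = x k" by (simp add: X_def)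

lemma X_sum: "X (\<Sum>i\<in>A. g i) x = (\<Sum>i\<in>A. X (g i) x)"
  by (induction A rule: infinite_finite_induct) (auto simp: X_add)

lemma X_upd: "X v (x(k := s)) = X v x + coord v k * (s - x k)"
proof -
  have "supp v \<subseteq> insert k (supp v)" by auto
  then show ?thesis
    by (simp add: X_superset[of "insert k (supp v)" v] sum.insert_remove algebra_simps)
qed

text \<open>The Hermite polynomial of variance A, that is A^(n/2) times the n-th Hermite polynomial
  at x / sqrt A. The recurrence stays meaningful at A = 0, where it yields x^n.\<close>

fun wp :: "nat \<Rightarrow> real \<Rightarrow> real \<Rightarrow> real" where
  "wp 0 A x = 1"
| "wp (Suc 0) A x = x"
| "wp (Suc (Suc n)) A x = x * wp (Suc n) A x - real (Suc n) * A * wp n A x"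

lemma wp_Suc: "wp (Suc n) A x = x * wp n A x - real n * A * wp (n - 1) A x"
  by (cases n) auto

text \<open>Binomial type: the generating function exp (t x - A t^2 / 2) is multiplicative in the
  pair (A, x). In the induction, multiplying by x + y creates lower-order terms, and the variance
  term of the recurrence cancels exactly these.\<close>

lemma wp_add: "wp n (A + B) (x + y) = (\<Sum>i\<le>n. real (n choose i) * wp i A x * wp (n - i) B y)"
proof (induction n "A + B" "x + y" rule: wp.induct)
  case (3 n)
  define c where "c n i = wp i A x * wp (n - i) B y" for n i
  have IH1: "wp (Suc n) (A + B) (x + y) = (\<Sum>i\<le>Suc n. real (Suc n choose i) * c (Suc n) i)"
    using 3(1) by (simp add: c_def mult.assoc)
  have IH2: "wp n (A + B) (x + y) = (\<Sum>i\<le>n. real (n choose i) * c n i)"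
    using 3(2) by (simp add: c_def mult.assoc)
  have ax: "x * c (Suc n) i = wp (Suc i) A x * wp (Suc n - i) B y + real i * A * (wp (i - 1) A x * wp (Suc n - i) B y)" for i
    by (simp add: c_def wp_Suc algebra_simps)
  have ay: "y * c (Suc n) i = wp i A x * wp (Suc (Suc n - i)) B y + real (Suc n - i) * B * (wp i A x * wp (Suc n - i - 1) B y)" for i
    by (simp add: c_def wp_Suc algebra_simps)
  have sA: "(\<Sum>i\<le>Suc n. real (Suc n choose i) * (real i * A * (wp (i - 1) A x * wp (Suc n - i) B y)))
     = real (Suc n) * A * (\<Sum>i\<le>n. real (n choose i) * c n i)"
  proof -
    have h: "real (Suc n choose Suc i) * real (Suc i) = real (Suc n) * real (n choose i)" for i
      using Suc_times_binomial[of i n] by (metis mult.commute of_nat_mult)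
    have e: "real (Suc n choose Suc i) * (real (Suc i) * A * (wp i A x * wp (n - i) B y)) = real (Suc n) * A * (real (n choose i) * c n i)"
      if "real (Suc n choose Suc i) * real (Suc i) = real (Suc n) * real (n choose i)" for i
    proof -
      have "real (Suc n choose Suc i) * (real (Suc i) * A * (wp i A x * wp (n - i) B y))
        = (real (Suc n choose Suc i) * real (Suc i)) * (A * (wp i A x * wp (n - i) B y))"
        by (simp only: mult_ac)
      then show ?thesis unfolding that c_def by (simp only: mult_ac)
    qed
    show ?thesis
      by (subst sum.atMost_Suc_shift) (simp add: sum_distrib_left e[OF h] del: of_nat_Suc binomial_Suc_Suc)
  qed
  have sB: "(\<Sum>i\<le>Suc n. real (Suc n choose i) * (real (Suc n - i) * B * (wp i A x * wp (Suc n - i - 1) B y)))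
     = real (Suc n) * B * (\<Sum>i\<le>n. real (n choose i) * c n i)"
  proof -
    have "real (Suc n choose i) * real (Suc n - i) = real (Suc n) * real (n choose i)" if "i \<le> n" for i
      using binomial_absorb_comp[of "Suc n" i] by (metis diff_Suc_1 mult.commute of_nat_mult)
    note h = this
    have e: "real (Suc n choose i) * (real (Suc n - i) * B * (wp i A x * wp (Suc n - i - 1) B y)) = real (Suc n) * B * (real (n choose i) * c n i)" if "i \<le> n" for i
    proof -
      have "real (Suc n choose i) * (real (Suc n - i) * B * (wp i A x * wp (Suc n - i - 1) B y))
        = (real (Suc n choose i) * real (Suc n - i)) * (B * (wp i A x * wp (Suc n - i - 1) B y))"
        by (simp only: mult_ac)
      moreover have "Suc n - i - 1 = n - i" by simp
      ultimately show ?thesis unfolding h[OF that] c_def by (simp only: mult_ac)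
    qed
    have "(\<Sum>i\<le>n. real (Suc n choose i) * (real (Suc n - i) * B * (wp i A x * wp (Suc n - i - 1) B y))) = (\<Sum>i\<le>n. real (Suc n) * B * (real (n choose i) * c n i))"
      by (intro sum.cong refl e) auto
    then show ?thesis
      by (simp only: sum.atMost_Suc sum_distrib_left) simp
  qed
  \<comment> \<open>Pascal's rule separates the terms that raise the index of x from those that
    raise the index of y.\<close>
  have main: "(\<Sum>i\<le>Suc (Suc n). real (Suc (Suc n) choose i) * c (Suc (Suc n)) i)
     = (\<Sum>i\<le>Suc n. real (Suc n choose i) * (wp (Suc i) A x * wp (Suc n - i) B y)) + (\<Sum>i\<le>Suc n. real (Suc n choose i) * (wp i A x * wp (Suc (Suc n - i)) B y))"
  proof -
    have "(\<Sum>i\<le>Suc (Suc n). real (Suc (Suc n) choose i) * c (Suc (Suc n)) i)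
      = c (Suc (Suc n)) 0 + (\<Sum>i\<le>Suc n. real (Suc n choose i) * c (Suc (Suc n)) (Suc i)) + (\<Sum>i\<le>Suc n. real (Suc n choose Suc i) * c (Suc (Suc n)) (Suc i))"
      by (subst sum.atMost_Suc_shift) (simp add: algebra_simps sum.distrib del: sum.atMost_Suc)
    also have "c (Suc (Suc n)) 0 + (\<Sum>i\<le>Suc n. real (Suc n choose i) * c (Suc (Suc n)) (Suc i)) + (\<Sum>i\<le>Suc n. real (Suc n choose Suc i) * c (Suc (Suc n)) (Suc i))
       = (\<Sum>i\<le>Suc n. real (Suc n choose i) * c (Suc (Suc n)) (Suc i)) + (\<Sum>i\<le>Suc (Suc n). real (Suc n choose i) * c (Suc (Suc n)) i)"
      by (subst (3) sum.atMost_Suc_shift) simp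
    also have "(\<Sum>i\<le>Suc (Suc n). real (Suc n choose i) * c (Suc (Suc n)) i) = (\<Sum>i\<le>Suc n. real (Suc n choose i) * c (Suc (Suc n)) i)"
      by (simp add: binomial_eq_0)
    also have "\<dots> = (\<Sum>i\<le>Suc n. real (Suc n choose i) * (wp i A x * wp (Suc (Suc n - i)) B y))"
      by (intro sum.cong refl) (simp add: c_def Suc_diff_le)
    finally show ?thesis by (simp add: c_def del: sum.atMost_Suc)
  qed
  have "wp (Suc (Suc n)) (A + B) (x + y) = (\<Sum>i\<le>Suc n. real (Suc n choose i) * (x * c (Suc n) i)) + (\<Sum>i\<le>Suc n. real (Suc n choose i) * (y * c (Suc n) i))
      - real (Suc n) * (A + B) * (\<Sum>i\<le>n. real (n choose i) * c n i)"
    unfolding wp.simps(3) IH1 IH2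
    by (simp add: sum_distrib_left algebra_simps sum.distrib del: sum.atMost_Suc binomial_Suc_Suc of_nat_Suc)
  also have "\<dots> = (\<Sum>i\<le>Suc (Suc n). real (Suc (Suc n) choose i) * c (Suc (Suc n)) i)"
    unfolding ax ay distrib_left sum.distrib main sA sB by (simp add: algebra_simps del: sum.atMost_Suc binomial_Suc_Suc of_nat_Suc)
  finally show ?case by (simp only: c_def mult.assoc)
qed auto

lemma wp_scale: "wp n (s\<^sup>2 * A) (s * x) = s ^ n * wp n A x"
  by (induction n A x rule: wp.induct) (auto simp: algebra_simps power2_eq_square)

text \<open>Turns the recurrence by derivatives that defines \<open>hermite\<close> into the
  three-term recurrence of \<open>wp\<close>.\<close>

lemma pderiv_hermite: "pderiv (hermite k) = smult (real k) (hermite (k - 1))"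
proof (induction k rule: less_induct)
  case (less k)
  show ?case
  proof (cases k)
    case (Suc j)
    have h: "hermite (Suc j) = [:0, 1:] * hermite j - smult (real j) (hermite (j - 1))"
      using less[of j] Suc by simp
    have "pderiv (hermite (Suc j)) = hermite j + [:0,1:] * smult (real j) (hermite (j - 1)) - smult (real j) (pderiv (hermite (j - 1)))"
      unfolding h pderiv_diff pderiv_mult pderiv_smult using less[of j] Suc by (simp add: pderiv_pCons)
    also have "\<dots> = smult (real (Suc j)) (hermite j)"
    proof (cases j)
      case (Suc i)
      have "hermite j = [:0,1:] * hermite i - pderiv (hermite i)" using Suc by simp
      then have P: "poly (pderiv (hermite i)) x = x * poly (hermite i) x - poly (hermite j) x" for x by simp
      have "poly (hermite j + [:0,1:] * smult (real j) (hermite (j - 1)) - smult (real j) (pderiv (hermite (j - 1)))) x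
        = poly (smult (real (Suc j)) (hermite j)) x" for x
      proof -
        have "j - 1 = i" using Suc by simp
        then show ?thesis
          by (simp only: poly_add poly_diff poly_mult poly_smult P) (simp add: algebra_simps del: hermite.simps)
      qed
      then show ?thesis by (subst poly_eq_poly_eq_iff[symmetric]) auto
    qed simp
    finally show ?thesis using Suc by simp
  qed simp
qed

lemma wp_hermite: "wp n 1 x = poly (hermite n) x"
proof (induction n rule: less_induct)
  case (less n)
  show ?case
  proof (cases n)
    case (Suc k)
    have "poly (hermite (Suc k)) x = x * poly (hermite k) x - real k * poly (hermite (k - 1)) x"
      by (simp add: pderiv_hermite)
    then show ?thesis
      using less[of k] less[of "k - 1"] Suc by (auto simp: wp_Suc simp del: wp.simps(3) hermite.simps(2))
  qed simp
qed

definition wk :: "nat \<Rightarrow> fvec \<Rightarrow> (nat \<Rightarrow> real) \<Rightarrow> real" where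
  "wk n v x = wp n (inner v v) (X v x)"

lemma wk_0[simp]: "wk 0 v x = 1" by (simp add: wk_def)
lemma wk_1[simp]: "wk (Suc 0) v x = X v x" by (simp add: wk_def)
lemma wk_Suc: "wk (Suc n) v x = X v x * wk n v x - real n * inner v v * wk (n - 1) v x"
  by (simp add: wk_def wp_Suc)

text \<open>Orthogonality makes the variances add, as \<open>wp_add\<close> wants. This identity
  carries both the polarization of Hermite products and the splitting into leading coordinates and
  tail.\<close>

lemma wk_add:
  assumes "inner v w = 0"
  shows "wk n (v + w) x = (\<Sum>i\<le>n. real (n choose i) * wk i v x * wk (n - i) w x)"
  using assms by (simp add: wk_def X_add inner_add_left inner_add_right inner_commute[of w v] wp_add)

lemma wk_scale: "wk n (s *\<^sub>R v) x = s ^ n * wk n v x"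
  by (simp add: wk_def X_scale wp_scale[symmetric] power2_eq_square mult.assoc)

lemma wk_ev: "wk n (ev k) x = poly (hermite n) (x k)"
  by (simp add: wk_def wp_hermite)

text \<open>A list of weighted vectors is a formal linear combination, and \<open>S f\<close>
  extends a function linearly to it. Repetitions are allowed, so sums of tensors are concatenations
  and no normal form has to be maintained.\<close>

definition S :: "(real \<times> 'v) list \<Rightarrow> ('v \<Rightarrow> real) \<Rightarrow> real" where
  "S f \<phi> = (\<Sum>p\<leftarrow>f. fst p * \<phi> (snd p))"

lemma S_Nil[simp]: "S [] \<phi> = 0" by (simp add: S_def)
lemma S_Cons[simp]: "S ((c, v) # f) \<phi> = c * \<phi> v + S f \<phi>" by (simp add: S_def)
lemma S_append[simp]: "S (f @ g) \<phi> = S f \<phi> + S g \<phi>" by (simp add: S_def)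
lemma S_zero[simp]: "S f (\<lambda>_. 0) = 0" by (simp add: S_def)
lemma S_add: "S f (\<lambda>v. \<phi> v + \<psi> v) = S f \<phi> + S f \<psi>"
  by (induction f) (auto simp: algebra_simps)
lemma S_diff: "S f (\<lambda>v. \<phi> v - \<psi> v) = S f \<phi> - S f \<psi>"
  by (induction f) (auto simp: algebra_simps)
lemma S_mult_left: "S f (\<lambda>v. c * \<phi> v) = c * S f \<phi>"
  by (induction f) (auto simp: algebra_simps)
lemma S_mult_right: "S f (\<lambda>v. \<phi> v * c) = S f \<phi> * c"
  by (induction f) (auto simp: algebra_simps)
lemma S_sum: "S f (\<lambda>v. \<Sum>i\<in>A. \<phi> i v) = (\<Sum>i\<in>A. S f (\<phi> i))"
  by (induction A rule: infinite_finite_induct) (auto simp: S_add)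
lemma S_swap: "S f (\<lambda>v. S g (\<lambda>w. \<phi> v w)) = S g (\<lambda>w. S f (\<lambda>v. \<phi> v w))"
  by (induction f) (auto simp: S_add S_mult_left)
lemma S_cong: "f = g \<Longrightarrow> (\<And>v. v \<in> snd ` set g \<Longrightarrow> \<phi> v = \<psi> v) \<Longrightarrow> S f \<phi> = S g \<psi>"
  unfolding S_def by (intro arg_cong[where f = sum_list] map_cong) auto
lemma S_map: "S (map (\<lambda>(c, v). (c * a v, b v)) f) \<phi> = S f (\<lambda>v. a v * \<phi> (b v))"
  by (induction f) (auto simp: algebra_simps)

section \<open>Gaussian integration by parts\<close>

text \<open>Finite moments of all orders: a class closed under sums and products, so that
  integrability of any expression built from Wick powers follows from its shape.\<close>

definition Lall :: "'a measure \<Rightarrow> ('a \<Rightarrow> real) set" where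
  "Lall M = {f \<in> borel_measurable M. \<forall>k::nat. integrable M (\<lambda>x. \<bar>f x\<bar> ^ k)}"

lemma Lall_measurable[measurable_dest]: "f \<in> Lall M \<Longrightarrow> f \<in> borel_measurable M"
  by (simp add: Lall_def)

lemma Lall_integrable_abs_pow: "f \<in> Lall M \<Longrightarrow> integrable M (\<lambda>x. \<bar>f x\<bar> ^ k)"
  by (simp add: Lall_def)

lemma Lall_integrable: "f \<in> Lall M \<Longrightarrow> integrable M f"
  using Lall_integrable_abs_pow[of f M 1] Lall_measurable[of f M]
  by (subst integrable_abs_iff[symmetric]) auto

lemma Lall_const[intro!, simp]: "finite_measure M \<Longrightarrow> (\<lambda>_. c) \<in> Lall M"
  by (auto simp: Lall_def finite_measure.integrable_const)

lemma Lall_bounded: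
  assumes "finite_measure M" "f \<in> borel_measurable M" "\<And>x. \<bar>f x\<bar> \<le> B"
  shows "f \<in> Lall M"
proof -
  have "integrable M (\<lambda>x. \<bar>f x\<bar> ^ k)" for k
    using assms(2) by (intro finite_measure.integrable_const_bound[OF assms(1), where B = "B ^ k"])
      (auto intro!: AE_I2 power_mono assms(3))
  then show ?thesis using assms by (auto simp: Lall_def)
qed

lemma Lall_add[intro]: assumes "f \<in> Lall M" "g \<in> Lall M" shows "(\<lambda>x. f x + g x) \<in> Lall M"
proof -
  note [measurable] = assms[THEN Lall_measurable]
  have "integrable M (\<lambda>x. \<bar>f x + g x\<bar> ^ k)" for k
  proof (rule Bochner_Integration.integrable_bound)
    show "integrable M (\<lambda>x. 2 ^ k * (\<bar>f x\<bar> ^ k + \<bar>g x\<bar> ^ k))"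
      using assms by (auto intro!: Lall_integrable_abs_pow)
    have "\<bar>f x + g x\<bar> ^ k \<le> 2 ^ k * (\<bar>f x\<bar> ^ k + \<bar>g x\<bar> ^ k)" for x
    proof -
      have "\<bar>f x + g x\<bar> ^ k \<le> (2 * max \<bar>f x\<bar> \<bar>g x\<bar>) ^ k" by (intro power_mono) auto
      also have "\<dots> \<le> 2 ^ k * (\<bar>f x\<bar> ^ k + \<bar>g x\<bar> ^ k)"
        by (auto simp: power_mult_distrib max_def)
      finally show ?thesis .
    qed
    then show "AE x in M. norm (\<bar>f x + g x\<bar> ^ k) \<le> norm (2 ^ k * (\<bar>f x\<bar> ^ k + \<bar>g x\<bar> ^ k))"
      by (auto intro!: AE_I2 simp: abs_mult)
  qed auto
  then show ?thesis by (auto simp: Lall_def)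
qed

lemma Lall_mult[intro]: assumes "f \<in> Lall M" "g \<in> Lall M" shows "(\<lambda>x. f x * g x) \<in> Lall M"
proof -
  note [measurable] = assms[THEN Lall_measurable]
  have "integrable M (\<lambda>x. \<bar>f x * g x\<bar> ^ k)" for k
  proof (rule Bochner_Integration.integrable_bound)
    show "integrable M (\<lambda>x. \<bar>f x\<bar> ^ (2 * k) + \<bar>g x\<bar> ^ (2 * k))"
      using assms by (auto intro!: Lall_integrable_abs_pow)
    have "\<bar>f x * g x\<bar> ^ k \<le> \<bar>f x\<bar> ^ (2 * k) + \<bar>g x\<bar> ^ (2 * k)" for x
    proof -
      have "2 * (\<bar>f x\<bar> ^ k * \<bar>g x\<bar> ^ k) \<le> (\<bar>f x\<bar> ^ k)\<^sup>2 + (\<bar>g x\<bar> ^ k)\<^sup>2"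
        using sum_squares_bound[of "\<bar>f x\<bar> ^ k" "\<bar>g x\<bar> ^ k"] by (simp add: mult.assoc)
      moreover have "0 \<le> \<bar>f x\<bar> ^ k * \<bar>g x\<bar> ^ k" by simp
      ultimately show ?thesis
        unfolding abs_mult power_mult_distrib power_even_eq power_mult[symmetric] mult.commute[of 2 k] by linarith
    qed
    then show "AE x in M. norm (\<bar>f x * g x\<bar> ^ k) \<le> norm (\<bar>f x\<bar> ^ (2 * k) + \<bar>g x\<bar> ^ (2 * k))"
      by (auto intro!: AE_I2)
  qed auto
  then show ?thesis by (auto simp: Lall_def)
qed

lemma Lall_cmult: "f \<in> Lall M \<Longrightarrow> (\<lambda>x. c * f x) \<in> Lall M"
  by (auto simp: Lall_def abs_mult power_mult_distrib)

lemma Lall_diff[intro]: "f \<in> Lall M \<Longrightarrow> g \<in> Lall M \<Longrightarrow> (\<lambda>x. f x - g x) \<in> Lall M"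
  using Lall_add[of f M "\<lambda>x. -1 * g x"] Lall_cmult[of g M "-1"] by simp

lemma Lall_power[intro]: "finite_measure M \<Longrightarrow> f \<in> Lall M \<Longrightarrow> (\<lambda>x. f x ^ k) \<in> Lall M"
  by (induction k) auto

lemma Lall_sum[intro]: "finite_measure M \<Longrightarrow> (\<And>i. i \<in> A \<Longrightarrow> f i \<in> Lall M) \<Longrightarrow> (\<lambda>x. \<Sum>i\<in>A. f i x) \<in> Lall M"
  by (induction A rule: infinite_finite_induct) auto

lemma Lall_S: "finite_measure M \<Longrightarrow> (\<And>v. v \<in> snd ` set f \<Longrightarrow> \<Phi> v \<in> Lall M) \<Longrightarrow> (\<lambda>x. S f (\<lambda>v. \<Phi> v x)) \<in> Lall M"
  by (induction f) (auto intro!: Lall_add Lall_cmult)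

section \<open>The standard Gaussian measure on sequences\<close>

definition Gam :: "(nat \<Rightarrow> real) measure" where
  "Gam = (\<Pi>\<^sub>M k\<in>UNIV. std_normal_distribution)"

interpretation Nd: real_distribution std_normal_distribution by (rule real_dist_normal_dist)

interpretation GP: product_prob_space "\<lambda>_::nat. std_normal_distribution" UNIV
  by standard

interpretation Gam: prob_space Gam
  unfolding Gam_def by (rule GP.prob_space_axioms)

lemma Gam_finite[simp, intro!]: "finite_measure Gam" by standard (simp add: Gam.emeasure_space_1)

lemma space_Gam[simp]: "space Gam = UNIV"
  by (simp add: Gam_def space_PiM)

lemma sets_Gam: "sets Gam = sets (\<Pi>\<^sub>M k\<in>UNIV. borel)"
  unfolding Gam_def by (intro sets_PiM_cong) auto

lemma measurable_Gam_coord[measurable]: "(\<lambda>x. x k) \<in> borel_measurable Gam"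
  using measurable_component_singleton[of k UNIV "\<lambda>_. borel :: real measure"]
  by (simp add: measurable_cong_sets[OF sets_Gam refl])

lemma measurable_GamI:
  assumes "\<And>k. (\<lambda>x. f x k) \<in> borel_measurable M"
  shows "f \<in> measurable M Gam"
proof -
  have "f \<in> measurable M (\<Pi>\<^sub>M k\<in>UNIV. borel)"
    by (rule measurable_PiM_single') (auto simp: assms)
  then show ?thesis by (simp add: measurable_cong_sets[OF refl sets_Gam])
qed

lemma Gam_coord: "distr Gam std_normal_distribution (\<lambda>x. x k) = std_normal_distribution"
  unfolding Gam_def by (rule GP.PiM_component) simp

definition mix :: "nat set \<Rightarrow> (nat \<Rightarrow> real) \<Rightarrow> (nat \<Rightarrow> real) \<Rightarrow> nat \<Rightarrow> real" where
  "mix A x y k = (if k \<in> A then x k else y k)"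

lemma measurable_mix[measurable]: "(\<lambda>z. mix A (fst z) (snd z)) \<in> measurable (Gam \<Otimes>\<^sub>M Gam) Gam"
  by (rule measurable_GamI) (simp add: mix_def)

lemma measurable_mix2[measurable]: "mix A x \<in> measurable Gam Gam"
  by (rule measurable_GamI) (simp add: mix_def)

lemma measurable_mix1[measurable]: "(\<lambda>x. mix A x y) \<in> measurable Gam Gam"
  by (rule measurable_GamI) (simp add: mix_def)

text \<open>Two independent Gaussian sequences spliced along A form a Gaussian sequence, as cylinder
  sets show. This expresses the independence of the coordinates inside and outside A without
  changing the index set; \<open>integral_mix\<close> is the resulting Fubini theorem.\<close>

lemma Gam_mix: "distr (Gam \<Otimes>\<^sub>M Gam) Gam (\<lambda>z. mix A (fst z) (snd z)) = Gam"
proof -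
  let ?N = "std_normal_distribution"
  have emb: "prod_emb UNIV (\<lambda>_. ?N) J (Pi\<^sub>E J F) = {x. \<forall>j\<in>J. x j \<in> F j}" for J :: "nat set" and F
    by (auto simp: prod_emb_def PiE_iff)
  have em: "emeasure Gam {x. \<forall>j\<in>J. x j \<in> F j} = (\<Prod>j\<in>J. emeasure ?N (F j))"
    if "finite J" "\<And>j. j \<in> J \<Longrightarrow> F j \<in> sets ?N" for J :: "nat set" and F
    using GP.emeasure_PiM_emb[of J F] that unfolding emb Gam_def by auto
  have ms: "{x. \<forall>j\<in>J. x j \<in> F j} \<in> sets Gam"
    if "finite J" "\<And>j. j \<in> J \<Longrightarrow> F j \<in> sets ?N" for J :: "nat set" and F
  proof -
    have "{x. x j \<in> F j} \<in> sets Gam" if "j \<in> J" for j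
      using measurable_sets[OF measurable_Gam_coord, of "F j" j] \<open>\<And>j. j \<in> J \<Longrightarrow> F j \<in> sets ?N\<close>[OF that] by (simp add: vimage_def)
    then have "{x \<in> space Gam. \<forall>j\<in>J. x j \<in> F j} \<in> sets Gam"
      using that(1) by (intro sets.sets_Collect_finite_All) auto
    then show ?thesis by simp
  qed
  have "distr (Gam \<Otimes>\<^sub>M Gam) Gam (\<lambda>z. mix A (fst z) (snd z)) = PiM UNIV (\<lambda>_. ?N)"
  proof (rule GP.PiM_eq)
    show "sets (distr (Gam \<Otimes>\<^sub>M Gam) Gam (\<lambda>z. mix A (fst z) (snd z))) = sets (PiM UNIV (\<lambda>_. ?N))"
      by (simp add: Gam_def)
  next
    fix J :: "nat set" and F assume J: "finite J" "\<And>j. j \<in> J \<Longrightarrow> F j \<in> sets ?N"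
    let ?P = "{x. \<forall>j\<in>J \<inter> A. x j \<in> F j}" and ?Q = "{x. \<forall>j\<in>J - A. x j \<in> F j}"
    have "emeasure (distr (Gam \<Otimes>\<^sub>M Gam) Gam (\<lambda>z. mix A (fst z) (snd z))) {x. \<forall>j\<in>J. x j \<in> F j}
        = emeasure (Gam \<Otimes>\<^sub>M Gam) (?P \<times> ?Q)"
      using J by (subst emeasure_distr) (auto intro!: ms arg_cong[where f = "emeasure _"] simp: space_pair_measure mix_def split: if_splits)
    also have "\<dots> = emeasure Gam ?P * emeasure Gam ?Q"
      using J by (intro Gam.emeasure_pair_measure_Times ms) auto
    also have "\<dots> = (\<Prod>j\<in>J \<inter> A. emeasure ?N (F j)) * (\<Prod>j\<in>J - A. emeasure ?N (F j))"
      using J by (subst (1 2) em) auto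
    also have "\<dots> = (\<Prod>j\<in>J. emeasure ?N (F j))"
      using J(1) by (metis prod.Int_Diff)
    finally show "emeasure (distr (Gam \<Otimes>\<^sub>M Gam) Gam (\<lambda>z. mix A (fst z) (snd z))) (prod_emb UNIV (\<lambda>_. ?N) J (Pi\<^sub>E J F)) = (\<Prod>j\<in>J. emeasure ?N (F j))"
      by (simp add: emb)
  qed
  then show ?thesis by (simp add: Gam_def)
qed

interpretation GG: pair_prob_space Gam Gam ..

lemma integral_mix_pair:
  assumes "(\<Phi> :: _ \<Rightarrow> real) \<in> borel_measurable Gam"
  shows "(\<integral>x. \<Phi> x \<partial>Gam) = (\<integral>z. \<Phi> (mix A (fst z) (snd z)) \<partial>(Gam \<Otimes>\<^sub>M Gam))"
proof -
  have "(\<integral>x. \<Phi> x \<partial>Gam) = (\<integral>x. \<Phi> x \<partial>distr (Gam \<Otimes>\<^sub>M Gam) Gam (\<lambda>z. mix A (fst z) (snd z)))" by (simp only: Gam_mix)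
  also have "\<dots> = (\<integral>z. \<Phi> (mix A (fst z) (snd z)) \<partial>(Gam \<Otimes>\<^sub>M Gam))" using assms by (intro integral_distr) auto
  finally show ?thesis .
qed

lemma integrable_mix_pair:
  assumes "integrable Gam (\<Phi> :: _ \<Rightarrow> real)"
  shows "integrable (Gam \<Otimes>\<^sub>M Gam) (\<lambda>z. \<Phi> (mix A (fst z) (snd z)))"
proof -
  have "integrable (distr (Gam \<Otimes>\<^sub>M Gam) Gam (\<lambda>z. mix A (fst z) (snd z))) \<Phi>" using assms by (simp only: Gam_mix)
  then show ?thesis by (rule integrable_distr[rotated]) (rule measurable_mix)
qed

lemma integral_mix:
  assumes "integrable Gam (\<Phi> :: _ \<Rightarrow> real)"
  shows "(\<integral>x. \<Phi> x \<partial>Gam) = (\<integral>x. (\<integral>y. \<Phi> (mix A x y) \<partial>Gam) \<partial>Gam)"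
  using integral_mix_pair[of \<Phi> A] GG.integral_fst'[OF integrable_mix_pair[OF assms, of A]] assms
  by auto

lemma integral_coord:
  "h \<in> borel_measurable borel \<Longrightarrow> (\<integral>x. h (x k) \<partial>Gam) = (\<integral>s. (h s :: real) \<partial>std_normal_distribution)"
proof -
  assume h: "h \<in> borel_measurable borel"
  have "(\<integral>s. h s \<partial>std_normal_distribution) = (\<integral>s. h s \<partial>distr Gam std_normal_distribution (\<lambda>x. x k))" by (simp only: Gam_coord)
  also have "\<dots> = (\<integral>x. h (x k) \<partial>Gam)" using h by (intro integral_distr) (auto simp: measurable_cong_sets[OF refl sets_density])
  finally show ?thesis by simp
qed

lemma integrable_coord:
  "h \<in> borel_measurable borel \<Longrightarrow> integrable std_normal_distribution h \<Longrightarrow> integrable Gam (\<lambda>x. (h (x k) :: real))"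
proof -
  assume h: "h \<in> borel_measurable borel" and i: "integrable std_normal_distribution h"
  from i have "integrable (distr Gam std_normal_distribution (\<lambda>x. x k)) h" by (simp only: Gam_coord)
  then show ?thesis by (rule integrable_distr[rotated]) (auto simp: measurable_cong_sets[OF refl sets_density])
qed

lemma coord_Lall: "(\<lambda>x. x k) \<in> Lall Gam"
proof -
  have "integrable std_normal_distribution (\<lambda>s. \<bar>s\<bar> ^ j)" for j
    using integrable_std_normal_moment_abs[of j] by (subst integrable_density) (auto simp: normal_density_nonneg)
  then have "integrable Gam (\<lambda>x. \<bar>x k\<bar> ^ j)" for j by (intro integrable_coord) auto
  then show ?thesis by (auto simp: Lall_def)
qed

lemma X_Lall[intro!, simp]: "X v \<in> Lall Gam"
  unfolding X_def by (intro Lall_sum Lall_cmult coord_Lall) auto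

lemma wk_Lall[intro!, simp]: "wk n v \<in> Lall Gam"
proof -
  have "wk n v \<in> Lall Gam \<and> wk (Suc n) v \<in> Lall Gam"
  proof (induction n)
    case (Suc n)
    then show ?case
      by (auto simp: wk_Suc[of "Suc n" v, abs_def] simp flip: mult.assoc intro!: Lall_diff Lall_mult Lall_cmult)
  qed (auto simp: wk_0[abs_def] wk_1[abs_def])
  then show ?thesis by simp
qed

lemma wk_measurable[measurable]: "wk n v \<in> borel_measurable Gam" by (rule Lall_measurable) simp
lemma X_measurable[measurable]: "X v \<in> borel_measurable Gam" by (rule Lall_measurable) simp

text \<open>Exponential growth, a class closed under products that is integrable for Gaussian measures.\<close>

definition egr :: "(real \<Rightarrow> real) \<Rightarrow> bool" where
  "egr g \<longleftrightarrow> (\<exists>C N. 0 \<le> C \<and> 0 \<le> N \<and> (\<forall>s. \<bar>g s\<bar> \<le> C * exp (N * \<bar>s\<bar>)))"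

lemma egr_const[simp, intro!]: "egr (\<lambda>_. c)"
  unfolding egr_def by (rule exI[of _ "\<bar>c\<bar>"], rule exI[of _ 0]) auto

lemma egr_id[simp, intro!]: "egr (\<lambda>s. s)"
  unfolding egr_def
proof (intro exI[of _ 1] conjI allI)
  fix s :: real
  show "\<bar>s\<bar> \<le> 1 * exp (1 * \<bar>s\<bar>)" using exp_ge_add_one_self[of "\<bar>s\<bar>"] unfolding mult_1 by linarith
qed auto

lemma egr_add[intro]: assumes "egr g" "egr h" shows "egr (\<lambda>s. g s + h s)"
proof -
  obtain C N where 1: "0 \<le> C" "0 \<le> N" "\<And>s. \<bar>g s\<bar> \<le> C * exp (N * \<bar>s\<bar>)" using assms(1) by (auto simp: egr_def)
  obtain C' N' where 2: "0 \<le> C'" "0 \<le> N'" "\<And>s. \<bar>h s\<bar> \<le> C' * exp (N' * \<bar>s\<bar>)" using assms(2) by (auto simp: egr_def)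
  have "\<bar>g s + h s\<bar> \<le> (C + C') * exp (max N N' * \<bar>s\<bar>)" for s
  proof -
    have "\<bar>g s + h s\<bar> \<le> C * exp (N * \<bar>s\<bar>) + C' * exp (N' * \<bar>s\<bar>)" using 1(3)[of s] 2(3)[of s] by linarith
    also have "\<dots> \<le> C * exp (max N N' * \<bar>s\<bar>) + C' * exp (max N N' * \<bar>s\<bar>)"
      using 1 2 by (intro add_mono mult_left_mono) (auto intro!: mult_right_mono)
    finally show ?thesis by (simp add: algebra_simps)
  qed
  then show ?thesis unfolding egr_def using 1 2 by (intro exI[of _ "C + C'"] exI[of _ "max N N'"]) auto
qed

lemma egr_mult[intro]: assumes "egr g" "egr h" shows "egr (\<lambda>s. g s * h s)"
proof -
  obtain C N where 1: "0 \<le> C" "0 \<le> N" "\<And>s. \<bar>g s\<bar> \<le> C * exp (N * \<bar>s\<bar>)" using assms(1) by (auto simp: egr_def)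
  obtain C' N' where 2: "0 \<le> C'" "0 \<le> N'" "\<And>s. \<bar>h s\<bar> \<le> C' * exp (N' * \<bar>s\<bar>)" using assms(2) by (auto simp: egr_def)
  have "\<bar>g s * h s\<bar> \<le> (C * C') * exp ((N + N') * \<bar>s\<bar>)" for s
  proof -
    have "\<bar>g s * h s\<bar> \<le> (C * exp (N * \<bar>s\<bar>)) * (C' * exp (N' * \<bar>s\<bar>))"
      unfolding abs_mult using 1 2 by (intro mult_mono) auto
    then show ?thesis by (simp add: algebra_simps exp_add)
  qed
  then show ?thesis unfolding egr_def using 1 2 by (intro exI[of _ "C * C'"] exI[of _ "N + N'"]) auto
qed

lemma egr_bounded: "(\<And>s. \<bar>g s\<bar> \<le> B) \<Longrightarrow> egr g"
  unfolding egr_def using order_trans[OF abs_ge_zero, of "g 0" B] by (intro exI[of _ B] exI[of _ 0]) auto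

lemma egr_integrable:
  assumes "egr g" "g \<in> borel_measurable borel"
  shows "integrable std_normal_distribution g"
proof -
  obtain C N where 1: "0 \<le> C" "0 \<le> N" "\<And>s. \<bar>g s\<bar> \<le> C * exp (N * \<bar>s\<bar>)" using assms(1) by (auto simp: egr_def)
  have e: "integrable std_normal_distribution (\<lambda>s. exp (c * s))" for c :: real
  proof -
    \<comment> \<open>Completing the square: an exponentially tilted Gaussian density is a shifted
      one.\<close>
    have "std_normal_density s * exp (c * s) = exp (c\<^sup>2 / 2) * normal_density c 1 s" for s
      by (simp add: normal_density_def exp_add[symmetric] field_simps power2_eq_square)
    moreover have "integrable lborel (\<lambda>s. exp (c\<^sup>2 / 2) * normal_density c 1 s)" by auto
    ultimately show ?thesis by (subst integrable_density) (auto simp: normal_density_nonneg)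
  qed
  show ?thesis
  proof (rule Bochner_Integration.integrable_bound)
    show "integrable std_normal_distribution (\<lambda>s. C * (exp (N * s) + exp (- N * s)))"
      using e[of N] e[of "-N"] by auto
    have "C * exp (N * \<bar>s\<bar>) \<le> C * (exp (N * s) + exp (- N * s))" for s
      using 1 by (intro mult_left_mono) (auto simp: abs_if)
    with 1(3) show "AE s in std_normal_distribution. norm (g s) \<le> norm (C * (exp (N * s) + exp (- N * s)))"
      using 1(1) by (intro AE_I2) (auto simp: abs_mult intro: order_trans)
  qed (use assms in auto)
qed

text \<open>The derivative of f times the density is f' - s f times the density. Exponential growth
  makes f times the density vanish at both ends, so the fundamental theorem of calculus on the whole
  line gives zero.\<close>

lemma stein_1d:
  assumes d: "\<And>s. (f has_real_derivative f' s) (at s)"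
    and c: "continuous_on UNIV f'" and g: "egr f" "egr f'"
  shows "(\<integral>s. s * f s \<partial>std_normal_distribution) = (\<integral>s. f' s \<partial>std_normal_distribution)"
proof -
  let ?\<phi> = "std_normal_density"
  have cf: "continuous_on UNIV f" using d by (meson DERIV_continuous continuous_at_imp_continuous_on)
  have [measurable]: "f \<in> borel_measurable borel" "f' \<in> borel_measurable borel"
    using cf c by (auto intro: borel_measurable_continuous_onI)
  have i1: "integrable std_normal_distribution (\<lambda>s. s * f s)" by (intro egr_integrable) (auto intro: g)
  have i2: "integrable std_normal_distribution f'" by (intro egr_integrable) (auto intro: g)
  have dphi: "(?\<phi> has_real_derivative - s * ?\<phi> s) (at s)" for s
    unfolding std_normal_density_def by (auto intro!: derivative_eq_intros simp: field_simps)
  let ?h = "\<lambda>s. ?\<phi> s * (f' s - s * f s)"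
  have lim: "((\<lambda>s. f s * ?\<phi> s) \<longlongrightarrow> 0) F" if "F = at_top \<or> F = at_bot" for F
  proof -
    obtain C N where 1: "0 \<le> C" "0 \<le> N" "\<And>s. \<bar>f s\<bar> \<le> C * exp (N * \<bar>s\<bar>)" using g(1) by (auto simp: egr_def)
    have a: "filterlim (\<lambda>s::real. N * s - s\<^sup>2 / 2) at_bot at_top"
      unfolding filterlim_at_bot
    proof
      fix Z :: real
      show "\<forall>\<^sub>F s in at_top. N * s - s\<^sup>2 / 2 \<le> Z"
        using eventually_ge_at_top[of "2 * N + 2 + 2 * \<bar>Z\<bar>"]
      proof eventually_elim
        case (elim s)
        have "(2 + 2 * \<bar>Z\<bar>) * s \<le> (s - 2 * N) * s" using elim 1 by (intro mult_right_mono) auto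
        moreover have "(2 + 2 * \<bar>Z\<bar>) * 1 \<le> (2 + 2 * \<bar>Z\<bar>) * s" using elim 1 by (intro mult_left_mono) auto
        ultimately show ?case by (simp add: power2_eq_square algebra_simps)
      qed
    qed
    have "((\<lambda>s. C * exp (N * \<bar>s\<bar> - s\<^sup>2 / 2)) \<longlongrightarrow> C * 0) F"
    proof (intro tendsto_mult tendsto_const filterlim_compose[OF exp_at_bot])
      from that show "filterlim (\<lambda>s. N * \<bar>s\<bar> - s\<^sup>2 / 2) at_bot F"
      proof
        assume F: "F = at_top"
        show ?thesis unfolding F using a
          by (rule filterlim_cong[THEN iffD1, OF refl refl, rotated]) (auto intro: eventually_mono[OF eventually_ge_at_top[of 0]])
      next
        assume F: "F = at_bot"
        show ?thesis unfolding F filterlim_at_bot_mirror using a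
          by (rule filterlim_cong[THEN iffD1, OF refl refl, rotated]) (auto intro: eventually_mono[OF eventually_ge_at_top[of 0]])
      qed
    qed
    then have z: "((\<lambda>s. C * exp (N * \<bar>s\<bar> - s\<^sup>2 / 2)) \<longlongrightarrow> 0) F" by simp
    have "\<bar>f s * ?\<phi> s\<bar> \<le> C * exp (N * \<bar>s\<bar> - s\<^sup>2 / 2)" for s
    proof -
      have "1\<^sup>2 \<le> 2 * pi" using pi_gt3 by simp
      then have "1 \<le> sqrt (2 * pi)" by (rule real_le_rsqrt)
      then have "1 / sqrt (2 * pi) \<le> 1" by (meson divide_le_eq_1_pos less_le_trans zero_less_one)
      then have p: "?\<phi> s \<le> exp (- s\<^sup>2 / 2)"
        unfolding std_normal_density_def using mult_right_mono[of "1 / sqrt (2 * pi)" 1 "exp (- s\<^sup>2 / 2)"] by simp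
      have "\<bar>f s * ?\<phi> s\<bar> \<le> (C * exp (N * \<bar>s\<bar>)) * exp (- s\<^sup>2 / 2)"
        unfolding abs_mult using 1(1) p by (intro mult_mono 1(3)) (simp_all add: normal_density_nonneg)
      also have "\<dots> = C * exp (N * \<bar>s\<bar> - s\<^sup>2 / 2)"
        unfolding mult.assoc exp_add[symmetric] by simp
      finally show ?thesis .
    qed
    then show ?thesis by (intro Lim_null_comparison[OF _ z] always_eventually) auto
  qed
  have int: "integrable lborel ?h"
  proof -
    have "integrable std_normal_distribution (\<lambda>s. f' s - s * f s)" using i1 i2 by auto
    then show ?thesis by (subst (asm) integrable_density) (auto simp: normal_density_nonneg)
  qed
  have "(LBINT s=-\<infinity>..\<infinity>. ?h s) = 0 - 0"
  proof (rule interval_integral_FTC_integrable[where F = "\<lambda>s. f s * ?\<phi> s"])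
    show "((\<lambda>s. f s * ?\<phi> s) has_vector_derivative ?h x) (at x)" for x
      unfolding has_real_derivative_iff_has_vector_derivative[symmetric]
      by (auto intro!: derivative_eq_intros d dphi simp: algebra_simps)
    show "isCont ?h x" for x
      using c cf dphi[THEN DERIV_isCont] by (intro continuous_intros) (auto simp: continuous_on_eq_continuous_at)
    show "set_integrable lborel (einterval (-\<infinity>) \<infinity>) ?h"
      using int by (simp add: set_integrable_def)
  qed (use lim in \<open>auto simp: ereal_tendsto_simps\<close>)
  then have "(LBINT s. ?h s) = 0"
    by (simp add: interval_lebesgue_integral_def set_lebesgue_integral_def)
  then have "(\<integral>s. f' s - s * f s \<partial>std_normal_distribution) = 0"
    by (subst integral_density) (auto simp: normal_density_nonneg)
  then show ?thesis using i1 i2 by simp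
qed

text \<open>\<open>\<Psi> u\<close> is the directional derivative of \<Phi>, in other words the
  Malliavin derivative paired with u. Smoothness and exponential growth are asked for along single
  coordinate lines only, the form in which \<open>stein_1d\<close> consumes them when the other
  coordinates are frozen; linearity in u is imposed rather than derived.\<close>

definition HD :: "((nat \<Rightarrow> real) \<Rightarrow> real) \<Rightarrow> (fvec \<Rightarrow> (nat \<Rightarrow> real) \<Rightarrow> real) \<Rightarrow> bool" where
  "HD \<Phi> \<Psi> \<longleftrightarrow> \<Phi> \<in> Lall Gam \<and> (\<forall>u. \<Psi> u \<in> Lall Gam) \<and>
    (\<forall>u x. \<Psi> u x = (\<Sum>k\<in>supp u. coord u k * \<Psi> (ev k) x)) \<and>
    (\<forall>k x. (\<forall>s. ((\<lambda>s. \<Phi> (x(k := s))) has_real_derivative \<Psi> (ev k) (x(k := s))) (at s)) \<and>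
      continuous_on UNIV (\<lambda>s. \<Psi> (ev k) (x(k := s))) \<and>
      egr (\<lambda>s. \<Phi> (x(k := s))) \<and> egr (\<lambda>s. \<Psi> (ev k) (x(k := s))))"

lemma HDD:
  assumes "HD \<Phi> \<Psi>"
  shows "\<Phi> \<in> Lall Gam" "\<Psi> u \<in> Lall Gam"
    "((\<lambda>s. \<Phi> (x(k := s))) has_real_derivative \<Psi> (ev k) (x(k := s))) (at s)"
    "continuous_on UNIV (\<lambda>s. \<Psi> (ev k) (x(k := s)))"
    "egr (\<lambda>s. \<Phi> (x(k := s)))" "egr (\<lambda>s. \<Psi> (ev k) (x(k := s)))"
  using assms unfolding HD_def by blast+

lemma HD_lin: "HD \<Phi> \<Psi> \<Longrightarrow> \<Psi> u x = (\<Sum>k\<in>supp u. coord u k * \<Psi> (ev k) x)"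
  unfolding HD_def by blast

lemma HDI:
  assumes "\<Phi> \<in> Lall Gam" "\<And>u. \<Psi> u \<in> Lall Gam"
    "\<And>u x. \<Psi> u x = (\<Sum>k\<in>supp u. coord u k * \<Psi> (ev k) x)"
    "\<And>x k s. ((\<lambda>s. \<Phi> (x(k := s))) has_real_derivative \<Psi> (ev k) (x(k := s))) (at s)"
    "\<And>x k. continuous_on UNIV (\<lambda>s. \<Psi> (ev k) (x(k := s)))"
    "\<And>x k. egr (\<lambda>s. \<Phi> (x(k := s)))" "\<And>x k. egr (\<lambda>s. \<Psi> (ev k) (x(k := s)))"
  shows "HD \<Phi> \<Psi>"
  unfolding HD_def using assms by blast

lemma HD_cont: "HD \<Phi> \<Psi> \<Longrightarrow> continuous_on UNIV (\<lambda>s. \<Phi> (x(k := s)))"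
  using HDD(3) by (meson DERIV_continuous continuous_at_imp_continuous_on)

lemma HD_const: "HD (\<lambda>_. c) (\<lambda>_ _. 0)"
  by (intro HDI) auto

lemma HD_X: "HD (X v) (\<lambda>u _. inner v u)"
proof -
  have "egr (\<lambda>s. X v (x(k := s)))" for x k unfolding X_upd diff_conv_add_uminus by (intro egr_add egr_mult) auto
  moreover have "inner v u = (\<Sum>k\<in>supp u. coord u k * coord v k)" for u
    using inner_fvec_def[of u v] by (simp add: inner_commute)
  ultimately show ?thesis
    by (intro HDI) (auto simp: X_upd intro!: derivative_eq_intros)
qed

lemma HD_add: assumes "HD \<Phi> \<Psi>" "HD \<Phi>' \<Psi>'" shows "HD (\<lambda>x. \<Phi> x + \<Phi>' x) (\<lambda>u x. \<Psi> u x + \<Psi>' u x)"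
proof (rule HDI)
  show "\<Psi> u x + \<Psi>' u x = (\<Sum>k\<in>supp u. coord u k * (\<Psi> (ev k) x + \<Psi>' (ev k) x))" for u x
  proof -
    have "\<Psi> u x = (\<Sum>k\<in>supp u. coord u k * \<Psi> (ev k) x)" "\<Psi>' u x = (\<Sum>k\<in>supp u. coord u k * \<Psi>' (ev k) x)"
      using assms HD_lin by blast+
    then show ?thesis by (simp add: algebra_simps sum.distrib)
  qed
qed (use assms in \<open>simp_all add: HDD Lall_add DERIV_add continuous_on_add egr_add\<close>)

lemma HD_mult: assumes "HD \<Phi> \<Psi>" "HD \<Phi>' \<Psi>'"
  shows "HD (\<lambda>x. \<Phi> x * \<Phi>' x) (\<lambda>u x. \<Psi> u x * \<Phi>' x + \<Phi> x * \<Psi>' u x)"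
proof (rule HDI)
  show "\<Psi> u x * \<Phi>' x + \<Phi> x * \<Psi>' u x = (\<Sum>k\<in>supp u. coord u k * (\<Psi> (ev k) x * \<Phi>' x + \<Phi> x * \<Psi>' (ev k) x))" for u x
  proof -
    have "\<Psi> u x = (\<Sum>k\<in>supp u. coord u k * \<Psi> (ev k) x)" "\<Psi>' u x = (\<Sum>k\<in>supp u. coord u k * \<Psi>' (ev k) x)"
      using assms HD_lin by blast+
    then show ?thesis by (simp add: algebra_simps sum.distrib sum_distrib_left sum_distrib_right)
  qed
next
  fix x k s
  have 1: "((\<lambda>s. \<Phi> (x(k := s))) has_real_derivative \<Psi> (ev k) (x(k := s))) (at s)" "((\<lambda>s. \<Phi>' (x(k := s))) has_real_derivative \<Psi>' (ev k) (x(k := s))) (at s)"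
    using assms HDD(3) by blast+
  show "((\<lambda>s. \<Phi> (x(k := s)) * \<Phi>' (x(k := s))) has_real_derivative \<Psi> (ev k) (x(k := s)) * \<Phi>' (x(k := s)) + \<Phi> (x(k := s)) * \<Psi>' (ev k) (x(k := s))) (at s)"
    using DERIV_mult[OF 1] by (simp add: algebra_simps)
qed (use assms HD_cont[OF assms(1)] HD_cont[OF assms(2)] in \<open>simp_all add: HDD Lall_add Lall_mult continuous_on_add continuous_on_mult egr_add egr_mult\<close>)

lemma HD_cmult: "HD \<Phi> \<Psi> \<Longrightarrow> HD (\<lambda>x. c * \<Phi> x) (\<lambda>u x. c * \<Psi> u x)"
  using HD_mult[OF HD_const[of c]] by simp

lemma HD_cong: "HD \<Phi> \<Psi> \<Longrightarrow> \<Phi> = \<Phi>' \<Longrightarrow> (\<And>u x. \<Psi> u x = \<Psi>' u x) \<Longrightarrow> HD \<Phi>' \<Psi>'"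
  by (metis ext)

lemma HD_sum: "(\<And>i. i \<in> A \<Longrightarrow> HD (\<Phi> i) (\<Psi> i)) \<Longrightarrow> HD (\<lambda>x. \<Sum>i\<in>A. \<Phi> i x) (\<lambda>u x. \<Sum>i\<in>A. \<Psi> i u x)"
  by (induction A rule: infinite_finite_induct) (auto intro: HD_const HD_add)

lemma HD_S: "(\<And>v. HD (\<Phi> v) (\<Psi> v)) \<Longrightarrow> HD (\<lambda>x. S f (\<lambda>v. \<Phi> v x)) (\<lambda>u x. S f (\<lambda>v. \<Psi> v u x))"
  by (induction f) (auto intro!: HD_const HD_add HD_cmult)

lemma HD_wk: "HD (wk n v) (\<lambda>u x. real n * wk (n - 1) v x * inner v u)"
proof -
  have "HD (wk n v) (\<lambda>u x. real n * wk (n - 1) v x * inner v u) \<and> HD (wk (Suc n) v) (\<lambda>u x. real (Suc n) * wk n v x * inner v u)"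
  proof (induction n)
    case 0
    show ?case using HD_const[of 1] HD_X[of v] by (simp add: wk_0[abs_def] wk_1[abs_def])
  next
    case (Suc n)
    have "HD (\<lambda>x. X v x * wk (Suc n) v x + (- (real (Suc n) * inner v v)) * wk n v x)
      (\<lambda>u x. (inner v u * wk (Suc n) v x + X v x * (real (Suc n) * wk n v x * inner v u)) + (- (real (Suc n) * inner v v)) * (real n * wk (n - 1) v x * inner v u))"
      using Suc by (intro HD_add HD_mult HD_cmult HD_X) auto
    moreover have "(\<lambda>x. X v x * wk (Suc n) v x + (- (real (Suc n) * inner v v)) * wk n v x) = wk (Suc (Suc n)) v"
      by (auto simp: wk_Suc[of "Suc n"])
    moreover have "(inner v u * wk (Suc n) v x + X v x * (real (Suc n) * wk n v x * inner v u)) + (- (real (Suc n) * inner v v)) * (real n * wk (n - 1) v x * inner v u)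
      = real (Suc (Suc n)) * wk (Suc n) v x * inner v u" for u x
    proof -
      have "real (Suc n) * (X v x * wk n v x - real n * inner v v * wk (n - 1) v x) = real (Suc n) * wk (Suc n) v x"
        by (simp add: wk_Suc)
      then have "inner v u * wk (Suc n) v x + (real (Suc n) * (X v x * wk n v x - real n * inner v v * wk (n - 1) v x)) * inner v u = real (Suc (Suc n)) * wk (Suc n) v x * inner v u"
        by (simp add: algebra_simps)
      then show ?thesis by (simp add: algebra_simps)
    qed
    ultimately show ?case using Suc HD_cong by (metis (no_types, lifting) diff_Suc_1)
  qed
  then show ?thesis by simp
qed

text \<open>The phase lets one rule serve for cosine and sine.\<close>

lemma HD_cos: assumes "HD \<Phi> \<Psi>" shows "HD (\<lambda>x. cos (\<Phi> x + \<theta>)) (\<lambda>u x. - sin (\<Phi> x + \<theta>) * \<Psi> u x)"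
proof -
  have [measurable]: "\<Phi> \<in> borel_measurable Gam" using HDD(1)[OF assms] by (rule Lall_measurable)
  have s: "(\<lambda>x. - sin (\<Phi> x + \<theta>)) \<in> Lall Gam" by (rule Lall_bounded[where B = 1]) auto
  have c: "(\<lambda>x. cos (\<Phi> x + \<theta>)) \<in> Lall Gam" by (rule Lall_bounded[where B = 1]) auto
  have e: "- sin (\<Phi> x + \<theta>) * \<Psi> u x = (\<Sum>k\<in>supp u. coord u k * (- sin (\<Phi> x + \<theta>) * \<Psi> (ev k) x))" for u x
  proof -
    note HD_lin[OF assms, of u x]
    then show ?thesis by (simp add: algebra_simps sum_distrib_left sum_negf)
  qed
  have d: "((\<lambda>s. cos (\<Phi> (x(k := s)) + \<theta>)) has_real_derivative - sin (\<Phi> (x(k := s)) + \<theta>) * \<Psi> (ev k) (x(k := s))) (at s)" for k x s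
    by (auto intro!: derivative_eq_intros HDD(3)[OF assms])
  show ?thesis
    by (intro HDI e c d Lall_mult s HDD[OF assms] egr_mult egr_bounded[where B = 1] continuous_on_mult)
      (auto intro!: HD_cont[OF assms] continuous_intros)
qed

lemma IBP_coord: assumes "HD \<Phi> \<Psi>" shows "(\<integral>x. x k * \<Phi> x \<partial>Gam) = (\<integral>x. \<Psi> (ev k) x \<partial>Gam)"
proof -
  have L: "\<Phi> \<in> Lall Gam" "\<Psi> (ev k) \<in> Lall Gam" using HDD[OF assms] by auto
  have mx: "mix (- {k}) x y = x(k := y k)" for x y by (auto simp: mix_def fun_eq_iff)
  have cP: "continuous_on UNIV (\<lambda>s. \<Psi> (ev k) (x(k := s)))" for x by (rule HDD[OF assms])
  \<comment> \<open>Integrate over coordinate k alone first: \<open>mix (- {k})\<close> keeps all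
    other coordinates at x.\<close>
  have "(\<integral>x. x k * \<Phi> x \<partial>Gam) = (\<integral>x. (\<integral>y. y k * \<Phi> (x(k := y k)) \<partial>Gam) \<partial>Gam)"
    using L(1) coord_Lall[of k] by (subst integral_mix[of _ "- {k}"]) (auto intro!: Lall_integrable simp: mx)
  also have "\<dots> = (\<integral>x. (\<integral>y. \<Psi> (ev k) (x(k := y k)) \<partial>Gam) \<partial>Gam)"
  proof (rule Bochner_Integration.integral_cong[OF refl])
    fix x
    have "(\<integral>y. y k * \<Phi> (x(k := y k)) \<partial>Gam) = (\<integral>s. s * \<Phi> (x(k := s)) \<partial>std_normal_distribution)"
      using HD_cont[OF assms, of x k] by (intro integral_coord borel_measurable_continuous_onI continuous_intros) auto
    also have "\<dots> = (\<integral>s. \<Psi> (ev k) (x(k := s)) \<partial>std_normal_distribution)"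
      by (intro stein_1d HDD[OF assms])
    also have "\<dots> = (\<integral>y. \<Psi> (ev k) (x(k := y k)) \<partial>Gam)"
      using cP by (intro integral_coord[symmetric] borel_measurable_continuous_onI) auto
    finally show "(\<integral>y. y k * \<Phi> (x(k := y k)) \<partial>Gam) = (\<integral>y. \<Psi> (ev k) (x(k := y k)) \<partial>Gam)" .
  qed
  also have "\<dots> = (\<integral>x. \<Psi> (ev k) x \<partial>Gam)"
    using L(2) by (subst (2) integral_mix[of _ "- {k}"]) (auto intro!: Lall_integrable simp: mx)
  finally show ?thesis .
qed

lemma IBP_X: assumes "HD \<Phi> \<Psi>" shows "(\<integral>x. X u x * \<Phi> x \<partial>Gam) = (\<integral>x. \<Psi> u x \<partial>Gam)"
proof -
  have L: "\<Phi> \<in> Lall Gam" "\<And>k. \<Psi> (ev k) \<in> Lall Gam" using HDD[OF assms] by auto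
  have "(\<integral>x. X u x * \<Phi> x \<partial>Gam) = (\<integral>x. (\<Sum>k\<in>supp u. coord u k * (x k * \<Phi> x)) \<partial>Gam)"
    by (simp add: X_def sum_distrib_right mult.assoc)
  also have "\<dots> = (\<Sum>k\<in>supp u. coord u k * (\<integral>x. x k * \<Phi> x \<partial>Gam))"
    using L(1) by (subst Bochner_Integration.integral_sum) (auto intro!: Lall_integrable Lall_cmult Lall_mult coord_Lall)
  also have "\<dots> = (\<integral>x. (\<Sum>k\<in>supp u. coord u k * \<Psi> (ev k) x) \<partial>Gam)"
    using L(2) by (subst Bochner_Integration.integral_sum) (auto intro!: Lall_integrable Lall_cmult simp: IBP_coord[OF assms])
  also have "\<dots> = (\<integral>x. \<Psi> u x \<partial>Gam)"
    by (simp only: HD_lin[OF assms, of u])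
  finally show ?thesis .
qed

text \<open>Integration by parts against \<open>X u\<close> also differentiates the factor
  \<open>wk n u\<close>; the subtracted term of the Wick recurrence removes exactly this
  contribution, so the derivative falls on \<Phi> alone.\<close>

lemma IBP_wk: assumes "HD \<Phi> \<Psi>" shows "(\<integral>x. wk (Suc n) u x * \<Phi> x \<partial>Gam) = (\<integral>x. wk n u x * \<Psi> u x \<partial>Gam)"
proof -
  have L: "\<Phi> \<in> Lall Gam" "\<Psi> u \<in> Lall Gam" using HDD[OF assms] by auto
  have i: "integrable Gam (\<lambda>x. real n * wk (n - 1) u x * inner u u * \<Phi> x)" "integrable Gam (\<lambda>x. wk n u x * \<Psi> u x)"
      "integrable Gam (\<lambda>x. X u x * (wk n u x * \<Phi> x))"
    using L by (auto intro!: Lall_integrable Lall_mult)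
  have "(\<integral>x. wk (Suc n) u x * \<Phi> x \<partial>Gam) = (\<integral>x. X u x * (wk n u x * \<Phi> x) \<partial>Gam) - (\<integral>x. real n * wk (n - 1) u x * inner u u * \<Phi> x \<partial>Gam)"
    using i by (subst Bochner_Integration.integral_diff[symmetric]) (auto simp: wk_Suc algebra_simps)
  also have "(\<integral>x. X u x * (wk n u x * \<Phi> x) \<partial>Gam) = (\<integral>x. real n * wk (n - 1) u x * inner u u * \<Phi> x + wk n u x * \<Psi> u x \<partial>Gam)"
    using IBP_X[OF HD_mult[OF HD_wk[of n u] assms]] .
  also have "\<dots> = (\<integral>x. real n * wk (n - 1) u x * inner u u * \<Phi> x \<partial>Gam) + (\<integral>x. wk n u x * \<Psi> u x \<partial>Gam)"
    using i by (subst Bochner_Integration.integral_add) auto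
  finally show ?thesis by simp
qed

section \<open>Expectations of products of Wick powers\<close>

text \<open>Falling factorial; truncated subtraction produces a zero factor as soon as i >
  p.\<close>

definition ff :: "nat \<Rightarrow> nat \<Rightarrow> real" where "ff p i = (\<Prod>j<i. real (p - j))"

lemma ff_0[simp]: "ff p 0 = 1" by (simp add: ff_def)
lemma ff_Suc: "ff p (Suc i) = ff p i * real (p - i)" by (simp add: ff_def)
lemma ff_eq_0: "p < i \<Longrightarrow> ff p i = 0"
  unfolding ff_def by (subst prod_zero_iff) (auto intro!: bexI[of _ p])
lemma ff_fact: "i \<le> p \<Longrightarrow> ff p i = fact p / fact (p - i)"
proof (induction i)
  case (Suc i)
  then have "p - i = Suc (p - Suc i)" by simp
  then have "fact (p - i) = real (p - i) * fact (p - Suc i)" by simp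
  moreover have "real (p - i) \<noteq> 0" using Suc by simp
  ultimately show ?case unfolding ff_Suc using Suc by (simp add: field_simps del: of_nat_diff)
qed simp

text \<open>\<open>A i\<close> is the i-th iterated derivative of \<open>A 0\<close> in the
  direction v. Derivatives in other directions enter only through the existential
  quantifier.\<close>

definition derseq :: "fvec \<Rightarrow> (nat \<Rightarrow> (nat \<Rightarrow> real) \<Rightarrow> real) \<Rightarrow> bool" where
  "derseq v A \<longleftrightarrow> (\<forall>i. \<exists>\<Psi>. HD (A i) \<Psi> \<and> \<Psi> v = A (Suc i))"

lemma derseq_wk: "derseq v (\<lambda>i x. ff p i * inner v u ^ i * wk (p - i) u x)"
  unfolding derseq_def
proof
  fix i
  have "HD (\<lambda>x. ff p i * inner v u ^ i * wk (p - i) u x) (\<lambda>w x. ff p i * inner v u ^ i * (real (p - i) * wk (p - i - 1) u x * inner u w))"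
    by (intro HD_cmult HD_wk)
  moreover have "(\<lambda>x. ff p i * inner v u ^ i * (real (p - i) * wk (p - i - 1) u x * inner u v)) = (\<lambda>x. ff p (Suc i) * inner v u ^ Suc i * wk (p - Suc i) u x)"
    by (auto simp: ff_Suc inner_commute[of u v])
  ultimately show "\<exists>\<Psi>. HD (\<lambda>x. ff p i * inner v u ^ i * wk (p - i) u x) \<Psi> \<and> \<Psi> v = (\<lambda>x. ff p (Suc i) * inner v u ^ Suc i * wk (p - Suc i) u x)"
    by blast
qed

lemma leibniz_sum:
  fixes A B :: "nat \<Rightarrow> real"
  shows "(\<Sum>i\<le>n. real (n choose i) * (A (Suc i) * B (n - i) + A i * B (Suc (n - i))))
    = (\<Sum>i\<le>Suc n. real (Suc n choose i) * (A i * B (Suc n - i)))"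
proof -
  have "(\<Sum>i\<le>Suc n. real (Suc n choose i) * (A i * B (Suc n - i)))
    = A 0 * B (Suc n) + (\<Sum>i\<le>n. real (n choose i) * (A (Suc i) * B (n - i))) + (\<Sum>i\<le>n. real (n choose Suc i) * (A (Suc i) * B (n - i)))"
    by (subst sum.atMost_Suc_shift) (simp add: algebra_simps sum.distrib)
  moreover have "A 0 * B (Suc n) + (\<Sum>i\<le>n. real (n choose Suc i) * (A (Suc i) * B (n - i))) = (\<Sum>i\<le>Suc n. real (n choose i) * (A i * B (Suc n - i)))"
    by (subst sum.atMost_Suc_shift) simp
  moreover have "(\<Sum>i\<le>Suc n. real (n choose i) * (A i * B (Suc n - i))) = (\<Sum>i\<le>n. real (n choose i) * (A i * B (Suc (n - i))))"
    by (simp add: binomial_eq_0 Suc_diff_le)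
  ultimately show ?thesis by (simp add: algebra_simps sum.distrib)
qed

lemma derseq_mult:
  assumes "derseq v A" "derseq v B"
  shows "derseq v (\<lambda>n x. \<Sum>i\<le>n. real (n choose i) * (A i x * B (n - i) x))"
  unfolding derseq_def
proof
  fix n
  obtain \<Psi> where P: "\<And>i. HD (A i) (\<Psi> i)" "\<And>i. \<Psi> i v = A (Suc i)" using assms(1) unfolding derseq_def by metis
  obtain \<Psi>' where P': "\<And>i. HD (B i) (\<Psi>' i)" "\<And>i. \<Psi>' i v = B (Suc i)" using assms(2) unfolding derseq_def by metis
  have "HD (\<lambda>x. \<Sum>i\<le>n. real (n choose i) * (A i x * B (n - i) x)) (\<lambda>u x. \<Sum>i\<le>n. real (n choose i) * (\<Psi> i u x * B (n - i) x + A i x * \<Psi>' (n - i) u x))"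
    by (intro HD_sum HD_cmult HD_mult P P')
  moreover have "(\<lambda>x. \<Sum>i\<le>n. real (n choose i) * (\<Psi> i v x * B (n - i) x + A i x * \<Psi>' (n - i) v x)) = (\<lambda>x. \<Sum>i\<le>Suc n. real (Suc n choose i) * (A i x * B (Suc n - i) x))"
    unfolding P P' leibniz_sum[of _ "\<lambda>i. A i _" "\<lambda>i. B i _"] ..
  ultimately show "\<exists>\<Psi>. HD (\<lambda>x. \<Sum>i\<le>n. real (n choose i) * (A i x * B (n - i) x)) \<Psi> \<and> \<Psi> v = (\<lambda>x. \<Sum>i\<le>Suc n. real (Suc n choose i) * (A i x * B (Suc n - i) x))"
    by blast
qed

text \<open>Every unit of Wick order is traded for one derivative, so mixed moments reduce to
  Leibniz's rule. The starting index j is general because each step of the induction passes to the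
  next derivative.\<close>

lemma derseq_IBP: assumes "derseq v A" shows "(\<integral>x. wk n v x * A j x \<partial>Gam) = (\<integral>x. A (j + n) x \<partial>Gam)"
proof (induction n arbitrary: j)
  case (Suc n)
  obtain \<Psi> where P: "HD (A j) \<Psi>" "\<Psi> v = A (Suc j)" using assms unfolding derseq_def by metis
  show ?case using IBP_wk[OF P(1), of n v] Suc[of "Suc j"] by (simp add: P(2))
qed simp

lemma E_wk: "(\<integral>x. wk k u x \<partial>Gam) = (if k = 0 then 1 else 0)"
proof (cases k)
  case (Suc n)
  then show ?thesis using IBP_wk[OF HD_const[of 1], of n u] by simp
qed (simp add: Gam.prob_space[unfolded space_Gam])

lemma E2: "(\<integral>x. wk n v x * wk m u x \<partial>Gam) = (if n = m then fact n * inner v u ^ n else 0)"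
proof -
  have "(\<integral>x. wk n v x * wk m u x \<partial>Gam) = ff m n * inner v u ^ n * (\<integral>x. wk (m - n) u x \<partial>Gam)"
    using derseq_IBP[OF derseq_wk[of v m u], of n 0] by simp
  then show ?thesis by (auto simp: E_wk ff_eq_0 ff_fact)
qed

lemma E3: "(\<integral>x. wk n v x * (wk p a x * wk q b x) \<partial>Gam) =
  (\<Sum>i\<le>n. real (n choose i) * (ff p i * inner v a ^ i * (ff q (n - i) * inner v b ^ (n - i)) * (\<integral>x. wk (p - i) a x * wk (q - (n - i)) b x \<partial>Gam)))"
proof -
  have "(\<integral>x. wk n v x * (wk p a x * wk q b x) \<partial>Gam) =
    (\<integral>x. (\<Sum>i\<le>n. real (n choose i) * ((ff p i * inner v a ^ i * wk (p - i) a x) * (ff q (n - i) * inner v b ^ (n - i) * wk (q - (n - i)) b x))) \<partial>Gam)"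
    using derseq_IBP[OF derseq_mult[OF derseq_wk[of v p a] derseq_wk[of v q b]], of n 0] by simp
  also have "\<dots> = (\<Sum>i\<le>n. (\<integral>x. real (n choose i) * (ff p i * inner v a ^ i * (ff q (n - i) * inner v b ^ (n - i)) * (wk (p - i) a x * wk (q - (n - i)) b x)) \<partial>Gam))"
    by (subst Bochner_Integration.integral_sum[symmetric])
      (auto intro!: Lall_integrable Lall_cmult Lall_mult Bochner_Integration.integral_cong sum.cong simp: mult_ac)
  finally show ?thesis by simp
qed

text \<open>The number of complete pairings of four vertices with P, P, Q, Q legs, without edges
  from a vertex to itself, in which n legs of each P-vertex go to the Q-vertices: P - n edges v-v',
  Q - n edges u-u', j edges on each of v-u and v'-u', and n - j on each of v-u' and v'-u.\<close>

definition W4 :: "nat \<Rightarrow> nat \<Rightarrow> nat \<Rightarrow> nat \<Rightarrow> real" where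
  "W4 P Q n j = (if n \<le> Q then (fact P * fact Q)\<^sup>2 / (fact (P - n) * fact (Q - n) * (fact j * fact (n - j))\<^sup>2) else 0)"

lemma W4_nonneg: "0 \<le> W4 P Q n j" by (simp add: W4_def)

lemma E3':
  assumes "j \<le> n"
  shows "ff Q j * ff Q (n - j) * (\<integral>x. wk n v x * (wk (Q - j) u x * wk (Q - (n - j)) u' x) \<partial>Gam)
   = (if n \<le> Q then (fact Q)\<^sup>2 / fact (Q - n) * real (n choose j) * (inner v u' ^ j * inner v u ^ (n - j)) * inner u u' ^ (Q - n) else 0)"
    (is "?L = ?R")
proof (cases "j \<le> Q \<and> n - j \<le> Q")
  case True
  let ?T = "\<lambda>l. real (n choose l) * (ff (Q - j) l * inner v u ^ l * (ff (Q - (n - j)) (n - l) * inner v u' ^ (n - l)) * (\<integral>x. wk (Q - j - l) u x * wk (Q - (n - j) - (n - l)) u' x \<partial>Gam))"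
  \<comment> \<open>The two remaining Wick powers have orders Q - j - l and Q - (n - j) - (n - l);
    equality of these forces l = n - j.\<close>
  have z: "?T l = 0" if "l \<le> n" "l \<noteq> n - j" for l
  proof (cases "l \<le> Q - j \<and> n - l \<le> Q - (n - j)")
    case T: True
    have "Q - j - l \<noteq> Q - (n - j) - (n - l)" using T True that assms by arith
    then show ?thesis by (simp add: E2)
  next
    case False
    then show ?thesis by (auto simp: ff_eq_0)
  qed
  have "(\<Sum>l\<le>n. ?T l) = (\<Sum>l\<in>{n - j}. ?T l)"
    using z by (intro sum.mono_neutral_right) auto
  then have s: "(\<Sum>l\<le>n. ?T l) = ?T (n - j)" by simp
  show ?thesis
  proof (cases "n \<le> Q")
    case n: True
    have e: "Q - j - (n - j) = Q - n" "Q - (n - j) - j = Q - n" "n - (n - j) = j" using n assms by auto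
    have f1: "ff Q j = fact Q / fact (Q - j)" "ff Q (n - j) = fact Q / fact (Q - (n - j))"
      "ff (Q - j) (n - j) = fact (Q - j) / fact (Q - n)" "ff (Q - (n - j)) j = fact (Q - (n - j)) / fact (Q - n)"
      using True assms n by (auto simp: ff_fact)
    have b: "n choose (n - j) = n choose j" using assms binomial_symmetric by metis
    show ?thesis unfolding E3 s e using n by (simp add: f1 E2 b power2_eq_square)
  next
    case False
    then have "ff (Q - j) (n - j) = 0" using True by (intro ff_eq_0) auto
    then show ?thesis unfolding E3 s using False by simp
  qed
next
  case False
  then show ?thesis using assms by (auto simp: ff_eq_0)
qed

text \<open>Diagram formula. Integration by parts in v distributes its P legs by Leibniz's rule; i
  of them go to v', the others leave a triple moment given by \<open>E3'\<close>. The substitution n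
  = P - i brings out the symmetric shape.\<close>

lemma E4: "(\<integral>x. wk P v x * (wk P v' x * (wk Q u x * wk Q u' x)) \<partial>Gam) =
  (\<Sum>n\<le>P. \<Sum>j\<le>n. W4 P Q n j * (inner v v' ^ (P - n) * inner u u' ^ (Q - n) * (inner v u * inner v' u') ^ j * (inner v u' * inner v' u) ^ (n - j)))"
proof -
  let ?A = "\<lambda>i x. ff P i * inner v v' ^ i * wk (P - i) v' x"
  let ?B = "\<lambda>i x. ff Q i * inner v u ^ i * wk (Q - i) u x"
  let ?C = "\<lambda>i x. ff Q i * inner v u' ^ i * wk (Q - i) u' x"
  have d: "derseq v (\<lambda>n x. \<Sum>i\<le>n. real (n choose i) * (?A i x * (\<Sum>j\<le>n - i. real (n - i choose j) * (?B j x * ?C (n - i - j) x))))"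
    using derseq_mult[OF derseq_wk[of v P v'] derseq_mult[OF derseq_wk[of v Q u] derseq_wk[of v Q u']]] by simp
  let ?c = "\<lambda>i j. real (P choose i) * (ff P i * inner v v' ^ i) * (real (P - i choose j) * (ff Q j * ff Q (P - i - j)) * (inner v u ^ j * inner v u' ^ (P - i - j)))"
  have "(\<integral>x. wk P v x * (wk P v' x * (wk Q u x * wk Q u' x)) \<partial>Gam) =
    (\<integral>x. (\<Sum>i\<le>P. real (P choose i) * (?A i x * (\<Sum>j\<le>P - i. real (P - i choose j) * (?B j x * ?C (P - i - j) x)))) \<partial>Gam)"
    using derseq_IBP[OF d, of P 0] by simp
  also have "\<dots> = (\<integral>x. (\<Sum>i\<le>P. \<Sum>j\<le>P - i. ?c i j * (wk (P - i) v' x * (wk (Q - j) u x * wk (Q - (P - i - j)) u' x))) \<partial>Gam)"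
    by (intro Bochner_Integration.integral_cong refl sum.cong) (simp add: sum_distrib_left mult_ac)
  also have "\<dots> = (\<Sum>i\<le>P. \<Sum>j\<le>P - i. ?c i j * (\<integral>x. wk (P - i) v' x * (wk (Q - j) u x * wk (Q - (P - i - j)) u' x) \<partial>Gam))"
    by (subst Bochner_Integration.integral_sum, (intro Lall_integrable Lall_sum Lall_cmult Lall_mult; simp),
        intro sum.cong refl, subst Bochner_Integration.integral_sum)
      (auto intro!: Lall_integrable Lall_cmult Lall_mult)
  also have "\<dots> = (\<Sum>n\<le>P. \<Sum>j\<le>n. ?c (P - n) j * (\<integral>x. wk n v' x * (wk (Q - j) u x * wk (Q - (n - j)) u' x) \<partial>Gam))"
    by (rule sum.reindex_bij_witness[of _ "\<lambda>n. P - n" "\<lambda>n. P - n"]) auto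
  also have "\<dots> = (\<Sum>n\<le>P. \<Sum>j\<le>n. W4 P Q n j * (inner v v' ^ (P - n) * inner u u' ^ (Q - n) * (inner v u * inner v' u') ^ j * (inner v u' * inner v' u) ^ (n - j)))"
  proof (intro sum.cong refl)
    fix n j assume "n \<in> {..P}" "j \<in> {..n}"
    then have n: "n \<le> P" and j: "j \<le> n" by auto
    have PP: "P - (P - n) = n" using n by simp
    have "?c (P - n) j * (\<integral>x. wk n v' x * (wk (Q - j) u x * wk (Q - (n - j)) u' x) \<partial>Gam)
      = real (P choose (P - n)) * (ff P (P - n) * inner v v' ^ (P - n)) * (real (n choose j) * (inner v u ^ j * inner v u' ^ (n - j)))
        * (ff Q j * ff Q (n - j) * (\<integral>x. wk n v' x * (wk (Q - j) u x * wk (Q - (n - j)) u' x) \<partial>Gam))"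
      unfolding PP by (simp only: mult_ac)
    also have "\<dots> = W4 P Q n j * (inner v v' ^ (P - n) * inner u u' ^ (Q - n) * (inner v u * inner v' u') ^ j * (inner v u' * inner v' u) ^ (n - j))"
    proof (cases "n \<le> Q")
      case True
      have b1: "real (P choose (P - n)) = fact P / (fact n * fact (P - n))"
        using n by (simp add: binomial_fact)
      have b2: "real (n choose j) = fact n / (fact j * fact (n - j))"
        using j by (simp add: binomial_fact)
      have b3: "ff P (P - n) = fact P / fact n" using n by (simp add: ff_fact)
      show ?thesis unfolding E3'[OF j] W4_def using True
        by (simp add: b1 b2 b3 power_mult_distrib power2_eq_square) (simp add: mult_ac)
    next
      case False
      then show ?thesis unfolding E3'[OF j] W4_def by simp
    qed
    finally show "?c (P - n) j * (\<integral>x. wk n v' x * (wk (Q - j) u x * wk (Q - (n - j)) u' x) \<partial>Gam)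
      = W4 P Q n j * (inner v v' ^ (P - n) * inner u u' ^ (Q - n) * (inner v u * inner v' u') ^ j * (inner v u' * inner v' u) ^ (n - j))" .
  qed
  finally show ?thesis .
qed

section \<open>Multiple integrals and their four-vertex networks\<close>

lemma S_integral:
  assumes "\<And>v. integrable M (\<Phi> v)"
  shows "(\<integral>x. S f (\<lambda>v. \<Phi> v x) \<partial>M) = S f (\<lambda>v. \<integral>x. \<Phi> v x \<partial>M)" "integrable M (\<lambda>x. S f (\<lambda>v. \<Phi> v x))"
proof -
  have "integrable M (\<lambda>x. S f (\<lambda>v. \<Phi> v x)) \<and> (\<integral>x. S f (\<lambda>v. \<Phi> v x) \<partial>M) = S f (\<lambda>v. \<integral>x. \<Phi> v x \<partial>M)"
    by (induction f) (auto simp: assms)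
  then show "(\<integral>x. S f (\<lambda>v. \<Phi> v x) \<partial>M) = S f (\<lambda>v. \<integral>x. \<Phi> v x \<partial>M)" "integrable M (\<lambda>x. S f (\<lambda>v. \<Phi> v x))" by auto
qed

lemma S_mult_S: "S f \<phi> * S g \<psi> = S f (\<lambda>v. S g (\<lambda>w. \<phi> v * \<psi> w))"
  by (simp add: S_mult_left S_mult_right)

text \<open>A list of weighted vectors $(c_k, v_k)$ encodes the symmetric tensor $\sum_k c_k v_k^{\otimes p}$; \<open>Ik p\<close> is its
  multiple Wiener integral and \<open>nn p\<close> the inner product of such tensors.\<close>

definition Ik :: "nat \<Rightarrow> (real \<times> fvec) list \<Rightarrow> (nat \<Rightarrow> real) \<Rightarrow> real" where
  "Ik p f x = S f (\<lambda>v. wk p v x)"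

lemma Ik_Lall[simp, intro!]: "Ik p f \<in> Lall Gam"
  unfolding Ik_def[abs_def] by (intro Lall_S) auto

lemma Ik_measurable[measurable]: "Ik p f \<in> borel_measurable Gam" by (rule Lall_measurable) simp

definition nn :: "nat \<Rightarrow> (real \<times> fvec) list \<Rightarrow> (real \<times> fvec) list \<Rightarrow> real" where
  "nn p f g = S f (\<lambda>v. S g (\<lambda>w. inner v w ^ p))"

lemma E_Ik_Ik: "(\<integral>x. Ik p f x * Ik q g x \<partial>Gam) = (if p = q then fact p * nn p f g else 0)"
proof -
  have "(\<integral>x. Ik p f x * Ik q g x \<partial>Gam) = S f (\<lambda>v. S g (\<lambda>w. \<integral>x. wk p v x * wk q w x \<partial>Gam))"
    unfolding Ik_def S_mult_S
    by (subst S_integral, (rule S_integral(2), rule Lall_integrable, auto)[1], subst S_integral) (auto intro!: Lall_integrable)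
  then show ?thesis by (auto simp: E2 nn_def S_mult_left)
qed

text \<open>A tensor network with four vertices, two carrying f and two carrying g. The exponents
  are edge multiplicities: a for v-v', a' for u-u', b for the parallel pair v-u, v'-u', and c for
  the crossed pair v-u', v'-u.\<close>

definition tet :: "nat \<Rightarrow> nat \<Rightarrow> nat \<Rightarrow> nat \<Rightarrow> (real \<times> fvec) list \<Rightarrow> (real \<times> fvec) list \<Rightarrow> real" where
  "tet a a' b c f g = S f (\<lambda>v. S f (\<lambda>v'. S g (\<lambda>u. S g (\<lambda>u'.
     inner v v' ^ a * inner u u' ^ a' * (inner v u * inner v' u') ^ b * (inner v u' * inner v' u) ^ c))))"

lemma S4_integral:
  assumes "\<And>a b c d. \<Phi> a b c d \<in> Lall Gam"
  shows "(\<integral>x. S f (\<lambda>v. S f' (\<lambda>v'. S g (\<lambda>u. S g' (\<lambda>u'. \<Phi> v v' u u' x)))) \<partial>Gam)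
    = S f (\<lambda>v. S f' (\<lambda>v'. S g (\<lambda>u. S g' (\<lambda>u'. \<integral>x. \<Phi> v v' u u' x \<partial>Gam))))"
  using Lall_integrable[OF assms] by (simp add: S_integral)

lemma E_Ik4: "(\<integral>x. Ik p f x ^ 4 \<partial>Gam) = (\<Sum>n\<le>p. \<Sum>j\<le>n. W4 p p n j * tet (p - n) (p - n) j (n - j) f f)"
proof -
  have "Ik p f x ^ 4 = S f (\<lambda>v. S f (\<lambda>v'. S f (\<lambda>u. S f (\<lambda>u'. wk p v x * (wk p v' x * (wk p u x * wk p u' x))))))" for x
    unfolding Ik_def by (simp add: S_mult_left S_mult_right power4_eq_xxxx mult_ac)
  then have "(\<integral>x. Ik p f x ^ 4 \<partial>Gam) = S f (\<lambda>v. S f (\<lambda>v'. S f (\<lambda>u. S f (\<lambda>u'. \<integral>x. wk p v x * (wk p v' x * (wk p u x * wk p u' x)) \<partial>Gam))))"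
    by (simp only:) (rule S4_integral, intro Lall_mult wk_Lall)
  then show ?thesis
    by (simp only: E4 S_sum S_mult_left tet_def)
qed

text \<open>Up to the factor (P + 1)(Q + 1), the inner product of the Malliavin derivatives of
  \<open>Ik (Suc P) f\<close> and \<open>Ik (Suc Q) g\<close>, whose concentration drives the normal
  approximation.\<close>

definition Gm :: "nat \<Rightarrow> nat \<Rightarrow> (real \<times> fvec) list \<Rightarrow> (real \<times> fvec) list \<Rightarrow> (nat \<Rightarrow> real) \<Rightarrow> real" where
  "Gm P Q f g x = S f (\<lambda>v. S g (\<lambda>u. inner v u * wk P v x * wk Q u x))"

lemma Gm_Lall[simp, intro!]: "Gm P Q f g \<in> Lall Gam"
  unfolding Gm_def[abs_def] by (intro Lall_S Lall_mult) auto

lemma E_Gm: "(\<integral>x. Gm P Q f g x \<partial>Gam) = (if P = Q then fact P * nn (Suc P) f g else 0)"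
proof -
  have "(\<integral>x. Gm P Q f g x \<partial>Gam) = S f (\<lambda>v. S g (\<lambda>u. inner v u * (\<integral>x. wk P v x * wk Q u x \<partial>Gam)))"
    unfolding Gm_def mult.assoc
    by (subst S_integral, (rule S_integral(2), rule Lall_integrable, auto intro!: Lall_cmult)[1], subst S_integral) (auto intro!: Lall_integrable Lall_cmult)
  then show ?thesis by (auto simp: E2 nn_def mult.left_commute S_mult_left)
qed

lemma E_Gm2: "(\<integral>x. (Gm P Q f g x)\<^sup>2 \<partial>Gam) = (\<Sum>n\<le>P. \<Sum>j\<le>n. W4 P Q n j * tet (P - n) (Q - n) (Suc j) (n - j) f g)"
proof -
  have "(Gm P Q f g x)\<^sup>2 = S f (\<lambda>v. S f (\<lambda>v'. S g (\<lambda>u. S g (\<lambda>u'. (inner v u * inner v' u') * (wk P v x * (wk P v' x * (wk Q u x * wk Q u' x)))))))" for x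
  proof -
    have "(Gm P Q f g x)\<^sup>2 = S f (\<lambda>v. S f (\<lambda>v'. S g (\<lambda>u. inner v u * wk P v x * wk Q u x) * S g (\<lambda>u'. inner v' u' * wk P v' x * wk Q u' x)))"
      unfolding Gm_def power2_eq_square by (rule S_mult_S)
    also have "\<dots> = S f (\<lambda>v. S f (\<lambda>v'. S g (\<lambda>u. S g (\<lambda>u'. (inner v u * inner v' u') * (wk P v x * (wk P v' x * (wk Q u x * wk Q u' x)))))))"
      unfolding S_mult_S by (simp only: mult_ac)
    finally show ?thesis .
  qed
  then have "(\<integral>x. (Gm P Q f g x)\<^sup>2 \<partial>Gam) = S f (\<lambda>v. S f (\<lambda>v'. S g (\<lambda>u. S g (\<lambda>u'. (inner v u * inner v' u') * (\<integral>x. (wk P v x * (wk P v' x * (wk Q u x * wk Q u' x))) \<partial>Gam)))))"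
    by (simp add: S4_integral Lall_mult Lall_cmult)
  also have "\<dots> = S f (\<lambda>v. S f (\<lambda>v'. S g (\<lambda>u. S g (\<lambda>u'. (\<Sum>n\<le>P. \<Sum>j\<le>n. W4 P Q n j * (inner v v' ^ (P - n) * inner u u' ^ (Q - n) * (inner v u * inner v' u') ^ Suc j * (inner v u' * inner v' u) ^ (n - j)))))))"
    unfolding E4 by (simp add: sum_distrib_left mult_ac)
  also have "\<dots> = (\<Sum>n\<le>P. \<Sum>j\<le>n. W4 P Q n j * tet (P - n) (Q - n) (Suc j) (n - j) f g)"
    by (simp only: S_sum S_mult_left tet_def)
  finally show ?thesis .
qed

section \<open>Positive kernels and contraction norms\<close>

text \<open>A bound D confines vectors to finitely many coordinates, where \<open>inner\<close> is a
  finite sum of rank-one kernels.\<close>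

definition below :: "nat \<Rightarrow> fvec \<Rightarrow> bool" where "below D v \<longleftrightarrow> (\<forall>k\<ge>D. coord v k = 0)"
definition bl :: "nat \<Rightarrow> (real \<times> fvec) list \<Rightarrow> bool" where "bl D f \<longleftrightarrow> (\<forall>v\<in>snd ` set f. below D v)"

lemma below_mono: "below D v \<Longrightarrow> D \<le> D' \<Longrightarrow> below D' v" by (auto simp: below_def)
lemma bl_mono: "bl D f \<Longrightarrow> D \<le> D' \<Longrightarrow> bl D' f" by (auto simp: bl_def intro: below_mono)
lemma below_ex: "\<exists>D. below D v"
proof -
  obtain D where "\<forall>k\<in>supp v. k < D" using finite_nat_set_iff_bounded[THEN iffD1, OF finite_supp[of v]] by blast
  then show ?thesis by (intro exI[of _ D]) (auto simp: below_def leD)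
qed
lemma bl_ex: "\<exists>D. bl D f"
proof (induction f)
  case (Cons p f)
  then obtain D D' where "bl D f" "below D' (snd p)" using below_ex by blast
  then show ?case by (intro exI[of _ "max D D'"]) (auto simp: bl_def intro: below_mono)
qed (simp add: bl_def)
lemma bl_ex2: "\<exists>D. bl D f \<and> bl D g"
  using bl_ex[of f] bl_ex[of g] bl_mono by (metis max.cobounded1 max.cobounded2)

lemma below_add: "below D v \<Longrightarrow> below D w \<Longrightarrow> below D (v + w)" by (simp add: below_def)
lemma below_scale: "below D v \<Longrightarrow> below D (r *\<^sub>R v)" by (simp add: below_def)

lemma inner_below: assumes "below D v" shows "inner v w = (\<Sum>k<D. coord v k * coord w k)"
  using assms by (intro inner_fvec_superset) (auto simp: below_def leI[THEN disjI1] not_le[symmetric])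

definition nw :: "(real \<times> 'a) list \<Rightarrow> bool" where "nw \<Phi> \<longleftrightarrow> (\<forall>p\<in>set \<Phi>. 0 \<le> fst p)"

text \<open>The tensor product of two lists with \<kappa> contracted into the weights. Weights of
  either sign occur for such lists; positivity then comes from the kernel applied to them.\<close>

definition pl :: "('a \<Rightarrow> 'b \<Rightarrow> real) \<Rightarrow> (real \<times> 'a) list \<Rightarrow> (real \<times> 'b) list \<Rightarrow> (real \<times> ('a \<times> 'b)) list" where
  "pl \<kappa> f g = concat (map (\<lambda>p. map (\<lambda>q. (fst p * fst q * \<kappa> (snd p) (snd q), (snd p, snd q))) g) f)"

lemma S_pl: "S (pl \<kappa> f g) \<phi> = S f (\<lambda>v. S g (\<lambda>u. \<kappa> v u * \<phi> (v, u)))"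
proof (induction f)
  case (Cons p f)
  have "S (map (\<lambda>q. (fst p * fst q * \<kappa> (snd p) (snd q), (snd p, snd q))) g) \<phi> = fst p * S g (\<lambda>u. \<kappa> (snd p) u * \<phi> (snd p, u))"
    by (induction g) (auto simp: algebra_simps)
  with Cons show ?case by (cases p) (simp add: pl_def)
qed (simp add: pl_def)

lemma set_pl: "snd ` set (pl \<kappa> f g) = snd ` set f \<times> snd ` set g"
  by (force simp: pl_def)

lemma nw_pl: "nw f \<Longrightarrow> nw g \<Longrightarrow> (\<And>x y. 0 \<le> \<kappa> x y) \<Longrightarrow> nw (pl \<kappa> f g)"
  by (auto simp: nw_def pl_def)

lemma S_pl_prod: "S (pl (\<lambda>_ _. 1) \<Phi> \<Psi>) (\<lambda>\<psi>. A (fst \<psi>) * B (snd \<psi>)) = S \<Phi> A * S \<Psi> B"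
  by (simp add: S_pl S_mult_left S_mult_right)

lemma S_nonneg: "nw \<Phi> \<Longrightarrow> (\<And>x. 0 \<le> \<psi> x) \<Longrightarrow> 0 \<le> S \<Phi> \<psi>"
  unfolding nw_def S_def by (intro sum_list_nonneg) auto

lemma S_nth: "S \<Phi> \<psi> = (\<Sum>i<length \<Phi>. fst (\<Phi> ! i) * \<psi> (snd (\<Phi> ! i)))"
  unfolding S_def by (simp add: sum_list_sum_nth atLeast0LessThan)

lemma S_CS:
  assumes "nw \<Phi>"
  shows "(S \<Phi> (\<lambda>x. a x * b x))\<^sup>2 \<le> S \<Phi> (\<lambda>x. a x * a x) * S \<Phi> (\<lambda>x. b x * b x)"
proof -
  have w: "0 \<le> fst (\<Phi> ! i)" if "i < length \<Phi>" for i using assms that by (auto simp: nw_def)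
  let ?s = "\<lambda>i. sqrt (fst (\<Phi> ! i))"
  have "(\<Sum>i<length \<Phi>. (?s i * a (snd (\<Phi> ! i))) * (?s i * b (snd (\<Phi> ! i))))\<^sup>2
    \<le> (\<Sum>i<length \<Phi>. (?s i * a (snd (\<Phi> ! i)))\<^sup>2) * (\<Sum>i<length \<Phi>. (?s i * b (snd (\<Phi> ! i)))\<^sup>2)"
    by (rule Cauchy_Schwarz_ineq_sum)
  moreover have "?s i * x * (?s i * y) = fst (\<Phi> ! i) * (x * y)" if "i < length \<Phi>" for i x y
    using w[OF that] by (simp add: algebra_simps real_sqrt_mult_self flip: mult.assoc)
  ultimately show ?thesis unfolding S_nth power2_eq_square by simp
qed

lemma kernel_nonneg:
  assumes "nw \<Psi>" and K: "\<And>V U. V \<in> snd ` set F \<Longrightarrow> U \<in> snd ` set F \<Longrightarrow> K V U = S \<Psi> (\<lambda>\<psi>. \<alpha> \<psi> V * \<alpha> \<psi> U)"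
  shows "0 \<le> S F (\<lambda>V. S F (\<lambda>U. K V U))"
proof -
  have "S F (\<lambda>V. S F (\<lambda>U. K V U)) = S F (\<lambda>V. S F (\<lambda>U. S \<Psi> (\<lambda>\<psi>. \<alpha> \<psi> V * \<alpha> \<psi> U)))"
    by (intro S_cong refl K)
  also have "\<dots> = S F (\<lambda>V. S \<Psi> (\<lambda>\<psi>. S F (\<lambda>U. \<alpha> \<psi> V * \<alpha> \<psi> U)))"
    by (subst S_swap) rule
  also have "\<dots> = S \<Psi> (\<lambda>\<psi>. S F (\<lambda>V. S F (\<lambda>U. \<alpha> \<psi> V * \<alpha> \<psi> U)))"
    by (subst S_swap) rule
  also have "\<dots> = S \<Psi> (\<lambda>\<psi>. S F (\<alpha> \<psi>) * S F (\<alpha> \<psi>))"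
    by (simp add: S_mult_S)
  finally show ?thesis using S_nonneg[OF assms(1), of "\<lambda>\<psi>. S F (\<alpha> \<psi>) * S F (\<alpha> \<psi>)"] by simp
qed

text \<open>Summed over features, the double sum becomes a weighted sum of products of two linear
  functionals, and Cauchy-Schwarz applies there. The feature representation is asked for on
  occurring vectors only, since it exists only below a bound.\<close>

lemma CS_kernel:
  assumes "nw \<Psi>"
    and K: "\<And>V U. V \<in> snd ` set F \<Longrightarrow> U \<in> snd ` set G \<Longrightarrow> K V U = S \<Psi> (\<lambda>\<psi>. \<alpha> \<psi> V * \<beta> \<psi> U)"
    and KF: "\<And>V U. V \<in> snd ` set F \<Longrightarrow> U \<in> snd ` set F \<Longrightarrow> KF V U = S \<Psi> (\<lambda>\<psi>. \<alpha> \<psi> V * \<alpha> \<psi> U)"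
    and KG: "\<And>V U. V \<in> snd ` set G \<Longrightarrow> U \<in> snd ` set G \<Longrightarrow> KG V U = S \<Psi> (\<lambda>\<psi>. \<beta> \<psi> V * \<beta> \<psi> U)"
  shows "(S F (\<lambda>V. S G (\<lambda>U. K V U)))\<^sup>2 \<le> S F (\<lambda>V. S F (\<lambda>U. KF V U)) * S G (\<lambda>V. S G (\<lambda>U. KG V U))"
proof -
  have e: "S F' (\<lambda>V. S G' (\<lambda>U. K' V U)) = S \<Psi> (\<lambda>\<psi>. S F' (a \<psi>) * S G' (b \<psi>))"
    if "\<And>V U. V \<in> snd ` set F' \<Longrightarrow> U \<in> snd ` set G' \<Longrightarrow> K' V U = S \<Psi> (\<lambda>\<psi>. a \<psi> V * b \<psi> U)" for F' G' K' a b
  proof -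
    have "S F' (\<lambda>V. S G' (\<lambda>U. K' V U)) = S F' (\<lambda>V. S G' (\<lambda>U. S \<Psi> (\<lambda>\<psi>. a \<psi> V * b \<psi> U)))"
      by (intro S_cong refl that)
    also have "\<dots> = S F' (\<lambda>V. S \<Psi> (\<lambda>\<psi>. S G' (\<lambda>U. a \<psi> V * b \<psi> U)))"
      by (subst S_swap) rule
    also have "\<dots> = S \<Psi> (\<lambda>\<psi>. S F' (\<lambda>V. S G' (\<lambda>U. a \<psi> V * b \<psi> U)))"
      by (subst S_swap) rule
    also have "\<dots> = S \<Psi> (\<lambda>\<psi>. S F' (a \<psi>) * S G' (b \<psi>))"
      by (simp add: S_mult_S)
    finally show ?thesis .
  qed
  have "S F (\<lambda>V. S G (\<lambda>U. K V U)) = S \<Psi> (\<lambda>\<psi>. S F (\<alpha> \<psi>) * S G (\<beta> \<psi>))" by (rule e) (rule K)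
  moreover have "S F (\<lambda>V. S F (\<lambda>U. KF V U)) = S \<Psi> (\<lambda>\<psi>. S F (\<alpha> \<psi>) * S F (\<alpha> \<psi>))" by (rule e) (rule KF)
  moreover have "S G (\<lambda>V. S G (\<lambda>U. KG V U)) = S \<Psi> (\<lambda>\<psi>. S G (\<beta> \<psi>) * S G (\<beta> \<psi>))" by (rule e) (rule KG)
  ultimately show ?thesis using S_CS[OF assms(1), of "\<lambda>\<psi>. S F (\<alpha> \<psi>)" "\<lambda>\<psi>. S G (\<beta> \<psi>)"] by simp
qed

text \<open>Positivity is witnessed by an explicit finite Gram representation. In this form it is
  stable under products, and the witnesses serve directly as features for
  \<open>CS_kernel\<close>.\<close>

definition psd :: "nat \<Rightarrow> (fvec \<Rightarrow> fvec \<Rightarrow> real) \<Rightarrow> bool" where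
  "psd D \<kappa> \<longleftrightarrow> (\<exists>\<Phi>. nw \<Phi> \<and> (\<forall>v w. below D v \<longrightarrow> below D w \<longrightarrow> \<kappa> v w = S \<Phi> (\<lambda>\<phi>. \<phi> v * \<phi> w)))"

lemma psdE:
  assumes "psd D \<kappa>"
  obtains \<Phi> where "nw \<Phi>" "\<And>v w. below D v \<Longrightarrow> below D w \<Longrightarrow> \<kappa> v w = S \<Phi> (\<lambda>\<phi>. \<phi> v * \<phi> w)"
  using assms unfolding psd_def by blast

lemma psd_const: "0 \<le> c \<Longrightarrow> psd D (\<lambda>_ _. c)"
  unfolding psd_def by (rule exI[of _ "[(c, \<lambda>_. 1)]"]) (auto simp: nw_def)

lemma psd_rank1: "psd D (\<lambda>v w. l v * l w)"
  unfolding psd_def by (rule exI[of _ "[(1, l)]"]) (auto simp: nw_def)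

lemma psd_add: assumes "psd D \<kappa>" "psd D \<kappa>'" shows "psd D (\<lambda>v w. \<kappa> v w + \<kappa>' v w)"
proof -
  obtain \<Phi> where 0: "nw \<Phi>" "\<And>v w. below D v \<Longrightarrow> below D w \<Longrightarrow> \<kappa> v w = S \<Phi> (\<lambda>\<phi>. \<phi> v * \<phi> w)" using assms(1) by (rule psdE) (blast intro: that)
  obtain \<Phi>' where 1: "nw \<Phi>'" "\<And>v w. below D v \<Longrightarrow> below D w \<Longrightarrow> \<kappa>' v w = S \<Phi>' (\<lambda>\<phi>. \<phi> v * \<phi> w)" using assms(2) by (rule psdE) (blast intro: that)
  show ?thesis using 0 1 unfolding psd_def by (intro exI[of _ "\<Phi> @ \<Phi>'"]) (auto simp: nw_def)
qed

text \<open>Schur's product theorem: products of features are features of the product.\<close>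

lemma psd_mult: assumes "psd D \<kappa>" "psd D \<kappa>'" shows "psd D (\<lambda>v w. \<kappa> v w * \<kappa>' v w)"
proof -
  obtain \<Phi> where 0: "nw \<Phi>" "\<And>v w. below D v \<Longrightarrow> below D w \<Longrightarrow> \<kappa> v w = S \<Phi> (\<lambda>\<phi>. \<phi> v * \<phi> w)" using assms(1) by (rule psdE) (blast intro: that)
  obtain \<Phi>' where 1: "nw \<Phi>'" "\<And>v w. below D v \<Longrightarrow> below D w \<Longrightarrow> \<kappa>' v w = S \<Phi>' (\<lambda>\<phi>. \<phi> v * \<phi> w)" using assms(2) by (rule psdE) (blast intro: that)
  let ?\<Phi> = "map (\<lambda>p. (fst p, \<lambda>v. fst (snd p) v * snd (snd p) v)) (pl (\<lambda>_ _. 1) \<Phi> \<Phi>')"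
  have "nw (pl (\<lambda>_ _. 1) \<Phi> \<Phi>')" by (intro nw_pl 0 1) auto
  then have "nw ?\<Phi>" by (auto simp: nw_def)
  moreover have "S ?\<Phi> (\<lambda>\<phi>. \<phi> v * \<phi> w) = S \<Phi> (\<lambda>\<phi>. \<phi> v * \<phi> w) * S \<Phi>' (\<lambda>\<phi>. \<phi> v * \<phi> w)" for v w
  proof -
    have "S ?\<Phi> (\<lambda>\<phi>. \<phi> v * \<phi> w) = S (pl (\<lambda>_ _. 1) \<Phi> \<Phi>') (\<lambda>q. (fst q v * snd q v) * (fst q w * snd q w))"
      by (simp add: S_def comp_def)
    also have "\<dots> = S (pl (\<lambda>_ _. 1) \<Phi> \<Phi>') (\<lambda>q. (fst q v * fst q w) * (snd q v * snd q w))"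
      by (simp only: mult_ac)
    finally show ?thesis by (simp only: S_pl_prod[of \<Phi> \<Phi>' "\<lambda>\<phi>. \<phi> v * \<phi> w" "\<lambda>\<phi>. \<phi> v * \<phi> w"])
  qed
  ultimately show ?thesis using 0 1 unfolding psd_def by (intro exI[of _ ?\<Phi>]) auto
qed

lemma psd_power: "psd D \<kappa> \<Longrightarrow> psd D (\<lambda>v w. \<kappa> v w ^ n)"
  by (induction n) (auto intro: psd_const psd_mult)

lemma psd_sum: "finite A \<Longrightarrow> (\<And>i. i \<in> A \<Longrightarrow> psd D (\<kappa> i)) \<Longrightarrow> psd D (\<lambda>v w. \<Sum>i\<in>A. \<kappa> i v w)"
  by (induction A rule: finite_induct) (auto intro: psd_const psd_add)

lemma psd_cong: "psd D \<kappa> \<Longrightarrow> (\<And>v w. below D v \<Longrightarrow> below D w \<Longrightarrow> \<kappa> v w = \<kappa>' v w) \<Longrightarrow> psd D \<kappa>'"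
  unfolding psd_def by simp

lemma psd_inner: "psd D inner"
  by (rule psd_cong[OF psd_sum[of "{..<D}" D "\<lambda>k v w. coord v k * coord w k"]]) (auto intro: psd_rank1 simp: inner_below)

lemma psd_comp: assumes "psd D' \<kappa>" "\<And>v. below D v \<Longrightarrow> below D' (T v)" shows "psd D (\<lambda>v w. \<kappa> (T v) (T w))"
proof -
  obtain \<Phi> where 1: "nw \<Phi>" "\<And>v w. below D' v \<Longrightarrow> below D' w \<Longrightarrow> \<kappa> v w = S \<Phi> (\<lambda>\<phi>. \<phi> v * \<phi> w)" using assms(1) by (rule psdE) (blast intro: that)
  let ?\<Phi> = "map (\<lambda>p. (fst p, \<lambda>v. snd p (T v))) \<Phi>"
  have "S ?\<Phi> (\<lambda>\<phi>. \<phi> v * \<phi> w) = S \<Phi> (\<lambda>\<phi>. \<phi> (T v) * \<phi> (T w))" for v w by (simp add: S_def comp_def)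
  then show ?thesis unfolding psd_def using 1 assms(2) by (intro exI[of _ ?\<Phi>]) (auto simp: nw_def)
qed

lemma psd_nonneg: assumes "psd D \<kappa>" "bl D f" shows "0 \<le> S f (\<lambda>v. S f (\<lambda>w. \<kappa> v w))"
proof -
  obtain \<Phi> where 1: "nw \<Phi>" "\<And>v w. below D v \<Longrightarrow> below D w \<Longrightarrow> \<kappa> v w = S \<Phi> (\<lambda>\<phi>. \<phi> v * \<phi> w)" using assms(1) by (rule psdE) (blast intro: that)
  show ?thesis by (rule kernel_nonneg[OF 1(1)]) (use assms(2) in \<open>auto simp: bl_def intro!: 1(2)\<close>)
qed

lemma nn_nonneg: "0 \<le> nn p f f"
  using bl_ex[of f] psd_nonneg psd_power[OF psd_inner] unfolding nn_def by blast

text \<open>The cycle is the squared norm, in the tensor product of the kernels \<open>p1\<close>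
  and \<open>p2\<close>, of the list of pairs weighted by k. Nothing is asked of the opposite edges
  \<open>k\<close>.\<close>

lemma cyc_nonneg:
  assumes "psd D p1" "psd D p2" "bl D f" "bl D g"
  shows "0 \<le> S f (\<lambda>v. S f (\<lambda>v'. S g (\<lambda>u. S g (\<lambda>u'. p1 v v' * p2 u u' * (k v u * k v' u')))))"
proof -
  obtain \<Phi> where 1: "nw \<Phi>" "\<And>v w. below D v \<Longrightarrow> below D w \<Longrightarrow> p1 v w = S \<Phi> (\<lambda>\<phi>. \<phi> v * \<phi> w)" using assms(1) by (rule psdE) (blast intro: that)
  obtain \<Psi> where 2: "nw \<Psi>" "\<And>v w. below D v \<Longrightarrow> below D w \<Longrightarrow> p2 v w = S \<Psi> (\<lambda>\<phi>. \<phi> v * \<phi> w)" using assms(2) by (rule psdE) (blast intro: that)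
  let ?F = "pl k f g"
  have "0 \<le> S ?F (\<lambda>V. S ?F (\<lambda>U. p1 (fst V) (fst U) * p2 (snd V) (snd U)))"
  proof (rule kernel_nonneg[where \<Psi> = "pl (\<lambda>_ _. 1) \<Phi> \<Psi>" and \<alpha> = "\<lambda>\<psi> V. fst \<psi> (fst V) * snd \<psi> (snd V)"])
    show "nw (pl (\<lambda>_ _. 1) \<Phi> \<Psi>)" by (intro nw_pl 1 2) auto
    fix V U assume "V \<in> snd ` set ?F" "U \<in> snd ` set ?F"
    then have "below D (fst V)" "below D (fst U)" "below D (snd V)" "below D (snd U)" using assms by (auto simp: set_pl bl_def)
    then show "p1 (fst V) (fst U) * p2 (snd V) (snd U) = S (pl (\<lambda>_ _. 1) \<Phi> \<Psi>) (\<lambda>\<psi>. fst \<psi> (fst V) * snd \<psi> (snd V) * (fst \<psi> (fst U) * snd \<psi> (snd U)))"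
      using S_pl_prod[of \<Phi> \<Psi> "\<lambda>\<phi>. \<phi> (fst V) * \<phi> (fst U)" "\<lambda>\<phi>. \<phi> (snd V) * \<phi> (snd U)"] by (simp add: 1(2) 2(2) mult_ac)
  qed
  also have "S ?F (\<lambda>V. S ?F (\<lambda>U. p1 (fst V) (fst U) * p2 (snd V) (snd U)))
    = S f (\<lambda>v. S g (\<lambda>u. S f (\<lambda>v'. S g (\<lambda>u'. p1 v v' * p2 u u' * (k v u * k v' u')))))"
    by (simp add: S_pl S_mult_left[symmetric] mult_ac)
  also have "\<dots> = S f (\<lambda>v. S f (\<lambda>v'. S g (\<lambda>u. S g (\<lambda>u'. p1 v v' * p2 u u' * (k v u * k v' u')))))"
    by (subst (2) S_swap) rule
  finally show ?thesis .
qed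

lemma tet_nonneg: "0 \<le> tet a a' b 0 f g"
proof -
  obtain D where D: "bl D f" "bl D g" using bl_ex2 by blast
  show ?thesis using cyc_nonneg[OF psd_power[OF psd_inner] psd_power[OF psd_inner] D, of a a' "\<lambda>v u. inner v u ^ b"]
    by (simp add: tet_def power_mult_distrib)
qed

lemma tet_pl: "tet a a' b c f g = S (pl (\<lambda>v v'. inner v v' ^ a) f f) (\<lambda>V. S (pl (\<lambda>v v'. inner v v' ^ a') g g) (\<lambda>U.
   (inner (fst V) (fst U) * inner (snd V) (snd U)) ^ b * (inner (fst V) (snd U) * inner (snd V) (fst U)) ^ c))"
  by (simp add: tet_def S_pl S_mult_left[symmetric] mult_ac)

text \<open>Cut the network between the two f-vertices and the two g-vertices and apply
  Cauchy-Schwarz to the severed edges. The crossed pairs only permute tensor slots on one side,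
  which is why \<open>?\<beta>\<close> exchanges the last two features, and a permutation leaves the
  norm unchanged.\<close>

lemma tet_CS: "(tet a a' b c f g)\<^sup>2 \<le> tet a a (b + c) 0 f f * tet a' a' (b + c) 0 g g"
proof -
  obtain D where D: "bl D f" "bl D g" using bl_ex2 by blast
  obtain \<Phi> where 1: "nw \<Phi>" "\<And>v w. below D v \<Longrightarrow> below D w \<Longrightarrow> inner v w ^ b = S \<Phi> (\<lambda>\<phi>. \<phi> v * \<phi> w)"
    using psd_power[OF psd_inner, of D "b"] by (rule psdE) (blast intro: that)
  obtain \<Psi> where 2: "nw \<Psi>" "\<And>v w. below D v \<Longrightarrow> below D w \<Longrightarrow> inner v w ^ c = S \<Psi> (\<lambda>\<phi>. \<phi> v * \<phi> w)"
    using psd_power[OF psd_inner, of D "c"] by (rule psdE) (blast intro: that)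
  let ?F = "pl (\<lambda>v v'. inner v v' ^ a) f f" and ?G = "pl (\<lambda>v v'. inner v v' ^ a') g g"
  let ?P = "pl (\<lambda>_ _. 1) (pl (\<lambda>_ _. 1) \<Phi> \<Phi>) (pl (\<lambda>_ _. 1) \<Psi> \<Psi>)"
  let ?\<alpha> = "\<lambda>\<psi> V. fst (fst \<psi>) (fst V) * fst (snd \<psi>) (fst V) * (snd (fst \<psi>) (snd V) * snd (snd \<psi>) (snd V))"
  let ?\<beta> = "\<lambda>\<psi> V. fst (fst \<psi>) (fst V) * snd (snd \<psi>) (fst V) * (snd (fst \<psi>) (snd V) * fst (snd \<psi>) (snd V))"
  have SP: "S ?P (\<lambda>\<psi>. A (fst (fst \<psi>)) * B (snd (fst \<psi>)) * (C (fst (snd \<psi>)) * E (snd (snd \<psi>)))) = S \<Phi> A * S \<Phi> B * (S \<Psi> C * S \<Psi> E)" for A B C E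
    by (simp add: S_pl S_mult_left S_mult_right)
  have bF: "below D (fst V) \<and> below D (snd V)" if "V \<in> snd ` set ?F" for V using that D by (auto simp: set_pl bl_def)
  have bG: "below D (fst V) \<and> below D (snd V)" if "V \<in> snd ` set ?G" for V using that D by (auto simp: set_pl bl_def)
  have "(S ?F (\<lambda>V. S ?G (\<lambda>U. (inner (fst V) (fst U) * inner (snd V) (snd U)) ^ b * (inner (fst V) (snd U) * inner (snd V) (fst U)) ^ c)))\<^sup>2
    \<le> S ?F (\<lambda>V. S ?F (\<lambda>U. (inner (fst V) (fst U) * inner (snd V) (snd U)) ^ (b + c))) * S ?G (\<lambda>V. S ?G (\<lambda>U. (inner (fst V) (fst U) * inner (snd V) (snd U)) ^ (b + c)))"
  proof (rule CS_kernel[where \<Psi> = ?P and \<alpha> = ?\<alpha> and \<beta> = ?\<beta>])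
    show "nw ?P" by (intro nw_pl 1 2) auto
  next
    fix V U assume "V \<in> snd ` set ?F" "U \<in> snd ` set ?G"
    then show "(inner (fst V) (fst U) * inner (snd V) (snd U)) ^ b * (inner (fst V) (snd U) * inner (snd V) (fst U)) ^ c = S ?P (\<lambda>\<psi>. ?\<alpha> \<psi> V * ?\<beta> \<psi> U)"
      using SP[of "\<lambda>\<phi>. \<phi> (fst V) * \<phi> (fst U)" "\<lambda>\<phi>. \<phi> (snd V) * \<phi> (snd U)" "\<lambda>\<phi>. \<phi> (fst V) * \<phi> (snd U)" "\<lambda>\<phi>. \<phi> (snd V) * \<phi> (fst U)"] bF bG
      by (simp add: power_mult_distrib 1(2) 2(2) mult_ac)
  next
    fix V U assume "V \<in> snd ` set ?F" "U \<in> snd ` set ?F"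
    then show "(inner (fst V) (fst U) * inner (snd V) (snd U)) ^ (b + c) = S ?P (\<lambda>\<psi>. ?\<alpha> \<psi> V * ?\<alpha> \<psi> U)"
      using SP[of "\<lambda>\<phi>. \<phi> (fst V) * \<phi> (fst U)" "\<lambda>\<phi>. \<phi> (snd V) * \<phi> (snd U)" "\<lambda>\<phi>. \<phi> (fst V) * \<phi> (fst U)" "\<lambda>\<phi>. \<phi> (snd V) * \<phi> (snd U)"] bF
      by (simp add: power_mult_distrib power_add 1(2) 2(2) mult_ac)
  next
    fix V U assume "V \<in> snd ` set ?G" "U \<in> snd ` set ?G"
    then show "(inner (fst V) (fst U) * inner (snd V) (snd U)) ^ (b + c) = S ?P (\<lambda>\<psi>. ?\<beta> \<psi> V * ?\<beta> \<psi> U)"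
      using SP[of "\<lambda>\<phi>. \<phi> (fst V) * \<phi> (fst U)" "\<lambda>\<phi>. \<phi> (snd V) * \<phi> (snd U)" "\<lambda>\<phi>. \<phi> (snd V) * \<phi> (snd U)" "\<lambda>\<phi>. \<phi> (fst V) * \<phi> (fst U)"] bG
      by (simp add: power_mult_distrib power_add 1(2) 2(2) mult_ac)
  qed
  then show ?thesis unfolding tet_pl by simp
qed

text \<open>\<open>Cn a r f\<close> is the squared norm of the $r$-th contraction of the tensor of order $a + r$ with itself.\<close>

definition Cn :: "nat \<Rightarrow> nat \<Rightarrow> (real \<times> fvec) list \<Rightarrow> real" where "Cn a r f = tet a a r 0 f f"

lemma Cn_nonneg: "0 \<le> Cn a r f" by (simp add: Cn_def tet_nonneg)

lemma tet_le: "\<bar>tet a a' b c f g\<bar> \<le> sqrt (Cn a (b + c) f) * sqrt (Cn a' (b + c) g)"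
  using real_sqrt_le_mono[OF tet_CS[of a a' b c f g]] by (simp add: Cn_def real_sqrt_mult)

lemma pair_form: "S (pl k f g) (\<lambda>V. S (pl k f g) (\<lambda>U. q (fst V) (snd V) (fst U) (snd U)))
    = S f (\<lambda>v. S f (\<lambda>v'. S g (\<lambda>u. S g (\<lambda>u'. k v u * k v' u' * q v u v' u'))))"
proof -
  have "S (pl k f g) (\<lambda>V. S (pl k f g) (\<lambda>U. q (fst V) (snd V) (fst U) (snd U)))
    = S f (\<lambda>v. S g (\<lambda>u. S f (\<lambda>v'. S g (\<lambda>u'. k v u * k v' u' * q v u v' u'))))"
    by (simp add: S_pl S_mult_left[symmetric] mult_ac)
  also have "\<dots> = S f (\<lambda>v. S f (\<lambda>v'. S g (\<lambda>u. S g (\<lambda>u'. k v u * k v' u' * q v u v' u'))))"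
    by (subst (2) S_swap) rule
  finally show ?thesis .
qed

text \<open>With no edges v-v' and u-u', the cut of \<open>tet_CS\<close> would yield only full
  norms. Cutting between (v, u) and (v', u') severs the crossed pairs instead, and by symmetry both
  Cauchy-Schwarz factors coincide.\<close>

lemma tet_cycle: "\<bar>tet 0 0 b c f g\<bar> \<le> tet c c b 0 f g"
proof -
  obtain D where D: "bl D f" "bl D g" using bl_ex2 by blast
  obtain \<Psi> where 2: "nw \<Psi>" "\<And>v w. below D v \<Longrightarrow> below D w \<Longrightarrow> inner v w ^ c = S \<Psi> (\<lambda>\<phi>. \<phi> v * \<phi> w)"
    using psd_power[OF psd_inner, of D "c"] by (rule psdE) (blast intro: that)
  let ?F = "pl (\<lambda>v u. inner v u ^ b) f g"
  let ?P = "pl (\<lambda>_ _. 1) \<Psi> \<Psi>"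
  let ?\<alpha> = "\<lambda>\<psi> V. fst \<psi> (fst V) * snd \<psi> (snd V)" and ?\<beta> = "\<lambda>\<psi> V. fst \<psi> (snd V) * snd \<psi> (fst V)"
  have SP: "S ?P (\<lambda>\<psi>. A (fst \<psi>) * B (snd \<psi>)) = S \<Psi> A * S \<Psi> B" for A B
    by (simp add: S_pl S_mult_left S_mult_right)
  have bF: "below D (fst V) \<and> below D (snd V)" if "V \<in> snd ` set ?F" for V using that D by (auto simp: set_pl bl_def)
  let ?K = "\<lambda>V U. (inner (fst V) (fst U) * inner (snd V) (snd U)) ^ c"
  have "(S ?F (\<lambda>V. S ?F (\<lambda>U. (inner (fst V) (snd U) * inner (fst U) (snd V)) ^ c)))\<^sup>2 \<le> S ?F (\<lambda>V. S ?F (\<lambda>U. ?K V U)) * S ?F (\<lambda>V. S ?F (\<lambda>U. ?K V U))"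
  proof (rule CS_kernel[where \<Psi> = ?P and \<alpha> = ?\<alpha> and \<beta> = ?\<beta>])
    show "nw ?P" by (intro nw_pl 2) auto
  next
    fix V U assume "V \<in> snd ` set ?F" "U \<in> snd ` set ?F"
    then show "(inner (fst V) (snd U) * inner (fst U) (snd V)) ^ c = S ?P (\<lambda>\<psi>. ?\<alpha> \<psi> V * ?\<beta> \<psi> U)"
      using SP[of "\<lambda>\<phi>. \<phi> (fst V) * \<phi> (snd U)" "\<lambda>\<phi>. \<phi> (snd V) * \<phi> (fst U)"] bF by (simp add: power_mult_distrib 2(2) mult_ac)
  next
    fix V U assume "V \<in> snd ` set ?F" "U \<in> snd ` set ?F"
    then show "?K V U = S ?P (\<lambda>\<psi>. ?\<alpha> \<psi> V * ?\<alpha> \<psi> U)"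
      using SP[of "\<lambda>\<phi>. \<phi> (fst V) * \<phi> (fst U)" "\<lambda>\<phi>. \<phi> (snd V) * \<phi> (snd U)"] bF by (simp add: power_mult_distrib 2(2) mult_ac)
  next
    fix V U assume "V \<in> snd ` set ?F" "U \<in> snd ` set ?F"
    then show "?K V U = S ?P (\<lambda>\<psi>. ?\<beta> \<psi> V * ?\<beta> \<psi> U)"
      using SP[of "\<lambda>\<phi>. \<phi> (snd V) * \<phi> (snd U)" "\<lambda>\<phi>. \<phi> (fst V) * \<phi> (fst U)"] bF by (simp add: power_mult_distrib 2(2) mult_ac)
  qed
  then have "(S ?F (\<lambda>V. S ?F (\<lambda>U. (inner (fst V) (snd U) * inner (fst U) (snd V)) ^ c)))\<^sup>2 \<le> (S ?F (\<lambda>V. S ?F (\<lambda>U. ?K V U)))\<^sup>2"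
    by (simp add: power2_eq_square)
  moreover have "S ?F (\<lambda>V. S ?F (\<lambda>U. (inner (fst V) (snd U) * inner (fst U) (snd V)) ^ c)) = tet 0 0 b c f g"
    unfolding pair_form[of _ f g "\<lambda>v u v' u'. (inner v u' * inner v' u) ^ c"] tet_def by (simp add: power_mult_distrib mult_ac)
  moreover have "S ?F (\<lambda>V. S ?F (\<lambda>U. ?K V U)) = tet c c b 0 f g"
    unfolding pair_form[of _ f g "\<lambda>v u v' u'. (inner v v' * inner u u') ^ c"] tet_def by (simp add: power_mult_distrib mult_ac)
  ultimately show ?thesis using tet_nonneg by (metis abs_le_square_iff abs_of_nonneg)
qed

text \<open>Relabelling the vertices of the four-cycle exchanges its two kinds of edges.\<close>

lemma Cn_sym: "Cn a r f = Cn r a f"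
proof -
  have "Cn a r f = S f (\<lambda>v. S f (\<lambda>u. S f (\<lambda>v'. S f (\<lambda>u'. inner v v' ^ a * inner u u' ^ a * (inner v u * inner v' u') ^ r))))"
    unfolding Cn_def tet_def by (subst (2) S_swap) simp
  then show ?thesis unfolding Cn_def tet_def by (simp add: power_mult_distrib mult_ac)
qed

lemma tet_00: "tet 0 0 b c f f = Cn b c f"
proof -
  have "tet 0 0 b c f f = S f (\<lambda>v. S f (\<lambda>v'. S f (\<lambda>u. S f (\<lambda>u'. (inner v u * inner v' u') ^ b * (inner v u' * inner v' u) ^ c))))"
    by (simp add: tet_def)
  also have "\<dots> = S f (\<lambda>v. S f (\<lambda>u. S f (\<lambda>v'. S f (\<lambda>u'. (inner v u * inner v' u') ^ b * (inner v u' * inner v' u) ^ c))))"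
    by (subst (2) S_swap) rule
  also have "\<dots> = S f (\<lambda>v. S f (\<lambda>u. S f (\<lambda>u'. S f (\<lambda>v'. (inner v u * inner v' u') ^ b * (inner v u' * inner v' u) ^ c))))"
    by (subst (3) S_swap) rule
  also have "\<dots> = Cn b c f" unfolding Cn_def tet_def by (simp add: power_mult_distrib mult_ac inner_commute)
  finally show ?thesis .
qed

text \<open>Cauchy-Schwarz across a cut that severs every edge.\<close>

lemma Cn_le_nn: "Cn a r f \<le> (nn (a + r) f f)\<^sup>2"
proof -
  obtain D where D: "bl D f" using bl_ex by blast
  obtain \<Phi> where 1: "nw \<Phi>" "\<And>v w. below D v \<Longrightarrow> below D w \<Longrightarrow> inner v w ^ a = S \<Phi> (\<lambda>\<phi>. \<phi> v * \<phi> w)"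
    using psd_power[OF psd_inner, of D "a"] by (rule psdE) (blast intro: that)
  obtain \<Psi> where 2: "nw \<Psi>" "\<And>v w. below D v \<Longrightarrow> below D w \<Longrightarrow> inner v w ^ r = S \<Psi> (\<lambda>\<phi>. \<phi> v * \<phi> w)"
    using psd_power[OF psd_inner, of D "r"] by (rule psdE) (blast intro: that)
  let ?F = "pl (\<lambda>_ _. 1) f f"
  let ?P = "pl (\<lambda>_ _. 1) (pl (\<lambda>_ _. 1) \<Phi> \<Phi>) (pl (\<lambda>_ _. 1) \<Psi> \<Psi>)"
  let ?\<alpha> = "\<lambda>\<psi> V. fst (fst \<psi>) (fst V) * fst (snd \<psi>) (fst V) * (snd (fst \<psi>) (snd V) * snd (snd \<psi>) (snd V))"
  let ?\<beta> = "\<lambda>\<psi> V. fst (fst \<psi>) (fst V) * snd (snd \<psi>) (fst V) * (snd (fst \<psi>) (snd V) * fst (snd \<psi>) (snd V))"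
  have SP: "S ?P (\<lambda>\<psi>. A (fst (fst \<psi>)) * B (snd (fst \<psi>)) * (C (fst (snd \<psi>)) * E (snd (snd \<psi>)))) = S \<Phi> A * S \<Phi> B * (S \<Psi> C * S \<Psi> E)" for A B C E
    by (simp add: S_pl S_mult_left S_mult_right)
  have bF: "below D (fst V) \<and> below D (snd V)" if "V \<in> snd ` set ?F" for V using that D by (auto simp: set_pl bl_def)
  let ?K = "\<lambda>V U. (inner (fst V) (fst U) * inner (snd V) (snd U)) ^ (a + r)"
  have "(S ?F (\<lambda>V. S ?F (\<lambda>U. (inner (fst V) (fst U) * inner (snd V) (snd U)) ^ a * (inner (fst V) (snd U) * inner (snd V) (fst U)) ^ r)))\<^sup>2
    \<le> S ?F (\<lambda>V. S ?F (\<lambda>U. ?K V U)) * S ?F (\<lambda>V. S ?F (\<lambda>U. ?K V U))"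
  proof (rule CS_kernel[where \<Psi> = ?P and \<alpha> = ?\<alpha> and \<beta> = ?\<beta>])
    show "nw ?P" by (intro nw_pl 1 2) auto
  next
    fix V U assume "V \<in> snd ` set ?F" "U \<in> snd ` set ?F"
    then show "(inner (fst V) (fst U) * inner (snd V) (snd U)) ^ a * (inner (fst V) (snd U) * inner (snd V) (fst U)) ^ r = S ?P (\<lambda>\<psi>. ?\<alpha> \<psi> V * ?\<beta> \<psi> U)"
      using SP[of "\<lambda>\<phi>. \<phi> (fst V) * \<phi> (fst U)" "\<lambda>\<phi>. \<phi> (snd V) * \<phi> (snd U)" "\<lambda>\<phi>. \<phi> (fst V) * \<phi> (snd U)" "\<lambda>\<phi>. \<phi> (snd V) * \<phi> (fst U)"] bF
      by (simp add: power_mult_distrib 1(2) 2(2) mult_ac)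
  next
    fix V U assume "V \<in> snd ` set ?F" "U \<in> snd ` set ?F"
    then show "?K V U = S ?P (\<lambda>\<psi>. ?\<alpha> \<psi> V * ?\<alpha> \<psi> U)"
      using SP[of "\<lambda>\<phi>. \<phi> (fst V) * \<phi> (fst U)" "\<lambda>\<phi>. \<phi> (snd V) * \<phi> (snd U)" "\<lambda>\<phi>. \<phi> (fst V) * \<phi> (fst U)" "\<lambda>\<phi>. \<phi> (snd V) * \<phi> (snd U)"] bF
      by (simp add: power_mult_distrib power_add 1(2) 2(2) mult_ac)
  next
    fix V U assume "V \<in> snd ` set ?F" "U \<in> snd ` set ?F"
    then show "?K V U = S ?P (\<lambda>\<psi>. ?\<beta> \<psi> V * ?\<beta> \<psi> U)"
      using SP[of "\<lambda>\<phi>. \<phi> (fst V) * \<phi> (fst U)" "\<lambda>\<phi>. \<phi> (snd V) * \<phi> (snd U)" "\<lambda>\<phi>. \<phi> (snd V) * \<phi> (snd U)" "\<lambda>\<phi>. \<phi> (fst V) * \<phi> (fst U)"] bF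
      by (simp add: power_mult_distrib power_add 1(2) 2(2) mult_ac)
  qed
  moreover have "S ?F (\<lambda>V. S ?F (\<lambda>U. (inner (fst V) (fst U) * inner (snd V) (snd U)) ^ a * (inner (fst V) (snd U) * inner (snd V) (fst U)) ^ r)) = tet 0 0 a r f f"
    by (simp add: S_pl tet_def)
  moreover have "S ?F (\<lambda>V. S ?F (\<lambda>U. ?K V U)) = (nn (a + r) f f)\<^sup>2"
  proof -
    have "S ?F (\<lambda>V. S ?F (\<lambda>U. ?K V U)) = S f (\<lambda>v. S f (\<lambda>v'. S f (\<lambda>u. S f (\<lambda>u'. inner v u ^ (a + r) * inner v' u' ^ (a + r)))))"
      by (simp add: S_pl power_mult_distrib)
    also have "\<dots> = nn (a + r) f f * nn (a + r) f f"
      unfolding nn_def S_mult_S ..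
    finally show ?thesis by (simp add: power2_eq_square)
  qed
  ultimately have "(Cn a r f)\<^sup>2 \<le> ((nn (a + r) f f)\<^sup>2)\<^sup>2"
    by (simp add: tet_00 power2_eq_square)
  then show ?thesis by (rule power2_le_imp_le) simp
qed

text \<open>The self-contraction of \<open>f @ g\<close> has four parts. The square of a sum of four
  terms costs a factor 4, and each mixed part is at most the mean of the two pure ones, which gives
  another factor 2.\<close>

lemma Cn_append: "Cn a r (f @ g) \<le> 8 * (Cn a r f + Cn a r g)"
proof -
  obtain D where D: "bl D f" "bl D g" using bl_ex2 by blast
  obtain \<Phi> where 1: "nw \<Phi>" "\<And>v w. below D v \<Longrightarrow> below D w \<Longrightarrow> inner v w ^ r = S \<Phi> (\<lambda>\<phi>. \<phi> v * \<phi> w)"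
    using psd_power[OF psd_inner, of D "r"] by (rule psdE) (blast intro: that)
  \<comment> \<open>Coordinates, in the features of \<open>inner ^ r\<close>, of the contraction of
    f with g along a edges; the r remaining legs on either side are free.\<close>
  define Y where "Y f g \<psi> = S f (\<lambda>v. S g (\<lambda>w. inner v w ^ a * (fst \<psi> v * snd \<psi> w)))" for f g :: "(real \<times> fvec) list" and \<psi> :: "(fvec \<Rightarrow> real) \<times> (fvec \<Rightarrow> real)"
  let ?P = "pl (\<lambda>_ _. 1) \<Phi> \<Phi>"
  have nwP: "nw ?P" by (intro nw_pl 1) auto
  have N: "S ?P (\<lambda>\<psi>. Y f1 g1 \<psi> * Y f1 g1 \<psi>) = tet r r a 0 f1 g1" if "bl D f1" "bl D g1" for f1 g1
  proof -
    let ?F = "pl (\<lambda>v w. inner v w ^ a) f1 g1"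
    have "tet r r a 0 f1 g1 = S ?F (\<lambda>V. S ?F (\<lambda>U. inner (fst V) (fst U) ^ r * inner (snd V) (snd U) ^ r))"
      unfolding pair_form[of _ f1 g1 "\<lambda>v u v' u'. inner v v' ^ r * inner u u' ^ r"] tet_def by (simp add: power_mult_distrib mult_ac)
    also have "\<dots> = S ?F (\<lambda>V. S ?F (\<lambda>U. S ?P (\<lambda>\<psi>. (fst \<psi> (fst V) * snd \<psi> (snd V)) * (fst \<psi> (fst U) * snd \<psi> (snd U)))))"
    proof (intro S_cong refl)
      fix V U assume "V \<in> snd ` set ?F" "U \<in> snd ` set ?F"
      then have "below D (fst V)" "below D (fst U)" "below D (snd V)" "below D (snd U)" using that by (auto simp: set_pl bl_def)
      then show "inner (fst V) (fst U) ^ r * inner (snd V) (snd U) ^ r = S ?P (\<lambda>\<psi>. (fst \<psi> (fst V) * snd \<psi> (snd V)) * (fst \<psi> (fst U) * snd \<psi> (snd U)))"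
        using S_pl_prod[of \<Phi> \<Phi> "\<lambda>\<phi>. \<phi> (fst V) * \<phi> (fst U)" "\<lambda>\<phi>. \<phi> (snd V) * \<phi> (snd U)"] by (simp add: 1(2) mult_ac)
    qed
    also have "\<dots> = S ?F (\<lambda>V. S ?P (\<lambda>\<psi>. S ?F (\<lambda>U. (fst \<psi> (fst V) * snd \<psi> (snd V)) * (fst \<psi> (fst U) * snd \<psi> (snd U)))))"
      by (subst S_swap) rule
    also have "\<dots> = S ?P (\<lambda>\<psi>. S ?F (\<lambda>V. S ?F (\<lambda>U. (fst \<psi> (fst V) * snd \<psi> (snd V)) * (fst \<psi> (fst U) * snd \<psi> (snd U)))))"
      by (subst S_swap) rule
    also have "\<dots> = S ?P (\<lambda>\<psi>. Y f1 g1 \<psi> * Y f1 g1 \<psi>)"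
      unfolding S_mult_S[symmetric] by (simp add: S_pl[of _ f1 g1] Y_def)
    finally show ?thesis by simp
  qed
  have Cnt: "Cn a r h = tet r r a 0 h h" for h using Cn_sym[of a r h] by (simp add: Cn_def)
  have Dfg: "bl D (f @ g)" using D by (auto simp: bl_def)
  have "Cn a r (f @ g) = S ?P (\<lambda>\<psi>. Y (f @ g) (f @ g) \<psi> * Y (f @ g) (f @ g) \<psi>)"
    unfolding Cnt N[OF Dfg Dfg] ..
  also have "\<dots> \<le> S ?P (\<lambda>\<psi>. 4 * (Y f f \<psi> * Y f f \<psi> + Y f g \<psi> * Y f g \<psi> + Y g f \<psi> * Y g f \<psi> + Y g g \<psi> * Y g g \<psi>))"
  proof -
    have "0 \<le> S ?P (\<lambda>\<psi>. 4 * (Y f f \<psi> * Y f f \<psi> + Y f g \<psi> * Y f g \<psi> + Y g f \<psi> * Y g f \<psi> + Y g g \<psi> * Y g g \<psi>) - Y (f @ g) (f @ g) \<psi> * Y (f @ g) (f @ g) \<psi>)"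
    proof (rule S_nonneg[OF nwP])
      fix \<psi>
      have e: "Y (f @ g) (f @ g) \<psi> = Y f f \<psi> + Y f g \<psi> + Y g f \<psi> + Y g g \<psi>" by (simp add: Y_def S_add)
      have "(s + t + u + w) * (s + t + u + w) \<le> 4 * (s * s + t * t + u * u + w * w)" for s t u w :: real
        using sum_squares_ge_zero[of "s - t" "u - w"] sum_squares_ge_zero[of "s - u" "t - w"] sum_squares_ge_zero[of "s - w" "t - u"] by (simp add: algebra_simps)
      then show "0 \<le> 4 * (Y f f \<psi> * Y f f \<psi> + Y f g \<psi> * Y f g \<psi> + Y g f \<psi> * Y g f \<psi> + Y g g \<psi> * Y g g \<psi>) - Y (f @ g) (f @ g) \<psi> * Y (f @ g) (f @ g) \<psi>"
        unfolding e by simp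
    qed
    then show ?thesis by (simp add: S_diff)
  qed
  also have "\<dots> = 4 * (tet r r a 0 f f + tet r r a 0 f g + tet r r a 0 g f + tet r r a 0 g g)"
    by (simp add: S_add S_mult_left N D)
  also have "\<dots> \<le> 8 * (Cn a r f + Cn a r g)"
  proof -
    have "tet r r a 0 h k \<le> (Cn a r h + Cn a r k) / 2" for h k
    proof -
      have "tet r r a 0 h k \<le> sqrt (Cn r a h) * sqrt (Cn r a k)" using tet_le[of r r a 0 h k] by simp
      also have "\<dots> \<le> (Cn r a h + Cn r a k) / 2"
        using arith_geo_mean_sqrt[OF Cn_nonneg Cn_nonneg, of r a h r a k] by (simp add: real_sqrt_mult)
      finally show ?thesis by (simp add: Cn_sym[of a r])
    qed
    from this[of f f] this[of f g] this[of g f] this[of g g] show ?thesis by (simp add: field_simps)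
  qed
  finally show ?thesis .
qed

lemma Cn_scale: "Cn a r (map (\<lambda>(c, v). (c * t, v)) f) = t ^ 4 * Cn a r f"
proof -
  have "S (map (\<lambda>(c, v). (c * t, v)) f) \<phi> = t * S f \<phi>" for \<phi> :: "fvec \<Rightarrow> real"
    using S_map[of "\<lambda>_. t" "\<lambda>v. v" f \<phi>] by (simp add: S_mult_left)
  then show ?thesis by (simp add: Cn_def tet_def S_mult_left power4_eq_xxxx mult_ac)
qed

text \<open>Polarization by Lagrange interpolation: a coefficient of a polynomial of degree at most
  N is a fixed combination of its values at 0, ..., N. Mixed terms can thus be isolated from pure
  powers, which is all that weighted lists can express.\<close>

lemma extract_coeff:
  assumes "r \<le> N"
  obtains l :: "nat \<Rightarrow> real" where "\<And>c. (\<Sum>j\<le>N. l j * (\<Sum>k\<le>N. c k * real j ^ k)) = c r"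
proof -
  define L where "L j = (\<Prod>i\<in>{..N} - {j}. smult (1 / (real j - real i)) [:- real i, 1:])" for j
  have pL: "poly (L j) (real i) = (if i = j then 1 else 0)" if "i \<le> N" "j \<le> N" for i j
  proof (cases "i = j")
    case True
    then show ?thesis by (auto simp: L_def poly_prod diff_divide_distrib[symmetric] intro!: prod.neutral)
  next
    case False
    then show ?thesis using that by (auto simp: L_def poly_prod intro!: prod_zero bexI[of _ i])
  qed
  have dL: "degree (L j) \<le> N" if "j \<le> N" for j
  proof -
    have "degree (L j) \<le> (\<Sum>i\<in>{..N} - {j}. degree (smult (1 / (real j - real i)) [:- real i, 1:]))"
      unfolding L_def by (rule order_trans[OF degree_prod_sum_le]) (simp_all add: comp_def)
    also have "\<dots> \<le> (\<Sum>i\<in>{..N} - {j}. 1)" by (intro sum_mono) auto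
    also have "\<dots> = N" using that by simp
    finally show ?thesis .
  qed
  show ?thesis
  proof (rule that[of "\<lambda>j. coeff (L j) r"])
    fix c :: "nat \<Rightarrow> real"
    define p where "p = (\<Sum>k\<le>N. monom (c k) k)"
    have pp: "poly p x = (\<Sum>k\<le>N. c k * x ^ k)" for x by (simp add: p_def poly_sum poly_monom)
    have dp: "degree p \<le> N" unfolding p_def by (intro degree_sum_le) (auto intro: order_trans[OF degree_monom_le])
    have "p = (\<Sum>j\<le>N. smult (poly p (real j)) (L j))"
    proof (rule poly_eqI_degree[where A = "real ` {..N}"])
      fix x assume "x \<in> real ` {..N}"
      then obtain i where i: "x = real i" "i \<le> N" by auto
      have "poly (\<Sum>j\<le>N. smult (poly p (real j)) (L j)) x = (\<Sum>j\<le>N. if j = i then poly p (real j) else 0)"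
        unfolding poly_sum i(1) by (intro sum.cong) (use i pL in auto)
      then show "poly p x = poly (\<Sum>j\<le>N. smult (poly p (real j)) (L j)) x" using i by simp
    next
      have c: "card (real ` {..N}) = Suc N" by (subst card_image) (auto simp: inj_on_def)
      show "degree p < card (real ` {..N})" using dp c by simp
      have "degree (\<Sum>j\<le>N. smult (poly p (real j)) (L j)) \<le> N"
        by (intro degree_sum_le) (auto intro: order_trans[OF degree_smult_le] dL)
      then show "degree (\<Sum>j\<le>N. smult (poly p (real j)) (L j)) < card (real ` {..N})" using c by simp
    qed
    then have "coeff p r = (\<Sum>j\<le>N. poly p (real j) * coeff (L j) r)"
      by (metis (no_types, lifting) coeff_smult coeff_sum sum.cong)
    moreover have "coeff p r = c r" using assms by (simp add: p_def coeff_sum)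
    ultimately show "(\<Sum>j\<le>N. coeff (L j) r * (\<Sum>k\<le>N. c k * real j ^ k)) = c r"
      by (simp add: pp mult.commute)
  qed
qed

lemma binomial_powers: "(a + s * b) ^ m = (\<Sum>k\<le>m. (real (m choose k) * (a ^ (m - k) * b ^ k)) * s ^ k)" for a b s :: real
  by (subst add.commute, subst binomial_ring) (simp add: power_mult_distrib mult_ac)

lemma scale_sum: "r * (\<Sum>k\<in>A. c k * x k) = (\<Sum>k\<in>A. (r * c k) * (x k :: real))"
  by (simp only: sum_distrib_left mult.assoc)

text \<open>Up to the factor \<open>2 * n choose n\<close>, the sum is the squared norm of a
  symmetrized contraction. The symmetric product of n copies of each vector of a pair is the
  coefficient of s^n in the 2n-th tensor power of \<open>fst V + s *\<^sub>R snd V\<close>, and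
  interpolation in s keeps everything expressed by powers of inner products.\<close>

lemma sym_nonneg: "0 \<le> (\<Sum>j\<le>n. (real (n choose j))\<^sup>2 * tet a a j (n - j) f f)"
proof -
  obtain D where D: "bl D f" using bl_ex by blast
  obtain l :: "nat \<Rightarrow> real" where l: "\<And>c. (\<Sum>j\<le>2 * n. l j * (\<Sum>k\<le>2 * n. c k * real j ^ k)) = c n"
    using extract_coeff[of n "2 * n"] by auto
  obtain \<Phi> where 1: "nw \<Phi>" "\<And>v w. below D v \<Longrightarrow> below D w \<Longrightarrow> inner v w ^ (2 * n) = S \<Phi> (\<lambda>\<phi>. \<phi> v * \<phi> w)"
    using psd_power[OF psd_inner, of D "2 * n"] by (rule psdE) (blast intro: that)
  let ?F = "pl (\<lambda>v v'. inner v v' ^ a) f f"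
  let ?K = "\<lambda>V U. (\<Sum>j\<le>n. (real (n choose j))\<^sup>2 * ((inner (fst V) (fst U) * inner (snd V) (snd U)) ^ j * (inner (fst V) (snd U) * inner (snd V) (fst U)) ^ (n - j)))"
  \<comment> \<open>Both interpolations together pick the coefficient of s^n t^n in (A + t B + s C +
    s t E)^(2n), first in s and then in t.\<close>
  have ext: "(\<Sum>s\<le>2 * n. l s * (\<Sum>t\<le>2 * n. l t * ((A + real t * B) + real s * (C + real t * E)) ^ (2 * n)))
     = real (2 * n choose n) * (\<Sum>j\<le>n. (real (n choose j))\<^sup>2 * ((A * E) ^ j * (B * C) ^ (n - j)))" for A B C E
  proof -
    have "(\<Sum>s\<le>2 * n. l s * (\<Sum>t\<le>2 * n. l t * ((A + real t * B) + real s * (C + real t * E)) ^ (2 * n)))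
      = (\<Sum>t\<le>2 * n. l t * (\<Sum>s\<le>2 * n. l s * ((A + real t * B) + real s * (C + real t * E)) ^ (2 * n)))"
      unfolding sum_distrib_left by (subst sum.swap) (simp add: mult.left_commute)
    also have "\<dots> = (\<Sum>t\<le>2 * n. l t * (real (2 * n choose n) * ((A + real t * B) ^ n * (C + real t * E) ^ n)))"
      unfolding binomial_powers l by simp
    also have "\<dots> = (\<Sum>t\<le>2 * n. l t * (\<Sum>k\<le>2 * n. (real (2 * n choose n) * (\<Sum>i\<le>k. (real (n choose i) * (A ^ (n - i) * B ^ i)) * (real (n choose (k - i)) * (C ^ (n - (k - i)) * E ^ (k - i))))) * real t ^ k))"
    proof (intro sum.cong refl arg_cong2[where f = "(*)"])
      fix t
      have "(A + real t * B) ^ n * (C + real t * E) ^ n = (\<Sum>k\<le>n + n. (\<Sum>i\<le>k. (real (n choose i) * (A ^ (n - i) * B ^ i)) * (real (n choose (k - i)) * (C ^ (n - (k - i)) * E ^ (k - i)))) * real t ^ k)"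
        unfolding binomial_powers by (rule polynomial_product) (auto simp: binomial_eq_0)
      then show "real (2 * n choose n) * ((A + real t * B) ^ n * (C + real t * E) ^ n) = (\<Sum>k\<le>2 * n. (real (2 * n choose n) * (\<Sum>i\<le>k. (real (n choose i) * (A ^ (n - i) * B ^ i)) * (real (n choose (k - i)) * (C ^ (n - (k - i)) * E ^ (k - i))))) * real t ^ k)"
        unfolding mult_2 by (simp only: scale_sum)
    qed
    also have "\<dots> = real (2 * n choose n) * (\<Sum>i\<le>n. (real (n choose i) * (A ^ (n - i) * B ^ i)) * (real (n choose (n - i)) * (C ^ (n - (n - i)) * E ^ (n - i))))"
      unfolding l ..
    also have "(\<Sum>i\<le>n. (real (n choose i) * (A ^ (n - i) * B ^ i)) * (real (n choose (n - i)) * (C ^ (n - (n - i)) * E ^ (n - i))))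
       = (\<Sum>j\<le>n. (real (n choose j))\<^sup>2 * ((A * E) ^ j * (B * C) ^ (n - j)))"
    proof (rule sum.reindex_bij_witness[of _ "\<lambda>j. n - j" "\<lambda>j. n - j"])
      fix i assume "i \<in> {..n}"
      then have "n choose (n - i) = n choose i" using binomial_symmetric[of i n] by simp
      with \<open>i \<in> {..n}\<close> show "(real (n choose (n - i)))\<^sup>2 * ((A * E) ^ (n - i) * (B * C) ^ (n - (n - i))) = (real (n choose i) * (A ^ (n - i) * B ^ i)) * (real (n choose (n - i)) * (C ^ (n - (n - i)) * E ^ (n - i)))"
        by (simp add: power2_eq_square power_mult_distrib mult_ac)
    qed auto
    finally show ?thesis .
  qed
  have "0 \<le> S ?F (\<lambda>V. S ?F (\<lambda>U. real (2 * n choose n) * ?K V U))"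
  proof (rule kernel_nonneg[OF 1(1), where \<alpha> = "\<lambda>\<phi> V. \<Sum>s\<le>2 * n. l s * \<phi> (fst V + real s *\<^sub>R snd V)"])
    fix V U assume "V \<in> snd ` set ?F" "U \<in> snd ` set ?F"
    then have b: "below D (fst V)" "below D (fst U)" "below D (snd V)" "below D (snd U)" using D by (auto simp: set_pl bl_def)
    have "S \<Phi> (\<lambda>\<phi>. (\<Sum>s\<le>2 * n. l s * \<phi> (fst V + real s *\<^sub>R snd V)) * (\<Sum>s\<le>2 * n. l s * \<phi> (fst U + real s *\<^sub>R snd U)))
      = (\<Sum>s\<le>2 * n. l s * (\<Sum>t\<le>2 * n. l t * S \<Phi> (\<lambda>\<phi>. \<phi> (fst V + real s *\<^sub>R snd V) * \<phi> (fst U + real t *\<^sub>R snd U))))"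
      by (simp add: sum_product S_sum S_mult_left[symmetric] sum_distrib_left mult_ac)
    also have "\<dots> = (\<Sum>s\<le>2 * n. l s * (\<Sum>t\<le>2 * n. l t * inner (fst V + real s *\<^sub>R snd V) (fst U + real t *\<^sub>R snd U) ^ (2 * n)))"
      using b by (simp add: 1(2) below_add below_scale)
    also have "\<dots> = (\<Sum>s\<le>2 * n. l s * (\<Sum>t\<le>2 * n. l t * ((inner (fst V) (fst U) + real t * inner (fst V) (snd U)) + real s * (inner (snd V) (fst U) + real t * inner (snd V) (snd U))) ^ (2 * n)))"
      by (simp add: inner_add_left inner_add_right algebra_simps)
    finally show "real (2 * n choose n) * ?K V U = S \<Phi> (\<lambda>\<phi>. (\<Sum>s\<le>2 * n. l s * \<phi> (fst V + real s *\<^sub>R snd V)) * (\<Sum>s\<le>2 * n. l s * \<phi> (fst U + real s *\<^sub>R snd U)))"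
      unfolding ext by simp
  qed
  also have "S ?F (\<lambda>V. S ?F (\<lambda>U. real (2 * n choose n) * ?K V U)) = real (2 * n choose n) * (\<Sum>j\<le>n. (real (n choose j))\<^sup>2 * tet a a j (n - j) f f)"
    by (simp only: S_mult_left S_sum tet_pl)
  finally show ?thesis by (simp add: zero_le_mult_iff)
qed

text \<open>All blocks of the diagram formula are nonnegative by \<open>sym_nonneg\<close>. The
  blocks n = 0 and n = p together contain three times the squared variance, and the latter contains
  in addition the contraction in question, with a weight of at least 1 because j! (p - j)! divides
  p!.\<close>

lemma fourth_moment_lower:
  assumes "0 < j" "j < p"
  shows "Cn j (p - j) f \<le> (\<integral>x. Ik p f x ^ 4 \<partial>Gam) - 3 * (fact p * nn p f f)\<^sup>2"
proof -
  let ?T = "\<lambda>n. \<Sum>j\<le>n. W4 p p n j * tet (p - n) (p - n) j (n - j) f f"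
  have T: "0 \<le> ?T n" if "n \<le> p" for n
  proof -
    \<comment> \<open>The weight is \<open>(n choose j)\<close> squared times a factor free of j,
      the shape required by \<open>sym_nonneg\<close>.\<close>
    have "?T n = (\<Sum>j\<le>n. (fact p ^ 4 / (fact (p - n) * fact n)\<^sup>2) * ((real (n choose j))\<^sup>2 * tet (p - n) (p - n) j (n - j) f f))"
    proof (intro sum.cong refl)
      fix j assume "j \<in> {..n}"
      then have h: "real (n choose j) = fact n / (fact j * fact (n - j))" by (simp add: binomial_fact)
      show "W4 p p n j * tet (p - n) (p - n) j (n - j) f f = (fact p ^ 4 / (fact (p - n) * fact n)\<^sup>2) * ((real (n choose j))\<^sup>2 * tet (p - n) (p - n) j (n - j) f f)"
        using that by (simp add: W4_def h power_divide power_mult_distrib power2_eq_square power4_eq_xxxx)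
    qed
    also have "\<dots> = (fact p ^ 4 / (fact (p - n) * fact n)\<^sup>2) * (\<Sum>j\<le>n. (real (n choose j))\<^sup>2 * tet (p - n) (p - n) j (n - j) f f)"
      by (simp only: sum_distrib_left)
    finally show ?thesis using sym_nonneg[of n "p - n" f] by simp
  qed
  have p: "0 < p" using assms by simp
  have T0: "?T 0 = (fact p * nn p f f)\<^sup>2"
  proof -
    have "tet p p 0 0 f f = nn p f f * nn p f f"
      unfolding tet_def nn_def by (simp add: S_mult_left S_mult_right)
    then show ?thesis by (simp add: W4_def power2_eq_square)
  qed
  have e1: "tet 0 0 p 0 f f = (nn p f f)\<^sup>2"
    unfolding tet_def nn_def power2_eq_square by (simp add: S_mult_S power_mult_distrib)
  have e2: "tet 0 0 0 p f f = (nn p f f)\<^sup>2"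
    unfolding tet_00 Cn_sym[of 0 p f] unfolding tet_00[symmetric] e1 ..
  \<comment> \<open>The extreme terms i = 0 and i = p of this block give two squared variances;
    block 0 gives the third.\<close>
  have Tp: "2 * (fact p * nn p f f)\<^sup>2 + Cn j (p - j) f \<le> ?T p"
  proof -
    have "(\<Sum>i\<in>{0, j, p}. W4 p p p i * tet 0 0 i (p - i) f f) \<le> (\<Sum>i\<le>p. W4 p p p i * tet 0 0 i (p - i) f f)"
      using assms by (intro sum_mono2) (auto intro!: mult_nonneg_nonneg W4_nonneg simp: tet_00 Cn_nonneg)
    moreover have "(\<Sum>i\<in>{0, j, p}. W4 p p p i * tet 0 0 i (p - i) f f) = 2 * (fact p * nn p f f)\<^sup>2 + W4 p p p j * Cn j (p - j) f"
      using assms by (simp add: e1[unfolded tet_00] e2[unfolded tet_00] tet_00 W4_def power2_eq_square)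
    moreover have "1 * Cn j (p - j) f \<le> W4 p p p j * Cn j (p - j) f"
    proof (intro mult_right_mono Cn_nonneg)
      have "(fact j * fact (p - j) :: real) \<le> fact p"
      proof -
        have "fact j * fact (p - j) dvd (fact p :: nat)" using fact_fact_dvd_fact[of j "p - j"] assms by simp
        then have "fact j * fact (p - j) \<le> (fact p :: nat)" by (rule dvd_imp_le) simp
        then have "real (fact j * fact (p - j)) \<le> real (fact p)" by (simp only: of_nat_le_iff)
        then show ?thesis by simp
      qed
      then have 1: "(fact j * fact (p - j) :: real)\<^sup>2 \<le> (fact p)\<^sup>2" by (intro power_mono) auto
      have "1 \<le> (fact p :: real)\<^sup>2" by (simp add: fact_ge_1)
      then have "(fact p :: real)\<^sup>2 * 1 \<le> (fact p)\<^sup>2 * (fact p)\<^sup>2" by (intro mult_left_mono) auto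
      then have "(fact j * fact (p - j) :: real)\<^sup>2 \<le> (fact p * fact p)\<^sup>2" using 1 by (simp add: power_mult_distrib)
      then show "1 \<le> W4 p p p j" by (simp add: W4_def)
    qed
    ultimately show ?thesis by simp
  qed
  have "?T 0 + ?T p \<le> (\<Sum>n\<in>{..p}. ?T n)"
  proof -
    have "(\<Sum>n\<in>{0, p}. ?T n) \<le> (\<Sum>n\<in>{..p}. ?T n)" by (intro sum_mono2 T) auto
    then show ?thesis using p by simp
  qed
  then show ?thesis unfolding E_Ik4 using T0 Tp by linarith
qed

text \<open>The range leaves out a = 0 and a = q, where \<open>Cn\<close> is the square of
  \<open>nn q f f\<close> and no decay can be expected.\<close>

definition CnS :: "nat \<Rightarrow> (real \<times> fvec) list \<Rightarrow> real" where
  "CnS q f = (\<Sum>a\<in>{1..<q}. sqrt (Cn a (q - a) f))"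

lemma CnS_ge: "0 < a \<Longrightarrow> a < q \<Longrightarrow> sqrt (Cn a (q - a) f) \<le> CnS q f"
  unfolding CnS_def by (rule member_le_sum) (auto simp: Cn_nonneg)

lemma CnS_nonneg: "0 \<le> CnS q f"
  unfolding CnS_def by (intro sum_nonneg) (auto simp: Cn_nonneg)

definition K4 :: "nat \<Rightarrow> nat \<Rightarrow> real" where "K4 P Q = (\<Sum>n\<le>P. \<Sum>j\<le>n. W4 P Q n j)"

text \<open>Since n <= P < Q, each network keeps Q - n > 0 edges between the two g-vertices besides
  the Suc n crossing ones. The contraction of g is therefore a proper one, and the factor of f is
  bounded by its norm.\<close>

lemma Gm_off_diag:
  assumes "P < Q"
  shows "(\<integral>x. (Gm P Q f g x)\<^sup>2 \<partial>Gam) \<le> K4 P Q * (nn (Suc P) f f * CnS (Suc Q) g)"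
proof -
  have "tet (P - n) (Q - n) (Suc j) (n - j) f g \<le> nn (Suc P) f f * CnS (Suc Q) g" if "n \<le> P" "j \<le> n" for n j
  proof -
    have "tet (P - n) (Q - n) (Suc j) (n - j) f g \<le> sqrt (Cn (P - n) (Suc n) f) * sqrt (Cn (Q - n) (Suc n) g)"
      using order_trans[OF abs_ge_self tet_le[of "P - n" "Q - n" "Suc j" "n - j" f g]] that by simp
    also have "\<dots> \<le> nn (Suc P) f f * CnS (Suc Q) g"
    proof (intro mult_mono)
      show "sqrt (Cn (P - n) (Suc n) f) \<le> nn (Suc P) f f"
        using Cn_le_nn[of "P - n" "Suc n" f] that by (intro real_le_lsqrt) (auto simp: nn_nonneg)
      show "sqrt (Cn (Q - n) (Suc n) g) \<le> CnS (Suc Q) g"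
        using CnS_ge[of "Q - n" "Suc Q" g] assms that by (auto simp: Suc_diff_le)
    qed (auto simp: nn_nonneg Cn_nonneg)
    finally show ?thesis .
  qed
  then have "(\<integral>x. (Gm P Q f g x)\<^sup>2 \<partial>Gam) \<le> (\<Sum>n\<le>P. \<Sum>j\<le>n. W4 P Q n j * (nn (Suc P) f f * CnS (Suc Q) g))"
    unfolding E_Gm2 by (intro sum_mono mult_left_mono W4_nonneg) auto
  then show ?thesis by (simp add: K4_def sum_distrib_right)
qed

text \<open>The diagram n = j = P is the squared mean. For n < P both sides of \<open>tet_le\<close>
  are proper contractions; for n = P and j < P no edge joins equal tensors and
  \<open>tet_cycle\<close> takes over.\<close>

lemma Gm_diag: "(\<integral>x. (Gm P P f g x - fact P * nn (Suc P) f g)\<^sup>2 \<partial>Gam) \<le> K4 P P * (CnS (Suc P) f * CnS (Suc P) g)"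
proof -
  have i: "integrable Gam (Gm P P f g)" "integrable Gam (\<lambda>x. (Gm P P f g x)\<^sup>2)"
    by (auto intro!: Lall_integrable Lall_power)
  have "(\<integral>x. (Gm P P f g x - fact P * nn (Suc P) f g)\<^sup>2 \<partial>Gam) = (\<integral>x. (Gm P P f g x)\<^sup>2 \<partial>Gam) - (fact P * nn (Suc P) f g)\<^sup>2"
    using Gam.variance_eq[OF i] E_Gm[of P P f g] by simp
  also have "(\<integral>x. (Gm P P f g x)\<^sup>2 \<partial>Gam) = (\<Sum>p\<in>(SIGMA n:{..P}. {..n}). W4 P P (fst p) (snd p) * tet (P - fst p) (P - fst p) (Suc (snd p)) (fst p - snd p) f g)" (is "_ = sum ?t _")
    unfolding E_Gm2 by (subst sum.Sigma) (auto simp: case_prod_beta)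
  also have "\<dots> = ?t (P, P) + sum ?t ((SIGMA n:{..P}. {..n}) - {(P, P)})"
    by (rule sum.remove) auto
  also have "?t (P, P) = (fact P * nn (Suc P) f g)\<^sup>2"
  proof -
    have "tet 0 0 (Suc P) 0 f g = nn (Suc P) f g * nn (Suc P) f g"
    proof -
      have "nn (Suc P) f g * nn (Suc P) f g = S f (\<lambda>v. S f (\<lambda>v'. S g (\<lambda>u. S g (\<lambda>u'. inner v u ^ Suc P * inner v' u' ^ Suc P))))"
        unfolding nn_def S_mult_S ..
      then show ?thesis unfolding tet_def by (simp add: power_mult_distrib mult_ac)
    qed
    then show ?thesis by (simp add: W4_def power2_eq_square)
  qed
  also have "(fact P * nn (Suc P) f g)\<^sup>2 + sum ?t ((SIGMA n:{..P}. {..n}) - {(P, P)}) - (fact P * nn (Suc P) f g)\<^sup>2 = sum ?t ((SIGMA n:{..P}. {..n}) - {(P, P)})" by simp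
  also have "\<dots> \<le> (\<Sum>p\<in>(SIGMA n:{..P}. {..n}) - {(P, P)}. W4 P P (fst p) (snd p) * (CnS (Suc P) f * CnS (Suc P) g))"
  proof (intro sum_mono mult_left_mono W4_nonneg)
    fix p assume "p \<in> (SIGMA n:{..P}. {..n}) - {(P, P)}"
    then obtain n j where p: "p = (n, j)" "n \<le> P" "j \<le> n" "n < P \<or> j < P" by (cases p) auto
    show "tet (P - fst p) (P - fst p) (Suc (snd p)) (fst p - snd p) f g \<le> CnS (Suc P) f * CnS (Suc P) g"
    proof (cases "n < P")
      case True
      have "tet (P - n) (P - n) (Suc j) (n - j) f g \<le> sqrt (Cn (P - n) (Suc n) f) * sqrt (Cn (P - n) (Suc n) g)"
        using order_trans[OF abs_ge_self tet_le[of "P - n" "P - n" "Suc j" "n - j" f g]] p by simp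
      also have "\<dots> \<le> CnS (Suc P) f * CnS (Suc P) g"
        using CnS_ge[of "P - n" "Suc P" g] CnS_ge[of "P - n" "Suc P" f] True by (intro mult_mono CnS_nonneg) (auto simp: Suc_diff_le Cn_nonneg)
      finally show ?thesis using p by simp
    next
      case False
      then have n: "n = P" "j < P" using p by auto
      have "tet 0 0 (Suc j) (P - j) f g \<le> tet (P - j) (P - j) (Suc j) 0 f g" using tet_cycle[of "Suc j" "P - j" f g] by simp
      also have "\<dots> \<le> sqrt (Cn (P - j) (Suc j) f) * sqrt (Cn (P - j) (Suc j) g)" using tet_le[of "P - j" "P - j" "Suc j" 0 f g] by simp
      also have "\<dots> \<le> CnS (Suc P) f * CnS (Suc P) g"
        using CnS_ge[of "P - j" "Suc P" g] CnS_ge[of "P - j" "Suc P" f] n by (intro mult_mono CnS_nonneg) (auto simp: Suc_diff_le Cn_nonneg)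
      finally show ?thesis using p n by simp
    qed
  qed
  also have "\<dots> \<le> (\<Sum>p\<in>(SIGMA n:{..P}. {..n}). W4 P P (fst p) (snd p) * (CnS (Suc P) f * CnS (Suc P) g))"
    by (intro sum_mono2) (auto intro!: mult_nonneg_nonneg W4_nonneg CnS_nonneg)
  also have "\<dots> = K4 P P * (CnS (Suc P) f * CnS (Suc P) g)"
    unfolding K4_def sum_distrib_right by (subst sum.Sigma) (auto simp: case_prod_beta)
  finally show ?thesis by simp
qed

lemma Gm_commute: "Gm P Q f g x = Gm Q P g f x"
  unfolding Gm_def by (subst S_swap) (simp add: inner_commute mult_ac)

section \<open>A central limit theorem for sums of chaos elements\<close>

lemma cos_quad: "\<bar>cos (a + y) - cos a + y * sin a\<bar> \<le> y\<^sup>2" for a y :: real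
proof -
  have "\<bar>Re (iexp a * (iexp y - (\<Sum>k\<le>1. (\<i> * complex_of_real y) ^ k / fact k)))\<bar> \<le> cmod (iexp a * (iexp y - (\<Sum>k\<le>1. (\<i> * complex_of_real y) ^ k / fact k)))"
    by (rule abs_Re_le_cmod)
  also have "\<dots> \<le> \<bar>y\<bar> ^ Suc 1 / fact (Suc 1)" using iexp_approx1[of y 1] by (simp add: norm_mult)
  also have "\<dots> \<le> y\<^sup>2" by (simp add: power2_eq_square abs_mult_self_eq)
  also have "Re (iexp a * (iexp y - (\<Sum>k\<le>1. (\<i> * complex_of_real y) ^ k / fact k))) = cos (a + y) - cos a + y * sin a"
    by (simp add: cos_add Re_exp Im_exp algebra_simps)
  finally show ?thesis .
qed

lemma DERIV_E_cos:
  assumes "prob_space M" and Z: "Z \<in> Lall M"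
  shows "((\<lambda>t. \<integral>x. cos (t * Z x + \<theta>) \<partial>M) has_real_derivative - (\<integral>x. Z x * sin (t * Z x + \<theta>) \<partial>M)) (at t)"
proof -
  interpret prob_space M by fact
  have fm: "finite_measure M" by standard (simp add: emeasure_space_1)
  note [measurable] = Lall_measurable[OF Z]
  have bs: "(\<lambda>x. sin (s * Z x + \<theta>)) \<in> Lall M" "(\<lambda>x. cos (s * Z x + \<theta>)) \<in> Lall M" for s
    by (rule Lall_bounded[OF fm, where B = 1], auto)+
  let ?c = "\<lambda>t. \<integral>x. cos (t * Z x + \<theta>) \<partial>M" and ?d = "- (\<integral>x. Z x * sin (t * Z x + \<theta>) \<partial>M)"
  have b: "\<bar>(?c (t + h) - ?c t) / h - ?d\<bar> \<le> \<bar>h\<bar> * (\<integral>x. (Z x)\<^sup>2 \<partial>M)" if "h \<noteq> 0" for h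
  proof -
    have i: "integrable M (\<lambda>x. cos ((t + h) * Z x + \<theta>))" "integrable M (\<lambda>x. cos (t * Z x + \<theta>))"
      "integrable M (\<lambda>x. h * (Z x * sin (t * Z x + \<theta>)))" "integrable M (\<lambda>x. h\<^sup>2 * (Z x)\<^sup>2)"
      by (auto intro!: Lall_integrable Lall_cmult Lall_mult bs Z Lall_power fm)
    have "\<bar>?c (t + h) - ?c t - h * ?d\<bar> = \<bar>\<integral>x. cos ((t + h) * Z x + \<theta>) - cos (t * Z x + \<theta>) + h * (Z x * sin (t * Z x + \<theta>)) \<partial>M\<bar>"
      using i by simp
    also have "\<dots> \<le> (\<integral>x. h\<^sup>2 * (Z x)\<^sup>2 \<partial>M)"
    proof (rule order_trans[OF integral_abs_bound integral_mono])
      fix x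
      show "\<bar>cos ((t + h) * Z x + \<theta>) - cos (t * Z x + \<theta>) + h * (Z x * sin (t * Z x + \<theta>))\<bar> \<le> h\<^sup>2 * (Z x)\<^sup>2"
        using cos_quad[of "t * Z x + \<theta>" "h * Z x"] by (simp add: algebra_simps power_mult_distrib)
    qed (use i in auto)
    also have "\<dots> = \<bar>h\<bar> * (\<bar>h\<bar> * (\<integral>x. (Z x)\<^sup>2 \<partial>M))" by (simp add: power2_eq_square)
    finally have "\<bar>?c (t + h) - ?c t - h * ?d\<bar> \<le> \<bar>h\<bar> * (\<bar>h\<bar> * (\<integral>x. (Z x)\<^sup>2 \<partial>M))" .
    moreover have "?c (t + h) - ?c t - h * ?d = h * ((?c (t + h) - ?c t) / h - ?d)" using that by (simp add: field_simps)
    ultimately have "\<bar>h\<bar> * \<bar>(?c (t + h) - ?c t) / h - ?d\<bar> \<le> \<bar>h\<bar> * (\<bar>h\<bar> * (\<integral>x. (Z x)\<^sup>2 \<partial>M))" by (simp only: abs_mult)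
    then show ?thesis using that by (simp only: mult_le_cancel_left_pos zero_less_abs_iff not_False_eq_True)
  qed
  have "((\<lambda>h. (?c (t + h) - ?c t) / h - ?d) \<longlongrightarrow> 0) (at 0)"
  proof (rule Lim_null_comparison)
    show "\<forall>\<^sub>F h in at 0. norm ((?c (t + h) - ?c t) / h - ?d) \<le> \<bar>h\<bar> * (\<integral>x. (Z x)\<^sup>2 \<partial>M)"
      using b by (auto simp: eventually_at_filter)
    have "((\<lambda>h::real. \<bar>h\<bar> * (\<integral>x. (Z x)\<^sup>2 \<partial>M)) \<longlongrightarrow> \<bar>0\<bar> * (\<integral>x. (Z x)\<^sup>2 \<partial>M)) (at 0)"
      by (intro tendsto_intros)
    then show "((\<lambda>h::real. \<bar>h\<bar> * (\<integral>x. (Z x)\<^sup>2 \<partial>M)) \<longlongrightarrow> 0) (at 0)" by simp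
  qed
  then show ?thesis unfolding DERIV_def by (rule LIM_zero_cancel)
qed

lemma Gam_square_le:
  fixes f :: "(nat \<Rightarrow> real) \<Rightarrow> real"
  assumes "integrable Gam f" "integrable Gam (\<lambda>x. (f x)\<^sup>2)"
  shows "(\<integral>x. f x \<partial>Gam)\<^sup>2 \<le> (\<integral>x. (f x)\<^sup>2 \<partial>Gam)"
  using Gam.variance_positive[of f] Gam.variance_eq[OF assms] by simp

text \<open>Stein's method on characteristic functions. Integration by parts expresses the
  derivative of c t = E cos (t Xs + \<theta>) by the products \<open>Gm\<close> of Malliavin
  derivatives. Replacing these by their means gives the Gaussian equation c' = - t \<sigma> c, and
  the fluctuations \<open>Z\<close> bound the error; the factor q' comes from differentiating
  \<open>wk q'\<close>.\<close>

lemma clt_bound: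
  fixes g :: "nat \<Rightarrow> (real \<times> fvec) list" and Q :: nat and \<theta> :: real
  defines "Xs \<equiv> \<lambda>x. \<Sum>q\<in>{1..Q}. Ik q (g q) x"
  defines "\<sigma> \<equiv> \<Sum>q\<in>{1..Q}. fact q * nn q (g q) (g q)"
  defines "Z \<equiv> \<lambda>q q' x. Gm (q - 1) (q' - 1) (g q) (g q') x - (if q = q' then fact (q - 1) * nn q (g q) (g q) else 0)"
  shows "\<bar>(\<integral>x. cos (Xs x + \<theta>) \<partial>Gam) - exp (- \<sigma> / 2) * cos \<theta>\<bar>
    \<le> (\<Sum>q\<in>{1..Q}. \<Sum>q'\<in>{1..Q}. real q' * sqrt (\<integral>x. (Z q q' x)\<^sup>2 \<partial>Gam))"
proof -
  have XL: "Xs \<in> Lall Gam" unfolding Xs_def by (intro Lall_sum) auto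
  have ZL: "Z q q' \<in> Lall Gam" for q q' unfolding Z_def by (intro Lall_diff Gm_Lall Lall_const) auto
  note [measurable] = Lall_measurable[OF XL]
  have cL: "(\<lambda>x. cos (t * Xs x + \<theta>)) \<in> Lall Gam" for t \<theta> by (rule Lall_bounded[where B = 1]) auto
  have sL: "(\<lambda>x. sin (t * Xs x + \<theta>)) \<in> Lall Gam" for t \<theta> by (rule Lall_bounded[where B = 1]) auto
  define \<delta> where "\<delta> = (\<Sum>q\<in>{1..Q}. \<Sum>q'\<in>{1..Q}. real q' * sqrt (\<integral>x. (Z q q' x)\<^sup>2 \<partial>Gam))"
  have \<delta>0: "0 \<le> \<delta>" unfolding \<delta>_def by (intro sum_nonneg mult_nonneg_nonneg) auto
  define c where "c t = (\<integral>x. cos (t * Xs x + \<theta>) \<partial>Gam)" for t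
  define c' where "c' t = - (\<integral>x. Xs x * sin (t * Xs x + \<theta>) \<partial>Gam)" for t
  have dc: "(c has_real_derivative c' t) (at t)" for t
    unfolding c_def[abs_def] c'_def by (rule DERIV_E_cos[OF Gam.prob_space_axioms XL])
  have HDX: "HD Xs (\<lambda>u x. \<Sum>q\<in>{1..Q}. S (g q) (\<lambda>w. real q * wk (q - 1) w x * inner w u))"
    unfolding Xs_def Ik_def by (intro HD_sum HD_S HD_wk)
  have ibp: "(\<integral>x. Ik q (g q) x * sin (t * Xs x + \<theta>) \<partial>Gam) = t * (\<Sum>q'\<in>{1..Q}. real q' * (\<integral>x. cos (t * Xs x + \<theta>) * Gm (q - 1) (q' - 1) (g q) (g q') x \<partial>Gam))"
    if "q \<in> {1..Q}" for q t
  proof -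
    \<comment> \<open>The sine is a cosine with its phase shifted by pi / 2.\<close>
    have HDs: "HD (\<lambda>x. sin (t * Xs x + \<theta>)) (\<lambda>u x. cos (t * Xs x + \<theta>) * (t * (\<Sum>q\<in>{1..Q}. S (g q) (\<lambda>w. real q * wk (q - 1) w x * inner w u))))"
    proof (rule HD_cong[OF HD_cos[OF HD_cmult[OF HDX, of t], of "\<theta> - pi / 2"]])
      have s: "cos (y + (\<theta> - pi / 2)) = sin (y + \<theta>)" for y by (simp add: cos_diff add_diff_eq)
      show "(\<lambda>x. cos (t * Xs x + (\<theta> - pi / 2))) = (\<lambda>x. sin (t * Xs x + \<theta>))" by (simp only: s)
      have s2: "- sin (y + (\<theta> - pi / 2)) = cos (y + \<theta>)" for y by (simp add: sin_diff add_diff_eq)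
      show "- sin (t * Xs x + (\<theta> - pi / 2)) * (t * (\<Sum>q\<in>{1..Q}. S (g q) (\<lambda>w. real q * wk (q - 1) w x * inner w u))) = cos (t * Xs x + \<theta>) * (t * (\<Sum>q\<in>{1..Q}. S (g q) (\<lambda>w. real q * wk (q - 1) w x * inner w u)))" for u x
        by (simp only: s2)
    qed
    have q: "q = Suc (q - 1)" using that by simp
    have "(\<integral>x. Ik q (g q) x * sin (t * Xs x + \<theta>) \<partial>Gam) = (\<integral>x. S (g q) (\<lambda>v. wk q v x * sin (t * Xs x + \<theta>)) \<partial>Gam)"
      by (simp add: Ik_def S_mult_right)
    also have "\<dots> = S (g q) (\<lambda>v. \<integral>x. wk q v x * sin (t * Xs x + \<theta>) \<partial>Gam)"
      by (intro S_integral Lall_integrable Lall_mult wk_Lall sL)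
    also have "\<dots> = S (g q) (\<lambda>v. \<integral>x. wk (q - 1) v x * (cos (t * Xs x + \<theta>) * (t * (\<Sum>q\<in>{1..Q}. S (g q) (\<lambda>w. real q * wk (q - 1) w x * inner w v)))) \<partial>Gam)"
      by (subst q, subst IBP_wk[OF HDs]) rule
    also have "\<dots> = (\<integral>x. S (g q) (\<lambda>v. wk (q - 1) v x * (cos (t * Xs x + \<theta>) * (t * (\<Sum>q\<in>{1..Q}. S (g q) (\<lambda>w. real q * wk (q - 1) w x * inner w v))))) \<partial>Gam)"
      by (intro S_integral(1)[symmetric] Lall_integrable Lall_mult wk_Lall cL Lall_cmult Lall_sum Lall_S Lall_const) auto
    also have "\<dots> = (\<integral>x. (\<Sum>q'\<in>{1..Q}. t * (real q' * (cos (t * Xs x + \<theta>) * Gm (q - 1) (q' - 1) (g q) (g q') x))) \<partial>Gam)"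
      by (intro Bochner_Integration.integral_cong refl)
        (simp add: Gm_def sum_distrib_left S_sum S_mult_left[symmetric] mult_ac inner_commute)
    also have "\<dots> = (\<Sum>q'\<in>{1..Q}. t * (real q' * (\<integral>x. cos (t * Xs x + \<theta>) * Gm (q - 1) (q' - 1) (g q) (g q') x \<partial>Gam)))"
      by (subst Bochner_Integration.integral_sum) (auto intro!: Lall_integrable Lall_cmult Lall_mult cL)
    finally show ?thesis by (simp only: sum_distrib_left)
  qed
  \<comment> \<open>The approximate differential equation: each term of the error is estimated by
    Cauchy-Schwarz, as the cosine is bounded by 1.\<close>
  have bound: "\<bar>c' t + t * \<sigma> * c t\<bar> \<le> \<bar>t\<bar> * \<delta>" for t
  proof -
    have "c' t = - (\<Sum>q\<in>{1..Q}. \<integral>x. Ik q (g q) x * sin (t * Xs x + \<theta>) \<partial>Gam)"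
    proof -
      have "Xs x * y = (\<Sum>q\<in>{1..Q}. Ik q (g q) x * y)" for x y by (simp add: Xs_def sum_distrib_right)
      then show ?thesis unfolding c'_def
        by (simp only:) (subst Bochner_Integration.integral_sum, auto intro!: Lall_integrable Lall_mult sL)
    qed
    also have "\<dots> = - t * (\<Sum>q\<in>{1..Q}. \<Sum>q'\<in>{1..Q}. real q' * (\<integral>x. cos (t * Xs x + \<theta>) * Gm (q - 1) (q' - 1) (g q) (g q') x \<partial>Gam))"
      by (simp add: ibp sum_distrib_left sum_negf)
    finally have c': "c' t = - t * (\<Sum>q\<in>{1..Q}. \<Sum>q'\<in>{1..Q}. real q' * (\<integral>x. cos (t * Xs x + \<theta>) * Gm (q - 1) (q' - 1) (g q) (g q') x \<partial>Gam))" .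
    have "\<sigma> = (\<Sum>q\<in>{1..Q}. \<Sum>q'\<in>{1..Q}. real q' * (if q = q' then fact (q - 1) * nn q (g q) (g q) else 0))"
      unfolding \<sigma>_def
    proof (intro sum.cong refl)
      fix q assume q: "q \<in> {1..Q}"
      then have "fact q = real q * fact (q - 1)" by (cases q) auto
      then show "fact q * nn q (g q) (g q) = (\<Sum>q'\<in>{1..Q}. real q' * (if q = q' then fact (q - 1) * nn q (g q) (g q) else 0))"
        using q by (simp add: if_distrib[of "(*) _"] cong: if_cong)
    qed
    then have s: "t * \<sigma> * c t = t * (\<Sum>q\<in>{1..Q}. \<Sum>q'\<in>{1..Q}. real q' * (\<integral>x. cos (t * Xs x + \<theta>) * (if q = q' then fact (q - 1) * nn q (g q) (g q) else 0) \<partial>Gam))"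
      by (simp only: c_def sum_distrib_left sum_distrib_right mult_ac Bochner_Integration.integral_mult_right_zero Bochner_Integration.integral_mult_left_zero)
    have "c' t + t * \<sigma> * c t = - t * (\<Sum>q\<in>{1..Q}. \<Sum>q'\<in>{1..Q}. real q' * (\<integral>x. cos (t * Xs x + \<theta>) * Z q q' x \<partial>Gam))"
    proof -
      have "(\<integral>x. cos (t * Xs x + \<theta>) * Z q q' x \<partial>Gam) = (\<integral>x. cos (t * Xs x + \<theta>) * Gm (q - 1) (q' - 1) (g q) (g q') x \<partial>Gam) - (\<integral>x. cos (t * Xs x + \<theta>) * (if q = q' then fact (q - 1) * nn q (g q) (g q) else 0) \<partial>Gam)" for q q'
        unfolding Z_def right_diff_distrib
        by (rule Bochner_Integration.integral_diff) (intro Lall_integrable Lall_mult cL Gm_Lall Lall_const Gam_finite)+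
      then show ?thesis unfolding c' s by (simp add: right_diff_distrib sum_subtractf)
    qed
    then have "\<bar>c' t + t * \<sigma> * c t\<bar> = \<bar>t\<bar> * \<bar>\<Sum>q\<in>{1..Q}. \<Sum>q'\<in>{1..Q}. real q' * (\<integral>x. cos (t * Xs x + \<theta>) * Z q q' x \<partial>Gam)\<bar>"
      by (simp add: abs_mult)
    also have "\<dots> \<le> \<bar>t\<bar> * \<delta>"
      unfolding \<delta>_def
    proof (intro mult_left_mono order_trans[OF sum_abs] sum_mono)
      fix q q'
      have "\<bar>\<integral>x. cos (t * Xs x + \<theta>) * Z q q' x \<partial>Gam\<bar> \<le> sqrt (\<integral>x. (Z q q' x)\<^sup>2 \<partial>Gam)"
      proof -
        have "(\<integral>x. cos (t * Xs x + \<theta>) * Z q q' x \<partial>Gam)\<^sup>2 \<le> (\<integral>x. (cos (t * Xs x + \<theta>) * Z q q' x)\<^sup>2 \<partial>Gam)"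
          by (rule Gam_square_le) (auto intro!: Lall_integrable Lall_power Lall_mult cL ZL)
        also have "\<dots> \<le> (\<integral>x. (Z q q' x)\<^sup>2 \<partial>Gam)"
        proof (rule integral_mono)
          fix x
          have "(cos (t * Xs x + \<theta>))\<^sup>2 * (Z q q' x)\<^sup>2 \<le> 1 * (Z q q' x)\<^sup>2"
            by (intro mult_right_mono) (auto simp: cos_squared_eq)
          then show "(cos (t * Xs x + \<theta>) * Z q q' x)\<^sup>2 \<le> (Z q q' x)\<^sup>2" by (simp add: power_mult_distrib)
        qed (auto intro!: Lall_integrable Lall_power Lall_mult cL ZL)
        finally show ?thesis by (rule real_le_rsqrt[of "\<bar>_\<bar>", unfolded power2_abs])
      qed
      then show "\<bar>real q' * (\<integral>x. cos (t * Xs x + \<theta>) * Z q q' x \<partial>Gam)\<bar> \<le> real q' * sqrt (\<integral>x. (Z q q' x)\<^sup>2 \<partial>Gam)"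
        by (simp add: abs_mult mult_left_mono)
    qed auto
    finally show ?thesis .
  qed
  have \<sigma>0: "0 \<le> \<sigma>" unfolding \<sigma>_def by (intro sum_nonneg mult_nonneg_nonneg nn_nonneg) auto
  \<comment> \<open>Integrating factor: h would be constant for an exact Gaussian, and the mean
    value theorem on [0, 1] controls its increment.\<close>
  define h where "h t = exp (\<sigma> * t\<^sup>2 / 2) * c t" for t
  have dh: "(h has_real_derivative exp (\<sigma> * t\<^sup>2 / 2) * (c' t + t * \<sigma> * c t)) (at t)" for t
    unfolding h_def[abs_def] by (auto intro!: derivative_eq_intros dc simp: algebra_simps)
  obtain z where z: "0 < z" "z < 1" "h 1 - h 0 = (1 - 0) * (exp (\<sigma> * z\<^sup>2 / 2) * (c' z + z * \<sigma> * c z))"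
    using MVT2[of 0 1 h "\<lambda>t. exp (\<sigma> * t\<^sup>2 / 2) * (c' t + t * \<sigma> * c t)"] dh by auto
  have "\<bar>h 1 - h 0\<bar> \<le> exp (\<sigma> / 2) * \<delta>"
  proof -
    have "\<bar>h 1 - h 0\<bar> = exp (\<sigma> * z\<^sup>2 / 2) * \<bar>c' z + z * \<sigma> * c z\<bar>" unfolding z(3) by (simp add: abs_mult)
    also have "\<dots> \<le> exp (\<sigma> / 2) * \<delta>"
    proof (intro mult_mono)
      have "z\<^sup>2 \<le> 1" using z by (simp add: power_le_one)
      then show "exp (\<sigma> * z\<^sup>2 / 2) \<le> exp (\<sigma> / 2)" using \<sigma>0 by (simp add: mult_left_le)
      have "\<bar>z\<bar> * \<delta> \<le> 1 * \<delta>" using z \<delta>0 by (intro mult_right_mono) auto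
      then show "\<bar>c' z + z * \<sigma> * c z\<bar> \<le> \<delta>" using bound[of z] by simp
    qed auto
    finally show ?thesis .
  qed
  then have "exp (- \<sigma> / 2) * \<bar>h 1 - h 0\<bar> \<le> exp (- \<sigma> / 2) * (exp (\<sigma> / 2) * \<delta>)" by (intro mult_left_mono) auto
  moreover have "exp (- \<sigma> / 2) * (exp (\<sigma> / 2) * \<delta>) = \<delta>" by (simp add: mult.assoc[symmetric] exp_add[symmetric])
  moreover have "exp (- \<sigma> / 2) * \<bar>h 1 - h 0\<bar> = \<bar>exp (- \<sigma> / 2) * (h 1 - h 0)\<bar>" by (simp add: abs_mult)
  moreover have "exp (- \<sigma> / 2) * (h 1 - h 0) = c 1 - exp (- \<sigma> / 2) * cos \<theta>"
    by (simp add: h_def c_def Gam.prob_space[unfolded space_Gam] right_diff_distrib mult.assoc[symmetric] exp_add[symmetric])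
  ultimately have "\<bar>c 1 - exp (- \<sigma> / 2) * cos \<theta>\<bar> \<le> \<delta>" by metis
  then show ?thesis unfolding \<delta>_def c_def mult_1 .
qed

text \<open>Only the variance of each order is prescribed: products of derivatives of different
  orders vanish by \<open>Gm_off_diag\<close>, so the orders decouple. Joint limits follow by
  forming linear combinations beforehand.\<close>

lemma clt:
  fixes g :: "nat \<Rightarrow> nat \<Rightarrow> (real \<times> fvec) list"
  assumes Cn: "\<And>q. 1 \<le> q \<Longrightarrow> q \<le> Q \<Longrightarrow> (\<lambda>n. CnS q (g n q)) \<longlonglongrightarrow> 0"
    and s: "\<And>q. 1 \<le> q \<Longrightarrow> q \<le> Q \<Longrightarrow> (\<lambda>n. fact q * nn q (g n q) (g n q)) \<longlonglongrightarrow> s q"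
  shows "(\<lambda>n. \<integral>x. cos ((\<Sum>q\<in>{1..Q}. Ik q (g n q) x) + \<theta>) \<partial>Gam) \<longlonglongrightarrow> exp (- (\<Sum>q\<in>{1..Q}. s q) / 2) * cos \<theta>"
proof -
  define Z where "Z n q q' x = Gm (q - 1) (q' - 1) (g n q) (g n q') x - (if q = q' then fact (q - 1) * nn q (g n q) (g n q) else 0)" for n q q' x
  have nnl: "(\<lambda>n. nn q (g n q) (g n q)) \<longlonglongrightarrow> s q / fact q" if "1 \<le> q" "q \<le> Q" for q
    using tendsto_divide[OF s[OF that] tendsto_const, of "fact q"] by simp
  have off: "(\<lambda>n. \<integral>x. (Gm (q - 1) (q' - 1) (g n q) (g n q') x)\<^sup>2 \<partial>Gam) \<longlonglongrightarrow> 0" if "1 \<le> q" "q < q'" "q' \<le> Q" for q q'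
  proof (rule tendsto_sandwich[of "\<lambda>_. 0"])
    show "\<forall>\<^sub>F n in sequentially. (\<integral>x. (Gm (q - 1) (q' - 1) (g n q) (g n q') x)\<^sup>2 \<partial>Gam) \<le> K4 (q - 1) (q' - 1) * (nn q (g n q) (g n q) * CnS q' (g n q'))"
      using Gm_off_diag[of "q - 1" "q' - 1"] that by (intro always_eventually) auto
    have "(\<lambda>n. K4 (q - 1) (q' - 1) * (nn q (g n q) (g n q) * CnS q' (g n q'))) \<longlonglongrightarrow> K4 (q - 1) (q' - 1) * (s q / fact q * 0)"
      using that by (intro tendsto_intros nnl Cn) auto
    then show "(\<lambda>n. K4 (q - 1) (q' - 1) * (nn q (g n q) (g n q) * CnS q' (g n q'))) \<longlonglongrightarrow> 0" by simp
  qed auto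
  have Zl: "(\<lambda>n. \<integral>x. (Z n q q' x)\<^sup>2 \<partial>Gam) \<longlonglongrightarrow> 0" if q: "q \<in> {1..Q}" "q' \<in> {1..Q}" for q q'
  proof -
    consider "q < q'" | "q' < q" | "q = q'" by linarith
    then show ?thesis
    proof cases
      case 1
      then show ?thesis using off[of q q'] q by (simp add: Z_def)
    next
      case 2
      have "(\<integral>x. (Z n q q' x)\<^sup>2 \<partial>Gam) = (\<integral>x. (Gm (q' - 1) (q - 1) (g n q') (g n q) x)\<^sup>2 \<partial>Gam)" for n
        unfolding Z_def Gm_commute[of "q - 1" "q' - 1"] using 2 by simp
      then show ?thesis using off[of q' q] q 2 by simp
    next
      case 3
      show ?thesis
      proof (rule tendsto_sandwich[of "\<lambda>_. 0"])
        show "\<forall>\<^sub>F n in sequentially. (\<integral>x. (Z n q q' x)\<^sup>2 \<partial>Gam) \<le> K4 (q - 1) (q - 1) * (CnS q (g n q) * CnS q (g n q))"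
          using Gm_diag[of "q - 1"] q 3 by (intro always_eventually) (auto simp: Z_def)
        have "(\<lambda>n. K4 (q - 1) (q - 1) * (CnS q (g n q) * CnS q (g n q))) \<longlonglongrightarrow> K4 (q - 1) (q - 1) * (0 * 0)"
          using q by (intro tendsto_intros Cn) auto
        then show "(\<lambda>n. K4 (q - 1) (q - 1) * (CnS q (g n q) * CnS q (g n q))) \<longlonglongrightarrow> 0" by simp
      qed auto
    qed
  qed
  have "(\<lambda>n. \<Sum>q\<in>{1..Q}. \<Sum>q'\<in>{1..Q}. real q' * sqrt (\<integral>x. (Z n q q' x)\<^sup>2 \<partial>Gam)) \<longlonglongrightarrow> (\<Sum>q\<in>{1..Q}. \<Sum>q'\<in>{1..Q}. real q' * sqrt 0)"
    by (intro tendsto_sum tendsto_mult tendsto_const tendsto_real_sqrt Zl)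
  then have d: "(\<lambda>n. \<Sum>q\<in>{1..Q}. \<Sum>q'\<in>{1..Q}. real q' * sqrt (\<integral>x. (Z n q q' x)\<^sup>2 \<partial>Gam)) \<longlonglongrightarrow> 0" by simp
  have "(\<lambda>n. (\<integral>x. cos ((\<Sum>q\<in>{1..Q}. Ik q (g n q) x) + \<theta>) \<partial>Gam) - exp (- (\<Sum>q\<in>{1..Q}. fact q * nn q (g n q) (g n q)) / 2) * cos \<theta>) \<longlonglongrightarrow> 0"
    using clt_bound[where Q = Q and \<theta> = \<theta> and g = "g n" for n] unfolding Z_def[symmetric] by (intro Lim_null_comparison[OF _ d] always_eventually) auto
  moreover have "(\<lambda>n. exp (- (\<Sum>q\<in>{1..Q}. fact q * nn q (g n q) (g n q)) / 2) * cos \<theta>) \<longlonglongrightarrow> exp (- (\<Sum>q\<in>{1..Q}. s q) / 2) * cos \<theta>"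
    by (intro tendsto_intros s) auto
  ultimately show ?thesis using tendsto_add by fastforce
qed

text \<open>The central limit theorem for a constant sequence of order 1: \<open>CnS\<close> is an
  empty sum there, so the limit is an exact formula.\<close>

lemma E_cos_X: "(\<integral>x. cos (X v x + \<theta>) \<partial>Gam) = exp (- inner v v / 2) * cos \<theta>"
proof -
  have "(\<lambda>n::nat. \<integral>x. cos ((\<Sum>q\<in>{1..1}. Ik q [(1, v)] x) + \<theta>) \<partial>Gam) \<longlonglongrightarrow> exp (- (\<Sum>q\<in>{1..1::nat}. inner v v) / 2) * cos \<theta>"
    by (rule clt) (auto simp: CnS_def nn_def)
  then show ?thesis by (simp add: Ik_def LIMSEQ_const_iff)
qed

text \<open>One coordinate is added at a time. For v orthogonal to \<open>ev i\<close>,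
  \<open>wk_add\<close> makes the Wick power of \<open>v + s *\<^sub>R ev i\<close> a polynomial in
  s whose coefficient at s^(k i) is the wanted product, and \<open>extract_coeff\<close> isolates
  it. Supports are tracked so that the next direction is again orthogonal.\<close>

lemma hermite_product_span:
  assumes "finite I"
  shows "\<exists>f. (\<forall>x. (\<Prod>i\<in>I. poly (hermite (k i)) (x i)) = Ik (\<Sum>i\<in>I. k i) f x) \<and> (\<forall>v\<in>snd ` set f. supp v \<subseteq> I)"
  using assms
proof (induction I rule: finite_induct)
  case empty
  show ?case by (intro exI[of _ "[(1, 0)]"]) (auto simp: Ik_def)
next
  case (insert i I)
  then obtain f where f: "\<And>x. (\<Prod>i\<in>I. poly (hermite (k i)) (x i)) = Ik (\<Sum>i\<in>I. k i) f x" "\<And>v. v \<in> snd ` set f \<Longrightarrow> supp v \<subseteq> I" by blast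
  define q where "q = (\<Sum>i\<in>I. k i)"
  define N where "N = k i + q"
  have le: "k i \<le> N" by (simp add: N_def)
  obtain l :: "nat \<Rightarrow> real" where l: "\<And>c. (\<Sum>j\<le>N. l j * (\<Sum>m\<le>N. c m * real j ^ m)) = c (k i)"
    using extract_coeff[OF le] by blast
  define C where "C = real (N choose q)"
  have C: "C \<noteq> 0" by (simp add: C_def N_def)
  \<comment> \<open>Interpolation nodes with their weights, divided by the binomial coefficient that
    \<open>wk_add\<close> attaches to the wanted term.\<close>
  define L where "L = map (\<lambda>j. (l j / C, real j)) [0..<Suc N]"
  have SL: "S L \<psi> = (\<Sum>j\<le>N. l j * \<psi> (real j)) / C" for \<psi>
    by (simp add: S_def L_def comp_def interv_sum_list_conv_sum_set_nat sum_divide_distrib atLeast0AtMost atLeastLessThanSuc_atLeastAtMost del: upt_Suc)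
  define g where "g = map (\<lambda>p. (fst p, fst (snd p) + snd (snd p) *\<^sub>R ev i)) (pl (\<lambda>_ _. 1) f L)"
  have Sg: "S g \<phi> = S f (\<lambda>v. S L (\<lambda>s. \<phi> (v + s *\<^sub>R ev i)))" for \<phi> :: "fvec \<Rightarrow> real"
  proof -
    have "S g \<phi> = S (pl (\<lambda>_ _. 1) f L) (\<lambda>q. \<phi> (fst q + snd q *\<^sub>R ev i))"
      by (simp add: g_def S_def comp_def)
    then show ?thesis by (simp add: S_pl)
  qed
  have "(\<Prod>i\<in>insert i I. poly (hermite (k i)) (x i)) = Ik N g x" for x
  proof -
    have "Ik N g x = S f (\<lambda>v. wk q v x * wk (k i) (ev i) x)"
      unfolding Ik_def Sg
    proof (intro S_cong refl)
      fix v assume "v \<in> snd ` set f"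
      then have "coord v i = 0" using f(2) insert by blast
      then have o: "inner v (s *\<^sub>R ev i) = 0" for s by simp
      have w: "wk N (v + s *\<^sub>R ev i) x = (\<Sum>m\<le>N. (real (N choose m) * (wk (N - m) v x * wk m (ev i) x)) * s ^ m)" for s
      proof -
        have "wk N (v + s *\<^sub>R ev i) x = (\<Sum>m\<le>N. real (N choose m) * wk m v x * (s ^ (N - m) * wk (N - m) (ev i) x))"
          using wk_add[OF o] by (simp add: wk_scale)
        also have "\<dots> = (\<Sum>m\<le>N. (real (N choose m) * (wk (N - m) v x * wk m (ev i) x)) * s ^ m)"
        proof (rule sum.reindex_bij_witness[of _ "\<lambda>m. N - m" "\<lambda>m. N - m"])
          fix m assume "m \<in> {..N}"
          then have "N choose (N - m) = N choose m" using binomial_symmetric[of m N] by simp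
          with \<open>m \<in> {..N}\<close> show "real (N choose (N - m)) * (wk (N - (N - m)) v x * wk (N - m) (ev i) x) * s ^ (N - m) = real (N choose m) * wk m v x * (s ^ (N - m) * wk (N - m) (ev i) x)"
            by simp
        qed auto
        finally show ?thesis .
      qed
      have e: "N - k i = q" "N choose (k i) = N choose q" using binomial_symmetric[of q N] by (auto simp: N_def)
      show "S L (\<lambda>s. wk N (v + s *\<^sub>R ev i) x) = wk q v x * wk (k i) (ev i) x"
        unfolding SL w l e using C by (simp add: C_def)
    qed
    also have "\<dots> = Ik q f x * poly (hermite (k i)) (x i)"
      by (simp add: Ik_def S_mult_right wk_ev)
    finally show ?thesis using insert(1,2) f(1)[of x] by (simp add: q_def)
  qed
  moreover have "supp v \<subseteq> insert i I" if "v \<in> snd ` set g" for v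
  proof -
    have "\<exists>w\<in>snd ` set f. \<exists>s. v = w + s *\<^sub>R ev i"
      using that unfolding g_def by (force simp: pl_def)
    then show ?thesis using f(2) by fastforce
  qed
  moreover have "(\<Sum>i\<in>insert i I. k i) = N" using insert by (simp add: N_def q_def)
  ultimately show ?case by auto
qed

section \<open>Characteristic functions and isometries\<close>

text \<open>A bounded weight is absorbed into the measure, which makes Levy's one-dimensional
  uniqueness theorem available for expectations with further factors. The phases 0 and - pi / 2
  supply real and imaginary part.\<close>

lemma weighted_law:
  fixes P :: "'a measure" and Z W :: "'a \<Rightarrow> real"
  assumes "prob_space P" and [measurable]: "Z \<in> borel_measurable P" "W \<in> borel_measurable P"
    and W: "\<And>x. 0 \<le> W x" "\<And>x. W x \<le> 2" and m: "m = (\<integral>x. W x \<partial>P)" "m > 0"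
  defines "\<mu> \<equiv> distr (density P (\<lambda>x. ennreal (W x / m))) borel Z"
  shows "real_distribution \<mu>"
    "char \<mu> t = Complex ((\<integral>x. W x * cos (t * Z x + 0) \<partial>P) / m) ((\<integral>x. W x * cos (t * Z x + - pi / 2) \<partial>P) / m)"
    "B \<in> sets borel \<Longrightarrow> measure \<mu> B = (\<integral>x. W x * indicator B (Z x) \<partial>P) / m"
proof -
  interpret P: prob_space P by fact
  have Wm: "0 \<le> W x / m" for x using W m by simp
  have iW: "integrable P (\<lambda>x. W x / m)" using W
    by (intro integrable_divide P.integrable_const_bound[where B = 2]) auto
  have "emeasure (density P (\<lambda>x. ennreal (W x / m))) (space P) = ennreal (\<integral>x. W x / m \<partial>P)"
    by (subst emeasure_density) (auto simp: nn_integral_eq_integral[OF iW] Wm cong: nn_integral_cong)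
  also have "\<dots> = 1" using m by simp
  finally interpret D: prob_space "density P (\<lambda>x. ennreal (W x / m))" by (intro prob_spaceI) simp
  show "real_distribution \<mu>" unfolding \<mu>_def
    by (intro real_distribution.intro D.prob_space_distr) (auto intro!: real_distribution_axioms.intro)
  have ii: "integrable P (\<lambda>x. (W x / m) *\<^sub>R iexp (t * Z x))"
  proof (rule P.integrable_const_bound[where B = "2 / m"])
    show "AE x in P. norm ((W x / m) *\<^sub>R iexp (t * Z x)) \<le> 2 / m"
      using W m by (auto intro!: AE_I2 divide_right_mono)
  qed measurable
  have c: "char \<mu> t = (\<integral>x. (W x / m) *\<^sub>R iexp (t * Z x) \<partial>P)"
    unfolding char_def \<mu>_def
    by (subst integral_distr, simp, simp, subst integral_density) (auto simp: Wm)
  show "char \<mu> t = Complex ((\<integral>x. W x * cos (t * Z x + 0) \<partial>P) / m) ((\<integral>x. W x * cos (t * Z x + - pi / 2) \<partial>P) / m)"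
  proof (rule complex_eqI)
    have "Re (char \<mu> t) = (\<integral>x. Re ((W x / m) *\<^sub>R iexp (t * Z x)) \<partial>P)"
      unfolding c by (rule integral_bounded_linear[OF bounded_linear_Re ii, symmetric])
    then show "Re (char \<mu> t) = Re (Complex ((\<integral>x. W x * cos (t * Z x + 0) \<partial>P) / m) ((\<integral>x. W x * cos (t * Z x + - pi / 2) \<partial>P) / m))"
      by (simp add: Re_exp)
    have "Im (char \<mu> t) = (\<integral>x. Im ((W x / m) *\<^sub>R iexp (t * Z x)) \<partial>P)"
      unfolding c by (rule integral_bounded_linear[OF bounded_linear_Im ii, symmetric])
    moreover have "cos (y + - pi / 2) = sin y" for y :: real by (simp add: cos_diff)
    ultimately show "Im (char \<mu> t) = Im (Complex ((\<integral>x. W x * cos (t * Z x + 0) \<partial>P) / m) ((\<integral>x. W x * cos (t * Z x + - pi / 2) \<partial>P) / m))"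
      by (simp only: complex.sel) (simp add: Im_exp)
  qed
  show "measure \<mu> B = (\<integral>x. W x * indicator B (Z x) \<partial>P) / m" if [measurable]: "B \<in> sets borel"
  proof -
    interpret mu: real_distribution \<mu> by fact
    have "measure \<mu> B = (\<integral>y. indicator B y \<partial>\<mu>)" by simp
    also have "\<dots> = (\<integral>x. (W x / m) *\<^sub>R indicator B (Z x) \<partial>P)"
      unfolding \<mu>_def by (subst integral_distr, simp, simp, subst integral_density) (auto simp: Wm)
    finally show ?thesis by simp
  qed
qed

lemma weight_determines:
  fixes P :: "'a measure" and Q :: "'b measure"
  assumes P: "prob_space P" "Z \<in> borel_measurable P" "W \<in> borel_measurable P" "\<And>x. 0 \<le> W x" "\<And>x. W x \<le> (2::real)"
    and Q: "prob_space Q" "Z' \<in> borel_measurable Q" "W' \<in> borel_measurable Q" "\<And>x. 0 \<le> W' x" "\<And>x. W' x \<le> (2::real)"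
    and eq: "\<And>s \<theta>. (\<integral>x. W x * cos (s * Z x + \<theta>) \<partial>P) = (\<integral>x. W' x * cos (s * Z' x + \<theta>) \<partial>Q)"
    and B: "B \<in> sets borel"
  shows "(\<integral>x. W x * indicator B (Z x) \<partial>P) = (\<integral>x. W' x * indicator B (Z' x) \<partial>Q)"
proof -
  interpret P: prob_space P by fact
  interpret Q: prob_space Q by fact
  note [measurable] = P(2,3) Q(2,3) B
  define m where "m = (\<integral>x. W x \<partial>P)"
  have m': "m = (\<integral>x. W' x \<partial>Q)" using eq[of 0 0] by (simp add: m_def)
  have iW: "integrable P W" using P by (intro P.integrable_const_bound[where B = 2]) auto
  have iW': "integrable Q W'" using Q by (intro Q.integrable_const_bound[where B = 2]) auto
  have m0: "0 \<le> m" unfolding m_def using P by (intro Bochner_Integration.integral_nonneg) auto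
  show ?thesis
  \<comment> \<open>A weight of mass zero cannot be normalised, but then both sides vanish.\<close>
  proof (cases "m = 0")
    case True
    have "0 \<le> (\<integral>x. W x * indicator B (Z x) \<partial>P)" "0 \<le> (\<integral>x. W' x * indicator B (Z' x) \<partial>Q)"
      using P Q by (auto intro!: Bochner_Integration.integral_nonneg)
    moreover have "(\<integral>x. W x * indicator B (Z x) \<partial>P) \<le> m"
      unfolding m_def using P by (intro integral_mono iW Bochner_Integration.integrable_bound[OF iW]) (auto simp: indicator_def)
    moreover have "(\<integral>x. W' x * indicator B (Z' x) \<partial>Q) \<le> m"
      unfolding m' using Q by (intro integral_mono iW' Bochner_Integration.integrable_bound[OF iW']) (auto simp: indicator_def)
    ultimately show ?thesis using True by linarith
  next
    case False
    then have mp: "m > 0" using m0 by simp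
    note wP = weighted_law[OF P m_def mp] and wQ = weighted_law[OF Q m' mp]
    have "distr (density P (\<lambda>x. ennreal (W x / m))) borel Z = distr (density Q (\<lambda>x. ennreal (W' x / m))) borel Z'"
      by (rule Levy_uniqueness[OF wP(1) wQ(1)], intro ext) (simp only: wP(2) wQ(2) eq)
    then have "(\<integral>x. W x * indicator B (Z x) \<partial>P) / m = (\<integral>x. W' x * indicator B (Z' x) \<partial>Q) / m"
      by (metis wP(3)[OF B] wQ(3)[OF B])
    then show ?thesis using False by simp
  qed
qed

text \<open>Indicators are brought in one coordinate at a time: a weight made of the earlier
  indicators and a cosine determines the weighted law of the next coordinate. Keeping v and \<theta>
  arbitrary provides the characteristic functions that this requires.\<close>

lemma law_eq_aux:
  fixes P :: "'a measure" and Q :: "'b measure"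
  assumes P: "prob_space P" and [measurable]: "\<And>i. Z i \<in> borel_measurable P"
    and Q: "prob_space Q" and [measurable]: "\<And>i. Z' i \<in> borel_measurable Q"
    and eq: "\<And>v \<theta>. (\<integral>x. cos (X v (\<lambda>i. Z i x) + \<theta>) \<partial>P) = (\<integral>x. cos (X v (\<lambda>i. Z' i x) + \<theta>) \<partial>Q)"
    and K: "finite K" "\<And>k. k \<in> K \<Longrightarrow> B k \<in> sets borel"
  shows "(\<integral>x. (\<Prod>k\<in>K. indicator (B k) (Z k x)) * cos (X v (\<lambda>i. Z i x) + \<theta>) \<partial>P) = (\<integral>x. (\<Prod>k\<in>K. indicator (B k) (Z' k x)) * cos (X v (\<lambda>i. Z' i x) + \<theta>) \<partial>Q)"
  using K
proof (induction K arbitrary: v \<theta> rule: finite_induct)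
  case empty
  then show ?case using eq by simp
next
  case (insert k K)
  interpret P: prob_space P by fact
  interpret Q: prob_space Q by fact
  have [measurable]: "j \<in> insert k K \<Longrightarrow> B j \<in> sets borel" for j using insert by blast
  have mP[measurable]: "(\<lambda>x. X v (\<lambda>i. Z i x)) \<in> borel_measurable P" for v unfolding X_def by measurable
  have mQ[measurable]: "(\<lambda>x. X v (\<lambda>i. Z' i x)) \<in> borel_measurable Q" for v unfolding X_def by measurable
  let ?I = "\<lambda>x. (\<Prod>k\<in>K. indicator (B k) (Z k x)) :: real" and ?I' = "\<lambda>x. (\<Prod>k\<in>K. indicator (B k) (Z' k x)) :: real"
  have I01: "0 \<le> ?I x" "?I x \<le> 1" "0 \<le> ?I' y" "?I' y \<le> 1" for x y
    by (auto intro!: prod_nonneg prod_le_1 simp: indicator_def)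
  have I2: "?I x \<le> 2" "?I' y \<le> 2" for x y using I01(2)[of x] I01(4)[of y] by linarith+
  have [measurable]: "?I \<in> borel_measurable P" "?I' \<in> borel_measurable Q" by measurable
  have bI: "\<bar>?I x * c\<bar> \<le> \<bar>c\<bar>" "\<bar>?I' y * c\<bar> \<le> \<bar>c\<bar>" for x y c
    using I01 by (auto simp: abs_mult intro!: mult_left_le_one_le)
  have iP: "integrable P (\<lambda>x. ?I x * cos (h x))" if "h \<in> borel_measurable P" for h
    using that by (intro P.integrable_const_bound[where B = 1]) (auto intro!: AE_I2 order_trans[OF bI(1)])
  have iQ: "integrable Q (\<lambda>x. ?I' x * cos (h x))" if "h \<in> borel_measurable Q" for h
    using that by (intro Q.integrable_const_bound[where B = 1]) (auto intro!: AE_I2 order_trans[OF bI(2)])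
  have Xk: "X (v + s *\<^sub>R ev k) y = X v y + s * y k" for v s y by (simp add: X_add X_scale)
  have IH: "(\<integral>x. ?I x * cos (X v (\<lambda>i. Z i x) + \<theta>) \<partial>P) = (\<integral>x. ?I' x * cos (X v (\<lambda>i. Z' i x) + \<theta>) \<partial>Q)" for v \<theta>
    using insert by blast
  have 1: "(\<integral>x. ?I x * indicator (B k) (Z k x) \<partial>P) = (\<integral>x. ?I' x * indicator (B k) (Z' k x) \<partial>Q)"
  proof (rule weight_determines[OF P _ _ _ _ Q])
    show "(\<integral>x. ?I x * cos (s * Z k x + \<theta>) \<partial>P) = (\<integral>x. ?I' x * cos (s * Z' k x + \<theta>) \<partial>Q)" for s \<theta>
      using IH[of "0 + s *\<^sub>R ev k" \<theta>] unfolding Xk by simp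
  qed (use I01 I2 in auto)
  \<comment> \<open>A weight must be nonnegative, hence 1 + cos, which also explains the bound 2.
    The expectation without the cosine, known from \<open>1\<close>, is subtracted at the
    end.\<close>
  let ?W = "\<lambda>x. ?I x * (1 + cos (X v (\<lambda>i. Z i x) + \<theta>))" and ?W' = "\<lambda>x. ?I' x * (1 + cos (X v (\<lambda>i. Z' i x) + \<theta>))"
  \<comment> \<open>Product to sum: the additional cosine becomes a change of v by multiples of
    \<open>ev k\<close>, to which the induction hypothesis applies.\<close>
  have cc: "c * (1 + cos a) * cos b = c * cos b + (c * cos (a + b) + c * cos (a - b)) / 2" for a b c :: real
    by (simp add: cos_add cos_diff algebra_simps)
  have 2: "(\<integral>x. ?W x * indicator (B k) (Z k x) \<partial>P) = (\<integral>x. ?W' x * indicator (B k) (Z' k x) \<partial>Q)"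
  proof (rule weight_determines[OF P _ _ _ _ Q])
    fix s \<theta>'
    have e: "c * (1 + cos (X v y + \<theta>)) * cos (s * y k + \<theta>') = c * cos (X (0 + s *\<^sub>R ev k) y + \<theta>')
       + (c * cos (X (v + s *\<^sub>R ev k) y + (\<theta> + \<theta>')) + c * cos (X (v + (- s) *\<^sub>R ev k) y + (\<theta> - \<theta>'))) / 2" for c y
      unfolding cc Xk by (simp add: algebra_simps)
    have "(\<integral>x. ?W x * cos (s * Z k x + \<theta>') \<partial>P) = (\<integral>x. ?I x * cos (X (0 + s *\<^sub>R ev k) (\<lambda>i. Z i x) + \<theta>') \<partial>P)
       + ((\<integral>x. ?I x * cos (X (v + s *\<^sub>R ev k) (\<lambda>i. Z i x) + (\<theta> + \<theta>')) \<partial>P) + (\<integral>x. ?I x * cos (X (v + (- s) *\<^sub>R ev k) (\<lambda>i. Z i x) + (\<theta> - \<theta>')) \<partial>P)) / 2"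
      unfolding e[of _ "\<lambda>i. Z i _"]
      by (subst Bochner_Integration.integral_add, (intro iP integrable_divide Bochner_Integration.integrable_add; measurable)+, subst integral_divide_zero, subst Bochner_Integration.integral_add, (intro iP; measurable)+) simp
    moreover have "(\<integral>x. ?W' x * cos (s * Z' k x + \<theta>') \<partial>Q) = (\<integral>x. ?I' x * cos (X (0 + s *\<^sub>R ev k) (\<lambda>i. Z' i x) + \<theta>') \<partial>Q)
       + ((\<integral>x. ?I' x * cos (X (v + s *\<^sub>R ev k) (\<lambda>i. Z' i x) + (\<theta> + \<theta>')) \<partial>Q) + (\<integral>x. ?I' x * cos (X (v + (- s) *\<^sub>R ev k) (\<lambda>i. Z' i x) + (\<theta> - \<theta>')) \<partial>Q)) / 2"
      unfolding e[of _ "\<lambda>i. Z' i _"]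
      by (subst Bochner_Integration.integral_add, (intro iQ integrable_divide Bochner_Integration.integrable_add; measurable)+, subst integral_divide_zero, subst Bochner_Integration.integral_add, (intro iQ; measurable)+) simp
    ultimately show "(\<integral>x. ?W x * cos (s * Z k x + \<theta>') \<partial>P) = (\<integral>x. ?W' x * cos (s * Z' k x + \<theta>') \<partial>Q)"
      unfolding IH by simp
  next
    have c2: "0 \<le> 1 + cos y" "1 + cos y \<le> 2" for y :: real using cos_ge_minus_one[of y] cos_le_one[of y] by linarith+
    fix x show "0 \<le> ?W x" using I01(1) c2 by (intro mult_nonneg_nonneg)
    show "?W x \<le> 2" using mult_mono[OF I01(2)[of x] c2(2)[of "X v (\<lambda>i. Z i x) + \<theta>"]] c2 by simp
  next
    have c2: "0 \<le> 1 + cos y" "1 + cos y \<le> 2" for y :: real using cos_ge_minus_one[of y] cos_le_one[of y] by linarith+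
    fix x show "0 \<le> ?W' x" using I01(3) c2 by (intro mult_nonneg_nonneg)
    show "?W' x \<le> 2" using mult_mono[OF I01(4)[of x] c2(2)[of "X v (\<lambda>i. Z' i x) + \<theta>"]] c2 by simp
  qed auto
  have ic: "\<bar>indicator C y * cos z\<bar> \<le> (1::real)" "\<bar>indicator C y :: real\<bar> \<le> 1" for C :: "real set" and y z by (auto simp: indicator_def)
  have iP2: "integrable P (\<lambda>x. ?I x * (indicator (B k) (Z k x) * cos (h x)))" "integrable P (\<lambda>x. ?I x * indicator (B k) (Z k x))" if "h \<in> borel_measurable P" for h
    using that by (auto intro!: P.integrable_const_bound[where B = 1] AE_I2 order_trans[OF bI(1)] ic simp del: abs_mult)
  have iQ2: "integrable Q (\<lambda>x. ?I' x * (indicator (B k) (Z' k x) * cos (h x)))" "integrable Q (\<lambda>x. ?I' x * indicator (B k) (Z' k x))" if "h \<in> borel_measurable Q" for h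
    using that by (auto intro!: Q.integrable_const_bound[where B = 1] AE_I2 order_trans[OF bI(2)] ic simp del: abs_mult)
  have "(\<integral>x. ?I x * (indicator (B k) (Z k x) * cos (X v (\<lambda>i. Z i x) + \<theta>)) \<partial>P) = (\<integral>x. ?W x * indicator (B k) (Z k x) \<partial>P) - (\<integral>x. ?I x * indicator (B k) (Z k x) \<partial>P)"
  proof -
    have e: "?W x * indicator (B k) (Z k x) = ?I x * (indicator (B k) (Z k x) * cos (X v (\<lambda>i. Z i x) + \<theta>)) + ?I x * indicator (B k) (Z k x)" for x by (simp add: algebra_simps)
    show ?thesis unfolding e by (subst Bochner_Integration.integral_add) (auto intro!: iP2(1) iP2(2)[of "\<lambda>_. 0"])
  qed
  also have "\<dots> = (\<integral>x. ?W' x * indicator (B k) (Z' k x) \<partial>Q) - (\<integral>x. ?I' x * indicator (B k) (Z' k x) \<partial>Q)" unfolding 1 2 ..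
  also have "\<dots> = (\<integral>x. ?I' x * (indicator (B k) (Z' k x) * cos (X v (\<lambda>i. Z' i x) + \<theta>)) \<partial>Q)"
  proof -
    have e: "?W' x * indicator (B k) (Z' k x) = ?I' x * (indicator (B k) (Z' k x) * cos (X v (\<lambda>i. Z' i x) + \<theta>)) + ?I' x * indicator (B k) (Z' k x)" for x by (simp add: algebra_simps)
    show ?thesis unfolding e by (subst Bochner_Integration.integral_add) (auto intro!: iQ2(1) iQ2(2)[of "\<lambda>_. 0"])
  qed
  finally show ?case using insert(1,2) by (simp add: mult_ac)
qed

text \<open>The indicator of a cylinder set is the case v = 0, \<theta> = 0 of
  \<open>law_eq_aux\<close>, and cylinder sets determine a probability measure on sequences.\<close>

lemma law_eqI:
  fixes P :: "'a measure" and Q :: "'b measure"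
  assumes P: "prob_space P" and [measurable]: "\<And>i. Z i \<in> borel_measurable P"
    and Q: "prob_space Q" and [measurable]: "\<And>i. Z' i \<in> borel_measurable Q"
    and eq: "\<And>v \<theta>. (\<integral>x. cos (X v (\<lambda>i. Z i x) + \<theta>) \<partial>P) = (\<integral>x. cos (X v (\<lambda>i. Z' i x) + \<theta>) \<partial>Q)"
  shows "law P Z = law Q Z'"
  unfolding law_def
proof (rule measure_eqI_PiM_infinite)
  interpret P: prob_space P by fact
  interpret Q: prob_space Q by fact
  have mP[measurable]: "(\<lambda>x i. Z i x) \<in> measurable P (\<Pi>\<^sub>M i\<in>UNIV. borel)" by (rule measurable_PiM_single') auto
  have mQ[measurable]: "(\<lambda>x i. Z' i x) \<in> measurable Q (\<Pi>\<^sub>M i\<in>UNIV. borel)" by (rule measurable_PiM_single') auto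
  interpret PD: prob_space "distr P (\<Pi>\<^sub>M i\<in>UNIV. borel) (\<lambda>\<omega> i. Z i \<omega>)" by (rule P.prob_space_distr) simp
  interpret QD: prob_space "distr Q (\<Pi>\<^sub>M i\<in>UNIV. borel) (\<lambda>\<omega> i. Z' i \<omega>)" by (rule Q.prob_space_distr) simp
  show "finite_measure (distr P (\<Pi>\<^sub>M i\<in>UNIV. borel) (\<lambda>\<omega> i. Z i \<omega>))" by unfold_locales
  fix A :: "nat \<Rightarrow> real set" and J :: "nat set" assume J: "finite J" "\<And>i. i \<in> J \<Longrightarrow> A i \<in> sets borel"
  let ?C = "prod_emb UNIV (\<lambda>_. borel) J (Pi\<^sub>E J A) :: (nat \<Rightarrow> real) set"
  have C[measurable]: "?C \<in> sets (\<Pi>\<^sub>M i\<in>UNIV. borel)" using J by (intro sets_PiM_I) auto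
  have ind: "indicator ?C y = (\<Prod>k\<in>J. indicator (A k) (y k) :: real)" for y
    using J(1) by (auto simp: prod_emb_def PiE_iff indicator_def prod_zero_iff)
  have "measure (distr P (\<Pi>\<^sub>M i\<in>UNIV. borel) (\<lambda>\<omega> i. Z i \<omega>)) ?C = (\<integral>y. indicator ?C y \<partial>distr P (\<Pi>\<^sub>M i\<in>UNIV. borel) (\<lambda>\<omega> i. Z i \<omega>))"
    using C by simp
  also have "\<dots> = (\<integral>x. (\<Prod>k\<in>J. indicator (A k) (Z k x)) * cos (X 0 (\<lambda>i. Z i x) + 0) \<partial>P)"
    by (subst integral_distr) (simp_all add: ind)
  also have "\<dots> = (\<integral>x. (\<Prod>k\<in>J. indicator (A k) (Z' k x)) * cos (X 0 (\<lambda>i. Z' i x) + 0) \<partial>Q)"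
    by (rule law_eq_aux[OF P _ Q _ eq J]) auto
  also have "\<dots> = (\<integral>y. indicator ?C y \<partial>distr Q (\<Pi>\<^sub>M i\<in>UNIV. borel) (\<lambda>\<omega> i. Z' i \<omega>))"
    by (subst integral_distr) (simp_all add: ind)
  also have "\<dots> = measure (distr Q (\<Pi>\<^sub>M i\<in>UNIV. borel) (\<lambda>\<omega> i. Z' i \<omega>)) ?C" using C by simp
  finally show "emeasure (distr P (\<Pi>\<^sub>M i\<in>UNIV. borel) (\<lambda>\<omega> i. Z i \<omega>)) ?C = emeasure (distr Q (\<Pi>\<^sub>M i\<in>UNIV. borel) (\<lambda>\<omega> i. Z' i \<omega>)) ?C"
    by (simp add: PD.emeasure_eq_measure QD.emeasure_eq_measure)
qed auto

section \<open>Isometries and the invariance of the Gaussian measure\<close>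

definition fisom :: "(fvec \<Rightarrow> fvec) \<Rightarrow> bool" where
  "fisom L \<longleftrightarrow> (\<forall>v w. L (v + w) = L v + L w) \<and> (\<forall>r v. L (r *\<^sub>R v) = r *\<^sub>R L v) \<and> (\<forall>v w. inner (L v) (L w) = inner v w)"

lemma fisom_X: assumes "fisom L" shows "X v (\<lambda>k. X (L (ev k)) x) = X (L v) x"
proof -
  have add: "L (v + w) = L v + L w" and sc: "L (r *\<^sub>R v) = r *\<^sub>R L v" for v w r using assms by (auto simp: fisom_def)
  have "L 0 = 0" using sc[of 0 0] by simp
  then have "L (\<Sum>k\<in>A. g k) = (\<Sum>k\<in>A. L (g k))" for g and A :: "nat set"
    by (induction A rule: infinite_finite_induct) (auto simp: add)
  then have "X (L (\<Sum>k\<in>supp v. coord v k *\<^sub>R ev k)) x = X v (\<lambda>k. X (L (ev k)) x)"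
    by (simp add: sc X_sum X_scale X_def[of v])
  then show ?thesis using fvec_expand[of v] by simp
qed

text \<open>By \<open>E_cos_X\<close> the characteristic functions depend on inner products only.
  Isometries onto a proper subspace, such as the ones that shift or double the coordinates, are
  included.\<close>

lemma Gam_isom:
  assumes L: "fisom L" and \<Phi>: "\<Phi> \<in> borel_measurable Gam"
  shows "(\<integral>x. (\<Phi> (\<lambda>k. X (L (ev k)) x) :: real) \<partial>Gam) = (\<integral>x. \<Phi> x \<partial>Gam)"
proof -
  have "law Gam (\<lambda>k x. X (L (ev k)) x) = law Gam (\<lambda>k x. x k)"
  proof (rule law_eqI)
    fix v \<theta>
    have "(\<lambda>i. x i) = x" for x :: "nat \<Rightarrow> real" by simp
    then show "(\<integral>x. cos (X v (\<lambda>k. X (L (ev k)) x) + \<theta>) \<partial>Gam) = (\<integral>x. cos (X v (\<lambda>k. x k) + \<theta>) \<partial>Gam)"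
      unfolding fisom_X[OF L] E_cos_X using L by (simp add: fisom_def E_cos_X)
  qed (auto intro: Gam.prob_space_axioms)
  then have e: "(\<integral>y. \<Phi> y \<partial>law Gam (\<lambda>k x. X (L (ev k)) x)) = (\<integral>y. \<Phi> y \<partial>law Gam (\<lambda>k x. x k))" by simp
  have \<Phi>': "\<Phi> \<in> borel_measurable (\<Pi>\<^sub>M i\<in>UNIV. borel)" using \<Phi> by (simp add: measurable_cong_sets[OF sets_Gam refl])
  have "(\<integral>y. \<Phi> y \<partial>law Gam (\<lambda>k x. X (L (ev k)) x)) = (\<integral>x. \<Phi> (\<lambda>k. X (L (ev k)) x) \<partial>Gam)"
    unfolding law_def using \<Phi>' by (intro integral_distr measurable_PiM_single') auto
  moreover have "(\<integral>y. \<Phi> y \<partial>law Gam (\<lambda>k x. x k)) = (\<integral>x. \<Phi> (\<lambda>k. x k) \<partial>Gam)"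
    unfolding law_def using \<Phi>' by (intro integral_distr measurable_PiM_single') auto
  ultimately show ?thesis using e by simp
qed

lemma Ik_isom: "fisom L \<Longrightarrow> Ik p f (\<lambda>k. X (L (ev k)) x) = Ik p (map (\<lambda>(c, v). (c, L v)) f) x"
proof -
  assume L: "fisom L"
  have "wk p v (\<lambda>k. X (L (ev k)) x) = wk p (L v) x" for v
    using L by (simp add: wk_def fisom_X fisom_def)
  then show ?thesis unfolding Ik_def using S_map[of "\<lambda>_. 1" L f] by simp
qed

section \<open>Independence and hypercontractivity\<close>

text \<open>Functions of disjoint sets of coordinates take the place of independent families of
  variables.\<close>

definition dep :: "nat set \<Rightarrow> ((nat \<Rightarrow> real) \<Rightarrow> real) \<Rightarrow> bool" where
  "dep A \<phi> \<longleftrightarrow> (\<forall>x y. (\<forall>k\<in>A. x k = y k) \<longrightarrow> \<phi> x = \<phi> y)"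

lemma depD: "dep A \<phi> \<Longrightarrow> (\<And>k. k \<in> A \<Longrightarrow> x k = y k) \<Longrightarrow> \<phi> x = \<phi> y" unfolding dep_def by blast
lemma dep_mix1: "dep A \<phi> \<Longrightarrow> \<phi> (mix A x y) = \<phi> x" by (rule depD[of A \<phi>]) (auto simp: mix_def)
lemma dep_mix2: "dep B \<phi> \<Longrightarrow> A \<inter> B = {} \<Longrightarrow> \<phi> (mix A x y) = \<phi> y" by (rule depD[of B \<phi>]) (auto simp: mix_def)
lemma dep_mono: "dep A \<phi> \<Longrightarrow> A \<subseteq> B \<Longrightarrow> dep B \<phi>" unfolding dep_def by blast

lemma dep_X: "supp v \<subseteq> A \<Longrightarrow> dep A (X v)"
  unfolding dep_def X_def by (auto intro!: sum.cong)
lemma dep_wk: "supp v \<subseteq> A \<Longrightarrow> dep A (wk n v)"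
  using dep_X unfolding dep_def wk_def by metis
lemma dep_Ik:
  assumes "\<And>v. v \<in> snd ` set f \<Longrightarrow> supp v \<subseteq> A" shows "dep A (Ik p f)"
  unfolding dep_def
proof (intro allI impI)
  fix x y :: "nat \<Rightarrow> real" assume xy: "\<forall>k\<in>A. x k = y k"
  show "Ik p f x = Ik p f y" unfolding Ik_def
    by (intro S_cong refl) (use depD[OF dep_wk[OF assms]] xy in blast)
qed

lemma indep_integral:
  assumes "dep A \<phi>" "dep B \<psi>" "A \<inter> B = {}" "\<phi> \<in> Lall Gam" "\<psi> \<in> Lall Gam"
  shows "(\<integral>x. \<phi> x * \<psi> x \<partial>Gam) = (\<integral>x. \<phi> x \<partial>Gam) * (\<integral>x. \<psi> x \<partial>Gam)"
proof -
  have "(\<integral>x. \<phi> x * \<psi> x \<partial>Gam) = (\<integral>x. (\<integral>y. \<phi> (mix A x y) * \<psi> (mix A x y) \<partial>Gam) \<partial>Gam)"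
    using assms by (intro integral_mix Lall_integrable Lall_mult)
  also have "\<dots> = (\<integral>x. (\<integral>y. \<phi> x * \<psi> y \<partial>Gam) \<partial>Gam)"
    by (simp add: dep_mix1[OF assms(1)] dep_mix2[OF assms(2,3)])
  finally show ?thesis by simp
qed

text \<open>Polynomials of degree at most p in the first m coordinates. The number of variables is a
  parameter because hypercontractivity is proved by peeling them off one by one.\<close>

inductive Pol :: "nat \<Rightarrow> nat \<Rightarrow> ((nat \<Rightarrow> real) \<Rightarrow> real) \<Rightarrow> bool" for m where
  Pol_const: "Pol m p (\<lambda>_. c)"
| Pol_var: "k < m \<Longrightarrow> Pol m p F \<Longrightarrow> Pol m (Suc p) (\<lambda>x. x k * F x)"
| Pol_add: "Pol m p F \<Longrightarrow> Pol m p G \<Longrightarrow> Pol m p (\<lambda>x. F x + G x)"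

lemma Pol_mono: "Pol m p F \<Longrightarrow> p \<le> p' \<Longrightarrow> Pol m p' F"
proof (induction arbitrary: p' rule: Pol.induct)
  case (Pol_var k p F)
  then obtain p'' where "p' = Suc p''" "p \<le> p''" by (cases p') auto
  then show ?case using Pol_var by (auto intro: Pol.Pol_var)
qed (auto intro: Pol.intros)

lemma Pol_cmult: "Pol m p F \<Longrightarrow> Pol m p (\<lambda>x. c * F x)"
proof (induction rule: Pol.induct)
  case (Pol_var k p F)
  from Pol.Pol_var[OF Pol_var(1,3)] show ?case by (simp add: mult_ac)
next
  case (Pol_add p F G)
  from Pol.Pol_add[OF Pol_add(3,4)] show ?case by (simp add: distrib_left)
qed (auto intro: Pol.intros)

lemma Pol_mult: "Pol m p F \<Longrightarrow> Pol m q G \<Longrightarrow> Pol m (p + q) (\<lambda>x. F x * G x)"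
proof (induction rule: Pol.induct)
  case (Pol_const p c)
  show ?case by (rule Pol_cmult, rule Pol_mono[OF Pol_const]) simp
next
  case (Pol_var k p F)
  from Pol.Pol_var[OF Pol_var(1) Pol_var(3)[OF Pol_var(4)]] show ?case by (simp add: mult_ac)
next
  case (Pol_add p F G')
  from Pol.Pol_add[OF Pol_add(3)[OF Pol_add(5)] Pol_add(4)[OF Pol_add(5)]] show ?case by (simp add: distrib_right)
qed

lemma Pol_sum: "(\<And>i. i \<in> A \<Longrightarrow> Pol m p (F i)) \<Longrightarrow> Pol m p (\<lambda>x. \<Sum>i\<in>A. F i x)"
  by (induction A rule: infinite_finite_induct) (auto intro: Pol.intros)

lemma Pol_Lall: "Pol m p F \<Longrightarrow> F \<in> Lall Gam"
  by (induction rule: Pol.induct) (auto intro!: Lall_mult Lall_add coord_Lall)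

lemma Pol_dep: "Pol m p F \<Longrightarrow> dep {..<m} F"
proof (induction rule: Pol.induct)
  case (Pol_var k p F)
  then show ?case unfolding dep_def using lessThan_iff by metis
next
  case (Pol_add p F G)
  then show ?case unfolding dep_def by metis
qed (simp add: dep_def)

lemma Pol_wk: assumes "below m v" shows "Pol m n (wk n v)"
proof -
  have X1: "Pol m 1 (X v)"
  proof -
    have "Pol m (Suc 0) (\<lambda>x. coord v k * (x k * 1))" if "k \<in> supp v" for k
    proof -
      have "k < m" using that assms by (metis (mono_tags) below_def mem_Collect_eq not_le)
      then show ?thesis by (intro Pol_cmult Pol.Pol_var Pol.Pol_const)
    qed
    then have "Pol m 1 (\<lambda>x. \<Sum>k\<in>supp v. coord v k * (x k * 1))" by (intro Pol_sum) auto
    then show ?thesis by (simp add: X_def[abs_def])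
  qed
  have "Pol m n (wk n v) \<and> Pol m (Suc n) (wk (Suc n) v)"
  proof (induction n)
    case 0
    then show ?case using X1 Pol_const[of m 0 1] by (simp add: wk_0[abs_def] wk_1[abs_def])
  next
    case (Suc n)
    have a: "Pol m (Suc (Suc n)) (\<lambda>x. X v x * wk (Suc n) v x)" using Pol_mult[OF X1 conjunct2[OF Suc]] by simp
    have b: "Pol m (Suc (Suc n)) (\<lambda>x. (- (real (Suc n) * inner v v)) * wk n v x)"
      by (rule Pol_cmult[OF Pol_mono[OF conjunct1[OF Suc]]]) simp
    have "Pol m (Suc (Suc n)) (\<lambda>x. X v x * wk (Suc n) v x + (- (real (Suc n) * inner v v)) * wk n v x)"
      by (rule Pol_add[OF a b])
    moreover have "(\<lambda>x. X v x * wk (Suc n) v x + (- (real (Suc n) * inner v v)) * wk n v x) = wk (Suc (Suc n)) v"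
      by (auto simp: wk_Suc[of "Suc n"])
    ultimately show ?case using Suc by simp
  qed
  then show ?thesis by simp
qed

lemma Pol_Ik: assumes "bl m f" shows "Pol m p (Ik p f)"
proof -
  have "Pol m p (\<lambda>x. S f (\<lambda>v. wk p v x))" using assms
  proof (induction f)
    case (Cons a f)
    have "bl m f" "below m (snd a)" using Cons(2) by (auto simp: bl_def)
    then have "Pol m p (\<lambda>x. fst a * wk p (snd a) x + S f (\<lambda>v. wk p v x))"
      using Pol_add[OF Pol_cmult[OF Pol_wk] Cons(1)] by simp
    then show ?case by (cases a) simp
  qed (auto intro: Pol_const)
  then show ?thesis by (simp add: Ik_def[abs_def])
qed

abbreviation Hm :: "nat \<Rightarrow> nat \<Rightarrow> (nat \<Rightarrow> real) \<Rightarrow> real" where "Hm m j \<equiv> wk j (ev m)"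

lemma Hm_rec: "x m * Hm m j x = Hm m (Suc j) x + real j * Hm m (j - 1) x"
  by (simp add: wk_Suc[of j])

text \<open>Hermite polynomials in the last variable, rather than monomials, make the second moment
  a sum of squares; the coefficient of index j has degree at most p - j, which is where
  \<open>hypercontractive\<close> gains powers of its constant.\<close>

lemma Pol_form:
  "Pol m' p F \<Longrightarrow> m' = Suc m \<Longrightarrow> \<exists>c. (\<forall>j\<le>p. Pol m (p - j) (c j)) \<and> (\<forall>x. F x = (\<Sum>j\<le>p. Hm m j x * c j x))"
proof (induction rule: Pol.induct)
  case (Pol_const p a)
  have "(\<Sum>j\<le>p. Hm m j x * (if j = 0 then a else 0)) = (\<Sum>j\<le>p. if j = 0 then a else 0)" for x
    by (intro sum.cong) auto
  then have "(\<Sum>j\<le>p. Hm m j x * (if j = 0 then a else 0)) = a" for x by simp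
  then show ?case by (intro exI[of _ "\<lambda>j _. if j = 0 then a else 0"]) (auto intro!: Pol.Pol_const)
next
  case (Pol_add p F G)
  obtain c where c: "\<And>j. j \<le> p \<Longrightarrow> Pol m (p - j) (c j)" "\<And>x. F x = (\<Sum>j\<le>p. Hm m j x * c j x)" using Pol_add.IH(1)[OF Pol_add.prems] by blast
  obtain c' where c': "\<And>j. j \<le> p \<Longrightarrow> Pol m (p - j) (c' j)" "\<And>x. G x = (\<Sum>j\<le>p. Hm m j x * c' j x)" using Pol_add.IH(2)[OF Pol_add.prems] by blast
  show ?case by (rule exI[of _ "\<lambda>j x. c j x + c' j x"]) (simp add: c(2) c'(2) distrib_left sum.distrib Pol.Pol_add[OF c(1) c'(1)])
next
  case (Pol_var k p F)
  obtain c where c: "\<And>j. j \<le> p \<Longrightarrow> Pol m (p - j) (c j)" "\<And>x. F x = (\<Sum>j\<le>p. Hm m j x * c j x)" using Pol_var.IH[OF Pol_var.prems] by blast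
  show ?case
  proof (cases "k = m")
    case False
    then have k: "k < m" using Pol_var by simp
    let ?c = "\<lambda>j x. if j \<le> p then x k * c j x else 0"
    have "Pol m (Suc p - j) (?c j)" if "j \<le> Suc p" for j
    proof (cases "j \<le> p")
      case True
      then show ?thesis using Pol.Pol_var[OF k c(1)[OF True]] by (simp add: Suc_diff_le)
    qed (simp add: Pol.Pol_const)
    moreover have "x k * F x = (\<Sum>j\<le>Suc p. Hm m j x * ?c j x)" for x
      by (simp add: c(2) sum_distrib_left mult_ac)
    ultimately show ?thesis by (intro exI[of _ ?c]) auto
  next
    case True
    let ?c = "\<lambda>j x. (if j = 0 then 0 else c (j - 1) x) + (if j < p then real (Suc j) * c (Suc j) x else 0)"
    have "Pol m (Suc p - j) (?c j)" if "j \<le> Suc p" for j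
    proof (rule Pol.Pol_add)
      show "Pol m (Suc p - j) (\<lambda>x. if j = 0 then 0 else c (j - 1) x)"
        using c(1)[of "j - 1"] that by (cases j) (simp_all add: Pol.Pol_const)
      show "Pol m (Suc p - j) (\<lambda>x. if j < p then real (Suc j) * c (Suc j) x else 0)"
      proof (cases "j < p")
        case True
        then have "Pol m (p - Suc j) (c (Suc j))" using c(1)[of "Suc j"] by simp
        then have "Pol m (Suc p - j) (c (Suc j))" by (rule Pol_mono) simp
        then show ?thesis using True Pol_cmult[of m "Suc p - j" "c (Suc j)" "real (Suc j)"] by simp
      qed (simp add: Pol.Pol_const)
    qed
    moreover have "x k * F x = (\<Sum>j\<le>Suc p. Hm m j x * ?c j x)" for x
    proof -
      have "x k * F x = (\<Sum>j\<le>p. (x m * Hm m j x) * c j x)" by (simp add: c(2) sum_distrib_left True mult.assoc)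
      also have "\<dots> = (\<Sum>j\<le>p. Hm m (Suc j) x * c j x) + (\<Sum>j\<le>p. real j * Hm m (j - 1) x * c j x)"
        unfolding Hm_rec distrib_right sum.distrib ..
      also have "(\<Sum>j\<le>p. Hm m (Suc j) x * c j x) = (\<Sum>j\<le>Suc p. Hm m j x * (if j = 0 then 0 else c (j - 1) x))"
        by (subst sum.atMost_Suc_shift) simp
      also have "(\<Sum>j\<le>p. real j * Hm m (j - 1) x * c j x) = (\<Sum>j<p. Hm m j x * (real (Suc j) * c (Suc j) x))"
        by (cases p) (simp, simp add: sum.atMost_Suc_shift lessThan_Suc_atMost mult_ac del: sum.atMost_Suc of_nat_Suc)
      also have "\<dots> = (\<Sum>j\<le>Suc p. Hm m j x * (if j < p then real (Suc j) * c (Suc j) x else 0))"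
        by (rule sum.mono_neutral_cong_left) auto
      finally show ?thesis by (simp only: distrib_left sum.distrib)
    qed
    ultimately show ?thesis by (intro exI[of _ ?c]) auto
  qed
qed

definition hh :: "nat \<Rightarrow> nat \<Rightarrow> nat \<Rightarrow> nat \<Rightarrow> nat \<Rightarrow> real" where
  "hh m i j k l = (\<integral>x. Hm m i x * Hm m j x * (Hm m k x * Hm m l x) \<partial>Gam)"

lemma hh_indep: "hh m i j k l = hh 0 i j k l"
proof -
  have "hh m i j k l = (\<integral>s. poly (hermite i) s * poly (hermite j) s * (poly (hermite k) s * poly (hermite l) s) \<partial>std_normal_distribution)" for m
    unfolding hh_def wk_ev
    by (rule integral_coord[where h = "\<lambda>s. poly (hermite i) s * poly (hermite j) s * (poly (hermite k) s * poly (hermite l) s)"])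
       (intro borel_measurable_continuous_onI continuous_intros)
  then show ?thesis by simp
qed

lemma quad_discriminant:
  fixes A B C :: real
  assumes q: "\<And>t. 0 \<le> t\<^sup>2 * A - 2 * t * C + B" and "0 \<le> A" "0 \<le> B"
  shows "C\<^sup>2 \<le> A * B"
proof (cases "A = 0")
  case True
  have "C = 0"
  proof (rule ccontr)
    assume C: "C \<noteq> 0"
    have 1: "2 * ((B + 1) / C) * C = 2 * (B + 1)" using C by simp
    have 2: "((B + 1) / C)\<^sup>2 * A = 0" using True by simp
    have "0 \<le> 0 - 2 * (B + 1) + B" using q[of "(B + 1) / C"] unfolding 1 2 .
    then show False using assms(3) by (simp add: algebra_simps)
  qed
  then show ?thesis using True by simp
next
  case False
  then have A: "A > 0" using assms by simp
  have "0 \<le> A * ((C / A)\<^sup>2 * A - 2 * (C / A) * C + B)" using q[of "C / A"] A by (intro mult_nonneg_nonneg) auto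
  also have "\<dots> = A * B - C\<^sup>2" using A by (simp add: field_simps power2_eq_square)
  finally show ?thesis by simp
qed

lemma CS_integral:
  fixes a b :: "(nat \<Rightarrow> real) \<Rightarrow> real"
  assumes "a \<in> Lall Gam" "b \<in> Lall Gam"
  shows "(\<integral>x. a x * b x \<partial>Gam)\<^sup>2 \<le> (\<integral>x. (a x)\<^sup>2 \<partial>Gam) * (\<integral>x. (b x)\<^sup>2 \<partial>Gam)"
proof -
  let ?A = "\<integral>x. (a x)\<^sup>2 \<partial>Gam" and ?B = "\<integral>x. (b x)\<^sup>2 \<partial>Gam" and ?C = "\<integral>x. a x * b x \<partial>Gam"
  have i: "integrable Gam (\<lambda>x. (a x)\<^sup>2)" "integrable Gam (\<lambda>x. (b x)\<^sup>2)" "integrable Gam (\<lambda>x. a x * b x)"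
    using assms by (auto intro!: Lall_integrable Lall_power)
  have q: "0 \<le> t\<^sup>2 * ?A - 2 * t * ?C + ?B" for t
  proof -
    have "0 \<le> (\<integral>x. (t * a x - b x)\<^sup>2 \<partial>Gam)" by simp
    also have "\<dots> = (\<integral>x. t\<^sup>2 * (a x)\<^sup>2 - 2 * t * (a x * b x) + (b x)\<^sup>2 \<partial>Gam)"
      by (simp add: power2_eq_square algebra_simps)
    also have "\<dots> = t\<^sup>2 * ?A - 2 * t * ?C + ?B" using i by simp
    finally show ?thesis .
  qed
  show ?thesis by (rule quad_discriminant[OF q]) simp_all
qed

text \<open>Hoelder's inequality for four factors, as Cauchy-Schwarz applied twice.\<close>

lemma E4_bound:
  assumes L: "\<And>i. i < 4 \<Longrightarrow> c i \<in> Lall Gam" and d: "\<And>i. i < 4 \<Longrightarrow> (\<integral>x. c i x ^ 4 \<partial>Gam) \<le> d i ^ 4" "\<And>i. i < 4 \<Longrightarrow> (0::real) \<le> d i"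
  shows "\<bar>\<integral>x. c 0 x * c 1 x * (c 2 x * c 3 x) \<partial>Gam\<bar> \<le> d 0 * d 1 * (d 2 * d (3::nat))"
proof -
  have CS: "\<bar>\<integral>x. a x * b x \<partial>Gam\<bar> \<le> sqrt ((\<integral>x. (a x)\<^sup>2 \<partial>Gam) * (\<integral>x. (b x)\<^sup>2 \<partial>Gam))" if "a \<in> Lall Gam" "b \<in> Lall Gam" for a b
  proof -
    have i: "integrable Gam (\<lambda>x. (a x)\<^sup>2)" "integrable Gam (\<lambda>x. (b x)\<^sup>2)" using that by (auto intro!: Lall_integrable Lall_power)
    have "(\<integral>x. a x * b x \<partial>Gam)\<^sup>2 \<le> (\<integral>x. (a x)\<^sup>2 \<partial>Gam) * (\<integral>x. (b x)\<^sup>2 \<partial>Gam)"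
      by (rule CS_integral[OF that])
    then show ?thesis using real_sqrt_le_mono by fastforce
  qed
  have sq: "sqrt ((\<integral>x. (a x * b x)\<^sup>2 \<partial>Gam)) \<le> e * f" if "a \<in> Lall Gam" "b \<in> Lall Gam" "(\<integral>x. a x ^ 4 \<partial>Gam) \<le> e ^ 4" "(\<integral>x. b x ^ 4 \<partial>Gam) \<le> f ^ 4" "0 \<le> e" "0 \<le> f" for a b and e f :: real
  proof -
    have p4: "((y::real)\<^sup>2)\<^sup>2 = y ^ 4" for y by (simp add: power2_eq_square power4_eq_xxxx)
    have "(\<integral>x. (a x * b x)\<^sup>2 \<partial>Gam) \<le> sqrt ((\<integral>x. a x ^ 4 \<partial>Gam) * (\<integral>x. b x ^ 4 \<partial>Gam))"
      using CS[of "\<lambda>x. (a x)\<^sup>2" "\<lambda>x. (b x)\<^sup>2"] that by (simp add: Lall_power power_mult_distrib p4)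
    also have "\<dots> \<le> sqrt (e ^ 4 * f ^ 4)"
      using that by (intro real_sqrt_le_mono mult_mono) auto
    also have "e ^ 4 * f ^ 4 = ((e * f)\<^sup>2)\<^sup>2" by (simp add: power2_eq_square power4_eq_xxxx)
    finally have "(\<integral>x. (a x * b x)\<^sup>2 \<partial>Gam) \<le> (e * f)\<^sup>2" by (simp only: real_sqrt_abs abs_power2)
    then show ?thesis using that by (intro real_le_lsqrt) auto
  qed
  have "\<bar>\<integral>x. c 0 x * c 1 x * (c 2 x * c 3 x) \<partial>Gam\<bar> \<le> sqrt ((\<integral>x. (c 0 x * c 1 x)\<^sup>2 \<partial>Gam) * (\<integral>x. (c 2 x * c 3 x)\<^sup>2 \<partial>Gam))"
    using L by (intro CS Lall_mult) auto
  also have "\<dots> = sqrt (\<integral>x. (c 0 x * c 1 x)\<^sup>2 \<partial>Gam) * sqrt (\<integral>x. (c 2 x * c 3 x)\<^sup>2 \<partial>Gam)" by (rule real_sqrt_mult)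
  also have "\<dots> \<le> (d 0 * d 1) * (d 2 * d 3)"
    using L d by (intro mult_mono sq mult_nonneg_nonneg) auto
  finally show ?thesis .
qed

lemma prod4_mono:
  "0 \<le> x1 \<Longrightarrow> x1 \<le> y1 \<Longrightarrow> 0 \<le> x2 \<Longrightarrow> x2 \<le> y2 \<Longrightarrow> 0 \<le> x3 \<Longrightarrow> x3 \<le> y3 \<Longrightarrow> 0 \<le> x4 \<Longrightarrow> x4 \<le> y4 \<Longrightarrow>
    x1 * x2 * (x3 * x4) \<le> y1 * y2 * (y3 * (y4 :: real))"
  by (intro mult_mono mult_nonneg_nonneg) (auto intro: order_trans)

lemma integral_sum4:
  assumes "\<And>i j k l. i \<le> q \<Longrightarrow> j \<le> q \<Longrightarrow> k \<le> q \<Longrightarrow> l \<le> (q::nat) \<Longrightarrow> \<Phi> i j k l \<in> Lall Gam"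
  shows "(\<integral>x. (\<Sum>i\<le>q. \<Sum>j\<le>q. \<Sum>k\<le>q. \<Sum>l\<le>q. \<Phi> i j k l x) \<partial>Gam) = (\<Sum>i\<le>q. \<Sum>j\<le>q. \<Sum>k\<le>q. \<Sum>l\<le>q. \<integral>x. \<Phi> i j k l x \<partial>Gam)"
proof -
  have 1: "(\<integral>x. (\<Sum>i\<le>q. \<Psi> i x) \<partial>Gam) = (\<Sum>i\<le>q. \<integral>x. \<Psi> i x \<partial>Gam)" if "\<And>i. i \<le> q \<Longrightarrow> \<Psi> i \<in> Lall Gam" for \<Psi> :: "nat \<Rightarrow> _ \<Rightarrow> real"
    using that by (intro Bochner_Integration.integral_sum Lall_integrable) auto
  have 2: "(\<integral>x. (\<Sum>k\<le>q. \<Sum>l\<le>q. \<Phi> i j k l x) \<partial>Gam) = (\<Sum>k\<le>q. \<Sum>l\<le>q. \<integral>x. \<Phi> i j k l x \<partial>Gam)" if "i \<le> q" "j \<le> q" for i j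
    using that assms by (subst 1) (auto intro!: Lall_sum sum.cong 1)
  have 3: "(\<integral>x. (\<Sum>j\<le>q. \<Sum>k\<le>q. \<Sum>l\<le>q. \<Phi> i j k l x) \<partial>Gam) = (\<Sum>j\<le>q. \<Sum>k\<le>q. \<Sum>l\<le>q. \<integral>x. \<Phi> i j k l x \<partial>Gam)" if "i \<le> q" for i
    using that assms by (subst 1) (auto intro!: Lall_sum sum.cong 2)
  show ?thesis using assms by (subst 1) (auto intro!: Lall_sum sum.cong 3)
qed

lemma le_if_add: "A \<le> (if P then a else b) \<Longrightarrow> 0 \<le> b \<Longrightarrow> A \<le> (if P then a else 0) + (b :: real)"
  by (cases P) auto

text \<open>The assumptions \<open>two\<close> mean that at least two of the four indices are
  positive, so at least two factors equal the smaller number r.\<close>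

lemma hyper_term:
  assumes "0 \<le> r" "r \<le> s"
    and e: "\<And>n. e n = (if n = (0::nat) then s else r :: real)"
    and two: "\<not> (j = 0 \<and> k = 0 \<and> l = 0)" "\<not> (i = 0 \<and> k = 0 \<and> l = 0)" "\<not> (i = 0 \<and> j = 0 \<and> l = 0)" "\<not> (i = 0 \<and> j = 0 \<and> k = 0)"
  shows "e i * e j * (e k * e l) \<le> s\<^sup>2 * r\<^sup>2"
proof -
  have 1: "s * r * (r * r) \<le> s * r * (s * r)" using assms by (intro mult_left_mono mult_right_mono mult_nonneg_nonneg) auto
  have 2: "r * r * (r * r) \<le> s * r * (s * r)" using assms by (intro mult_mono mult_nonneg_nonneg) auto
  show ?thesis using two 1 2 by (auto simp: e power2_eq_square mult_ac)
qed

text \<open>Induction on the number of variables with a constant independent of it. In the Hermite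
  expansion in the last variable, each index j > 0 lowers the degree of the coefficient and so gains
  at least a factor 1 / K against K ^ q. Terms of the fourth moment with exactly one positive index
  vanish; apart from the term with no positive index, every term therefore gains at least twice,
  which outweighs the total B <= K^2 of the Hermite moments.\<close>

lemma hypercontractive:
  "\<exists>K\<ge>1. \<forall>m q F. q \<le> p \<longrightarrow> Pol m q F \<longrightarrow> (\<integral>x. F x ^ 4 \<partial>Gam) \<le> (K ^ q) ^ 4 * (\<integral>x. (F x)\<^sup>2 \<partial>Gam)\<^sup>2"
proof -
  define B where "B = (\<Sum>i\<le>p. \<Sum>j\<le>p. \<Sum>k\<le>p. \<Sum>l\<le>p. \<bar>hh 0 i j k l\<bar>)"
  have B0: "0 \<le> B" unfolding B_def by (intro sum_nonneg) auto
  define K where "K = 1 + B"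
  have K1: "1 \<le> K" and KB: "B \<le> K\<^sup>2" using B0 by (auto simp: K_def power2_eq_square algebra_simps)
  have main: "(\<integral>x. F x ^ 4 \<partial>Gam) \<le> (K ^ q) ^ 4 * (\<integral>x. (F x)\<^sup>2 \<partial>Gam)\<^sup>2" if "q \<le> p" "Pol m q F" for m q F
    using that
  proof (induction m arbitrary: q F)
    case 0
    have "F x = F (\<lambda>_. 0)" for x using depD[OF Pol_dep[OF 0(2)]] by simp
    then obtain c where c: "F = (\<lambda>_. c)" by blast
    have "1 * c ^ 4 \<le> (K ^ q) ^ 4 * c ^ 4" using K1 by (intro mult_right_mono) (auto simp: one_le_power)
    then show ?case by (simp add: c Gam.prob_space[unfolded space_Gam] power2_eq_square power4_eq_xxxx)
  next
    case (Suc m)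
    obtain c where c: "\<And>j. j \<le> q \<Longrightarrow> Pol m (q - j) (c j)" "\<And>x. F x = (\<Sum>j\<le>q. Hm m j x * c j x)"
      using Pol_form[OF Suc(3) refl] by blast
    have cL: "c j \<in> Lall Gam" if "j \<le> q" for j using Pol_Lall[OF c(1)[OF that]] .
    have cd: "dep {..<m} (c j)" if "j \<le> q" for j using Pol_dep[OF c(1)[OF that]] .
    have hd: "dep {m} (Hm m j)" for j by (rule dep_wk) auto
    define b where "b j = sqrt (\<integral>x. (c j x)\<^sup>2 \<partial>Gam)" for j
    have b0: "0 \<le> b j" and b2: "(b j)\<^sup>2 = (\<integral>x. (c j x)\<^sup>2 \<partial>Gam)" for j by (auto simp: b_def)
    have E2F: "(\<integral>x. (F x)\<^sup>2 \<partial>Gam) = (\<Sum>j\<le>q. fact j * (b j)\<^sup>2)"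
    proof -
      have "(\<integral>x. (F x)\<^sup>2 \<partial>Gam) = (\<integral>x. (\<Sum>i\<le>q. \<Sum>j\<le>q. (Hm m i x * Hm m j x) * (c i x * c j x)) \<partial>Gam)"
        by (simp add: c(2) power2_eq_square sum_product mult_ac)
      also have "\<dots> = (\<Sum>i\<le>q. \<Sum>j\<le>q. \<integral>x. (Hm m i x * Hm m j x) * (c i x * c j x) \<partial>Gam)"
        by (subst Bochner_Integration.integral_sum, (intro Lall_integrable Lall_sum Lall_mult cL; simp)[1], intro sum.cong refl,
            subst Bochner_Integration.integral_sum) (auto intro!: Lall_integrable Lall_mult cL)
      also have "\<dots> = (\<Sum>i\<le>q. \<Sum>j\<le>q. (if i = j then fact i * (\<integral>x. c i x * c j x \<partial>Gam) else 0))"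
      proof (intro sum.cong refl)
        fix i j assume "i \<in> {..q}" "j \<in> {..q}"
        then have ij: "i \<le> q" "j \<le> q" by auto
        have "(\<integral>x. (Hm m i x * Hm m j x) * (c i x * c j x) \<partial>Gam) = (\<integral>x. Hm m i x * Hm m j x \<partial>Gam) * (\<integral>x. c i x * c j x \<partial>Gam)"
        proof (rule indep_integral[where A = "{m}" and B = "{..<m}"])
          show "dep {m} (\<lambda>x. Hm m i x * Hm m j x)" using hd[of i] hd[of j] unfolding dep_def by metis
          show "dep {..<m} (\<lambda>x. c i x * c j x)" using cd[OF ij(1)] cd[OF ij(2)] unfolding dep_def by metis
        qed (use cL ij in auto)
        then show "(\<integral>x. (Hm m i x * Hm m j x) * (c i x * c j x) \<partial>Gam) = (if i = j then fact i * (\<integral>x. c i x * c j x \<partial>Gam) else 0)"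
          by (simp add: E2)
      qed
      also have "\<dots> = (\<Sum>j\<le>q. fact j * (b j)\<^sup>2)" by (simp add: b2) (simp add: power2_eq_square)
      finally show ?thesis .
    qed
    define D where "D = K ^ q"
    have D0: "0 \<le> D" using K1 by (simp add: D_def)
    \<comment> \<open>s is the L2 norm of F, A the norm of F without its part of degree 0 in the
      last variable, and r = A / K records the gain of a positive index.\<close>
    define s where "s = sqrt (\<Sum>j\<le>q. fact j * (b j)\<^sup>2)"
    define A where "A = sqrt (\<Sum>j\<in>{1..q}. fact j * (b j)\<^sup>2)"
    have s2: "s\<^sup>2 = (\<Sum>j\<le>q. fact j * (b j)\<^sup>2)" unfolding s_def by (simp add: sum_nonneg)
    have A2: "A\<^sup>2 = (\<Sum>j\<in>{1..q}. fact j * (b j)\<^sup>2)" unfolding A_def by (simp add: sum_nonneg)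
    have sA: "s\<^sup>2 = (b 0)\<^sup>2 + A\<^sup>2"
    proof -
      have "{..q} = insert 0 {1..q}" by auto
      then show ?thesis unfolding s2 A2 by simp
    qed
    have s0: "0 \<le> s" and A0: "0 \<le> A" unfolding s_def A_def by (auto intro!: sum_nonneg)
    have "A\<^sup>2 \<le> s\<^sup>2" "(b 0)\<^sup>2 \<le> s\<^sup>2" using sA by simp_all
    then have As: "A \<le> s" and b0s: "b 0 \<le> s" using s0 by (auto dest: power2_le_imp_le)
    have bA: "b j \<le> A" if "1 \<le> j" "j \<le> q" for j
    proof (rule power2_le_imp_le[OF _ A0])
      have "1 * (b j)\<^sup>2 \<le> fact j * (b j)\<^sup>2" by (intro mult_right_mono) (auto simp: fact_ge_1)
      also have "\<dots> \<le> A\<^sup>2" unfolding A2 using that by (intro member_le_sum[of j "{1..q}" "\<lambda>j. fact j * (b j)\<^sup>2"]) auto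
      finally show "(b j)\<^sup>2 \<le> A\<^sup>2" by simp
    qed
    define r where "r = A / K"
    have r0: "0 \<le> r" using A0 K1 by (simp add: r_def)
    have "A / K \<le> A / 1" using A0 K1 by (intro divide_left_mono) auto
    then have rs: "r \<le> s" using As by (simp add: r_def)
    define e where "e n = (if n = (0::nat) then s else r)" for n
    have c4: "(\<integral>x. c j x ^ 4 \<partial>Gam) \<le> (K ^ (q - j) * b j) ^ 4" if "j \<le> q" for j
      using Suc.IH[of "q - j" "c j"] that Suc.prems c(1) by (simp add: b2[symmetric] power_mult_distrib power_mult[symmetric])
    have de: "K ^ (q - j) * b j \<le> D * e j" if "j \<le> q" for j
    proof (cases "j = 0")
      case True
      then show ?thesis using b0s D0 by (simp add: e_def D_def mult_left_mono)
    next
      case False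
      have "K ^ (q - j) \<le> K ^ (q - 1)" using K1 False by (intro power_increasing) auto
      then have "K ^ (q - j) * b j \<le> K ^ (q - 1) * A" using bA[of j] False that K1 b0 by (intro mult_mono) auto
      also have "\<dots> = D * r"
        using False that K1 power_Suc[of K "q - 1"] by (simp add: D_def r_def)
      finally show ?thesis using False by (simp add: e_def)
    qed
    have e0: "0 \<le> e n" for n using r0 s0 by (simp add: e_def)
    have tbound: "hh m i j k l * (\<integral>x. c i x * c j x * (c k x * c l x) \<partial>Gam) \<le> (if i = 0 \<and> j = 0 \<and> k = 0 \<and> l = 0 then D ^ 4 * (b 0) ^ 4 else \<bar>hh 0 i j k l\<bar> * (D ^ 4 * (s\<^sup>2 * r\<^sup>2)))"
      if le: "i \<le> q" "j \<le> q" "k \<le> q" "l \<le> q" for i j k l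
    proof -
      have ec: "\<bar>\<integral>x. c i x * c j x * (c k x * c l x) \<partial>Gam\<bar> \<le> (K ^ (q - i) * b i) * (K ^ (q - j) * b j) * ((K ^ (q - k) * b k) * (K ^ (q - l) * b l))"
      proof -
        define a where "a n = (if n = 0 then i else if n = 1 then j else if n = 2 then k else l)" for n :: nat
        have aq: "a n \<le> q" for n using le by (simp add: a_def)
        have "\<bar>\<integral>x. c (a 0) x * c (a 1) x * (c (a 2) x * c (a 3) x) \<partial>Gam\<bar> \<le> (K ^ (q - a 0) * b (a 0)) * (K ^ (q - a 1) * b (a 1)) * ((K ^ (q - a 2) * b (a 2)) * (K ^ (q - a 3) * b (a 3)))"
          by (rule E4_bound[of "\<lambda>n. c (a n)" "\<lambda>n. K ^ (q - a n) * b (a n)"]) (use aq cL c4 b0 K1 in auto)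
        then show ?thesis by (simp add: a_def)
      qed
      show ?thesis
      proof (cases "i = 0 \<and> j = 0 \<and> k = 0 \<and> l = 0")
        case True
        then have "hh m i j k l = 1" by (simp add: hh_def Gam.prob_space[unfolded space_Gam])
        then show ?thesis using True ec by (simp add: D_def power4_eq_xxxx mult_ac)
      next
        case False
        show ?thesis
        proof (cases "(j = 0 \<and> k = 0 \<and> l = 0) \<or> (i = 0 \<and> k = 0 \<and> l = 0) \<or> (i = 0 \<and> j = 0 \<and> l = 0) \<or> (i = 0 \<and> j = 0 \<and> k = 0)")
          case True
          \<comment> \<open>A single positive index leaves the mean of one Hermite polynomial, which
            is zero.\<close>
          then have "hh m i j k l = 0" using False by (auto simp: hh_def E_wk)
          then show ?thesis using False D0 by (auto intro!: mult_nonneg_nonneg)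
        next
          case F2: False
          have "hh m i j k l * (\<integral>x. c i x * c j x * (c k x * c l x) \<partial>Gam) \<le> \<bar>hh m i j k l\<bar> * \<bar>\<integral>x. c i x * c j x * (c k x * c l x) \<partial>Gam\<bar>"
            unfolding abs_mult[symmetric] by (rule abs_ge_self)
          also have "\<dots> \<le> \<bar>hh m i j k l\<bar> * ((D * e i) * (D * e j) * ((D * e k) * (D * e l)))"
          proof (rule mult_left_mono[OF order_trans[OF ec prod4_mono]])
            have "0 \<le> K ^ (q - n) * b n" for n using K1 b0 by simp
            then show "0 \<le> K ^ (q - i) * b i" "0 \<le> K ^ (q - j) * b j" "0 \<le> K ^ (q - k) * b k" "0 \<le> K ^ (q - l) * b l" by blast+
          qed (use de le in auto)
          also have "\<dots> = \<bar>hh m i j k l\<bar> * (D ^ 4 * (e i * e j * (e k * e l)))" by (simp add: power4_eq_xxxx mult_ac)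
          also have "\<dots> \<le> \<bar>hh m i j k l\<bar> * (D ^ 4 * (s\<^sup>2 * r\<^sup>2))"
            by (rule mult_left_mono, rule mult_left_mono, rule hyper_term[OF r0 rs e_def]) (use F2 D0 in auto)
          finally show ?thesis using False hh_indep[of m i j k l] by auto
        qed
      qed
    qed
    have "(\<integral>x. F x ^ 4 \<partial>Gam) = (\<Sum>i\<le>q. \<Sum>j\<le>q. \<Sum>k\<le>q. \<Sum>l\<le>q. hh m i j k l * (\<integral>x. c i x * c j x * (c k x * c l x) \<partial>Gam))"
    proof -
      have "F x ^ 4 = (\<Sum>i\<le>q. \<Sum>j\<le>q. \<Sum>k\<le>q. \<Sum>l\<le>q. (Hm m i x * Hm m j x * (Hm m k x * Hm m l x)) * (c i x * c j x * (c k x * c l x)))" for x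
      proof -
        have "F x ^ 4 = (F x * F x) * (F x * F x)" by (simp add: power4_eq_xxxx)
        also have "F x * F x = (\<Sum>i\<le>q. \<Sum>j\<le>q. (Hm m i x * c i x) * (Hm m j x * c j x))" by (simp only: c(2) sum_product)
        also have "\<dots> * \<dots> = (\<Sum>i\<le>q. \<Sum>j\<le>q. \<Sum>k\<le>q. \<Sum>l\<le>q. ((Hm m i x * c i x) * (Hm m j x * c j x)) * ((Hm m k x * c k x) * (Hm m l x * c l x)))"
          by (simp only: sum_distrib_right) (simp only: sum_distrib_left)
        finally show ?thesis by (simp only: mult_ac)
      qed
      then have "(\<integral>x. F x ^ 4 \<partial>Gam) = (\<Sum>i\<le>q. \<Sum>j\<le>q. \<Sum>k\<le>q. \<Sum>l\<le>q. \<integral>x. (Hm m i x * Hm m j x * (Hm m k x * Hm m l x)) * (c i x * c j x * (c k x * c l x)) \<partial>Gam)"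
        by (simp only:) (rule integral_sum4, intro Lall_mult wk_Lall cL)
      also have "\<dots> = (\<Sum>i\<le>q. \<Sum>j\<le>q. \<Sum>k\<le>q. \<Sum>l\<le>q. hh m i j k l * (\<integral>x. c i x * c j x * (c k x * c l x) \<partial>Gam))"
      proof (intro sum.cong refl)
        fix i j k l assume "i \<in> {..q}" "j \<in> {..q}" "k \<in> {..q}" "l \<in> {..q}"
        then have le: "i \<le> q" "j \<le> q" "k \<le> q" "l \<le> q" by auto
        show "(\<integral>x. (Hm m i x * Hm m j x * (Hm m k x * Hm m l x)) * (c i x * c j x * (c k x * c l x)) \<partial>Gam) = hh m i j k l * (\<integral>x. c i x * c j x * (c k x * c l x) \<partial>Gam)"
          unfolding hh_def
        proof (rule indep_integral[where A = "{m}" and B = "{..<m}"])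
          show "dep {m} (\<lambda>x. Hm m i x * Hm m j x * (Hm m k x * Hm m l x))"
            unfolding dep_def using depD[OF hd] by (metis (no_types, lifting))
          show "dep {..<m} (\<lambda>x. c i x * c j x * (c k x * c l x))"
            unfolding dep_def using depD[OF cd] le by (metis (no_types, lifting))
        qed (use cL le in \<open>auto intro!: Lall_mult\<close>)
      qed
      finally show ?thesis .
    qed
    also have "\<dots> \<le> (\<Sum>i\<le>q. \<Sum>j\<le>q. \<Sum>k\<le>q. \<Sum>l\<le>q. (if i = 0 \<and> j = 0 \<and> k = 0 \<and> l = 0 then D ^ 4 * (b 0) ^ 4 else 0) + \<bar>hh 0 i j k l\<bar> * (D ^ 4 * (s\<^sup>2 * r\<^sup>2)))"
    proof (intro sum_mono)
      fix i j k l assume "i \<in> {..q}" "j \<in> {..q}" "k \<in> {..q}" "l \<in> {..q}"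
      then have "hh m i j k l * (\<integral>x. c i x * c j x * (c k x * c l x) \<partial>Gam) \<le> (if i = 0 \<and> j = 0 \<and> k = 0 \<and> l = 0 then D ^ 4 * (b 0) ^ 4 else \<bar>hh 0 i j k l\<bar> * (D ^ 4 * (s\<^sup>2 * r\<^sup>2)))" by (intro tbound) auto
      moreover have "0 \<le> \<bar>hh 0 i j k l\<bar> * (D ^ 4 * (s\<^sup>2 * r\<^sup>2))" using D0 by (intro mult_nonneg_nonneg) auto
      ultimately show "hh m i j k l * (\<integral>x. c i x * c j x * (c k x * c l x) \<partial>Gam) \<le> (if i = 0 \<and> j = 0 \<and> k = 0 \<and> l = 0 then D ^ 4 * (b 0) ^ 4 else 0) + \<bar>hh 0 i j k l\<bar> * (D ^ 4 * (s\<^sup>2 * r\<^sup>2))"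
        by (rule le_if_add)
    qed
    also have "\<dots> = D ^ 4 * (b 0) ^ 4 + (\<Sum>i\<le>q. \<Sum>j\<le>q. \<Sum>k\<le>q. \<Sum>l\<le>q. \<bar>hh 0 i j k l\<bar>) * (D ^ 4 * (s\<^sup>2 * r\<^sup>2))"
    proof -
      have z: "(\<Sum>l\<le>q. if P \<and> l = 0 then y else 0) = (if P then y else (0::real))" for P y by (cases P) (simp_all add: sum.delta)
      have z': "(\<Sum>i\<le>q. if i = 0 then y else (0::real)) = y" for y by simp
      have "(\<Sum>i\<le>q. \<Sum>j\<le>q. \<Sum>k\<le>q. \<Sum>l\<le>q. (if i = 0 \<and> j = 0 \<and> k = 0 \<and> l = 0 then D ^ 4 * (b 0) ^ 4 else 0)) = D ^ 4 * (b 0) ^ 4"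
        unfolding conj_assoc[symmetric] z z' ..
      then show ?thesis by (simp only: sum.distrib sum_distrib_right)
    qed
    also have "\<dots> \<le> D ^ 4 * (b 0) ^ 4 + K\<^sup>2 * (D ^ 4 * (s\<^sup>2 * r\<^sup>2))"
    proof -
      have "(\<Sum>i\<le>q. \<Sum>j\<le>q. \<Sum>k\<le>q. \<Sum>l\<le>q. \<bar>hh 0 i j k l\<bar>) \<le> B"
      proof -
        have nest: "(\<Sum>i\<le>q. f i) \<le> (\<Sum>i\<le>p. f' i)" if "\<And>i. f i \<le> f' i" "\<And>i. 0 \<le> f' i" for f f' :: "nat \<Rightarrow> real"
          using that Suc.prems(1) by (intro order_trans[OF sum_mono[of _ f f'] sum_mono2]) auto
        show ?thesis unfolding B_def by (intro nest sum_nonneg abs_ge_zero order_refl)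
      qed
      then show ?thesis using KB D0 by (intro add_left_mono mult_right_mono) auto
    qed
    \<comment> \<open>The two factors r = A / K absorb the bound K^2 for the Hermite moments; what
      remains is bounded by s^4 because s^2 = (b 0)^2 + A^2.\<close>
    also have "K\<^sup>2 * (D ^ 4 * (s\<^sup>2 * r\<^sup>2)) = D ^ 4 * (s\<^sup>2 * A\<^sup>2)" using K1 by (simp add: r_def power_divide)
    also have "D ^ 4 * (b 0) ^ 4 + D ^ 4 * (s\<^sup>2 * A\<^sup>2) \<le> D ^ 4 * (s\<^sup>2)\<^sup>2"
    proof -
      have "(b 0) ^ 4 = (b 0)\<^sup>2 * (b 0)\<^sup>2" by (simp add: power2_eq_square power4_eq_xxxx)
      also have "\<dots> \<le> s\<^sup>2 * (b 0)\<^sup>2" using sA by (intro mult_right_mono) auto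
      finally have "(b 0) ^ 4 + s\<^sup>2 * A\<^sup>2 \<le> s\<^sup>2 * ((b 0)\<^sup>2 + A\<^sup>2)" by (simp add: algebra_simps)
      also have "\<dots> = (s\<^sup>2)\<^sup>2" by (simp only: sA[symmetric] power2_eq_square[of "s\<^sup>2"])
      finally show ?thesis using D0 by (simp add: distrib_left[symmetric] mult_left_mono)
    qed
    finally show ?case unfolding E2F s2[symmetric] D_def .
  qed
  then show ?thesis using K1 by blast
qed

text \<open>Hypercontractivity for the square and once more for the function itself. The uniform
  bound is what later turns convergence in law into convergence of fourth moments.\<close>

lemma Ik_eighth: "\<exists>C. \<forall>f. (\<integral>x. Ik p f x ^ 8 \<partial>Gam) \<le> C * (\<integral>x. (Ik p f x)\<^sup>2 \<partial>Gam) ^ 4"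
proof -
  obtain K where K: "\<And>m q F. q \<le> p + p \<Longrightarrow> Pol m q F \<Longrightarrow> (\<integral>x. F x ^ 4 \<partial>Gam) \<le> (K ^ q) ^ 4 * (\<integral>x. (F x)\<^sup>2 \<partial>Gam)\<^sup>2"
    using hypercontractive[of "p + p"] by blast
  have "(\<integral>x. Ik p f x ^ 8 \<partial>Gam) \<le> ((K ^ (p + p)) ^ 4 * ((K ^ p) ^ 4)\<^sup>2) * (\<integral>x. (Ik p f x)\<^sup>2 \<partial>Gam) ^ 4" for f
  proof -
    obtain m where m: "bl m f" using bl_ex by blast
    let ?F = "Ik p f"
    have P: "Pol m p ?F" using m by (rule Pol_Ik)
    have e8: "(?F x * ?F x) ^ 4 = ?F x ^ 8" and e4: "(?F x * ?F x)\<^sup>2 = ?F x ^ 4" for x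
      by (simp_all add: power_mult_distrib power_add[symmetric])
    have "(\<integral>x. ?F x ^ 8 \<partial>Gam) \<le> (K ^ (p + p)) ^ 4 * (\<integral>x. ?F x ^ 4 \<partial>Gam)\<^sup>2"
      using K[OF _ Pol_mult[OF P P]] by (simp add: e8 e4)
    also have "\<dots> \<le> (K ^ (p + p)) ^ 4 * ((K ^ p) ^ 4 * (\<integral>x. (?F x)\<^sup>2 \<partial>Gam)\<^sup>2)\<^sup>2"
      using K[OF _ P] by (intro mult_left_mono power_mono Bochner_Integration.integral_nonneg) auto
    also have "\<dots> = ((K ^ (p + p)) ^ 4 * ((K ^ p) ^ 4)\<^sup>2) * (\<integral>x. (?F x)\<^sup>2 \<partial>Gam) ^ 4"
      by (simp only: power_mult_distrib power_mult[symmetric] mult.assoc) simp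
    finally show ?thesis .
  qed
  then show ?thesis by blast
qed

section \<open>Influences and rotations\<close>

text \<open>The Loewner order on kernels. It is compatible with products of positive kernels, so a
  factor inside a network may be replaced by a larger one.\<close>

definition dom :: "nat \<Rightarrow> (fvec \<Rightarrow> fvec \<Rightarrow> real) \<Rightarrow> (fvec \<Rightarrow> fvec \<Rightarrow> real) \<Rightarrow> bool" where
  "dom D k1 k2 \<longleftrightarrow> psd D (\<lambda>v w. k2 v w - k1 v w)"

lemma dom_S: "dom D k1 k2 \<Longrightarrow> bl D f \<Longrightarrow> S f (\<lambda>v. S f (\<lambda>w. k1 v w)) \<le> S f (\<lambda>v. S f (\<lambda>w. k2 v w))"
  unfolding dom_def using psd_nonneg[of D "\<lambda>v w. k2 v w - k1 v w" f] by (simp add: S_diff)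

lemma dom_psd: "psd D k1 \<Longrightarrow> dom D k1 k2 \<Longrightarrow> psd D k2"
  unfolding dom_def using psd_add[of D k1 "\<lambda>v w. k2 v w - k1 v w"] by simp

lemma dom_refl: "dom D k k" unfolding dom_def using psd_const[of 0] by simp

lemma dom_mult:
  assumes "psd D k1" "dom D k1 k2" "psd D l1" "dom D l1 l2"
  shows "dom D (\<lambda>v w. k1 v w * l1 v w) (\<lambda>v w. k2 v w * l2 v w)"
proof -
  have "psd D (\<lambda>v w. (k2 v w - k1 v w) * l2 v w + k1 v w * (l2 v w - l1 v w))"
    using assms dom_psd[OF assms(3,4)] unfolding dom_def by (intro psd_add psd_mult)
  then show ?thesis unfolding dom_def by (simp add: algebra_simps)
qed

lemma dom_power: "psd D k1 \<Longrightarrow> dom D k1 k2 \<Longrightarrow> dom D (\<lambda>v w. k1 v w ^ n) (\<lambda>v w. k2 v w ^ n)"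
proof (induction n)
  case (Suc n)
  then show ?case by (simp add: dom_mult psd_power)
qed (simp add: dom_refl)

text \<open>The kernel form of b^n - a^n <= n (b - a) b^(n-1) for 0 <= a <= b. The induction
  exhibits the difference as a sum of products of positive kernels.\<close>

lemma dom_power_diff:
  assumes "psd D k1" "dom D k1 k2"
  shows "dom D (\<lambda>v w. k2 v w ^ n - k1 v w ^ n) (\<lambda>v w. real n * ((k2 v w - k1 v w) * k2 v w ^ (n - 1)))"
  unfolding dom_def
proof (induction n)
  case 0
  show ?case using psd_const[of 0] by simp
next
  case (Suc n)
  have "psd D (\<lambda>v w. k2 v w * (real n * ((k2 v w - k1 v w) * k2 v w ^ (n - 1)) - (k2 v w ^ n - k1 v w ^ n)) + (k2 v w - k1 v w) * (k2 v w ^ n - k1 v w ^ n))"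
    using Suc assms dom_psd[OF assms] dom_power[OF assms, of n] unfolding dom_def by (intro psd_add psd_mult)
  moreover have "k2 v w * (real n * ((k2 v w - k1 v w) * k2 v w ^ (n - 1)) - (k2 v w ^ n - k1 v w ^ n)) + (k2 v w - k1 v w) * (k2 v w ^ n - k1 v w ^ n)
    = real (Suc n) * ((k2 v w - k1 v w) * k2 v w ^ (Suc n - 1)) - (k2 v w ^ Suc n - k1 v w ^ Suc n)" for v w
    by (cases n) (simp_all add: algebra_simps)
  ultimately show ?case by simp
qed

lift_definition cut :: "nat set \<Rightarrow> fvec \<Rightarrow> fvec" is "\<lambda>A v k. if k \<in> A then v k else 0"
  subgoal for A v by (rule finite_subset[of _ "{k. v k \<noteq> 0}"]) auto done

lemma coord_cut[simp]: "coord (cut A v) k = (if k \<in> A then coord v k else 0)" by transfer simp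

lemma below_cut: "below D v \<Longrightarrow> below D (cut A v)" by (simp add: below_def)

lemma inner_cut: "inner (cut A v) w = inner (cut A v) (cut A w)"
  using inner_fvec_superset[of "supp v" "cut A v"] by (auto simp: subset_iff intro!: sum.cong)

lemma inner_cut_disjoint: "A \<inter> B = {} \<Longrightarrow> inner (cut A v) (cut B w) = 0"
  using inner_fvec_superset[of "supp v" "cut A v" "cut B w"] by (auto simp: subset_iff intro!: sum.neutral)

lemma cut_Un: "A \<inter> B = {} \<Longrightarrow> cut (A \<union> B) v = cut A v + cut B v"
  by (rule fvec_eqI) auto

lemma inner_cut_Un: "A \<inter> B = {} \<Longrightarrow> inner (cut (A \<union> B) v) (cut (A \<union> B) w) = inner (cut A v) (cut A w) + inner (cut B v) (cut B w)"
  using inner_cut_disjoint[of A B] inner_cut_disjoint[of B A] by (simp add: cut_Un inner_add_left inner_add_right Int_commute)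

lemma cut_UNIV[simp]: "cut UNIV v = v" by (rule fvec_eqI) simp

lemma inner_cut_finite: "finite A \<Longrightarrow> inner (cut A v) (cut A w) = (\<Sum>j\<in>A. coord v j * coord w j)"
  by (subst inner_fvec_superset[of A]) auto

lemma psd_cut: "psd D (\<lambda>v w. inner (cut A v) (cut A w))"
  by (rule psd_comp[OF psd_inner below_cut])

lemma dom_cut: assumes "A \<subseteq> B" shows "dom D (\<lambda>v w. inner (cut A v) (cut A w)) (\<lambda>v w. inner (cut B v) (cut B w))"
proof -
  have "B = A \<union> (B - A)" using assms by auto
  then have "inner (cut B v) (cut B w) - inner (cut A v) (cut A w) = inner (cut (B - A) v) (cut (B - A) w)" for v w
    using inner_cut_Un[of A "B - A" v w] by auto
  then show ?thesis unfolding dom_def by (simp add: psd_cut)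
qed

lemma dom_cut_inner: "dom D (\<lambda>v w. inner (cut A v) (cut A w)) inner"
  using dom_cut[of A UNIV D] by simp

text \<open>The entry of a tensor power of v at the index tuple J.\<close>

definition cJ :: "nat list \<Rightarrow> fvec \<Rightarrow> real" where "cJ J v = prod_list (map (coord v) J)"

lemma cJ_simps[simp]: "cJ [] v = 1" "cJ (j # J) v = coord v j * cJ J v" by (simp_all add: cJ_def)

text \<open>Each coordinate contributes one rank-one summand of \<open>inner\<close>, so a single
  entry is dominated factor by factor.\<close>

lemma dom_cJ: "dom D (\<lambda>v w. cJ J v * cJ J w) (\<lambda>v w. inner v w ^ length J)"
proof (induction J)
  case (Cons j J)
  have "dom D (\<lambda>v w. (coord v j * coord w j) * (cJ J v * cJ J w)) (\<lambda>v w. inner v w * inner v w ^ length J)"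
    using Cons dom_cut_inner[of D "{j}"] psd_rank1[of D "\<lambda>v. coord v j"]
    by (intro dom_mult psd_rank1) (auto simp: inner_cut_finite)
  then show ?case by (simp add: mult_ac)
qed (simp add: dom_refl)

text \<open>For unit \<open>h\<close> this is $p$ times the squared norm of the contraction of the tensor with \<open>h\<close>.\<close>

definition Inf' :: "nat \<Rightarrow> (real \<times> fvec) list \<Rightarrow> fvec \<Rightarrow> real" where
  "Inf' p f h = real p * S f (\<lambda>v. S f (\<lambda>w. inner v h * inner w h * inner v w ^ (p - 1)))"

lemma Inf_nonneg: "0 \<le> Inf' p f h"
proof -
  obtain D where "bl D f" using bl_ex by blast
  then have "0 \<le> S f (\<lambda>v. S f (\<lambda>w. inner v h * inner w h * inner v w ^ (p - 1)))"
    by (intro psd_nonneg[of D] psd_mult psd_rank1 psd_power psd_inner)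
  then show ?thesis by (simp add: Inf'_def)
qed

lemma Inf_scale: "Inf' p f (r *\<^sub>R h) = r\<^sup>2 * Inf' p f h"
proof -
  have "inner v (r *\<^sub>R h) * inner w (r *\<^sub>R h) * inner v w ^ (p - 1) = r\<^sup>2 * (inner v h * inner w h * inner v w ^ (p - 1))" for v w
    by (simp add: power2_eq_square)
  then show ?thesis unfolding Inf'_def by (simp only: S_mult_left) simp
qed

section \<open>Orthonormal systems and the greedy choice of directions\<close>

definition onb :: "nat \<Rightarrow> (nat \<Rightarrow> fvec) \<Rightarrow> bool" where
  "onb m h \<longleftrightarrow> (\<forall>i<m. \<forall>j<m. inner (h i) (h j) = (if i = j then 1 else 0))"

definition resid :: "nat \<Rightarrow> (nat \<Rightarrow> fvec) \<Rightarrow> fvec \<Rightarrow> fvec" where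
  "resid m h v = v - (\<Sum>j<m. inner v (h j) *\<^sub>R h j)"

lemma inner_sum_onb: "onb m h \<Longrightarrow> i < m \<Longrightarrow> inner (\<Sum>j<m. c j *\<^sub>R h j) (h i) = c i"
  unfolding onb_def by (subst inner_sum_left) (simp add: if_distrib[of "(*) _"] cong: if_cong)

lemma resid_orth: "onb m h \<Longrightarrow> i < m \<Longrightarrow> inner (resid m h v) (h i) = 0"
  unfolding resid_def inner_diff_left using inner_sum_onb[of m h i "\<lambda>j. inner v (h j)"] by simp

lemma inner_resid': assumes "onb m h" shows "inner (resid m h v) w = inner v w - (\<Sum>j<m. inner v (h j) * inner w (h j))"
  unfolding resid_def by (simp add: inner_diff_left inner_sum_left inner_commute[of w])

lemma inner_resid: assumes "onb m h" shows "inner (resid m h v) (resid m h w) = inner v w - (\<Sum>j<m. inner v (h j) * inner w (h j))"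
proof -
  have "inner (resid m h v) (resid m h w) = inner (resid m h v) w - (\<Sum>j<m. inner w (h j) * inner (resid m h v) (h j))"
    by (subst (2) resid_def) (simp add: inner_diff_right inner_sum_right)
  also have "(\<Sum>j<m. inner w (h j) * inner (resid m h v) (h j)) = 0" using resid_orth[OF assms] by (intro sum.neutral) auto
  finally show ?thesis using inner_resid'[OF assms] by simp
qed

lemma below_resid_ex: "\<exists>D. \<forall>D'\<ge>D. \<forall>v. below D' v \<longrightarrow> below D' (resid m h v)"
proof -
  have "\<exists>D. \<forall>j<m. below D (h j)"
  proof (induction m)
    case (Suc m)
    then obtain D where "\<forall>j<m. below D (h j)" by blast
    moreover obtain D' where "below D' (h m)" using below_ex by blast
    ultimately show ?case by (intro exI[of _ "max D D'"]) (auto simp: less_Suc_eq intro: below_mono)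
  qed simp
  then obtain D where D: "\<And>j. j < m \<Longrightarrow> below D (h j)" by blast
  have "below D' (resid m h v)" if "D \<le> D'" "below D' v" for D' v
    using that below_mono[OF D that(1)] by (auto simp: below_def resid_def)
  then show ?thesis by blast
qed

text \<open>The inner product of residuals is a positive kernel; multiplied by
  \<open>inner ^ (p - 1)\<close> and evaluated on f it is the difference of the two sides, up to the
  factor p.\<close>

lemma bessel:
  assumes "onb m h"
  shows "(\<Sum>j<m. Inf' p f (h j)) \<le> real p * nn p f f"
proof (cases p)
  case (Suc q)
  obtain D where D: "bl D f" "\<And>v. below D v \<Longrightarrow> below D (resid m h v)"
    using bl_ex[of f] below_resid_ex[of m h] bl_mono by (metis nle_le)
  have "0 \<le> S f (\<lambda>v. S f (\<lambda>w. inner (resid m h v) (resid m h w) * inner v w ^ q))"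
    by (intro psd_nonneg[OF _ D(1)] psd_mult psd_power psd_inner psd_comp[OF psd_inner D(2)])
  also have "\<dots> = nn p f f - (\<Sum>j<m. S f (\<lambda>v. S f (\<lambda>w. inner v (h j) * inner w (h j) * inner v w ^ q)))"
    by (simp add: inner_resid[OF assms] left_diff_distrib S_diff S_sum sum_distrib_right nn_def Suc)
  finally have "real p * (\<Sum>j<m. S f (\<lambda>v. S f (\<lambda>w. inner v (h j) * inner w (h j) * inner v w ^ q))) \<le> real p * nn p f f"
    by (intro mult_left_mono) auto
  then show ?thesis by (simp add: Inf'_def sum_distrib_left Suc)
qed (simp add: Inf'_def)

lemma Inf_bound: "Inf' p f h \<le> real p * nn p f f * inner h h"
proof (cases "h = 0")
  case False
  then have n: "norm h \<noteq> 0" by simp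
  let ?h = "(1 / norm h) *\<^sub>R h"
  have "onb 1 (\<lambda>_. ?h)" using n by (simp add: onb_def dot_square_norm power2_eq_square)
  from bessel[OF this, of p f] have "Inf' p f ?h \<le> real p * nn p f f" by simp
  then have "(norm h)\<^sup>2 * Inf' p f ?h \<le> (norm h)\<^sup>2 * (real p * nn p f f)" by (intro mult_left_mono) auto
  then show ?thesis unfolding Inf_scale using n by (simp add: dot_square_norm power_divide mult_ac)
qed (simp add: Inf'_def)

text \<open>The supremum of the influences over the admissible unit vectors need not be attained,
  hence the factor 2. Admissible vectors exist because some coordinate lies outside all supports of
  \<open>hs\<close>.\<close>

lemma greedy_step:
  fixes hs :: "fvec list"
  shows "\<exists>h. inner h h = 1 \<and> (\<forall>g\<in>set hs. inner h g = 0) \<and>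
    (\<forall>h'. inner h' h' = 1 \<longrightarrow> (\<forall>g\<in>set hs. inner h' g = 0) \<longrightarrow> Inf' p f h' \<le> 2 * Inf' p f h)"
proof -
  let ?U = "{h. inner h h = 1 \<and> (\<forall>g\<in>set hs. inner h g = 0)}"
  have ne: "?U \<noteq> {}"
  proof -
    have "finite (\<Union>g\<in>set hs. supp g)" by auto
    then obtain k where "k \<notin> (\<Union>g\<in>set hs. supp g)" using ex_new_if_finite infinite_UNIV_nat by blast
    then have "ev k \<in> ?U" by auto
    then show ?thesis by blast
  qed
  have "Inf' p f h \<le> real p * nn p f f" if "h \<in> ?U" for h using Inf_bound[of p f h] that by simp
  then have bdd: "bdd_above (Inf' p f ` ?U)" by (intro bdd_aboveI[of _ "real p * nn p f f"]) blast
  define \<sigma> where "\<sigma> = (SUP h\<in>?U. Inf' p f h)"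
  have up: "Inf' p f h \<le> \<sigma>" if "h \<in> ?U" for h unfolding \<sigma>_def using that bdd by (rule cSUP_upper)
  show ?thesis
  proof (cases "\<sigma> \<le> 0")
    case True
    obtain h where "h \<in> ?U" using ne by blast
    moreover have "Inf' p f h' \<le> 2 * Inf' p f h" if "h' \<in> ?U" for h' using up[OF that] True Inf_nonneg[of p f h] by linarith
    ultimately show ?thesis by blast
  next
    case False
    then have "\<sigma> / 2 < \<sigma>" by simp
    then obtain h where "h \<in> ?U" "\<sigma> / 2 < Inf' p f h" unfolding \<sigma>_def using less_cSUP_iff[OF ne bdd] by blast
    moreover have "Inf' p f h' \<le> 2 * Inf' p f h" if "h' \<in> ?U" for h' using up[OF that] calculation(2) by linarith
    ultimately show ?thesis by blast
  qed
qed

text \<open>Step t of the greedy choice serves the component \<open>fst (prod_decode t)\<close>, so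
  each of infinitely many components is served infinitely often.\<close>

definition visits :: "nat \<Rightarrow> nat \<Rightarrow> nat" where
  "visits i m = card {t. t < m \<and> fst (prod_decode t) = i}"

lemma visits_at_top: "filterlim (visits i) at_top sequentially"
proof -
  have "k \<le> visits i m" if "prod_encode (i, k) \<le> m" for k m
  proof -
    have "prod_encode (i, j) < prod_encode (i, k)" if "j < k" for j
      using that lift_Suc_mono_less[of "\<lambda>k. prod_encode (i, k)" j k] by (simp add: prod_encode_def)
    then have "(\<lambda>j. prod_encode (i, j)) ` {..<k} \<subseteq> {t. t < m \<and> fst (prod_decode t) = i}"
      using that by fastforce
    then have "card ((\<lambda>j. prod_encode (i, j)) ` {..<k}) \<le> visits i m"
      unfolding visits_def by (rule card_mono[rotated]) simp
    moreover have "inj_on (\<lambda>j. prod_encode (i, j)) {..<k}" by (auto simp: inj_on_def)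
    ultimately show ?thesis by (simp add: card_image)
  qed
  then show ?thesis unfolding filterlim_at_top eventually_sequentially by blast
qed

text \<open>A direction h' orthogonal to the first m choices was a competitor at each of those
  steps, so every choice made for component i has at least half of the influence of the normalised
  h'. The choices being orthonormal, Bessel's inequality bounds the sum of their influences, and
  dividing by the number of visits bounds that of h'.\<close>

lemma greedy:
  fixes f :: "nat \<Rightarrow> (real \<times> fvec) list" and p :: "nat \<Rightarrow> nat"
  obtains h :: "nat \<Rightarrow> fvec" where "\<And>m. onb m h"
    "\<And>i m h'. (\<And>j. j < m \<Longrightarrow> inner h' (h j) = 0) \<Longrightarrow> real (visits i m) * Inf' (p i) (f i) h' \<le> 2 * (real (p i) * nn (p i) (f i) (f i)) * inner h' h'"
proof -
  define e where "e t = fst (prod_decode t)" for t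
  define P where "P t hs h \<longleftrightarrow> inner h h = 1 \<and> (\<forall>g\<in>set hs. inner h g = 0) \<and>
    (\<forall>h'. inner h' h' = 1 \<longrightarrow> (\<forall>g\<in>set hs. inner h' g = 0) \<longrightarrow> Inf' (p (e t)) (f (e t)) h' \<le> 2 * Inf' (p (e t)) (f (e t)) h)" for t hs h
  have exP: "\<exists>h. P t hs h" for t hs unfolding P_def by (rule greedy_step)
  define hs where "hs = rec_nat [] (\<lambda>t l. (SOME h. P t l h) # l)"
  define h where "h t = (SOME h. P t (hs t) h)" for t
  have hs0: "hs 0 = []" and hsS: "hs (Suc t) = h t # hs t" for t by (simp_all add: hs_def h_def)
  have shs: "set (hs t) = h ` {..<t}" for t by (induction t) (auto simp: hs0 hsS lessThan_Suc)
  have Ph: "P t (hs t) (h t)" for t unfolding h_def using exP by (rule someI_ex)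
  have n1: "inner (h t) (h t) = 1" for t using Ph[of t] by (simp add: P_def)
  have o1: "inner (h t) (h j) = 0" if "j < t" for j t using Ph[of t] that by (auto simp: P_def shs)
  have onb: "onb m h" for m
    unfolding onb_def using n1 o1 by (metis inner_commute nat_neq_iff)
  have "real (visits i m) * Inf' (p i) (f i) h' \<le> 2 * (real (p i) * nn (p i) (f i) (f i)) * inner h' h'"
    if orth: "\<And>j. j < m \<Longrightarrow> inner h' (h j) = 0" for i m h'
  proof (cases "h' = 0")
    case False
    then have nz: "norm h' \<noteq> 0" by simp
    let ?u = "(1 / norm h') *\<^sub>R h'"
    have u: "inner ?u ?u = 1" using nz by (simp add: dot_square_norm power2_eq_square)
    have st: "Inf' (p i) (f i) ?u \<le> 2 * Inf' (p i) (f i) (h t)" if "t < m" "e t = i" for t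
    proof -
      have "\<forall>g\<in>set (hs t). inner ?u g = 0" using orth that by (auto simp: shs)
      then show ?thesis using Ph[of t] u that unfolding P_def by blast
    qed
    have "real (visits i m) * Inf' (p i) (f i) ?u = (\<Sum>t\<in>{t. t < m \<and> e t = i}. Inf' (p i) (f i) ?u)"
      by (simp add: visits_def e_def)
    also have "\<dots> \<le> (\<Sum>t\<in>{t. t < m \<and> e t = i}. 2 * Inf' (p i) (f i) (h t))" by (intro sum_mono st) auto
    also have "\<dots> \<le> (\<Sum>t<m. 2 * Inf' (p i) (f i) (h t))" by (intro sum_mono2) (auto simp: Inf_nonneg)
    also have "\<dots> \<le> 2 * (real (p i) * nn (p i) (f i) (f i))"
      using bessel[OF onb, of "p i" "f i" m] by (simp add: sum_distrib_left[symmetric])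
    finally have "(norm h')\<^sup>2 * (real (visits i m) * Inf' (p i) (f i) ?u) \<le> (norm h')\<^sup>2 * (2 * (real (p i) * nn (p i) (f i) (f i)))"
      by (intro mult_left_mono) auto
    then show ?thesis unfolding Inf_scale using nz by (simp add: dot_square_norm power_divide mult_ac)
  qed (simp add: Inf'_def)
  with onb show ?thesis using that by blast
qed

section \<open>Rotation of the chosen directions to the leading coordinates\<close>

lift_definition shift :: "nat \<Rightarrow> fvec \<Rightarrow> fvec" is "\<lambda>m v k. if k < m then 0 else v (k - m)"
  subgoal for m v
  proof -
    assume "finite {k. v k \<noteq> 0}"
    then have "finite ((\<lambda>k. k + m) ` {k. v k \<noteq> 0})" by simp
    moreover have "{k. (if k < m then 0 else v (k - m)) \<noteq> 0} \<subseteq> (\<lambda>k. k + m) ` {k. v k \<noteq> 0}"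
      by (auto simp: image_iff) (metis le_add_diff_inverse2 not_less)
    ultimately show ?thesis by (rule finite_subset[rotated])
  qed done

lift_definition unshift :: "nat \<Rightarrow> fvec \<Rightarrow> fvec" is "\<lambda>m v k. v (k + m)"
  subgoal for m v
    using finite_vimageI[of "{k. v k \<noteq> 0}" "\<lambda>k. k + m"] by (simp add: vimage_def inj_on_def) done

lemma coord_shift[simp]: "coord (shift m v) k = (if k < m then 0 else coord v (k - m))" by transfer simp
lemma coord_unshift[simp]: "coord (unshift m v) k = coord v (k + m)" by transfer simp

lemma shift_linear: "shift m (v + w) = shift m v + shift m w" "shift m (r *\<^sub>R v) = r *\<^sub>R shift m v"
  by (rule fvec_eqI, simp)+

lemma inner_shift: "inner (shift m v) w = inner v (unshift m w)"
proof -
  have "supp (shift m v) \<subseteq> (\<lambda>k. k + m) ` supp v" by (auto simp: image_iff) (metis le_add_diff_inverse2 not_less)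
  then have "inner (shift m v) w = (\<Sum>k\<in>(\<lambda>k. k + m) ` supp v. coord (shift m v) k * coord w k)"
    by (intro inner_fvec_superset) auto
  also have "\<dots> = inner v (unshift m w)" by (subst sum.reindex) (auto simp: inj_on_def inner_fvec_def)
  finally show ?thesis .
qed

lemma unshift_shift[simp]: "unshift m (shift m v) = v" by (rule fvec_eqI) simp

text \<open>Sends \<open>h j\<close> to \<open>ev j\<close> and moves the orthogonal residual m
  places up. The two parts land on disjoint coordinates, so this is an isometry without completing h
  to a basis.\<close>

definition rot :: "nat \<Rightarrow> (nat \<Rightarrow> fvec) \<Rightarrow> fvec \<Rightarrow> fvec" where
  "rot m h v = (\<Sum>j<m. inner v (h j) *\<^sub>R ev j) + shift m (resid m h v)"

lemma coord_rot: "k < m \<Longrightarrow> coord (rot m h v) k = inner v (h k)"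
  by (simp add: rot_def if_distrib[of "(*) _"] cong: if_cong)

lemma resid_linear: "resid m h (v + w) = resid m h v + resid m h w" "resid m h (r *\<^sub>R v) = r *\<^sub>R resid m h v"
  by (simp_all add: resid_def inner_add_left algebra_simps sum.distrib scaleR_sum_right)

lemma fisom_rot: assumes "onb m h" shows "fisom (rot m h)"
  unfolding fisom_def
proof (intro conjI allI)
  fix v w r
  show "rot m h (v + w) = rot m h v + rot m h w"
    by (simp add: rot_def resid_linear shift_linear inner_add_left algebra_simps sum.distrib)
  show "rot m h (r *\<^sub>R v) = r *\<^sub>R rot m h v"
    by (simp add: rot_def resid_linear shift_linear algebra_simps scaleR_sum_right)
  have z: "inner (\<Sum>j<m. c j *\<^sub>R ev j) (shift m u) = 0" for c u by (simp add: inner_sum_left)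
  have z': "inner (shift m u) (\<Sum>j<m. c j *\<^sub>R ev j) = 0" for c u using z by (simp add: inner_commute)
  have "inner (\<Sum>j<m. inner v (h j) *\<^sub>R ev j) (\<Sum>j<m. inner w (h j) *\<^sub>R ev j) = (\<Sum>j<m. inner v (h j) * inner w (h j))"
    unfolding inner_sum_left by (intro sum.cong refl) (simp add: if_distrib[of "(*) _"] cong: if_cong)
  moreover have "inner (shift m (resid m h v)) (shift m (resid m h w)) = inner v w - (\<Sum>j<m. inner v (h j) * inner w (h j))"
    unfolding inner_shift by (simp add: inner_resid[OF assms])
  ultimately show "inner (rot m h v) (rot m h w) = inner v w"
    unfolding rot_def inner_add_left inner_add_right z z' by simp
qed

text \<open>Carries a direction in the tail coordinates back through the rotation: it becomes
  orthogonal to all \<open>h j\<close>, where the greedy bound is available, and does not grow in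
  length.\<close>

lemma inner_rot_tail:
  assumes "onb m h" "\<And>k. k < m \<Longrightarrow> coord g k = 0"
  shows "inner (rot m h v) g = inner v (resid m h (unshift m g))" "inner (resid m h (unshift m g)) (resid m h (unshift m g)) \<le> inner g g"
proof -
  have "inner (\<Sum>j<m. inner v (h j) *\<^sub>R ev j) g = 0" using assms(2) by (simp add: inner_sum_left)
  then have "inner (rot m h v) g = inner (resid m h v) (unshift m g)"
    by (simp add: rot_def inner_add_left inner_shift)
  also have "\<dots> = inner v (resid m h (unshift m g))"
    using inner_resid'[OF assms(1), of v "unshift m g"] inner_resid'[OF assms(1), of "unshift m g" v]
    by (simp add: inner_commute mult.commute)
  finally show "inner (rot m h v) g = inner v (resid m h (unshift m g))" .
  have "shift m (unshift m g) = g" using assms(2) by (intro fvec_eqI) auto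
  then have "inner (unshift m g) (unshift m g) = inner g g" using inner_shift[of m "unshift m g" g] by simp
  moreover have "0 \<le> (\<Sum>j<m. inner (unshift m g) (h j) * inner (unshift m g) (h j))" by (intro sum_nonneg) auto
  ultimately show "inner (resid m h (unshift m g)) (resid m h (unshift m g)) \<le> inner g g"
    unfolding inner_resid[OF assms(1)] by simp
qed

text \<open>Bolzano-Weierstrass at each index and a diagonal sequence; it serves for the influences
  and later for the covariances.\<close>

lemma subseq_all:
  fixes g :: "nat \<Rightarrow> 'c::countable \<Rightarrow> real"
  assumes "\<And>c. \<exists>B. \<forall>n. \<bar>g n c\<bar> \<le> B"
  obtains r :: "nat \<Rightarrow> nat" where "strict_mono r" "\<And>c. convergent (\<lambda>n. g (r n) c)"
proof -
  interpret subseqs "\<lambda>k s. convergent (\<lambda>n. g (s n) (from_nat k))"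
  proof
    fix k and s :: "nat \<Rightarrow> nat"
    obtain B where B: "\<And>n. \<bar>g n (from_nat k)\<bar> \<le> B" using assms by blast
    have "bounded (range (\<lambda>n. g (s n) (from_nat k)))" using B by (intro boundedI[of _ B]) auto
    then obtain l r where "strict_mono r" "((\<lambda>n. g (s n) (from_nat k)) \<circ> r) \<longlonglongrightarrow> l"
      using bounded_imp_convergent_subsequence by blast
    then show "\<exists>r. strict_mono r \<and> convergent (\<lambda>n. g ((s \<circ> r) n) (from_nat k))" by (auto simp: comp_def convergent_def)
  qed
  have "convergent (\<lambda>n. g (diagseq n) c)" for c
  proof -
    have "convergent (\<lambda>n. g ((diagseq \<circ> (+) (Suc (to_nat c))) n) (from_nat (to_nat c)))"
    proof (rule diagseq_holds)
      fix r s :: "nat \<Rightarrow> nat" and n :: nat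
      assume "strict_mono r" "convergent (\<lambda>na. g (s na) (from_nat n))"
      then show "convergent (\<lambda>na. g ((s \<circ> r) na) (from_nat n))"
        using convergent_subseq_convergent[of "\<lambda>na. g (s na) (from_nat n)" r] by (simp add: comp_def)
    qed
    then have "convergent (\<lambda>n. g (diagseq (n + Suc (to_nat c))) c)" by (simp add: comp_def add.commute)
    then show ?thesis by (subst (asm) convergent_ignore_initial_segment)
  qed
  then show ?thesis using that subseq_diagseq by blast
qed

text \<open>The chosen directions change with n, but only numbers attached to them have to converge:
  the influences are bounded and tend to \<tau> along a subsequence, and Bessel's inequality passes
  to the limit as summability. Rotation preserves the joint law of the integrals and all contraction
  norms, while it turns the first n chosen directions into coordinates.\<close>

lemma rotated_family:
  fixes f :: "nat \<Rightarrow> nat \<Rightarrow> (real \<times> fvec) list" and p :: "nat \<Rightarrow> nat" and C :: "nat \<Rightarrow> real"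
  assumes C: "\<And>n i. nn (p i) (f n i) (f n i) \<le> C i"
  obtains s :: "nat \<Rightarrow> nat" and F :: "nat \<Rightarrow> nat \<Rightarrow> (real \<times> fvec) list" and \<tau> :: "nat \<Rightarrow> nat \<Rightarrow> real" and \<epsilon> :: "nat \<Rightarrow> nat \<Rightarrow> real" where
    "\<And>n. n \<le> s n"
    "\<And>n i. nn (p i) (F n i) (F n i) \<le> C i"
    "\<And>n v \<theta>. (\<integral>x. cos (X v (\<lambda>i. Ik (p i) (F n i) x) + \<theta>) \<partial>Gam) = (\<integral>x. cos (X v (\<lambda>i. Ik (p i) (f (s n) i) x) + \<theta>) \<partial>Gam)"
    "\<And>n i a r. Cn a r (F n i) = Cn a r (f (s n) i)"
    "\<And>i j. 0 \<le> \<tau> i j" "\<And>i. summable (\<tau> i)"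
    "\<And>i. (\<lambda>n. \<Sum>j<n. \<bar>Inf' (p i) (F n i) (ev j) - \<tau> i j\<bar>) \<longlonglongrightarrow> 0"
    "\<And>i. \<epsilon> i \<longlonglongrightarrow> 0"
    "\<And>i n h. (\<And>k. k < n \<Longrightarrow> coord h k = 0) \<Longrightarrow> Inf' (p i) (F n i) h \<le> \<epsilon> i n * inner h h"
proof -
  have "\<forall>n. \<exists>h. (\<forall>m. onb m h) \<and> (\<forall>i m h'. (\<forall>j<m. inner h' (h j) = 0) \<longrightarrow> real (visits i m) * Inf' (p i) (f n i) h' \<le> 2 * (real (p i) * nn (p i) (f n i) (f n i)) * inner h' h')"
    using greedy[of p "f _"] by metis
  then obtain h where h: "\<And>n m. onb m (h n)"
    "\<And>n i m h'. (\<And>j. j < m \<Longrightarrow> inner h' (h n j) = 0) \<Longrightarrow> real (visits i m) * Inf' (p i) (f n i) h' \<le> 2 * (real (p i) * nn (p i) (f n i) (f n i)) * inner h' h'"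
    by metis
  define t where "t n ij = Inf' (p (fst ij)) (f n (fst ij)) (h n (snd ij))" for n and ij :: "nat \<times> nat"
  have tb: "\<bar>t n ij\<bar> \<le> real (p (fst ij)) * C (fst ij)" for n ij
  proof -
    have "inner (h n (snd ij)) (h n (snd ij)) = 1" using h(1)[of "Suc (snd ij)" n] by (simp add: onb_def)
    then have "t n ij \<le> real (p (fst ij)) * nn (p (fst ij)) (f n (fst ij)) (f n (fst ij))" unfolding t_def using Inf_bound by (metis mult.right_neutral)
    also have "\<dots> \<le> real (p (fst ij)) * C (fst ij)" using C by (intro mult_left_mono) auto
    finally show ?thesis using Inf_nonneg by (simp add: t_def)
  qed
  obtain r where r: "strict_mono r" "\<And>ij. convergent (\<lambda>n. t (r n) ij)"
    using subseq_all[of t] tb by blast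
  define \<tau> where "\<tau> i j = lim (\<lambda>n. t (r n) (i, j))" for i j
  have tl: "(\<lambda>n. t (r n) (i, j)) \<longlonglongrightarrow> \<tau> i j" for i j unfolding \<tau>_def using r(2) convergent_LIMSEQ_iff by blast
  have t0: "0 \<le> t n ij" for n ij by (simp add: t_def Inf_nonneg)
  have \<tau>0: "0 \<le> \<tau> i j" for i j using tl t0 by (intro LIMSEQ_le_const[OF tl]) auto
  have \<tau>s: "(\<Sum>j<J. \<tau> i j) \<le> real (p i) * C i" for i J
  proof (rule LIMSEQ_le_const2)
    show "(\<lambda>n. \<Sum>j<J. t (r n) (i, j)) \<longlonglongrightarrow> (\<Sum>j<J. \<tau> i j)" by (intro tendsto_sum tl)
    have "(\<Sum>j<J. t (r n) (i, j)) \<le> real (p i) * C i" for n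
    proof -
      have "(\<Sum>j<J. t (r n) (i, j)) \<le> real (p i) * nn (p i) (f (r n) i) (f (r n) i)" unfolding t_def using bessel[OF h(1)] by simp
      also have "\<dots> \<le> real (p i) * C i" using C by (intro mult_left_mono) auto
      finally show ?thesis .
    qed
    then show "\<exists>N. \<forall>n\<ge>N. (\<Sum>j<J. t (r n) (i, j)) \<le> real (p i) * C i" by blast
  qed
  have summ: "summable (\<tau> i)" for i
  proof (rule bounded_imp_summable[OF \<tau>0])
    show "sum (\<tau> i) {..n} \<le> real (p i) * C i" for n using \<tau>s[where J = "Suc n" and i = i] unfolding lessThan_Suc_atMost .
  qed
  \<comment> \<open>Go far enough along the subsequence that the leading n by n influences are
    within 1 / (n + 1)^2 of their limits; n such errors sum to at most 1 / (n + 1). This allows the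
    number of leading coordinates to grow with n.\<close>
  have "\<exists>k\<ge>n. \<forall>i<n. \<forall>j<n. \<bar>t (r k) (i, j) - \<tau> i j\<bar> \<le> 1 / real (Suc n) ^ 2" for n
  proof -
    have "\<forall>\<^sub>F k in sequentially. \<forall>i\<in>{..<n}. \<forall>j\<in>{..<n}. \<bar>t (r k) (i, j) - \<tau> i j\<bar> \<le> 1 / real (Suc n) ^ 2"
    proof (intro eventually_ball_finite ballI finite_lessThan)
      fix i j
      have "\<forall>\<^sub>F k in sequentially. dist (t (r k) (i, j)) (\<tau> i j) < 1 / real (Suc n) ^ 2"
        by (rule tendstoD[OF tl]) simp
      then show "\<forall>\<^sub>F k in sequentially. \<bar>t (r k) (i, j) - \<tau> i j\<bar> \<le> 1 / real (Suc n) ^ 2"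
        by (rule eventually_mono) (simp add: dist_real_def)
    qed
    then obtain N where "\<And>k. k \<ge> N \<Longrightarrow> \<forall>i\<in>{..<n}. \<forall>j\<in>{..<n}. \<bar>t (r k) (i, j) - \<tau> i j\<bar> \<le> 1 / real (Suc n) ^ 2"
      by (auto simp: eventually_sequentially)
    from this[of "max N n"] show ?thesis by (intro exI[of _ "max N n"]) auto
  qed
  then obtain k where k: "\<And>n. n \<le> k n" "\<And>n i j. i < n \<Longrightarrow> j < n \<Longrightarrow> \<bar>t (r (k n)) (i, j) - \<tau> i j\<bar> \<le> 1 / real (Suc n) ^ 2"
    by metis
  define s where "s n = r (k n)" for n
  define F where "F n i = map (\<lambda>(c, v). (c, rot n (h (s n)) v)) (f (s n) i)" for n i
  have SF: "S (F n i) \<phi> = S (f (s n) i) (\<lambda>v. \<phi> (rot n (h (s n)) v))" for n i and \<phi> :: "fvec \<Rightarrow> real"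
    using S_map[of "\<lambda>_. 1" "rot n (h (s n))" "f (s n) i" \<phi>] by (simp add: F_def)
  have iso: "fisom (rot n (h (s n)))" for n by (rule fisom_rot[OF h(1)])
  then have ii: "inner (rot n (h (s n)) v) (rot n (h (s n)) w) = inner v w" for n v w by (simp add: fisom_def)
  have 1: "n \<le> s n" for n using k(1)[of n] seq_suble[OF r(1), of "k n"] by (simp add: s_def)
  have 2: "nn (p i) (F n i) (F n i) \<le> C i" for n i using C by (simp add: nn_def SF ii)
  have 3: "(\<integral>x. cos (X v (\<lambda>i. Ik (p i) (F n i) x) + \<theta>) \<partial>Gam) = (\<integral>x. cos (X v (\<lambda>i. Ik (p i) (f (s n) i) x) + \<theta>) \<partial>Gam)" for n v \<theta>
  proof -
    have "(\<lambda>x. cos (X v (\<lambda>i. Ik (p i) (f (s n) i) x) + \<theta>)) \<in> borel_measurable Gam" unfolding X_def by measurable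
    from Gam_isom[OF iso this, of n] show ?thesis by (simp add: Ik_isom[OF iso] F_def)
  qed
  have 4: "Cn a q (F n i) = Cn a q (f (s n) i)" for n i a q by (simp add: Cn_def tet_def SF ii)
  have Ie: "Inf' (p i) (F n i) (ev j) = t (s n) (i, j)" if "j < n" for n i j
    using that by (simp add: Inf'_def SF ii coord_rot t_def)
  have 7: "(\<lambda>n. \<Sum>j<n. \<bar>Inf' (p i) (F n i) (ev j) - \<tau> i j\<bar>) \<longlonglongrightarrow> 0" for i
  proof (rule tendsto_sandwich[of "\<lambda>_. 0"])
    show "\<forall>\<^sub>F n in sequentially. (\<Sum>j<n. \<bar>Inf' (p i) (F n i) (ev j) - \<tau> i j\<bar>) \<le> 1 / real (Suc n)"
      using eventually_gt_at_top[of i]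
    proof eventually_elim
      case (elim n)
      have "(\<Sum>j<n. \<bar>Inf' (p i) (F n i) (ev j) - \<tau> i j\<bar>) \<le> (\<Sum>j<n. 1 / real (Suc n) ^ 2)"
        using k(2) elim by (intro sum_mono) (auto simp: Ie s_def)
      also have "\<dots> = real n / real (Suc n) ^ 2" by simp
      also have "\<dots> \<le> real (Suc n) / real (Suc n) ^ 2" by (intro divide_right_mono) auto
      also have "\<dots> = 1 / real (Suc n)" by (simp add: power2_eq_square)
      finally show ?case .
    qed
    show "(\<lambda>n. 1 / real (Suc n)) \<longlonglongrightarrow> 0"
      using LIMSEQ_inverse_real_of_nat by (simp only: inverse_eq_divide)
  qed (auto intro!: sum_nonneg)
  \<comment> \<open>Before the first visit to i the general bound \<open>Inf_bound\<close> stands in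
    for the greedy one.\<close>
  define \<epsilon> where "\<epsilon> i n = (if visits i n = 0 then real (p i) * C i else 2 * (real (p i) * C i) / real (visits i n))" for i n
  have 8: "\<epsilon> i \<longlonglongrightarrow> 0" for i
  proof -
    have "(\<lambda>n. 2 * (real (p i) * C i) / real (visits i n)) \<longlonglongrightarrow> 0"
      by (rule tendsto_divide_0[OF tendsto_const filterlim_at_top_imp_at_infinity[OF filterlim_compose[OF filterlim_real_sequentially visits_at_top]]])
    moreover have "\<forall>\<^sub>F n in sequentially. 2 * (real (p i) * C i) / real (visits i n) = \<epsilon> i n"
      using filterlim_at_top[THEN iffD1, OF visits_at_top[of i], rule_format, of 1] by eventually_elim (auto simp: \<epsilon>_def)
    ultimately show ?thesis by (rule Lim_transform_eventually)
  qed
  have 9: "Inf' (p i) (F n i) g \<le> \<epsilon> i n * inner g g" if g: "\<And>k. k < n \<Longrightarrow> coord g k = 0" for i n g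
  proof -
    let ?g = "resid n (h (s n)) (unshift n g)"
    have e: "Inf' (p i) (F n i) g = Inf' (p i) (f (s n) i) ?g"
      using inner_rot_tail(1)[OF h(1) g] by (simp add: Inf'_def SF ii)
    have gg: "inner ?g ?g \<le> inner g g" by (rule inner_rot_tail(2)[OF h(1) g])
    have C0: "0 \<le> real (p i) * C i" using C[of i "s n"] nn_nonneg[of "p i" "f (s n) i"] by (intro mult_nonneg_nonneg) auto
    have Cb: "real (p i) * nn (p i) (f (s n) i) (f (s n) i) \<le> real (p i) * C i" using C by (intro mult_left_mono) auto
    show ?thesis
    proof (cases "visits i n = 0")
      case True
      have "Inf' (p i) (f (s n) i) ?g \<le> real (p i) * nn (p i) (f (s n) i) (f (s n) i) * inner ?g ?g" by (rule Inf_bound)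
      also have "\<dots> \<le> real (p i) * C i * inner g g" by (rule mult_mono[OF Cb gg C0]) simp
      finally show ?thesis using True e by (simp add: \<epsilon>_def)
    next
      case False
      have "real (visits i n) * Inf' (p i) (f (s n) i) ?g \<le> 2 * (real (p i) * nn (p i) (f (s n) i) (f (s n) i)) * inner ?g ?g"
        by (rule h(2)) (rule resid_orth[OF h(1)])
      also have "\<dots> \<le> 2 * (real (p i) * C i) * inner g g"
      proof (rule mult_mono[OF _ gg])
        show "2 * (real (p i) * nn (p i) (f (s n) i) (f (s n) i)) \<le> 2 * (real (p i) * C i)" by (rule mult_left_mono[OF Cb]) simp
      qed (use C0 in auto)
      finally show ?thesis using False e by (simp add: \<epsilon>_def field_simps)
    qed
  qed
  show ?thesis by (rule that[OF 1 2 3 4 \<tau>0 summ 7 8 9])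
qed

section \<open>Expansion along the leading coordinates\<close>

text \<open>Ordered index tuples instead of multi-indices: summation over all orderings absorbs the
  multinomial coefficients.\<close>

definition LJ :: "nat \<Rightarrow> nat \<Rightarrow> nat list set" where "LJ M r = {J. set J \<subseteq> {..<M} \<and> length J = r}"

lemma finite_LJ[simp]: "finite (LJ M r)" unfolding LJ_def by (rule finite_lists_length_eq) simp

lemma LJ_0: "LJ M 0 = {[]}" by (auto simp: LJ_def)
lemma LJ_00: "LJ 0 r = (if r = 0 then {[]} else {})" by (auto simp: LJ_def)
lemma LJ_mono: "M \<le> M' \<Longrightarrow> LJ M r \<subseteq> LJ M' r" by (auto simp: LJ_def)

lemma sum_LJ_Suc: "(\<Sum>J\<in>LJ M (Suc r). g J) = (\<Sum>j<M. \<Sum>J\<in>LJ M r. (g (j # J) :: real))"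
proof -
  have "LJ M (Suc r) = (\<lambda>(j, J). j # J) ` ({..<M} \<times> LJ M r)"
    by (auto simp: LJ_def length_Suc_conv image_iff)
  then have "(\<Sum>J\<in>LJ M (Suc r). g J) = (\<Sum>(j, J)\<in>{..<M} \<times> LJ M r. g (j # J))"
    by (simp add: sum.reindex inj_on_def case_prod_beta comp_def)
  then show ?thesis by (simp add: sum.cartesian_product)
qed

definition hJ :: "nat list \<Rightarrow> (nat \<Rightarrow> real) \<Rightarrow> real" where
  "hJ J x = (\<Prod>j\<in>set J. wk (count_list J j) (ev j) x)"

lemma hJ_superset: "finite A \<Longrightarrow> set J \<subseteq> A \<Longrightarrow> hJ J x = (\<Prod>j\<in>A. wk (count_list J j) (ev j) x)"
  unfolding hJ_def by (rule prod.mono_neutral_left) (auto simp: count_list_0_iff)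

lemma hJ_mset: assumes "mset J = mset J'" shows "hJ J x = hJ J' x"
proof -
  have "count_list J j = count_list J' j" for j using assms by (metis count_mset)
  moreover have "set J = set J'" using assms by (metis set_mset_mset)
  ultimately show ?thesis by (simp add: hJ_def)
qed

lemma count_list_remove1: "count_list (remove1 j J) i = (if i = j then count_list J i - 1 else count_list J i)"
  by (induction J) auto

lemma hJ_Cons: "hJ (j # J) x = x j * hJ J x - real (count_list J j) * hJ (remove1 j J) x"
proof -
  let ?A = "insert j (set J)"
  have r: "set (remove1 j J) \<subseteq> ?A" using set_remove1_subset by fastforce
  have f: "finite ?A" by simp
  have "hJ (j # J) x = wk (Suc (count_list J j)) (ev j) x * (\<Prod>i\<in>?A - {j}. wk (count_list J i) (ev i) x)"
    unfolding hJ_superset[OF f, of "j # J", simplified] by (subst prod.remove[of _ j]) (auto intro!: prod.cong)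
  moreover have "hJ J x = wk (count_list J j) (ev j) x * (\<Prod>i\<in>?A - {j}. wk (count_list J i) (ev i) x)"
    by (subst hJ_superset[OF f]) (auto simp: prod.remove[of _ j])
  moreover have "hJ (remove1 j J) x = wk (count_list J j - 1) (ev j) x * (\<Prod>i\<in>?A - {j}. wk (count_list J i) (ev i) x)"
    by (subst hJ_superset[OF f r], subst prod.remove[of _ j]) (auto simp: count_list_remove1 intro!: prod.cong)
  ultimately show ?thesis by (simp add: wk_Suc[of "count_list J j"] algebra_simps)
qed

lemma hJ_Lall[simp, intro!]: "hJ J \<in> Lall Gam"
proof -
  have "(\<lambda>x. \<Prod>j\<in>A. wk (c j) (ev j) x) \<in> Lall Gam" for A and c :: "nat \<Rightarrow> nat"
    by (induction A rule: infinite_finite_induct) auto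
  then show ?thesis by (simp add: hJ_def[abs_def])
qed

lemma hJ_measurable[measurable]: "hJ J \<in> borel_measurable Gam" by (rule Lall_measurable) simp

lemma dep_hJ: "dep (set J) (hJ J)"
  unfolding dep_def hJ_def by (auto intro!: prod.cong simp: wk_ev)

text \<open>Marking one occurrence of j in a tuple and deleting it leaves a shorter tuple; there are
  r positions for the mark, each with a factor \<open>coord v j\<close>. Symmetry of \<phi> makes
  the position irrelevant.\<close>

lemma sum_LJ_remove1:
  fixes \<phi> :: "nat list \<Rightarrow> real"
  assumes j: "j < M" and "\<And>J J'. mset J = mset J' \<Longrightarrow> \<phi> J = \<phi> J'"
  shows "(\<Sum>J\<in>LJ M r. cJ J v * (real (count_list J j) * \<phi> (remove1 j J))) = real r * coord v j * (\<Sum>J\<in>LJ M (r - 1). cJ J v * \<phi> J)"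
  using assms(2)
proof (induction r arbitrary: \<phi>)
  case 0
  show ?case by (simp add: LJ_0)
next
  case (Suc r)
  \<comment> \<open>The marked occurrence is the head or lies in J. If the head is j, then J and
    \<open>j # remove1 j J\<close> are permutations of each other whenever j occurs in J.\<close>
  have step: "real (count_list (k # J) j) * \<phi> (remove1 j (k # J)) = (if k = j then \<phi> J else 0) + real (count_list J j) * \<phi> (k # remove1 j J)" for k J
  proof (cases "k = j")
    case True
    have "real (count_list J j) * \<phi> J = real (count_list J j) * \<phi> (j # remove1 j J)"
    proof (cases "j \<in> set J")
      case True
      then have "mset J = mset (j # remove1 j J)" by (simp add: mset_remove1)
      then show ?thesis using Suc.prems by metis
    qed (simp add: count_list_0_iff)
    then show ?thesis using True by (simp add: algebra_simps)
  qed simp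
  have "(\<Sum>J\<in>LJ M (Suc r). cJ J v * (real (count_list J j) * \<phi> (remove1 j J)))
    = (\<Sum>k<M. \<Sum>J\<in>LJ M r. (if k = j then coord v k * (cJ J v * \<phi> J) else 0) + coord v k * (cJ J v * (real (count_list J j) * \<phi> (k # remove1 j J))))"
    unfolding sum_LJ_Suc step by (intro sum.cong refl) (simp add: algebra_simps)
  also have "\<dots> = coord v j * (\<Sum>J\<in>LJ M r. cJ J v * \<phi> J) + (\<Sum>k<M. coord v k * (\<Sum>J\<in>LJ M r. cJ J v * (real (count_list J j) * \<phi> (k # remove1 j J))))"
  proof -
    have "(\<Sum>k<M. \<Sum>J\<in>LJ M r. (if k = j then coord v k * (cJ J v * \<phi> J) else 0)) = (\<Sum>k<M. if k = j then coord v k * (\<Sum>J\<in>LJ M r. cJ J v * \<phi> J) else 0)"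
      by (intro sum.cong refl) (simp add: sum_distrib_left)
    also have "\<dots> = coord v j * (\<Sum>J\<in>LJ M r. cJ J v * \<phi> J)" using j by simp
    finally show ?thesis by (simp add: sum.distrib sum_distrib_left)
  qed
  also have "(\<Sum>k<M. coord v k * (\<Sum>J\<in>LJ M r. cJ J v * (real (count_list J j) * \<phi> (k # remove1 j J))))
     = (\<Sum>k<M. coord v k * (real r * coord v j * (\<Sum>J\<in>LJ M (r - 1). cJ J v * \<phi> (k # J))))"
    using Suc.prems by (intro sum.cong refl arg_cong2[where f = "(*)"] Suc.IH) simp
  also have "\<dots> = real r * coord v j * (\<Sum>J\<in>LJ M r. cJ J v * \<phi> J)"
  proof (cases r)
    case (Suc q)
    have "(\<Sum>J\<in>LJ M r. cJ J v * \<phi> J) = (\<Sum>k<M. coord v k * (\<Sum>J\<in>LJ M (r - 1). cJ J v * \<phi> (k # J)))"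
      unfolding Suc sum_LJ_Suc by (simp add: sum_distrib_left mult_ac)
    then show ?thesis by (simp add: sum_distrib_left mult_ac)
  qed simp
  finally show ?case by (simp add: algebra_simps)
qed

text \<open>The multinomial formula for Wick powers. Expanding the head of each tuple by
  \<open>hJ_Cons\<close> reproduces the Wick recurrence, and the deletion terms sum to its variance
  term by \<open>sum_LJ_remove1\<close>.\<close>

lemma wk_cut_expand: "wk r (cut {..<M} v) x = (\<Sum>J\<in>LJ M r. cJ J v * hJ J x)"
proof (induction r rule: less_induct)
  case (less r)
  show ?case
  proof (cases r)
    case 0
    then show ?thesis by (simp add: LJ_0 hJ_def)
  next
    case (Suc q)
    have XM: "X (cut {..<M} v) x = (\<Sum>j<M. coord v j * x j)"
      by (subst X_superset[of "{..<M}"]) auto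
    have "(\<Sum>J\<in>LJ M (Suc q). cJ J v * hJ J x)
      = (\<Sum>j<M. coord v j * x j * (\<Sum>J\<in>LJ M q. cJ J v * hJ J x) - coord v j * (\<Sum>J\<in>LJ M q. cJ J v * (real (count_list J j) * hJ (remove1 j J) x)))"
      unfolding sum_LJ_Suc hJ_Cons by (intro sum.cong refl) (simp add: sum_distrib_left sum_subtractf[symmetric] algebra_simps)
    also have "\<dots> = (\<Sum>j<M. coord v j * x j * wk q (cut {..<M} v) x - coord v j * (real q * coord v j * wk (q - 1) (cut {..<M} v) x))"
    proof (intro sum.cong refl)
      fix j assume "j \<in> {..<M}"
      then have j: "j < M" by simp
      have "(\<Sum>J\<in>LJ M q. cJ J v * (real (count_list J j) * hJ (remove1 j J) x)) = real q * coord v j * (\<Sum>J\<in>LJ M (q - 1). cJ J v * hJ J x)"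
        by (rule sum_LJ_remove1[OF j]) (rule hJ_mset)
      then show "coord v j * x j * (\<Sum>J\<in>LJ M q. cJ J v * hJ J x) - coord v j * (\<Sum>J\<in>LJ M q. cJ J v * (real (count_list J j) * hJ (remove1 j J) x))
        = coord v j * x j * wk q (cut {..<M} v) x - coord v j * (real q * coord v j * wk (q - 1) (cut {..<M} v) x)"
        using less[of q] less[of "q - 1"] Suc by simp
    qed
    also have "\<dots> = wk (Suc q) (cut {..<M} v) x"
      unfolding wk_Suc XM inner_cut_finite[OF finite_lessThan]
      by (simp add: sum_subtractf sum_distrib_left sum_distrib_right mult_ac)
    finally show ?thesis using Suc by simp
  qed
qed

text \<open>Coefficient of the monomial \<open>J\<close> in the leading coordinates, as a tensor in the coordinates from \<open>m\<close> on.\<close>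

definition Rl :: "(real \<times> fvec) list \<Rightarrow> nat \<Rightarrow> nat list \<Rightarrow> (real \<times> fvec) list" where
  "Rl f m J = map (\<lambda>(c, v). (c * cJ J v, cut {m..} v)) f"

lemma S_Rl: "S (Rl f m J) \<phi> = S f (\<lambda>v. cJ J v * \<phi> (cut {m..} v))"
  by (simp add: Rl_def S_map)

lemma dep_Rl: "dep {m..} (Ik q (Rl f m J))"
  by (rule dep_Ik) (auto simp: Rl_def split: if_splits)

definition cutl :: "nat set \<Rightarrow> (real \<times> fvec) list \<Rightarrow> (real \<times> fvec) list" where
  "cutl A f = map (\<lambda>(c, v). (c, cut A v)) f"

lemma S_cutl: "S (cutl A f) \<phi> = S f (\<lambda>v. \<phi> (cut A v))"
  using S_map[of "\<lambda>_. 1" "cut A" f \<phi>] by (simp add: cutl_def)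

text \<open>Three blocks of coordinates: those below M are expanded, the tail from m on is kept as a
  remainder, and those in between have been dropped by \<open>cutl\<close>.\<close>

lemma Ik_cutl_expand:
  assumes "M \<le> m"
  shows "Ik p (cutl ({..<M} \<union> {m..}) f) x = (\<Sum>r\<le>p. real (p choose r) * (\<Sum>J\<in>LJ M r. hJ J x * Ik (p - r) (Rl f m J) x))"
proof -
  have dis: "{..<M} \<inter> {m..} = {}" using assms by auto
  have "Ik p (cutl ({..<M} \<union> {m..}) f) x = S f (\<lambda>v. \<Sum>r\<le>p. real (p choose r) * (\<Sum>J\<in>LJ M r. hJ J x * (cJ J v * wk (p - r) (cut {m..} v) x)))"
    unfolding Ik_def S_cutl cut_Un[OF dis] wk_add[OF inner_cut_disjoint[OF dis]] wk_cut_expand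
    by (simp add: sum_distrib_left sum_distrib_right mult_ac)
  also have "\<dots> = (\<Sum>r\<le>p. real (p choose r) * (\<Sum>J\<in>LJ M r. hJ J x * Ik (p - r) (Rl f m J) x))"
    unfolding Ik_def S_Rl by (simp only: S_sum S_mult_left)
  finally show ?thesis .
qed

text \<open>Dropping coordinates is a projection, so the error is a difference of two norms;
  \<open>dom_power_diff\<close> linearises it in the dropped part of the inner product.\<close>

lemma Ik_cutl_error:
  assumes "M \<le> m"
  shows "(\<integral>x. (Ik p f x - Ik p (cutl ({..<M} \<union> {m..}) f) x)\<^sup>2 \<partial>Gam) \<le> fact p * (\<Sum>j\<in>{M..<m}. Inf' p f (ev j))"
proof -
  let ?A = "{..<M} \<union> {m..}" and ?B = "{M..<m}"
  obtain D where D: "bl D f" using bl_ex by blast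
  have i: "integrable Gam (\<lambda>x. Ik p f x * Ik p g x)" for f g by (intro Lall_integrable Lall_mult Ik_Lall)
  have "(\<integral>x. (Ik p f x - Ik p (cutl ?A f) x)\<^sup>2 \<partial>Gam)
    = (\<integral>x. Ik p f x * Ik p f x \<partial>Gam) - 2 * (\<integral>x. Ik p f x * Ik p (cutl ?A f) x \<partial>Gam) + (\<integral>x. Ik p (cutl ?A f) x * Ik p (cutl ?A f) x \<partial>Gam)"
    using i by (simp add: power2_eq_square algebra_simps)
  also have "\<dots> = fact p * (nn p f f - nn p (cutl ?A f) (cutl ?A f))"
  proof -
    have "inner v (cut ?A w) = inner (cut ?A v) (cut ?A w)" for v w using inner_cut[of ?A w v] by (simp add: inner_commute)
    then have "nn p f (cutl ?A f) = nn p (cutl ?A f) (cutl ?A f)" unfolding nn_def S_cutl by simp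
    then show ?thesis unfolding E_Ik_Ik by (simp add: algebra_simps)
  qed
  also have "nn p f f - nn p (cutl ?A f) (cutl ?A f) = S f (\<lambda>v. S f (\<lambda>w. inner v w ^ p - inner (cut ?A v) (cut ?A w) ^ p))"
    by (simp add: nn_def S_cutl S_diff)
  also have "\<dots> \<le> S f (\<lambda>v. S f (\<lambda>w. real p * ((inner v w - inner (cut ?A v) (cut ?A w)) * inner v w ^ (p - 1))))"
    by (rule dom_S[OF dom_power_diff[OF psd_cut dom_cut_inner] D])
  also have "\<dots> = (\<Sum>j\<in>?B. Inf' p f (ev j))"
  proof -
    have "inner v w - inner (cut ?A v) (cut ?A w) = (\<Sum>j\<in>?B. coord v j * coord w j)" for v w
    proof -
      have U: "?A \<union> ?B = UNIV" "?A \<inter> ?B = {}" using assms by auto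
      show ?thesis using inner_cut_Un[OF U(2), of v w] unfolding U(1) by (simp add: inner_cut_finite)
    qed
    then show ?thesis by (simp add: Inf'_def sum_distrib_left sum_distrib_right S_sum S_mult_left mult.assoc)
  qed
  finally show ?thesis by simp
qed

text \<open>Opening the edges v-v' of the cycle into features writes the contraction norm as a sum
  of influences of the vectors \<open>H \<phi>\<close>, whose squared lengths sum to the squared
  norm of the tensor. A uniform bound on the influences can be taken out of this sum.\<close>

lemma Cn_influence:
  assumes "\<And>h. S g (\<lambda>v. S g (\<lambda>w. inner v h * inner w h * inner v w ^ q)) \<le> l * inner h h"
  shows "Cn q 1 g \<le> l * nn (Suc q) g g"
proof -
  obtain D where D: "bl D g" using bl_ex by blast
  have bD: "below D v" if "v \<in> snd ` set g" for v using D that by (auto simp: bl_def)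
  obtain \<Phi> where 1: "nw \<Phi>" "\<And>v w. below D v \<Longrightarrow> below D w \<Longrightarrow> inner v w ^ q = S \<Phi> (\<lambda>\<phi>. \<phi> v * \<phi> w)"
    using psd_power[OF psd_inner, of D q] by (rule psdE) (blast intro: that)
  \<comment> \<open>The contraction of the tensor with the feature \<phi> in all but one slot, which
    leaves a vector.\<close>
  define H where "H \<phi> = sum_list (map (\<lambda>p. (fst p * \<phi> (snd p)) *\<^sub>R snd p) g)" for \<phi> :: "fvec \<Rightarrow> real"
  have iH: "inner u (H \<phi>) = S g (\<lambda>v. \<phi> v * inner u v)" for u \<phi>
    unfolding H_def by (induction g) (auto simp: inner_add_right)
  have HH: "inner (H \<phi>) (H \<phi>) = S g (\<lambda>v. S g (\<lambda>w. \<phi> v * \<phi> w * inner v w))" for \<phi>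
    unfolding iH[of "H \<phi>"] by (simp add: inner_commute[of "H \<phi>"] iH S_mult_left[symmetric] mult_ac)
  have "Cn q 1 g = S g (\<lambda>v. S g (\<lambda>v'. S \<Phi> (\<lambda>\<phi>. \<phi> v * \<phi> v') * S g (\<lambda>u. S g (\<lambda>u'. inner u u' ^ q * (inner v u * inner v' u')))))"
    unfolding Cn_def tet_def
    by (intro S_cong refl) (simp add: 1(2)[OF bD bD, symmetric] S_mult_left mult.assoc)
  also have "\<dots> = S g (\<lambda>v. S g (\<lambda>v'. S \<Phi> (\<lambda>\<phi>. \<phi> v * \<phi> v' * S g (\<lambda>u. S g (\<lambda>u'. inner u u' ^ q * (inner v u * inner v' u'))))))"
    by (simp only: S_mult_right)
  also have "\<dots> = S g (\<lambda>v. S \<Phi> (\<lambda>\<phi>. S g (\<lambda>v'. \<phi> v * \<phi> v' * S g (\<lambda>u. S g (\<lambda>u'. inner u u' ^ q * (inner v u * inner v' u'))))))"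
    by (subst S_swap[of g \<Phi>]) rule
  also have "\<dots> = S \<Phi> (\<lambda>\<phi>. S g (\<lambda>v. S g (\<lambda>v'. \<phi> v * \<phi> v' * S g (\<lambda>u. S g (\<lambda>u'. inner u u' ^ q * (inner v u * inner v' u'))))))"
    by (subst S_swap[of g \<Phi>]) rule
  also have "\<dots> = S \<Phi> (\<lambda>\<phi>. S g (\<lambda>u. S g (\<lambda>u'. inner u (H \<phi>) * inner u' (H \<phi>) * inner u u' ^ q)))"
  proof (intro arg_cong[where f = "S \<Phi>"] ext)
    fix \<phi> :: "fvec \<Rightarrow> real"
    have "S g (\<lambda>u. S g (\<lambda>u'. inner u (H \<phi>) * inner u' (H \<phi>) * inner u u' ^ q)) = S g (\<lambda>u. S g (\<lambda>u'. S g (\<lambda>v. S g (\<lambda>v'. \<phi> v * \<phi> v' * (inner u u' ^ q * (inner v u * inner v' u'))))))"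
      unfolding iH S_mult_S by (simp add: S_mult_right[symmetric] S_mult_left[symmetric] inner_commute mult_ac)
    also have "\<dots> = S g (\<lambda>u. S g (\<lambda>v. S g (\<lambda>u'. S g (\<lambda>v'. \<phi> v * \<phi> v' * (inner u u' ^ q * (inner v u * inner v' u'))))))"
      by (subst (2) S_swap) rule
    also have "\<dots> = S g (\<lambda>v. S g (\<lambda>u. S g (\<lambda>u'. S g (\<lambda>v'. \<phi> v * \<phi> v' * (inner u u' ^ q * (inner v u * inner v' u'))))))"
      by (subst S_swap) rule
    also have "\<dots> = S g (\<lambda>v. S g (\<lambda>u. S g (\<lambda>v'. S g (\<lambda>u'. \<phi> v * \<phi> v' * (inner u u' ^ q * (inner v u * inner v' u'))))))"
      by (subst (3) S_swap) rule
    also have "\<dots> = S g (\<lambda>v. S g (\<lambda>v'. S g (\<lambda>u. S g (\<lambda>u'. \<phi> v * \<phi> v' * (inner u u' ^ q * (inner v u * inner v' u'))))))"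
      by (subst (2) S_swap) rule
    finally show "S g (\<lambda>v. S g (\<lambda>v'. \<phi> v * \<phi> v' * S g (\<lambda>u. S g (\<lambda>u'. inner u u' ^ q * (inner v u * inner v' u'))))) = S g (\<lambda>u. S g (\<lambda>u'. inner u (H \<phi>) * inner u' (H \<phi>) * inner u u' ^ q))"
      by (simp only: S_mult_left)
  qed
  also have "\<dots> \<le> S \<Phi> (\<lambda>\<phi>. l * inner (H \<phi>) (H \<phi>))"
    using S_nonneg[OF 1(1), of "\<lambda>\<phi>. l * inner (H \<phi>) (H \<phi>) - S g (\<lambda>u. S g (\<lambda>u'. inner u (H \<phi>) * inner u' (H \<phi>) * inner u u' ^ q))"] assms by (simp add: S_diff)
  also have "\<dots> = l * S g (\<lambda>v. S g (\<lambda>w. S \<Phi> (\<lambda>\<phi>. \<phi> v * \<phi> w * inner v w)))"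
    unfolding HH S_mult_left by (subst S_swap, subst (2) S_swap) rule
  also have "\<dots> = l * nn (Suc q) g g"
    unfolding nn_def by (intro arg_cong[where f = "(*) l"] S_cong refl) (simp only: 1(2)[OF bD bD, symmetric] S_mult_right power_Suc2)
  finally show ?thesis .
qed

text \<open>By \<open>cyc_nonneg\<close>, enlarging the kernel on one pair of opposite edges
  enlarges the cycle, whatever the other pair is. This is done for one pair and, after relabelling,
  for the other.\<close>

lemma Cn_mono:
  assumes "dom D k1 inner" "psd D k1" "bl D f" and g: "\<And>\<phi>. S g \<phi> = S f (\<lambda>v. \<phi> (T v))" and T: "\<And>v w. inner (T v) (T w) = k1 v w"
  shows "Cn a r g \<le> Cn a r f"
proof -
  have *: "S f (\<lambda>v. S f (\<lambda>v'. S f (\<lambda>u. S f (\<lambda>u'. p1 v v' * p1 u u' * (k v u * k v' u'))))) \<le> S f (\<lambda>v. S f (\<lambda>v'. S f (\<lambda>u. S f (\<lambda>u'. p2 v v' * p2 u u' * (k v u * k v' u')))))"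
    if "psd D p1" "dom D p1 p2" for p1 p2 k
  proof -
    have "0 \<le> S f (\<lambda>v. S f (\<lambda>v'. S f (\<lambda>u. S f (\<lambda>u'. (p2 v v' - p1 v v') * p2 u u' * (k v u * k v' u'))))) + S f (\<lambda>v. S f (\<lambda>v'. S f (\<lambda>u. S f (\<lambda>u'. p1 v v' * (p2 u u' - p1 u u') * (k v u * k v' u')))))"
      using that dom_psd[OF that] assms(3) unfolding dom_def by (intro add_nonneg_nonneg cyc_nonneg)
    then show ?thesis by (simp add: algebra_simps S_add S_diff)
  qed
  have "Cn a r g = S f (\<lambda>v. S f (\<lambda>v'. S f (\<lambda>u. S f (\<lambda>u'. k1 v v' ^ a * k1 u u' ^ a * (k1 v u ^ r * k1 v' u' ^ r)))))"
    by (simp add: Cn_def tet_def g T power_mult_distrib)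
  also have "\<dots> \<le> S f (\<lambda>v. S f (\<lambda>v'. S f (\<lambda>u. S f (\<lambda>u'. inner v v' ^ a * inner u u' ^ a * (k1 v u ^ r * k1 v' u' ^ r)))))"
    by (rule *[OF psd_power[OF assms(2)] dom_power[OF assms(2,1)]])
  also have "\<dots> = S f (\<lambda>v. S f (\<lambda>u. S f (\<lambda>v'. S f (\<lambda>u'. inner v v' ^ a * inner u u' ^ a * (k1 v u ^ r * k1 v' u' ^ r)))))"
    by (subst (2) S_swap) rule
  also have "\<dots> = S f (\<lambda>v. S f (\<lambda>v'. S f (\<lambda>u. S f (\<lambda>u'. k1 v v' ^ r * k1 u u' ^ r * (inner v u ^ a * inner v' u' ^ a)))))"
    by (simp add: mult_ac)
  also have "\<dots> \<le> S f (\<lambda>v. S f (\<lambda>v'. S f (\<lambda>u. S f (\<lambda>u'. inner v v' ^ r * inner u u' ^ r * (inner v u ^ a * inner v' u' ^ a)))))"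
    by (rule *[OF psd_power[OF assms(2)] dom_power[OF assms(2,1)]])
  also have "\<dots> = Cn r a f" by (simp add: Cn_def tet_def power_mult_distrib)
  finally show ?thesis by (simp add: Cn_sym[of a])
qed

text \<open>Projecting one pair of opposite edges of the cycle onto coordinate j disconnects it into
  two copies of the influence, hence the square on the left.\<close>

lemma Inf_ev_le_Cn: "(Inf' p f (ev j))\<^sup>2 \<le> (real p)\<^sup>2 * Cn (p - 1) 1 f"
proof -
  obtain D where D: "bl D f" using bl_ex by blast
  let ?k = "\<lambda>v w. coord v j * coord w j"
  have dk: "dom D ?k inner" using dom_cut_inner[of D "{j}"] by (simp add: inner_cut_finite)
  have "0 \<le> S f (\<lambda>v. S f (\<lambda>v'. S f (\<lambda>u. S f (\<lambda>u'. (inner v v' - ?k v v') * inner u u' * (inner v u ^ (p - 1) * inner v' u' ^ (p - 1))))))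
     + S f (\<lambda>v. S f (\<lambda>v'. S f (\<lambda>u. S f (\<lambda>u'. ?k v v' * (inner u u' - ?k u u') * (inner v u ^ (p - 1) * inner v' u' ^ (p - 1))))))"
    using dk D psd_rank1[of D "\<lambda>v. coord v j"] psd_inner[of D] unfolding dom_def by (intro add_nonneg_nonneg cyc_nonneg)
  then have "S f (\<lambda>v. S f (\<lambda>v'. S f (\<lambda>u. S f (\<lambda>u'. ?k v v' * ?k u u' * (inner v u ^ (p - 1) * inner v' u' ^ (p - 1)))))) \<le> Cn 1 (p - 1) f"
    by (simp add: Cn_def tet_def algebra_simps S_add S_diff power_mult_distrib)
  also have "S f (\<lambda>v. S f (\<lambda>v'. S f (\<lambda>u. S f (\<lambda>u'. ?k v v' * ?k u u' * (inner v u ^ (p - 1) * inner v' u' ^ (p - 1)))))) = (S f (\<lambda>v. S f (\<lambda>w. ?k v w * inner v w ^ (p - 1))))\<^sup>2"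
  proof -
    have "(S f (\<lambda>v. S f (\<lambda>w. ?k v w * inner v w ^ (p - 1))))\<^sup>2 = S f (\<lambda>v. S f (\<lambda>v'. S f (\<lambda>u. S f (\<lambda>u'. (?k v u * inner v u ^ (p - 1)) * (?k v' u' * inner v' u' ^ (p - 1))))))"
      unfolding power2_eq_square S_mult_S ..
    then show ?thesis by (simp add: mult_ac)
  qed
  finally have "(real p)\<^sup>2 * (S f (\<lambda>v. S f (\<lambda>w. ?k v w * inner v w ^ (p - 1))))\<^sup>2 \<le> (real p)\<^sup>2 * Cn 1 (p - 1) f" by (intro mult_left_mono) auto
  then show ?thesis unfolding Cn_sym[of "p - 1" 1] by (simp add: Inf'_def power_mult_distrib)
qed

lemma nn_Rl: "nn q (Rl f m J) (Rl g m J') = S f (\<lambda>v. S g (\<lambda>w. cJ J v * cJ J' w * inner (cut {m..} v) (cut {m..} w) ^ q))"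
  by (simp add: nn_def S_Rl S_mult_left[symmetric] mult_ac)

lemma psd_cJ: "psd D (\<lambda>v w. cJ J v * cJ J w)" by (rule psd_rank1)

lemma nn_Rl_le: assumes "length J + q = p" shows "nn q (Rl f m J) (Rl f m J) \<le> nn p f f"
proof -
  obtain D where D: "bl D f" using bl_ex by blast
  have "dom D (\<lambda>v w. (cJ J v * cJ J w) * inner (cut {m..} v) (cut {m..} w) ^ q) (\<lambda>v w. inner v w ^ length J * inner v w ^ q)"
    by (intro dom_mult psd_cJ dom_cJ psd_power psd_cut dom_power dom_cut_inner)
  from dom_S[OF this D] show ?thesis unfolding nn_Rl assms[symmetric] nn_def[of "length J + q"] power_add .
qed

text \<open>The kernel of the coefficient tensor is dominated by that of f, and the tensor sees only
  the tail part of a direction. Its influences are thus bounded by tail influences of f, and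
  \<open>Cn_influence\<close> concludes.\<close>

lemma Cn_Rl_le:
  assumes "length J + Suc q = p" and l: "\<And>h. (\<And>k. k < m \<Longrightarrow> coord h k = 0) \<Longrightarrow> Inf' p f h \<le> l * inner h h" and "0 \<le> l"
  shows "Cn q 1 (Rl f m J) \<le> l * nn p f f"
proof -
  obtain D where D: "bl D f" using bl_ex by blast
  have "S (Rl f m J) (\<lambda>v. S (Rl f m J) (\<lambda>w. inner v h * inner w h * inner v w ^ q)) \<le> l * inner h h" for h
  proof -
    let ?h = "cut {m..} h"
    have e: "inner (cut {m..} v) h = inner v ?h" for v using inner_cut[of "{m..}" v h] inner_cut[of "{m..}" h v] by (simp add: inner_commute)
    have "S (Rl f m J) (\<lambda>v. S (Rl f m J) (\<lambda>w. inner v h * inner w h * inner v w ^ q))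
      = S f (\<lambda>v. S f (\<lambda>w. (inner v ?h * inner w ?h) * ((cJ J v * cJ J w) * inner (cut {m..} v) (cut {m..} w) ^ q)))"
      by (simp add: S_Rl e S_mult_left[symmetric] mult_ac)
    also have "\<dots> \<le> S f (\<lambda>v. S f (\<lambda>w. (inner v ?h * inner w ?h) * (inner v w ^ length J * inner v w ^ q)))"
      by (rule dom_S[OF _ D]) (intro dom_mult psd_cJ dom_cJ psd_power psd_cut dom_power dom_cut_inner dom_refl psd_rank1 psd_mult)
    also have "\<dots> = S f (\<lambda>v. S f (\<lambda>w. inner v ?h * inner w ?h * inner v w ^ (p - 1)))"
      using assms(1) by (simp add: power_add[symmetric] assms(1)[symmetric])
    also have "\<dots> \<le> Inf' p f ?h"
    proof -
      have "0 \<le> S f (\<lambda>v. S f (\<lambda>w. inner v ?h * inner w ?h * inner v w ^ (p - 1)))" by (intro psd_nonneg[OF _ D] psd_mult psd_rank1 psd_power psd_inner)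
      then show ?thesis unfolding Inf'_def using assms(1) mult_right_mono[of 1 "real p" "S f (\<lambda>v. S f (\<lambda>w. inner v ?h * inner w ?h * inner v w ^ (p - 1)))"] by simp
    qed
    also have "\<dots> \<le> l * inner ?h ?h" by (rule l) simp
    also have "\<dots> \<le> l * inner h h"
    proof (intro mult_left_mono assms(3))
      have "inner h h = inner ?h ?h + inner (cut (- {m..}) h) (cut (- {m..}) h)" using inner_cut_Un[OF Compl_disjoint, of "{m..}" h h] unfolding Compl_partition by simp
      then show "inner ?h ?h \<le> inner h h" using inner_ge_zero[of "cut (- {m..}) h"] by linarith
    qed
    finally show ?thesis .
  qed
  then have "Cn q 1 (Rl f m J) \<le> l * nn (Suc q) (Rl f m J) (Rl f m J)" by (rule Cn_influence)
  also have "\<dots> \<le> l * nn p f f" using assms by (intro mult_left_mono nn_Rl_le) auto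
  finally show ?thesis .
qed

section \<open>Gram factorisation and completeness\<close>

text \<open>Iterated Schur complements; where a pivot vanishes, $x / 0 = 0$ makes the step trivial.\<close>

fun schur :: "(nat \<Rightarrow> nat \<Rightarrow> real) \<Rightarrow> nat \<Rightarrow> nat \<Rightarrow> nat \<Rightarrow> real" where
  "schur s 0 i j = s i j"
| "schur s (Suc k) i j = schur s k i j - schur s k i k * schur s k j k / schur s k k k"

definition npsd :: "(nat \<Rightarrow> nat \<Rightarrow> real) \<Rightarrow> bool" where
  "npsd s \<longleftrightarrow> (\<forall>i j. s i j = s j i) \<and> (\<forall>n u. 0 \<le> (\<Sum>i<n. \<Sum>j<n. u i * u j * s i j))"

lemma npsd_D: assumes "npsd s" "finite A" shows "0 \<le> (\<Sum>i\<in>A. \<Sum>j\<in>A. u i * u j * s i j)"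
proof -
  obtain n where n: "A \<subseteq> {..<n}" using assms(2) finite_nat_iff_bounded by blast
  let ?u = "\<lambda>i. if i \<in> A then u i else 0"
  have in1: "(\<Sum>j<n. ?u i * ?u j * s i j) = ?u i * (\<Sum>j\<in>A. u j * s i j)" for i
  proof -
    have "(\<Sum>j<n. ?u i * ?u j * s i j) = (\<Sum>j\<in>A. ?u i * u j * s i j)"
      using n by (intro sum.mono_neutral_cong_right) auto
    then show ?thesis by (simp add: sum_distrib_left mult.assoc)
  qed
  have "(\<Sum>i<n. \<Sum>j<n. ?u i * ?u j * s i j) = (\<Sum>i\<in>A. u i * (\<Sum>j\<in>A. u j * s i j))"
    unfolding in1 using n by (intro sum.mono_neutral_cong_right) auto
  moreover have "0 \<le> (\<Sum>i<n. \<Sum>j<n. ?u i * ?u j * s i j)"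
    using assms(1)[unfolded npsd_def, THEN conjunct2, rule_format, of ?u n] .
  ultimately show ?thesis by (simp add: sum_distrib_left mult.assoc)
qed

lemma npsd_diag: assumes "npsd s" shows "0 \<le> s k k"
  using npsd_D[OF assms, of "{k}" "\<lambda>_. 1"] by simp

text \<open>With a zero diagonal entry the form is affine in the coefficient of k, and an affine
  function bounded below is constant.\<close>

lemma npsd_zero: assumes "npsd s" "s k k = 0" shows "s i k = 0"
proof (cases "i = k")
  case False
  have sym: "s k i = s i k" using assms(1) by (auto simp: npsd_def)
  have q: "0 \<le> s i i + 2 * t * s i k" for t
    using npsd_D[OF assms(1), of "{i, k}" "\<lambda>j. if j = i then 1 else t"] False assms(2) sym by (simp add: algebra_simps)
  show ?thesis
  proof (rule ccontr)
    assume n: "s i k \<noteq> 0"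
    have "2 * (- (s i i + 1) / (2 * s i k)) * s i k = - (s i i + 1)" using n by (simp add: field_simps)
    with q[of "- (s i i + 1) / (2 * s i k)"] show False by linarith
  qed
qed (use assms in simp)

lemma npsd_schur: assumes "npsd s" shows "npsd (schur s k)"
proof (induction k)
  case 0 then show ?case using assms by simp
next
  case (Suc k)
  let ?s = "schur s k"
  have sym: "?s i j = ?s j i" for i j using Suc by (auto simp: npsd_def)
  show ?case
  proof (cases "?s k k = 0")
    case True
    then have "schur s (Suc k) = ?s" by (intro ext) simp
    then show ?thesis using Suc by simp
  next
    case False
    have "0 \<le> (\<Sum>i<n. \<Sum>j<n. u i * u j * schur s (Suc k) i j)" for n u
    proof -
      define N where "N = max n (Suc k)"
      define w where "w i = (if i < n then u i else 0)" for i
      \<comment> \<open>The coefficient of k that minimises the form; the minimum is the form of the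
        Schur complement.\<close>
      define t where "t = - (\<Sum>i<N. w i * ?s i k) / ?s k k"
      have e: "(\<Sum>i<n. \<Sum>j<n. u i * u j * h i j) = (\<Sum>i<N. \<Sum>j<N. w i * w j * h i j)" for h :: "nat \<Rightarrow> nat \<Rightarrow> real"
      proof -
        have "(\<Sum>i<N. \<Sum>j<N. w i * w j * h i j) = (\<Sum>i<n. \<Sum>j<N. w i * w j * h i j)"
          by (intro sum.mono_neutral_right) (auto simp: w_def N_def)
        also have "\<dots> = (\<Sum>i<n. \<Sum>j<n. w i * w j * h i j)"
          by (intro sum.cong sum.mono_neutral_right) (auto simp: w_def N_def)
        finally show ?thesis by (simp add: w_def)
      qed
      define A where "A = (\<Sum>i<N. w i * ?s i k)"
      define B where "B = (\<Sum>i<N. \<Sum>j<N. w i * w j * ?s i j)"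
      have kN: "k < N" by (simp add: N_def)
      have d1: "(\<Sum>i<N. (if i = k then t else 0) * g i) = t * g k" for g :: "nat \<Rightarrow> real"
      proof -
        have "(\<Sum>i<N. (if i = k then t else 0) * g i) = (\<Sum>i<N. if i = k then t * g i else 0)" by (rule sum.cong) auto
        also have "\<dots> = t * g k" using kN by (subst sum.delta) auto
        finally show ?thesis .
      qed
      have inr: "(\<Sum>j<N. (w j + (if j = k then t else 0)) * ?s i j) = (\<Sum>j<N. w j * ?s i j) + t * ?s i k" for i
        by (simp only: distrib_right sum.distrib d1)
      have q: "(\<Sum>i<N. \<Sum>j<N. (w i + (if i = k then t else 0)) * (w j + (if j = k then t else 0)) * ?s i j)
        = (\<Sum>i<N. (w i + (if i = k then t else 0)) * ((\<Sum>j<N. w j * ?s i j) + t * ?s i k))"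
        by (intro sum.cong refl) (subst inr[symmetric], simp only: sum_distrib_left mult.assoc)
      also have "\<dots> = (\<Sum>i<N. w i * (\<Sum>j<N. w j * ?s i j)) + t * (\<Sum>i<N. w i * ?s i k) + t * (\<Sum>j<N. w j * ?s k j) + t * t * ?s k k"
      proof -
        have "(\<Sum>i<N. w i * ((\<Sum>j<N. w j * ?s i j) + t * ?s i k)) = (\<Sum>i<N. w i * (\<Sum>j<N. w j * ?s i j)) + t * (\<Sum>i<N. w i * ?s i k)"
          unfolding sum_distrib_left[of t] sum.distrib[symmetric] by (rule sum.cong) (auto simp: algebra_simps)
        then show ?thesis unfolding distrib_right sum.distrib d1 distrib_left[of t] by (simp only: add.assoc mult.assoc)
      qed
      also have "\<dots> = B + t * A + t * A + t * t * ?s k k"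
      proof -
        have "(\<Sum>j<N. w j * ?s k j) = A" unfolding A_def by (intro sum.cong refl) (subst sym, rule refl)
        moreover have "(\<Sum>i<N. w i * (\<Sum>j<N. w j * ?s i j)) = B" unfolding B_def by (simp only: sum_distrib_left mult.assoc)
        ultimately show ?thesis by (simp only: A_def)
      qed
      also have "\<dots> = B - A * A / ?s k k"
        using False by (simp add: t_def A_def[symmetric] field_simps)
      finally have "0 \<le> B - A * A / ?s k k"
        using Suc[unfolded npsd_def, THEN conjunct2, rule_format, of "\<lambda>i. w i + (if i = k then t else 0)" N] by simp
      moreover have "(\<Sum>i<N. \<Sum>j<N. w i * w j * schur s (Suc k) i j) = B - A * A / ?s k k"
      proof -
        have "w i * w j * schur s (Suc k) i j = w i * w j * ?s i j - (w i * ?s i k) * (w j * ?s j k) / ?s k k" for i j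
          by (simp add: algebra_simps)
        then show ?thesis by (simp only: sum_subtractf sum_divide_distrib[symmetric] A_def B_def sum_product)
      qed
      ultimately show ?thesis unfolding e by simp
    qed
    then show ?thesis unfolding npsd_def using sym by (auto simp: mult.commute)
  qed
qed

lemma schur_zero: assumes "npsd s" "i < k" shows "schur s k i j = 0"
  using assms(2)
proof (induction k arbitrary: j)
  case (Suc k)
  have ps: "npsd (schur s k)" using npsd_schur[OF assms(1)] .
  have sym: "schur s k i j = schur s k j i" for i j using ps by (auto simp: npsd_def)
  show ?case
  proof (cases "i < k")
    case True then show ?thesis using Suc.IH by simp
  next
    case False
    then have i: "i = k" using Suc(2) by simp
    show ?thesis
    proof (cases "schur s k k k = 0")
      case True
      then show ?thesis using npsd_zero[OF ps True, of j] i sym[of k j] by simp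
    next
      case False
      then show ?thesis using i sym[of k j] by simp
    qed
  qed
qed simp

text \<open>The rank-one steps telescope, and row i is eliminated after step i, so for every n >= i
  the factorisation is exact. The matrix may be infinite.\<close>

lemma cholesky:
  assumes "npsd s"
  obtains c :: "nat \<Rightarrow> nat \<Rightarrow> real" where "\<And>i j n. i \<le> n \<Longrightarrow> (\<Sum>k\<le>n. c i k * c j k) = s i j"
proof
  define c where "c i k = schur s k i k / sqrt (schur s k k k)" for i k
  have st: "schur s (Suc k) i j = schur s k i j - c i k * c j k" for i j k
    using npsd_diag[OF npsd_schur[OF assms], of k k] by (simp add: c_def)
  have "schur s (Suc n) i j = s i j - (\<Sum>k\<le>n. c i k * c j k)" for n i j
  proof (induction n)
    case 0 show ?case using st[of 0] by simp
  next
    case (Suc n) show ?case using st[of "Suc n" i j] unfolding Suc by simp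
  qed
  then show "(\<Sum>k\<le>n. c i k * c j k) = s i j" if "i \<le> n" for i j n
    using schur_zero[OF assms, of i "Suc n" j] that by simp
qed

section \<open>Completeness of square-integrable functions, stability of characteristic
  functions\<close>

lemma (in prob_space) expectation_abs_le:
  fixes f :: "'a \<Rightarrow> real"
  assumes [measurable]: "f \<in> borel_measurable M" and i: "integrable M (\<lambda>x. (f x)\<^sup>2)"
  shows "expectation (\<lambda>x. \<bar>f x\<bar>) \<le> sqrt (expectation (\<lambda>x. (f x)\<^sup>2))"
proof -
  have "integrable M f" using square_integrable_imp_integrable[OF _ i] by simp
  then have "integrable M (\<lambda>x. \<bar>f x\<bar>)" by simp
  then have "variance (\<lambda>x. \<bar>f x\<bar>) = expectation (\<lambda>x. (f x)\<^sup>2) - (expectation (\<lambda>x. \<bar>f x\<bar>))\<^sup>2"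
    using i by (subst variance_eq) auto
  then show ?thesis using variance_positive[of "\<lambda>x. \<bar>f x\<bar>"] by (intro real_le_rsqrt) simp
qed

text \<open>The Riesz-Fischer argument: an almost surely convergent subsequence defines Y, and
  Fatou's lemma along it transfers the Cauchy bound \<open>e n\<close> to the distance from
  \<open>f n\<close> to Y for every n.\<close>

lemma L2_complete:
  fixes f :: "nat \<Rightarrow> 'a \<Rightarrow> real"
  assumes "prob_space M" and [measurable]: "\<And>n. f n \<in> borel_measurable M" and i2: "\<And>n. integrable M (\<lambda>x. (f n x)\<^sup>2)"
    and e0: "e \<longlonglongrightarrow> 0" and Cauchy: "\<And>m n. m \<le> n \<Longrightarrow> (\<integral>x. (f n x - f m x)\<^sup>2 \<partial>M) \<le> e m"
  obtains Y where "Y \<in> borel_measurable M" "integrable M (\<lambda>x. (Y x)\<^sup>2)" "(\<lambda>n. \<integral>x. (f n x - Y x)\<^sup>2 \<partial>M) \<longlonglongrightarrow> 0"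
proof -
  interpret prob_space M by fact
  have idiff: "integrable M (\<lambda>x. (g x - h x)\<^sup>2)" if [measurable]: "g \<in> borel_measurable M" "h \<in> borel_measurable M"
    and i: "integrable M (\<lambda>x. (g x)\<^sup>2)" "integrable M (\<lambda>x. (h x)\<^sup>2)" for g h :: "'a \<Rightarrow> real"
  proof (rule Bochner_Integration.integrable_bound[of _ "\<lambda>x. 2 * (g x)\<^sup>2 + 2 * (h x)\<^sup>2"])
    have "(a - b)\<^sup>2 \<le> 2 * a\<^sup>2 + 2 * b\<^sup>2" for a b :: real
      using zero_le_power2[of "a + b"] by (simp add: power2_eq_square algebra_simps)
    then show "AE x in M. norm ((g x - h x)\<^sup>2) \<le> norm (2 * (g x)\<^sup>2 + 2 * (h x)\<^sup>2)" by auto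
  qed (use i in auto)
  have i1: "integrable M (f n)" for n using square_integrable_imp_integrable[OF _ i2] by simp
  have l1: "(\<integral>x. norm (f n x - f m x) \<partial>M) \<le> sqrt (e m)" if "m \<le> n" for m n
  proof -
    have "(\<integral>x. \<bar>f n x - f m x\<bar> \<partial>M) \<le> sqrt (\<integral>x. (f n x - f m x)\<^sup>2 \<partial>M)"
      using idiff[OF _ _ i2 i2, of n m] by (intro expectation_abs_le) auto
    also have "\<dots> \<le> sqrt (e m)" using Cauchy[OF that] by simp
    finally show ?thesis by simp
  qed
  have se: "(\<lambda>m. sqrt (e m)) \<longlonglongrightarrow> 0" using tendsto_real_sqrt[OF e0] by simp
  obtain r where r: "strict_mono r" and c: "AE x in M. Cauchy (\<lambda>k. f (r k) x)"
  proof (rule cauchy_L1_AE_cauchy_subseq[of M f])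
    show "\<exists>N. \<forall>i\<ge>N. \<forall>j\<ge>N. (LINT x|M. norm (f i x - f j x)) < e'" if e'0: "0 < e'" for e'
    proof -
      obtain N where N: "\<And>m. m \<ge> N \<Longrightarrow> sqrt (e m) < e'"
        using order_tendstoD(2)[OF se e'0] by (auto simp: eventually_sequentially)
      have "(LINT x|M. norm (f i x - f j x)) < e'" if "i \<ge> N" "j \<ge> N" for i j
      proof (cases "j \<le> i")
        case True then show ?thesis using l1[OF True] N[OF that(2)] by simp
      next
        case False
        then show ?thesis using l1[of i j] N[OF that(1)] abs_minus_commute[of "f i _" "f j _"] by simp
      qed
      then show ?thesis by blast
    qed
  qed (use i1 in auto)
  define Y where "Y x = lim (\<lambda>k. f (r k) x)" for x
  have [measurable]: "Y \<in> borel_measurable M" unfolding Y_def by measurable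
  have Yl: "AE x in M. (\<lambda>k. f (r k) x) \<longlonglongrightarrow> Y x"
    using c by eventually_elim (simp add: Y_def Cauchy_convergent_iff convergent_LIMSEQ_iff)
  have fat: "(\<integral>\<^sup>+x. ennreal ((f n x - Y x)\<^sup>2) \<partial>M) \<le> ennreal (e n)" for n
  proof -
    have "(\<integral>\<^sup>+x. ennreal ((f n x - Y x)\<^sup>2) \<partial>M) = (\<integral>\<^sup>+x. liminf (\<lambda>k. ennreal ((f n x - f (r k) x)\<^sup>2)) \<partial>M)"
    proof (rule nn_integral_cong_AE)
      show "AE x in M. ennreal ((f n x - Y x)\<^sup>2) = liminf (\<lambda>k. ennreal ((f n x - f (r k) x)\<^sup>2))"
        using Yl
      proof eventually_elim
        case (elim x)
        have "(\<lambda>k. ennreal ((f n x - f (r k) x)\<^sup>2)) \<longlonglongrightarrow> ennreal ((f n x - Y x)\<^sup>2)"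
          by (intro tendsto_intros elim)
        then show ?case using lim_imp_Liminf[of sequentially] by (metis trivial_limit_sequentially)
      qed
    qed
    also have "\<dots> \<le> liminf (\<lambda>k. \<integral>\<^sup>+x. ennreal ((f n x - f (r k) x)\<^sup>2) \<partial>M)" by (rule nn_integral_liminf) measurable
    also have "\<dots> \<le> ennreal (e n)"
    proof (rule Liminf_le, simp)
      have "(\<integral>\<^sup>+x. ennreal ((f n x - f (r k) x)\<^sup>2) \<partial>M) \<le> ennreal (e n)" if "k \<ge> n" for k
      proof -
        have "n \<le> r k" using that seq_suble[OF r, of k] by simp
        have "(\<integral>\<^sup>+x. ennreal ((f n x - f (r k) x)\<^sup>2) \<partial>M) = ennreal (\<integral>x. (f n x - f (r k) x)\<^sup>2 \<partial>M)"
          by (rule nn_integral_eq_integral) (use idiff[OF _ _ i2 i2, of n "r k"] in auto)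
        also have "(\<integral>x. (f n x - f (r k) x)\<^sup>2 \<partial>M) \<le> e n" using Cauchy[OF \<open>n \<le> r k\<close>] by (simp add: power2_commute)
        finally show ?thesis by (simp add: ennreal_leI)
      qed
      then show "\<forall>\<^sub>F k in sequentially. (\<integral>\<^sup>+x. ennreal ((f n x - f (r k) x)\<^sup>2) \<partial>M) \<le> ennreal (e n)"
        by (auto simp: eventually_sequentially)
    qed
    finally show ?thesis .
  qed
  have int: "integrable M (\<lambda>x. (f n x - Y x)\<^sup>2)" for n
    by (rule integrableI_bounded) (use fat[of n] in \<open>auto simp: less_top[symmetric] top_unique\<close>)
  have e_nn: "0 \<le> e n" for n using Cauchy[of n n] by simp
  have b: "(\<integral>x. (f n x - Y x)\<^sup>2 \<partial>M) \<le> e n" for n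
    using fat[of n] nn_integral_eq_integral[OF int[of n]] e_nn[of n] by simp
  show thesis
  proof
    show "Y \<in> borel_measurable M" by measurable
    have [measurable]: "(\<lambda>x. f 0 x - Y x) \<in> borel_measurable M" by measurable
    show "integrable M (\<lambda>x. (Y x)\<^sup>2)" using idiff[OF _ _ i2[of 0] int[of 0]] by simp
    show "(\<lambda>n. \<integral>x. (f n x - Y x)\<^sup>2 \<partial>M) \<longlonglongrightarrow> 0"
      by (rule real_tendsto_sandwich[OF _ _ tendsto_const e0]) (use b in auto)
  qed
qed

lemma cos_lipschitz: "\<bar>cos a - cos b\<bar> \<le> \<bar>a - b\<bar>" for a b :: real
proof -
  have "cos a - cos b = 2 * sin ((a + b) / 2) * sin ((b - a) / 2)" by (simp add: cos_diff_cos)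
  then have "\<bar>cos a - cos b\<bar> = 2 * (\<bar>sin ((a + b) / 2)\<bar> * \<bar>sin ((b - a) / 2)\<bar>)" by (simp add: abs_mult)
  also have "\<dots> \<le> 2 * (1 * \<bar>(b - a) / 2\<bar>)"
    by (intro mult_left_mono mult_mono abs_sin_x_le_abs_x) auto
  finally show ?thesis by simp
qed

text \<open>Cosine is Lipschitz, so approximation in L2 carries over to joint characteristic
  functions.\<close>

lemma cos_L2_le:
  assumes "prob_space P" and [measurable]: "\<And>i. Z i \<in> borel_measurable P" "\<And>i. Z' i \<in> borel_measurable P"
    and i2: "\<And>i. i \<in> supp v \<Longrightarrow> integrable P (\<lambda>x. (Z i x - Z' i x)\<^sup>2)"
  shows "\<bar>(\<integral>x. cos (X v (\<lambda>i. Z i x) + \<theta>) \<partial>P) - (\<integral>x. cos (X v (\<lambda>i. Z' i x) + \<theta>) \<partial>P)\<bar>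
    \<le> (\<Sum>i\<in>supp v. \<bar>coord v i\<bar> * sqrt (\<integral>x. (Z i x - Z' i x)\<^sup>2 \<partial>P))"
proof -
  interpret prob_space P by fact
  have [measurable]: "(\<lambda>x. X v (\<lambda>i. Z i x)) \<in> borel_measurable P" "(\<lambda>x. X v (\<lambda>i. Z' i x)) \<in> borel_measurable P"
    unfolding X_def by measurable
  have ci: "integrable P (\<lambda>x. cos (g x + \<theta>))" if [measurable]: "g \<in> borel_measurable P" for g
    by (rule integrable_const_bound[of _ 1]) auto
  have i1: "integrable P (\<lambda>x. Z i x - Z' i x)" if "i \<in> supp v" for i
    using square_integrable_imp_integrable[OF _ i2[OF that]] by simp
  have ab: "integrable P (\<lambda>x. \<bar>Z i x - Z' i x\<bar>)" if "i \<in> supp v" for i using i1[OF that] by simp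
  have "\<bar>(\<integral>x. cos (X v (\<lambda>i. Z i x) + \<theta>) \<partial>P) - (\<integral>x. cos (X v (\<lambda>i. Z' i x) + \<theta>) \<partial>P)\<bar>
    = \<bar>\<integral>x. cos (X v (\<lambda>i. Z i x) + \<theta>) - cos (X v (\<lambda>i. Z' i x) + \<theta>) \<partial>P\<bar>"
    by (simp add: ci)
  also have "\<dots> \<le> (\<integral>x. \<bar>cos (X v (\<lambda>i. Z i x) + \<theta>) - cos (X v (\<lambda>i. Z' i x) + \<theta>)\<bar> \<partial>P)"
    by (rule integral_abs_bound)
  also have "\<dots> \<le> (\<integral>x. (\<Sum>i\<in>supp v. \<bar>coord v i\<bar> * \<bar>Z i x - Z' i x\<bar>) \<partial>P)"
  proof (rule integral_mono)
    show "integrable P (\<lambda>x. \<bar>cos (X v (\<lambda>i. Z i x) + \<theta>) - cos (X v (\<lambda>i. Z' i x) + \<theta>)\<bar>)" by (intro integrable_abs Bochner_Integration.integrable_diff ci) measurable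
    show "integrable P (\<lambda>x. \<Sum>i\<in>supp v. \<bar>coord v i\<bar> * \<bar>Z i x - Z' i x\<bar>)"
      by (intro Bochner_Integration.integrable_sum integrable_mult_right ab)
    fix x
    have "\<bar>cos (X v (\<lambda>i. Z i x) + \<theta>) - cos (X v (\<lambda>i. Z' i x) + \<theta>)\<bar> \<le> \<bar>X v (\<lambda>i. Z i x) - X v (\<lambda>i. Z' i x)\<bar>"
      using cos_lipschitz[of "X v (\<lambda>i. Z i x) + \<theta>" "X v (\<lambda>i. Z' i x) + \<theta>"] by simp
    also have "\<dots> = \<bar>\<Sum>i\<in>supp v. coord v i * (Z i x - Z' i x)\<bar>"
      by (simp add: X_def sum_subtractf[symmetric] right_diff_distrib)
    also have "\<dots> \<le> (\<Sum>i\<in>supp v. \<bar>coord v i\<bar> * \<bar>Z i x - Z' i x\<bar>)" by (rule order_trans[OF sum_abs]) (simp add: abs_mult)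
    finally show "\<bar>cos (X v (\<lambda>i. Z i x) + \<theta>) - cos (X v (\<lambda>i. Z' i x) + \<theta>)\<bar> \<le> (\<Sum>i\<in>supp v. \<bar>coord v i\<bar> * \<bar>Z i x - Z' i x\<bar>)" .
  qed
  also have "\<dots> = (\<Sum>i\<in>supp v. \<bar>coord v i\<bar> * (\<integral>x. \<bar>Z i x - Z' i x\<bar> \<partial>P))"
    by (subst Bochner_Integration.integral_sum) (auto intro: ab)
  also have "\<dots> \<le> (\<Sum>i\<in>supp v. \<bar>coord v i\<bar> * sqrt (\<integral>x. (Z i x - Z' i x)\<^sup>2 \<partial>P))"
  proof (intro sum_mono mult_left_mono abs_ge_zero)
    fix i assume i: "i \<in> supp v"
    show "(\<integral>x. \<bar>Z i x - Z' i x\<bar> \<partial>P) \<le> sqrt (\<integral>x. (Z i x - Z' i x)\<^sup>2 \<partial>P)"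
      using i2[OF i] by (intro expectation_abs_le) auto
  qed
  finally show ?thesis .
qed

text \<open>Interchange of two limits: at each fixed M the approximation only has to be good
  eventually in n, with an error that vanishes as M grows.\<close>

lemma tendsto_approx:
  fixes a :: "nat \<Rightarrow> real"
  assumes ab: "\<And>M. \<forall>\<^sub>F n in sequentially. \<bar>a n - b n M\<bar> \<le> e n M" and e: "\<And>M. (\<lambda>n. e n M) \<longlonglongrightarrow> e' M" and e': "e' \<longlonglongrightarrow> 0"
    and b: "\<And>M. (\<lambda>n. b n M) \<longlonglongrightarrow> c M" and c: "c \<longlonglongrightarrow> l"
  shows "a \<longlonglongrightarrow> l"
proof (rule tendstoI)
  fix \<epsilon> :: real assume "0 < \<epsilon>"
  then have 4: "0 < \<epsilon> / 4" by simp
  have "\<forall>\<^sub>F M in sequentially. e' M < \<epsilon> / 4 \<and> dist (c M) l < \<epsilon> / 4"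
    using order_tendstoD(2)[OF e' 4] tendstoD[OF c 4] by eventually_elim simp
  then obtain M where M: "e' M < \<epsilon> / 4" "dist (c M) l < \<epsilon> / 4" using eventually_happens'[OF sequentially_bot] by blast
  show "\<forall>\<^sub>F n in sequentially. dist (a n) l < \<epsilon>"
    using ab[of M] order_tendstoD(2)[OF e M(1)] tendstoD[OF b[of M] 4]
    by eventually_elim (use M(2) in \<open>simp add: dist_real_def abs_if split: if_splits\<close>)
qed

section \<open>Limits of the remainders\<close>

lift_definition dbl :: "fvec \<Rightarrow> fvec" is "\<lambda>v k. if even k then v (k div 2) else 0"
  subgoal for v
  proof -
    assume "finite {k. v k \<noteq> 0}"
    then have "finite ((\<lambda>k. 2 * k) ` {k. v k \<noteq> 0})" by simp
    moreover have "{k. (if even k then v (k div 2) else 0) \<noteq> 0} \<subseteq> (\<lambda>k. 2 * k) ` {k. v k \<noteq> 0}"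
      by (auto simp: image_iff split: if_splits elim!: evenE)
    ultimately show ?thesis by (rule finite_subset[rotated])
  qed done

lemma coord_dbl[simp]: "coord (dbl v) k = (if even k then coord v (k div 2) else 0)" by transfer simp

lemma dbl_ev: "dbl (ev k) = ev (2 * k)" by (rule fvec_eqI) (auto elim!: evenE)

lemma fisom_dbl: "fisom dbl"
  unfolding fisom_def
proof (intro conjI allI)
  fix v w :: fvec
  have "supp (dbl v) \<subseteq> (\<lambda>k. 2 * k) ` supp v" by (auto simp: image_iff split: if_splits elim!: evenE)
  then have "inner (dbl v) (dbl w) = (\<Sum>k\<in>(\<lambda>k. 2 * k) ` supp v. coord (dbl v) k * coord (dbl w) k)"
    by (intro inner_fvec_superset) auto
  also have "\<dots> = inner v w" by (subst sum.reindex) (auto simp: inj_on_def inner_fvec_def)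
  finally show "inner (dbl v) (dbl w) = inner v w" .
qed (rule fvec_eqI, simp)+

lemma integral_even: "\<Phi> \<in> borel_measurable Gam \<Longrightarrow> (\<integral>x. (\<Phi> (\<lambda>k. x (2 * k)) :: real) \<partial>Gam) = (\<integral>x. \<Phi> x \<partial>Gam)"
  using Gam_isom[OF fisom_dbl, of \<Phi>] by (simp add: dbl_ev X_ev)

lemma count_list_map_inj: "inj f \<Longrightarrow> count_list (map f xs) (f x) = count_list xs x"
  by (induction xs) (auto dest: injD)

lemma hJ_even: "hJ J (\<lambda>k. x (2 * k)) = hJ (map ((*) 2) J) x"
proof -
  have i: "inj ((*) (2::nat))" by (simp add: inj_on_def)
  have "hJ (map ((*) 2) J) x = (\<Prod>j\<in>set J. wk (count_list (map ((*) 2) J) (2 * j)) (ev (2 * j)) x)"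
    unfolding hJ_def set_map by (subst prod.reindex) (auto simp: inj_on_def)
  also have "\<dots> = hJ J (\<lambda>k. x (2 * k))"
    unfolding hJ_def by (simp only: count_list_map_inj[OF i] wk_ev)
  finally show ?thesis by simp
qed

definition lc :: "('i \<Rightarrow> real) \<Rightarrow> ('i \<Rightarrow> (real \<times> fvec) list) \<Rightarrow> 'i list \<Rightarrow> (real \<times> fvec) list" where
  "lc u R as = concat (map (\<lambda>a. map (\<lambda>(c, v). (c * u a, v)) (R a)) as)"

lemma S_lc: "S (lc u R as) \<phi> = (\<Sum>a\<leftarrow>as. u a * S (R a) \<phi>)"
proof (induction as)
  case (Cons a as)
  have "S (map (\<lambda>(c, v). (c * u a, v)) (R a)) \<phi> = u a * S (R a) \<phi>"
    using S_map[of "\<lambda>_. u a" "\<lambda>v. v" "R a" \<phi>] by (simp add: S_mult_left)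
  with Cons show ?case by (simp add: lc_def)
qed (simp add: lc_def)

lemma tendsto0I: "g \<longlonglongrightarrow> 0 \<Longrightarrow> (\<And>n. 0 \<le> f n) \<Longrightarrow> (\<And>n. f n \<le> g n) \<Longrightarrow> f \<longlonglongrightarrow> 0" for f g :: "nat \<Rightarrow> real"
  by (rule real_tendsto_sandwich[OF _ _ tendsto_const]) auto

lemma Cn_Nil: "Cn a r [] = 0" by (simp add: Cn_def tet_def)

lemma Cn_lc_tendsto:
  assumes "\<And>x. x \<in> set as \<Longrightarrow> (\<lambda>n. Cn a r (R n x)) \<longlonglongrightarrow> 0"
  shows "(\<lambda>n. Cn a r (lc u (R n) as)) \<longlonglongrightarrow> 0"
  using assms
proof (induction as)
  case Nil then show ?case by (simp add: lc_def Cn_Nil)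
next
  case (Cons x as)
  have "Cn a r (lc u (R n) (x # as)) \<le> 8 * (u x ^ 4 * Cn a r (R n x) + Cn a r (lc u (R n) as))" for n
    using Cn_append[of a r "map (\<lambda>(c, v). (c * u x, v)) (R n x)" "lc u (R n) as"] by (simp add: lc_def Cn_scale)
  moreover have "(\<lambda>n. 8 * (u x ^ 4 * Cn a r (R n x) + Cn a r (lc u (R n) as))) \<longlonglongrightarrow> 8 * (u x ^ 4 * 0 + 0)"
    using Cons by (intro tendsto_intros) auto
  ultimately show ?case
    using tendsto0I[of "\<lambda>n. 8 * (u x ^ 4 * Cn a r (R n x) + Cn a r (lc u (R n) as))" "\<lambda>n. Cn a r (lc u (R n) (x # as))"] Cn_nonneg by simp
qed

lemma CnS_tendsto: assumes "\<And>a. 0 < a \<Longrightarrow> a < q \<Longrightarrow> (\<lambda>n. Cn a (q - a) (g n)) \<longlonglongrightarrow> 0" shows "(\<lambda>n. CnS q (g n)) \<longlonglongrightarrow> 0"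
proof -
  have "(\<lambda>n. \<Sum>a\<in>{1..<q}. sqrt (Cn a (q - a) (g n))) \<longlonglongrightarrow> (\<Sum>a\<in>{1..<q}. sqrt 0)"
    using assms by (intro tendsto_sum tendsto_real_sqrt) auto
  then show ?thesis by (simp add: CnS_def)
qed

text \<open>A coefficient of positive order is random and has a Gaussian limit, one of order zero is
  a number. The latter is split off as \<open>top_coeff\<close>, so that \<open>rem\<close> has mean
  zero throughout.\<close>

definition rem :: "(nat \<Rightarrow> nat) \<Rightarrow> (nat \<Rightarrow> nat \<Rightarrow> (real \<times> fvec) list) \<Rightarrow> (nat \<Rightarrow> nat) \<Rightarrow> nat \<Rightarrow> nat \<times> nat list \<Rightarrow> (nat \<Rightarrow> real) \<Rightarrow> real" where
  "rem p F m n a x = (if length (snd a) < p (fst a) then Ik (p (fst a) - length (snd a)) (Rl (F n (fst a)) (m n) (snd a)) x else 0)"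

definition top_coeff :: "(nat \<Rightarrow> nat) \<Rightarrow> (nat \<Rightarrow> nat \<Rightarrow> (real \<times> fvec) list) \<Rightarrow> nat \<Rightarrow> nat \<times> nat list \<Rightarrow> real" where
  "top_coeff p F n a = (if length (snd a) = p (fst a) then S (F n (fst a)) (cJ (snd a)) else 0)"

lemma rem_Lall[simp, intro!]: "rem p F m n a \<in> Lall Gam"
  by (cases "length (snd a) < p (fst a)") (simp_all add: rem_def[abs_def])

lemma rem_measurable[measurable]: "rem p F m n a \<in> borel_measurable Gam" by (rule Lall_measurable) simp

lemma dep_rem: "dep {m n..} (rem p F m n a)"
  using dep_Rl[of "m n" "p (fst a) - length (snd a)" "F n (fst a)" "snd a"] by (simp add: rem_def[abs_def] dep_def)

text \<open>The situation after rotation and extraction. A pair (i, J) stands for component i and a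
  tuple J of coordinates; \<tau> are the limiting influences, \<epsilon> bounds the influences in
  tail directions, and \<sigma>, \<alpha> are the limits of the covariances of the remainders and of
  the top coefficients. The assumption \<open>gauss\<close> is what the fourth moment theorem
  provides for components of order above d.\<close>

locale lim_family =
  fixes p :: "nat \<Rightarrow> nat" and d :: nat and F :: "nat \<Rightarrow> nat \<Rightarrow> (real \<times> fvec) list" and m :: "nat \<Rightarrow> nat"
    and C :: "nat \<Rightarrow> real" and \<tau> :: "nat \<Rightarrow> nat \<Rightarrow> real" and \<epsilon> :: "nat \<Rightarrow> nat \<Rightarrow> real"
    and \<sigma> :: "nat \<times> nat list \<Rightarrow> nat \<times> nat list \<Rightarrow> real" and \<alpha> :: "nat \<times> nat list \<Rightarrow> real"
  assumes d1: "1 \<le> d" and d3: "d \<le> 3" and m: "filterlim m at_top sequentially"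
    and C: "\<And>n i. nn (p i) (F n i) (F n i) \<le> C i"
    and tau0: "\<And>i j. 0 \<le> \<tau> i j" and tau_sum: "\<And>i. summable (\<tau> i)"
    and tau_lim: "\<And>i. (\<lambda>n. \<Sum>j<m n. \<bar>Inf' (p i) (F n i) (ev j) - \<tau> i j\<bar>) \<longlonglongrightarrow> 0"
    and eps: "\<And>i. \<epsilon> i \<longlonglongrightarrow> 0"
    and infl: "\<And>i n h. (\<And>k. k < m n \<Longrightarrow> coord h k = 0) \<Longrightarrow> Inf' (p i) (F n i) h \<le> \<epsilon> i n * inner h h"
    and gauss: "\<And>i a. d < p i \<Longrightarrow> 0 < a \<Longrightarrow> a < p i \<Longrightarrow> (\<lambda>n. Cn a (p i - a) (F n i)) \<longlonglongrightarrow> 0"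
    and cov_lim: "\<And>a b. (\<lambda>n. \<integral>x. rem p F m n a x * rem p F m n b x \<partial>Gam) \<longlonglongrightarrow> \<sigma> a b"
    and top_lim: "\<And>a. (\<lambda>n. top_coeff p F n a) \<longlonglongrightarrow> \<alpha> a"
begin

abbreviation "Z \<equiv> rem p F m"
abbreviation "al \<equiv> top_coeff p F"
abbreviation "q a \<equiv> p (fst a) - length (snd a)"
abbreviation "R n a \<equiv> Rl (F n (fst a)) (m n) (snd a)"

lemma Z_add_al: "length (snd a) \<le> p (fst a) \<Longrightarrow> Ik (q a) (R n a) x = Z n a x + al n a"
  by (auto simp: rem_def top_coeff_def Ik_def S_Rl wk_0)

lemma sigma_0: assumes "q a \<noteq> q b \<or> q a = 0" shows "\<sigma> a b = 0"
proof -
  have "(\<integral>x. Z n a x * Z n b x \<partial>Gam) = 0" for n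
    using assms by (cases "length (snd a) < p (fst a)"; cases "length (snd b) < p (fst b)") (auto simp: rem_def E_Ik_Ik)
  with cov_lim[of a b] show ?thesis by (simp add: LIMSEQ_const_iff)
qed

lemma sigma_sym: "\<sigma> a b = \<sigma> b a"
  using LIMSEQ_unique[OF cov_lim[of a b], of "\<sigma> b a"] cov_lim[of b a] by (simp add: mult.commute)

lemma integral_comb_sq:
  assumes "finite A" and g: "\<And>a. g a \<in> Lall Gam"
  shows "(\<integral>x. (\<Sum>a\<in>A. u a * g a x)\<^sup>2 \<partial>Gam) = (\<Sum>a\<in>A. \<Sum>b\<in>A. u a * u b * (\<integral>x. g a x * g b x \<partial>Gam))"
proof -
  have i: "integrable Gam (\<lambda>x. g a x * g b x)" for a b using g by (intro Lall_integrable Lall_mult) auto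
  have "(\<Sum>a\<in>A. u a * g a x)\<^sup>2 = (\<Sum>a\<in>A. \<Sum>b\<in>A. u a * u b * (g a x * g b x))" for x
    by (simp add: power2_eq_square sum_product algebra_simps)
  then show ?thesis using i by (simp add: Bochner_Integration.integral_sum)
qed

text \<open>Limits of Gram matrices are positive semidefinite, so after encoding the countable index
  set \<open>cholesky\<close> yields vectors with covariance \<sigma>.\<close>

lemma ex_factor: "\<exists>b. \<forall>a a'. inner (b a) (b a') = \<sigma> a a' \<and> supp (b a) \<subseteq> {k. odd k}"
proof -
  define s where "s i j = \<sigma> (from_nat i) (from_nat j)" for i j
  have "npsd s" unfolding npsd_def
  proof (intro conjI allI)
    show "s i j = s j i" for i j by (simp add: s_def sigma_sym)
    fix n :: nat and u :: "nat \<Rightarrow> real"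
    have "(\<lambda>N. \<Sum>i<n. \<Sum>j<n. u i * u j * (\<integral>x. Z N (from_nat i) x * Z N (from_nat j) x \<partial>Gam)) \<longlonglongrightarrow> (\<Sum>i<n. \<Sum>j<n. u i * u j * s i j)"
      unfolding s_def by (intro tendsto_intros cov_lim)
    moreover have "0 \<le> (\<Sum>i<n. \<Sum>j<n. u i * u j * (\<integral>x. Z N (from_nat i) x * Z N (from_nat j) x \<partial>Gam))" for N
      by (subst integral_comb_sq[symmetric]) auto
    ultimately show "0 \<le> (\<Sum>i<n. \<Sum>j<n. u i * u j * s i j)"
      by (intro tendsto_lowerbound[where F=sequentially]) auto
  qed
  then obtain c where c: "\<And>i j n. i \<le> n \<Longrightarrow> (\<Sum>k\<le>n. c i k * c j k) = s i j" using cholesky by blast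
  \<comment> \<open>Only odd coordinates are used; the even ones are reserved for the leading
    coordinates.\<close>
  define b where "b a = (\<Sum>k\<le>to_nat a. c (to_nat a) k *\<^sub>R ev (2 * k + 1))" for a :: "nat \<times> nat list"
  have cb: "coord (b a) (2 * k + 1) = (if k \<le> to_nat a then c (to_nat a) k else 0)" for a k
    by (simp add: b_def if_distrib[of "(*) _"] cong: if_cong)
  have le: "inner (b a) (b a') = \<sigma> a a'" if "to_nat a \<le> to_nat a'" for a a'
  proof -
    have "inner (b a) (b a') = (\<Sum>k\<le>to_nat a. c (to_nat a) k * coord (b a') (2 * k + 1))"
      by (subst (1) b_def) (simp add: inner_sum_left)
    also have "\<dots> = (\<Sum>k\<le>to_nat a. c (to_nat a) k * c (to_nat a') k)"
      unfolding cb using that by (intro sum.cong) auto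
    also have "\<dots> = \<sigma> a a'" by (simp add: c s_def)
    finally show ?thesis .
  qed
  have "inner (b a) (b a') = \<sigma> a a'" for a a'
    using le[of a a'] le[of a' a] sigma_sym[of a a'] by (cases "to_nat a \<le> to_nat a'") (auto simp: inner_commute)
  moreover have "supp (b a) \<subseteq> {k. odd k}" for a
  proof
    fix k assume k: "k \<in> supp (b a)"
    then have "\<exists>j\<le>to_nat a. c (to_nat a) j * coord (ev (2 * j + 1)) k \<noteq> 0" unfolding b_def
      by (simp only: coord_sum coord_simps mem_Collect_eq) (meson atMost_iff sum.neutral)
    then show "k \<in> {k. odd k}" by (auto split: if_splits)
  qed
  ultimately show ?thesis by blast
qed

definition b :: "nat \<times> nat list \<Rightarrow> fvec" where
  "b = (SOME b. \<forall>a a'. inner (b a) (b a') = \<sigma> a a' \<and> supp (b a) \<subseteq> {k. odd k})"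

lemma inner_b: "inner (b a) (b a') = \<sigma> a a'" and supp_b: "supp (b a) \<subseteq> {k. odd k}"
  using someI_ex[OF ex_factor] unfolding b_def by blast+

text \<open>Two sources of smallness: for p i <= d the tail influences, through
  \<open>Cn_Rl_le\<close>; for p i > d the unexpanded component itself, whose contractions only
  shrink under projection to the tail.\<close>

lemma Cn_R:
  assumes J: "length J < p i" and good: "p i \<le> d \<or> J = []" and a: "0 < a" "a < p i - length J"
  shows "(\<lambda>n. Cn a (p i - length J - a) (Rl (F n i) (m n) J)) \<longlonglongrightarrow> 0"
proof (cases "p i \<le> d")
  case True
  define q where "q = p i - length J"
  have q3: "q \<le> 3" using True d3 by (simp add: q_def)
  have b: "Cn (q - 1) 1 (Rl (F n i) (m n) J) \<le> \<bar>\<epsilon> i n\<bar> * \<bar>C i\<bar>" for n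
  proof -
    have "Cn (q - 1) 1 (Rl (F n i) (m n) J) \<le> \<bar>\<epsilon> i n\<bar> * nn (p i) (F n i) (F n i)"
    proof (rule Cn_Rl_le)
      show "length J + Suc (q - 1) = p i" using J by (simp add: q_def)
      show "Inf' (p i) (F n i) h \<le> \<bar>\<epsilon> i n\<bar> * inner h h" if "\<And>k. k < m n \<Longrightarrow> coord h k = 0" for h
        using infl[of n h i, OF that] mult_right_mono[OF abs_ge_self[of "\<epsilon> i n"], of "inner h h"] by auto
    qed simp
    also have "\<dots> \<le> \<bar>\<epsilon> i n\<bar> * \<bar>C i\<bar>" using C[of i n] by (intro mult_left_mono) auto
    finally show ?thesis .
  qed
  have "(\<lambda>n. \<bar>\<epsilon> i n\<bar> * \<bar>C i\<bar>) \<longlonglongrightarrow> \<bar>0\<bar> * \<bar>C i\<bar>" by (intro tendsto_intros eps)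
  then have l: "(\<lambda>n. Cn (q - 1) 1 (Rl (F n i) (m n) J)) \<longlonglongrightarrow> 0"
    using tendsto0I[of "\<lambda>n. \<bar>\<epsilon> i n\<bar> * \<bar>C i\<bar>", OF _ Cn_nonneg b] by simp
  \<comment> \<open>With q <= 3, one side of any proper contraction has exactly one leg, and the two
    possibilities are exchanged by \<open>Cn_sym\<close>.\<close>
  have "a = q - 1 \<and> q - a = 1 \<or> a = 1 \<and> q - a = q - 1" using a q3 unfolding q_def[symmetric] by auto
  then show ?thesis unfolding q_def[symmetric] using l Cn_sym[of "q - 1" 1] by auto
next
  case False
  then have J0: "J = []" using good by simp
  have le: "Cn a (p i - a) (Rl (F n i) (m n) []) \<le> Cn a (p i - a) (F n i)" for n
  proof -
    obtain D where "bl D (F n i)" using bl_ex by blast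
    then show ?thesis
      by (intro Cn_mono[of D "\<lambda>v w. inner (cut {m n..} v) (cut {m n..} w)" _ _ "cut {m n..}"] dom_cut_inner psd_cut) (auto simp: S_Rl)
  qed
  have "(\<lambda>n. Cn a (p i - a) (F n i)) \<longlonglongrightarrow> 0" using gauss[of i a] False a by simp
  then show ?thesis unfolding J0 list.size diff_zero by (rule tendsto0I[OF _ Cn_nonneg le])
qed

text \<open>The remainders with fixed coefficients u. Those of equal order are merged into one list
  per order, the shape that \<open>clt\<close> expects, and the limiting variances add up to the
  quadratic form of \<sigma>.\<close>

lemma inner_clt:
  assumes A: "finite A" and good: "\<And>a. a \<in> A \<Longrightarrow> p (fst a) \<le> d \<or> snd a = []"
  shows "(\<lambda>n. \<integral>y. cos ((\<Sum>a\<in>A. u a * (Z n a y + al n a)) + \<theta>) \<partial>Gam)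
    \<longlonglongrightarrow> exp (- (\<Sum>a\<in>A. \<Sum>b\<in>A. u a * u b * \<sigma> a b) / 2) * cos ((\<Sum>a\<in>A. u a * \<alpha> a) + \<theta>)"
proof -
  obtain as where as: "set as = A" "distinct as" using finite_distinct_list[OF A] by blast
  define Q where "Q = (\<Sum>a\<in>A. p (fst a))"
  have Q: "q a \<le> Q" if "a \<in> A" for a using member_le_sum[of a A "\<lambda>a. p (fst a)"] that A by (simp add: Q_def)
  \<comment> \<open>The coefficients restricted to remainders of order k.\<close>
  define w where "w k a = (if q a = k then u a else 0)" for k a
  define g where "g n k = lc u (R n) (filter (\<lambda>a. q a = k) as)" for n k
  have Sg: "S (g n k) \<phi> = (\<Sum>a\<in>A. w k a * S (R n a) \<phi>)" for n k \<phi>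
  proof -
    have "S (g n k) \<phi> = (\<Sum>a\<leftarrow>as. if q a = k then u a * S (R n a) \<phi> else 0)"
      unfolding g_def S_lc by (rule sum_list_map_filter')
    also have "\<dots> = (\<Sum>a\<in>A. if q a = k then u a * S (R n a) \<phi> else 0)"
      using as by (simp add: sum_list_distinct_conv_sum_set)
    finally show ?thesis by (simp add: w_def if_distrib[of "\<lambda>x. x * _"] cong: if_cong)
  qed
  have Ig: "Ik k (g n k) x = (\<Sum>a\<in>A. w k a * Z n a x)" if "1 \<le> k" for n k x
    unfolding Ik_def[of k "g n k"] Sg using that
    by (intro sum.cong refl) (auto simp: w_def rem_def Ik_def)
  have sumw: "(\<Sum>k\<in>{1..Q}. w k a * t) = u a * t" if "a \<in> A" "q a = 0 \<Longrightarrow> t = 0" for a t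
  proof -
    have "(\<Sum>k\<in>{1..Q}. w k a * t) = (\<Sum>k\<in>{1..Q}. if k = q a then u a * t else 0)" by (rule sum.cong) (auto simp: w_def)
    also have "\<dots> = (if q a \<in> {1..Q} then u a * t else 0)" by (rule sum.delta) simp
    finally show ?thesis using Q[OF that(1)] that(2) by (cases "q a = 0") auto
  qed
  have tot: "(\<Sum>k\<in>{1..Q}. Ik k (g n k) x) = (\<Sum>a\<in>A. u a * Z n a x)" for n x
  proof -
    have "(\<Sum>k\<in>{1..Q}. Ik k (g n k) x) = (\<Sum>k\<in>{1..Q}. \<Sum>a\<in>A. w k a * Z n a x)" by (intro sum.cong refl Ig) simp
    also have "\<dots> = (\<Sum>a\<in>A. \<Sum>k\<in>{1..Q}. w k a * Z n a x)" by (rule sum.swap)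
    also have "\<dots> = (\<Sum>a\<in>A. u a * Z n a x)" by (intro sum.cong refl sumw) (auto simp: rem_def)
    finally show ?thesis .
  qed
  define s where "s k = (\<Sum>a\<in>A. \<Sum>b\<in>A. w k a * w k b * \<sigma> a b)" for k
  have stot: "(\<Sum>k\<in>{1..Q}. s k) = (\<Sum>a\<in>A. \<Sum>b\<in>A. u a * u b * \<sigma> a b)"
  proof -
    \<comment> \<open>Since \<sigma> vanishes between different orders, the restriction on the
      second index can be lifted.\<close>
    have "w k a * w k b * \<sigma> a b = w k a * (u b * \<sigma> a b)" for k a b
      using sigma_0[of a b] by (auto simp: w_def)
    then have "(\<Sum>k\<in>{1..Q}. s k) = (\<Sum>k\<in>{1..Q}. \<Sum>a\<in>A. \<Sum>b\<in>A. w k a * (u b * \<sigma> a b))"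
      unfolding s_def by (intro sum.cong refl) blast
    also have "\<dots> = (\<Sum>a\<in>A. \<Sum>k\<in>{1..Q}. \<Sum>b\<in>A. w k a * (u b * \<sigma> a b))" by (rule sum.swap)
    also have "\<dots> = (\<Sum>a\<in>A. \<Sum>b\<in>A. \<Sum>k\<in>{1..Q}. w k a * (u b * \<sigma> a b))" by (intro sum.cong refl sum.swap)
    also have "\<dots> = (\<Sum>a\<in>A. \<Sum>b\<in>A. u a * (u b * \<sigma> a b))"
      by (intro sum.cong refl sumw) (auto simp: sigma_0)
    finally show ?thesis by (simp add: mult.assoc)
  qed
  have main: "(\<lambda>n. \<integral>x. cos ((\<Sum>k\<in>{1..Q}. Ik k (g n k) x) + \<theta>') \<partial>Gam) \<longlonglongrightarrow> exp (- (\<Sum>k\<in>{1..Q}. s k) / 2) * cos \<theta>'" for \<theta>'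
  proof (rule clt)
    fix k assume k: "1 \<le> k" "k \<le> Q"
    show "(\<lambda>n. CnS k (g n k)) \<longlonglongrightarrow> 0" unfolding g_def
    proof (intro CnS_tendsto Cn_lc_tendsto)
      fix c a assume c: "0 < c" "c < k" and a: "a \<in> set (filter (\<lambda>a. q a = k) as)"
      then have "a \<in> A" "q a = k" "length (snd a) < p (fst a)" using as k by auto
      then show "(\<lambda>n. Cn c (k - c) (R n a)) \<longlonglongrightarrow> 0" using Cn_R[of "snd a" "fst a" c] good[of a] c by auto
    qed
    have "fact k * nn k (g n k) (g n k) = (\<Sum>a\<in>A. \<Sum>b\<in>A. w k a * w k b * (\<integral>x. Z n a x * Z n b x \<partial>Gam))" for n
      using E_Ik_Ik[of k "g n k" k "g n k"] k(1) A
      by (simp add: Ig integral_comb_sq[symmetric] power2_eq_square)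
    then show "(\<lambda>n. fact k * nn k (g n k) (g n k)) \<longlonglongrightarrow> s k"
      unfolding s_def by (simp only:) (intro tendsto_intros cov_lim)
  qed
  define \<theta>' where "\<theta>' = (\<Sum>a\<in>A. u a * \<alpha> a) + \<theta>"
  \<comment> \<open>The top coefficients are deterministic and only move the phase, which
    converges.\<close>
  define tn where "tn n = (\<Sum>a\<in>A. u a * al n a) + \<theta>" for n
  have tn: "tn \<longlonglongrightarrow> \<theta>'" unfolding tn_def \<theta>'_def by (intro tendsto_intros top_lim)
  have bd: "\<bar>(\<integral>y. cos ((\<Sum>a\<in>A. u a * (Z n a y + al n a)) + \<theta>) \<partial>Gam) - (\<integral>x. cos ((\<Sum>k\<in>{1..Q}. Ik k (g n k) x) + \<theta>') \<partial>Gam)\<bar> \<le> \<bar>tn n - \<theta>'\<bar>" for n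
  proof -
    have ci: "integrable Gam (\<lambda>x. cos ((\<Sum>a\<in>A. u a * Z n a x) + t))" for t
      by (rule Gam.integrable_const_bound[of _ 1]) auto
    have e: "(\<Sum>a\<in>A. u a * (Z n a y + al n a)) + \<theta> = (\<Sum>a\<in>A. u a * Z n a y) + tn n" for y
      by (simp add: tn_def distrib_left sum.distrib)
    have "\<bar>(\<integral>y. cos ((\<Sum>a\<in>A. u a * (Z n a y + al n a)) + \<theta>) \<partial>Gam) - (\<integral>x. cos ((\<Sum>k\<in>{1..Q}. Ik k (g n k) x) + \<theta>') \<partial>Gam)\<bar>
      = \<bar>\<integral>y. cos ((\<Sum>a\<in>A. u a * Z n a y) + tn n) - cos ((\<Sum>a\<in>A. u a * Z n a y) + \<theta>') \<partial>Gam\<bar>"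
      unfolding e tot by (simp add: ci)
    also have "\<dots> \<le> (\<integral>y. \<bar>cos ((\<Sum>a\<in>A. u a * Z n a y) + tn n) - cos ((\<Sum>a\<in>A. u a * Z n a y) + \<theta>')\<bar> \<partial>Gam)"
      by (rule integral_abs_bound)
    also have "\<dots> \<le> (\<integral>y. \<bar>tn n - \<theta>'\<bar> \<partial>Gam)"
    proof (rule integral_mono)
      show "integrable Gam (\<lambda>y. \<bar>cos ((\<Sum>a\<in>A. u a * Z n a y) + tn n) - cos ((\<Sum>a\<in>A. u a * Z n a y) + \<theta>')\<bar>)"
        by (intro integrable_abs Bochner_Integration.integrable_diff ci)
      show "\<bar>cos ((\<Sum>a\<in>A. u a * Z n a y) + tn n) - cos ((\<Sum>a\<in>A. u a * Z n a y) + \<theta>')\<bar> \<le> \<bar>tn n - \<theta>'\<bar>" for y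
        using cos_lipschitz[of "(\<Sum>a\<in>A. u a * Z n a y) + tn n" "(\<Sum>a\<in>A. u a * Z n a y) + \<theta>'"] by simp
    qed simp
    finally show ?thesis by (simp add: Gam.prob_space[unfolded space_Gam])
  qed
  have "(\<lambda>n. (\<integral>y. cos ((\<Sum>a\<in>A. u a * (Z n a y + al n a)) + \<theta>) \<partial>Gam) - (\<integral>x. cos ((\<Sum>k\<in>{1..Q}. Ik k (g n k) x) + \<theta>') \<partial>Gam)) \<longlonglongrightarrow> 0"
    by (rule Lim_null_comparison[OF always_eventually tendsto_rabs_zero[OF LIM_zero[OF tn]]]) (use bd in simp)
  from tendsto_add[OF this main[of \<theta>']] show ?thesis
    unfolding stot \<theta>'_def[symmetric] diff_add_cancel add_0_left .
qed

end

section \<open>The limiting vector\<close>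

lemma inner_cut_subset: assumes "A \<subseteq> B" shows "inner (cut B v) (cut A w) = inner (cut A v) (cut A w)"
proof -
  have "cut A (cut B v) = cut A v" using assms by (intro fvec_eqI) (auto simp: coord_cut)
  then show ?thesis using inner_cut[of A w "cut B v"] by (simp add: inner_commute)
qed

text \<open>Leading and tail coordinates are independent, so the second moment is r! (p - r)! times
  the form of (k2^r - k1^r) l^(p-r). Loewner domination replaces this kernel by r (k2 - k1)
  inner^(p-1), and k2 - k1 splits into the coordinates between M and M'.\<close>

lemma cut_increment_bound:
  assumes "M \<le> M'" "M' \<le> m" "r \<le> p"
  shows "(\<integral>x. (S f (\<lambda>v. (wk r (cut {..<M'} v) x - wk r (cut {..<M} v) x) * wk (p - r) (cut {m..} v) x))\<^sup>2 \<partial>Gam)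
    \<le> fact r * fact (p - r) * real r * (\<Sum>j\<in>{M..<M'}. Inf' p f (ev j))"
proof -
  define k1 where "k1 v w = inner (cut {..<M} v) (cut {..<M} w)" for v w
  define k2 where "k2 v w = inner (cut {..<M'} v) (cut {..<M'} w)" for v w
  define l where "l v w = inner (cut {m..} v) (cut {m..} w)" for v w
  define g where "g v x = wk r (cut {..<M'} v) x - wk r (cut {..<M} v) x" for v x
  define h where "h v x = wk (p - r) (cut {m..} v) x" for v x
  have sub: "{..<M} \<subseteq> {..<M'}" using assms by auto
  obtain D where D: "bl D f" using bl_ex by blast
  have gL: "g v \<in> Lall Gam" for v unfolding g_def by (intro Lall_diff wk_Lall)
  have hL: "h v \<in> Lall Gam" for v unfolding h_def by simp
  have iw: "integrable Gam (\<lambda>x. wk r v x * wk r w x)" for v w by (intro Lall_integrable Lall_mult wk_Lall)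
  have Eg: "(\<integral>x. g v x * g w x \<partial>Gam) = fact r * (k2 v w ^ r - k1 v w ^ r)" for v w
  proof -
    have "(\<integral>x. g v x * g w x \<partial>Gam) = (\<integral>x. wk r (cut {..<M'} v) x * wk r (cut {..<M'} w) x \<partial>Gam) - (\<integral>x. wk r (cut {..<M'} v) x * wk r (cut {..<M} w) x \<partial>Gam)
       - (\<integral>x. wk r (cut {..<M} v) x * wk r (cut {..<M'} w) x \<partial>Gam) + (\<integral>x. wk r (cut {..<M} v) x * wk r (cut {..<M} w) x \<partial>Gam)"
      unfolding g_def using iw by (simp add: algebra_simps)
    also have "inner (cut {..<M} v) (cut {..<M'} w) = k1 v w" using inner_cut_subset[OF sub, of w v] by (simp add: k1_def inner_commute)
    ultimately show ?thesis unfolding E2 by (simp add: inner_cut_subset[OF sub] k1_def[symmetric] k2_def[symmetric] algebra_simps)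
  qed
  have sup: "supp (cut A v) \<subseteq> A" for A v by (auto simp: coord_cut)
  have dw: "dep A (wk n (cut B v))" if "B \<subseteq> A" for A B n v using dep_wk[of "cut B v" A n] sup[of B v] that by blast
  have dg: "dep {..<M'} (\<lambda>x. g v x * g w x)" for v w
    unfolding dep_def
  proof (intro allI impI)
    fix x y :: "nat \<Rightarrow> real" assume xy: "\<forall>k\<in>{..<M'}. x k = y k"
    have e: "wk r (cut B v) x = wk r (cut B v) y" if "B \<subseteq> {..<M'}" for B v
      by (rule depD[OF dw[OF that]]) (use xy in blast)
    show "g v x * g w x = g v y * g w y" unfolding g_def using e[OF sub] e[OF order_refl] by simp
  qed
  have dh: "dep {m..} (\<lambda>x. h v x * h w x)" for v w
    unfolding dep_def
  proof (intro allI impI)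
    fix x y :: "nat \<Rightarrow> real" assume xy: "\<forall>k\<in>{m..}. x k = y k"
    have e: "wk n (cut {m..} v) x = wk n (cut {m..} v) y" for v n
      by (rule depD[OF dw[OF order_refl]]) (use xy in blast)
    show "h v x * h w x = h v y * h w y" unfolding h_def using e by simp
  qed
  have E: "(\<integral>x. g v x * h v x * (g w x * h w x) \<partial>Gam) = fact r * fact (p - r) * ((k2 v w ^ r - k1 v w ^ r) * l v w ^ (p - r))" for v w
  proof -
    have "(\<integral>x. g v x * h v x * (g w x * h w x) \<partial>Gam) = (\<integral>x. (g v x * g w x) * (h v x * h w x) \<partial>Gam)" by (simp add: ac_simps)
    also have "\<dots> = (\<integral>x. g v x * g w x \<partial>Gam) * (\<integral>x. h v x * h w x \<partial>Gam)"
      using assms by (intro indep_integral[OF dg dh]) (auto intro!: gL hL Lall_mult)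
    finally show ?thesis unfolding Eg h_def E2 by (simp add: l_def)
  qed
  have "(\<integral>x. (S f (\<lambda>v. g v x * h v x))\<^sup>2 \<partial>Gam) = (\<integral>x. S f (\<lambda>v. S f (\<lambda>w. g v x * h v x * (g w x * h w x))) \<partial>Gam)"
    by (simp add: power2_eq_square S_mult_S)
  also have "\<dots> = S f (\<lambda>v. S f (\<lambda>w. \<integral>x. g v x * h v x * (g w x * h w x) \<partial>Gam))"
  proof -
    have i: "integrable Gam (\<lambda>x. g v x * h v x * (g w x * h w x))" for v w by (intro Lall_integrable Lall_mult gL hL)
    show ?thesis by (subst S_integral(1)) (simp_all add: S_integral i)
  qed
  also have "\<dots> = fact r * fact (p - r) * S f (\<lambda>v. S f (\<lambda>w. (k2 v w ^ r - k1 v w ^ r) * l v w ^ (p - r)))"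
    unfolding E by (simp only: S_mult_left)
  also have "\<dots> \<le> fact r * fact (p - r) * (real r * (\<Sum>j\<in>{M..<M'}. Inf' p f (ev j)))"
  proof (rule mult_left_mono)
    have p1: "psd D k1" and p2: "psd D k2" and pl: "psd D l" unfolding k1_def k2_def l_def by (rule psd_cut)+
    have d12: "dom D k1 k2" unfolding k1_def k2_def by (rule dom_cut[OF sub])
    have d2: "dom D k2 inner" and dl: "dom D l inner" unfolding k2_def l_def by (rule dom_cut_inner)+
    have pd: "psd D (\<lambda>v w. k2 v w - k1 v w)" using d12 by (simp add: dom_def)
    have pdr: "psd D (\<lambda>v w. k2 v w ^ r - k1 v w ^ r)" using dom_power[OF p1 d12, of r] by (simp add: dom_def)
    have "S f (\<lambda>v. S f (\<lambda>w. (k2 v w ^ r - k1 v w ^ r) * l v w ^ (p - r)))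
      \<le> S f (\<lambda>v. S f (\<lambda>w. (real r * ((k2 v w - k1 v w) * k2 v w ^ (r - 1))) * inner v w ^ (p - r)))"
      by (rule dom_S[OF dom_mult[OF pdr dom_power_diff[OF p1 d12] psd_power[OF pl] dom_power[OF pl dl]] D])
    also have "\<dots> = real r * S f (\<lambda>v. S f (\<lambda>w. (k2 v w - k1 v w) * (k2 v w ^ (r - 1) * inner v w ^ (p - r))))"
      by (simp only: mult.assoc S_mult_left)
    also have "\<dots> \<le> real r * S f (\<lambda>v. S f (\<lambda>w. (k2 v w - k1 v w) * (inner v w ^ (r - 1) * inner v w ^ (p - r))))"
      by (rule mult_left_mono[OF dom_S[OF dom_mult[OF pd dom_refl psd_mult[OF psd_power[OF p2] psd_power[OF psd_inner]]
          dom_mult[OF psd_power[OF p2] dom_power[OF p2 d2] psd_power[OF psd_inner] dom_refl]] D]]) simp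
    also have "\<dots> \<le> real r * (\<Sum>j\<in>{M..<M'}. Inf' p f (ev j))"
    proof (cases "r = 0")
      case False
      have kd: "k2 v w - k1 v w = (\<Sum>j\<in>{M..<M'}. coord v j * coord w j)" for v w
      proof -
        have U: "{..<M} \<union> {M..<M'} = {..<M'}" "{..<M} \<inter> {M..<M'} = {}" using assms by auto
        show ?thesis using inner_cut_Un[OF U(2), of v w] unfolding U(1) k1_def k2_def by (simp add: inner_cut_finite)
      qed
      have pw: "inner v w ^ (r - 1) * inner v w ^ (p - r) = inner v w ^ (p - 1)" for v w :: fvec
        using False assms by (simp add: power_add[symmetric])
      have "S f (\<lambda>v. S f (\<lambda>w. (k2 v w - k1 v w) * (inner v w ^ (r - 1) * inner v w ^ (p - r))))
        = (\<Sum>j\<in>{M..<M'}. S f (\<lambda>v. S f (\<lambda>w. coord v j * coord w j * inner v w ^ (p - 1))))"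
        unfolding kd pw by (simp only: sum_distrib_right S_sum)
      also have "\<dots> \<le> (\<Sum>j\<in>{M..<M'}. Inf' p f (ev j))"
      proof (rule sum_mono)
        fix j
        define s where "s = S f (\<lambda>v. S f (\<lambda>w. coord v j * coord w j * inner v w ^ (p - 1)))"
        have e: "Inf' p f (ev j) = real p * s" by (simp add: Inf'_def s_def)
        have "1 \<le> real p" using False assms by simp
        moreover have "0 \<le> s" using Inf_nonneg[of p f "ev j"] \<open>1 \<le> real p\<close> unfolding e by (simp add: zero_le_mult_iff)
        ultimately have "1 * s \<le> real p * s" by (intro mult_right_mono)
        then show "s \<le> Inf' p f (ev j)" unfolding e by simp
      qed
      finally show ?thesis by (intro mult_left_mono) auto
    qed simp
    finally show "S f (\<lambda>v. S f (\<lambda>w. (k2 v w ^ r - k1 v w ^ r) * l v w ^ (p - r))) \<le> real r * (\<Sum>j\<in>{M..<M'}. Inf' p f (ev j))" .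
  qed simp
  finally show ?thesis by (simp add: g_def h_def mult.assoc)
qed

lemma tail_tendsto: assumes "summable (f :: nat \<Rightarrow> real)" shows "(\<lambda>k. \<Sum>j. f (j + k)) \<longlonglongrightarrow> 0"
  using LIM_zero[OF summable_LIMSEQ[OF assms]] tendsto_minus[of "\<lambda>n. sum f {..<n} - suminf f" 0 sequentially]
  by (simp add: suminf_minus_initial_segment[OF assms])

section \<open>Cutoff expansions and the limits in n and M\<close>

context lim_family
begin

text \<open>Cutoff 0 admits only the empty tuple, so a component of order above d enters as a single
  remainder.\<close>

definition Mi :: "nat \<Rightarrow> nat \<Rightarrow> nat" where "Mi i M = (if p i \<le> d then M else 0)"
text \<open>The limit of remainder plus top coefficient; at most one of the two summands is
  nonzero.\<close>

definition N :: "nat \<times> nat list \<Rightarrow> (nat \<Rightarrow> real) \<Rightarrow> real" where "N a z = X (b a) z + \<alpha> a"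
definition Yr :: "nat \<Rightarrow> nat \<Rightarrow> nat \<Rightarrow> (nat \<Rightarrow> real) \<Rightarrow> real" where
  "Yr i r M z = real (p i choose r) * (\<Sum>J\<in>LJ (Mi i M) r. hJ (map ((*) 2) J) z * N (i, J) z)"
definition FM :: "nat \<Rightarrow> nat \<Rightarrow> nat \<Rightarrow> (nat \<Rightarrow> real) \<Rightarrow> real" where
  "FM n i M = Ik (p i) (cutl ({..<Mi i M} \<union> {m n..}) (F n i))"
definition IX :: "fvec \<Rightarrow> nat \<Rightarrow> (nat \<times> nat list) set" where
  "IX v M = Sigma (supp v) (\<lambda>i. \<Union>r\<le>p i. LJ (Mi i M) r)"
text \<open>The coefficient of the remainder a, which becomes a constant once the leading
  coordinates are frozen.\<close>

definition u :: "fvec \<Rightarrow> (nat \<Rightarrow> real) \<Rightarrow> nat \<times> nat list \<Rightarrow> real" where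
  "u v x a = coord v (fst a) * (real (p (fst a) choose length (snd a)) * hJ (snd a) x)"

lemma Mi_le: "Mi i M \<le> M" by (simp add: Mi_def)

lemma finite_IX[simp]: "finite (IX v M)" unfolding IX_def by (intro finite_SigmaI) auto

lemma sum_IX: "(\<Sum>a\<in>IX v M. g a) = (\<Sum>i\<in>supp v. \<Sum>r\<le>p i. \<Sum>J\<in>LJ (Mi i M) r. (g (i, J) :: real))"
proof -
  have "(\<Sum>a\<in>IX v M. g a) = (\<Sum>i\<in>supp v. \<Sum>J\<in>(\<Union>r\<le>p i. LJ (Mi i M) r). g (i, J))"
    unfolding IX_def by (subst sum.Sigma) auto
  also have "\<dots> = (\<Sum>i\<in>supp v. \<Sum>r\<le>p i. \<Sum>J\<in>LJ (Mi i M) r. g (i, J))"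
  proof (intro sum.cong refl sum.UNION_disjoint ballI impI)
    show "LJ (Mi i M) r \<inter> LJ (Mi i M) r' = {}" if "r \<noteq> r'" for i r r' using that by (auto simp: LJ_def)
  qed auto
  finally show ?thesis .
qed

lemma IX_D: assumes "a \<in> IX v M"
  shows "set (snd a) \<subseteq> {..<M}" "length (snd a) \<le> p (fst a)" "p (fst a) \<le> d \<or> snd a = []"
proof -
  obtain i J r where a: "a = (i, J)" "r \<le> p i" "J \<in> LJ (Mi i M) r" using assms by (cases a) (auto simp: IX_def)
  show "set (snd a) \<subseteq> {..<M}" "length (snd a) \<le> p (fst a)" "p (fst a) \<le> d \<or> snd a = []"
    using a Mi_le[of i M] by (auto simp: LJ_def Mi_def split: if_splits)
qed

lemma FM_sum: assumes "M \<le> m n" shows "X v (\<lambda>i. FM n i M x) = (\<Sum>a\<in>IX v M. u v x a * (Z n a x + al n a))"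
proof -
  have Mm: "Mi i M \<le> m n" for i using Mi_le[of i M] assms by simp
  have h: "u v x (i, J) * (Z n (i, J) x + al n (i, J)) = coord v i * (real (p i choose r) * (hJ J x * Ik (p i - r) (Rl (F n i) (m n) J) x))"
    if "r \<le> p i" "J \<in> LJ (Mi i M) r" for i r J
    using Z_add_al[of "(i, J)" n x] that by (simp add: u_def LJ_def)
  show ?thesis unfolding sum_IX X_def FM_def Ik_cutl_expand[OF Mm] sum_distrib_left by (intro sum.cong refl h[symmetric]) auto
qed

lemma Y_sum: "X v (\<lambda>i. \<Sum>r\<le>p i. Yr i r M z) = (\<Sum>a\<in>IX v M. u v (\<lambda>k. z (2 * k)) a * N a z)"
proof -
  have h: "u v (\<lambda>k. z (2 * k)) (i, J) * N (i, J) z = coord v i * (real (p i choose r) * (hJ (map ((*) 2) J) z * N (i, J) z))"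
    if "r \<le> p i" "J \<in> LJ (Mi i M) r" for i r J
    using that by (simp add: u_def LJ_def hJ_even)
  show ?thesis unfolding sum_IX X_def Yr_def sum_distrib_left by (intro sum.cong refl h[symmetric]) auto
qed

lemma u_measurable[measurable]: "(\<lambda>x. u v x a) \<in> borel_measurable Gam" unfolding u_def by measurable

lemma N_measurable[measurable]: "N a \<in> borel_measurable Gam" unfolding N_def[abs_def] by measurable

lemma Yr_measurable[measurable]: "Yr i r M \<in> borel_measurable Gam" unfolding Yr_def[abs_def] by measurable

lemma dep_N: "dep {k. odd k} (N a)"
  using dep_X[OF supp_b[of a]] by (simp add: dep_def N_def)

text \<open>At fixed leading coordinates \<open>inner_clt\<close> applies with the coefficients u,
  and dominated convergence integrates the result. The limit \<Phi> is the conditional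
  characteristic function belonging to the Gaussian variables N.\<close>

lemma cutoff_limit:
  "(\<lambda>n. \<integral>x. cos (X v (\<lambda>i. FM n i M x) + \<theta>) \<partial>Gam) \<longlonglongrightarrow> (\<integral>z. cos (X v (\<lambda>i. \<Sum>r\<le>p i. Yr i r M z) + \<theta>) \<partial>Gam)"
proof -
  let ?A = "IX v M"
  define \<Phi> where "\<Phi> x = exp (- (\<Sum>a\<in>?A. \<Sum>b\<in>?A. u v x a * u v x b * \<sigma> a b) / 2) * cos ((\<Sum>a\<in>?A. u v x a * \<alpha> a) + \<theta>)" for x
  define \<Psi> where "\<Psi> n x = (\<integral>y. cos ((\<Sum>a\<in>?A. u v x a * (Z n a y + al n a)) + \<theta>) \<partial>Gam)" for n x
  have uL: "(\<lambda>x. u v x a) \<in> borel_measurable Gam" for a by measurable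
  have ci: "integrable Gam (\<lambda>x. cos (g x :: real))" if [measurable]: "g \<in> borel_measurable Gam" for g
    by (rule Gam.integrable_const_bound[of _ 1]) auto
  have [measurable]: "\<Phi> \<in> borel_measurable Gam" unfolding \<Phi>_def by measurable
  have [measurable]: "\<Psi> n \<in> borel_measurable Gam" for n unfolding \<Psi>_def[abs_def]
  proof (rule Gam.borel_measurable_lebesgue_integral)
    have [measurable]: "(\<lambda>z. u v (fst z) a) \<in> borel_measurable (Gam \<Otimes>\<^sub>M Gam)" for a
      by (rule measurable_compose[OF measurable_fst uL])
    have [measurable]: "(\<lambda>z. Z n a (snd z)) \<in> borel_measurable (Gam \<Otimes>\<^sub>M Gam)" for a
      by (rule measurable_compose[OF measurable_snd rem_measurable])
    show "(\<lambda>(x, y). cos ((\<Sum>a\<in>?A. u v x a * (Z n a y + al n a)) + \<theta>)) \<in> borel_measurable (Gam \<Otimes>\<^sub>M Gam)"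
      unfolding split_beta by measurable
  qed
  have lim: "(\<lambda>n. \<integral>x. \<Psi> n x \<partial>Gam) \<longlonglongrightarrow> (\<integral>x. \<Phi> x \<partial>Gam)"
  proof (rule integral_dominated_convergence[where w="\<lambda>_. 1"])
    show "AE x in Gam. (\<lambda>n. \<Psi> n x) \<longlonglongrightarrow> \<Phi> x"
      unfolding \<Psi>_def \<Phi>_def by (rule AE_I2) (rule inner_clt[OF finite_IX IX_D(3)])
    show "AE x in Gam. norm (\<Psi> n x) \<le> 1" for n
    proof (rule AE_I2)
      fix x
      have "norm (\<Psi> n x) \<le> (\<integral>y. norm (cos ((\<Sum>a\<in>?A. u v x a * (Z n a y + al n a)) + \<theta>)) \<partial>Gam)"
        unfolding \<Psi>_def by (rule integral_norm_bound)
      also have "\<dots> \<le> (\<integral>y. 1 \<partial>Gam)" by (rule integral_mono) (auto intro!: ci)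
      finally show "norm (\<Psi> n x) \<le> 1" by (simp add: Gam.prob_space[unfolded space_Gam])
    qed
  qed auto
  have um: "u v (mix {..<M} x y) a = u v x a" if "a \<in> ?A" for a x y
  proof -
    have "hJ (snd a) (mix {..<M} x y) = hJ (snd a) x"
      by (rule dep_mix1[OF dep_mono[OF dep_hJ IX_D(1)[OF that]]])
    then show ?thesis by (simp add: u_def)
  qed
  \<comment> \<open>Coefficients use coordinates below M and remainders those from
    \<open>m n\<close> on, so for M <= m n they can be fed with independent copies.\<close>
  have pre: "(\<integral>x. cos (X v (\<lambda>i. FM n i M x) + \<theta>) \<partial>Gam) = (\<integral>x. \<Psi> n x \<partial>Gam)" if Mm: "M \<le> m n" for n
  proof -
    have Zm: "Z n a (mix {..<M} x y) = Z n a y" for a x y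
      using Mm by (intro dep_mix2[OF dep_rem]) auto
    show ?thesis unfolding FM_sum[OF Mm] \<Psi>_def
      by (subst integral_mix[of _ "{..<M}"]) (auto intro!: ci simp: um Zm cong: sum.cong)
  qed
  have "\<forall>\<^sub>F n in sequentially. M \<le> m n" using m by (simp add: filterlim_at_top)
  then have "\<forall>\<^sub>F n in sequentially. (\<integral>x. \<Psi> n x \<partial>Gam) = (\<integral>x. cos (X v (\<lambda>i. FM n i M x) + \<theta>) \<partial>Gam)"
    by eventually_elim (simp add: pre)
  from Lim_transform_eventually[OF lim this]
  have "(\<lambda>n. \<integral>x. cos (X v (\<lambda>i. FM n i M x) + \<theta>) \<partial>Gam) \<longlonglongrightarrow> (\<integral>x. \<Phi> x \<partial>Gam)" .
  moreover have "(\<integral>z. cos (X v (\<lambda>i. \<Sum>r\<le>p i. Yr i r M z) + \<theta>) \<partial>Gam) = (\<integral>x. \<Phi> x \<partial>Gam)"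
  proof -
    \<comment> \<open>In the limit the same separation runs between even coordinates, which feed the
      coefficients, and odd ones, which feed N.\<close>
    let ?e = "{k::nat. even k}"
    have ue: "u v (\<lambda>k. mix ?e x y (2 * k)) a = u v (\<lambda>k. x (2 * k)) a" for a x y by (simp add: mix_def)
    have Ne: "N a (mix ?e x y) = N a y" for a x y by (intro dep_mix2[OF dep_N]) auto
    have [measurable]: "(\<lambda>x. u v (\<lambda>k. x (2 * k)) a) \<in> borel_measurable Gam" for a
      unfolding u_def hJ_even by measurable
    have "(\<integral>z. cos (X v (\<lambda>i. \<Sum>r\<le>p i. Yr i r M z) + \<theta>) \<partial>Gam)
      = (\<integral>x. (\<integral>y. cos ((\<Sum>a\<in>?A. u v (\<lambda>k. x (2 * k)) a * N a y) + \<theta>) \<partial>Gam) \<partial>Gam)"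
      unfolding Y_sum by (subst integral_mix[of _ ?e]) (auto intro!: ci simp: ue Ne)
    also have "\<dots> = (\<integral>x. \<Phi> (\<lambda>k. x (2 * k)) \<partial>Gam)"
    proof (intro Bochner_Integration.integral_cong refl)
      fix x
      let ?u = "u v (\<lambda>k. x (2 * k))"
      define V where "V = (\<Sum>a\<in>?A. ?u a *\<^sub>R b a)"
      have "(\<Sum>a\<in>?A. ?u a * N a y) + \<theta> = X V y + ((\<Sum>a\<in>?A. ?u a * \<alpha> a) + \<theta>)" for y
        by (simp add: N_def V_def X_sum X_scale distrib_left sum.distrib)
      moreover have "inner V V = (\<Sum>a\<in>?A. \<Sum>b\<in>?A. ?u a * ?u b * \<sigma> a b)"
      proof -
        have "inner V V = (\<Sum>a\<in>?A. inner (?u a *\<^sub>R b a) V)" by (subst V_def) (simp only: inner_sum_left)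
        also have "\<dots> = (\<Sum>a\<in>?A. \<Sum>b\<in>?A. ?u a * ?u b * \<sigma> a b)"
          by (simp only: V_def inner_sum_right inner_scaleR_left inner_scaleR_right inner_b mult.assoc sum_distrib_left mult.left_commute)
        finally show ?thesis .
      qed
      ultimately show "(\<integral>y. cos ((\<Sum>a\<in>?A. ?u a * N a y) + \<theta>) \<partial>Gam) = \<Phi> (\<lambda>k. x (2 * k))"
        by (simp only: E_cos_X \<Phi>_def)
    qed
    also have "\<dots> = (\<integral>x. \<Phi> x \<partial>Gam)" by (rule integral_even) measurable
    finally show ?thesis .
  qed
  ultimately show ?thesis by simp
qed

text \<open>The number of summands grows with n; \<open>tau_lim\<close> controls all their errors at
  once, and the summability of \<tau> handles the rest.\<close>

lemma influence_tail: "(\<lambda>n. \<Sum>j\<in>{k..<m n}. Inf' (p i) (F n i) (ev j)) \<longlonglongrightarrow> (\<Sum>j. \<tau> i (j + k))"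
proof -
  have m': "filterlim (\<lambda>n. m n - k) at_top sequentially"
    unfolding filterlim_at_top
  proof
    fix Z
    have "\<forall>\<^sub>F n in sequentially. Z + k \<le> m n" using m by (simp add: filterlim_at_top)
    then show "\<forall>\<^sub>F n in sequentially. Z \<le> m n - k" by eventually_elim simp
  qed
  have "(\<lambda>n. \<Sum>j<n. \<tau> i (j + k)) \<longlonglongrightarrow> (\<Sum>j. \<tau> i (j + k))"
    using tau_sum[of i] by (intro summable_LIMSEQ) (simp add: summable_iff_shift)
  from filterlim_compose[OF this m'] have t: "(\<lambda>n. \<Sum>j\<in>{k..<m n}. \<tau> i j) \<longlonglongrightarrow> (\<Sum>j. \<tau> i (j + k))"
    by (simp add: sum.atLeastLessThan_shift_0[of _ k] atLeast0LessThan add.commute)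
  have "(\<lambda>n. (\<Sum>j\<in>{k..<m n}. Inf' (p i) (F n i) (ev j)) - (\<Sum>j\<in>{k..<m n}. \<tau> i j)) \<longlonglongrightarrow> 0"
  proof (rule Lim_null_comparison[OF always_eventually tau_lim[of i]], rule allI)
    fix n
    have "norm ((\<Sum>j\<in>{k..<m n}. Inf' (p i) (F n i) (ev j)) - (\<Sum>j\<in>{k..<m n}. \<tau> i j)) \<le> (\<Sum>j\<in>{k..<m n}. \<bar>Inf' (p i) (F n i) (ev j) - \<tau> i j\<bar>)"
      unfolding sum_subtractf[symmetric] real_norm_def by (rule sum_abs)
    also have "\<dots> \<le> (\<Sum>j<m n. \<bar>Inf' (p i) (F n i) (ev j) - \<tau> i j\<bar>)" by (intro sum_mono2) auto
    finally show "norm ((\<Sum>j\<in>{k..<m n}. Inf' (p i) (F n i) (ev j)) - (\<Sum>j\<in>{k..<m n}. \<tau> i j)) \<le> (\<Sum>j<m n. \<bar>Inf' (p i) (F n i) (ev j) - \<tau> i j\<bar>)" .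
  qed
  from tendsto_add[OF this t] show ?thesis by simp
qed

lemma influence_lim: "(\<lambda>n. Inf' (p i) (F n i) (ev j)) \<longlonglongrightarrow> \<tau> i j"
proof -
  have "\<forall>\<^sub>F n in sequentially. norm (Inf' (p i) (F n i) (ev j) - \<tau> i j) \<le> (\<Sum>j<m n. \<bar>Inf' (p i) (F n i) (ev j) - \<tau> i j\<bar>)"
  proof -
    have "\<forall>\<^sub>F n in sequentially. Suc j \<le> m n" using m by (simp add: filterlim_at_top)
    then show ?thesis
    proof eventually_elim
      case (elim n)
      then show ?case using member_le_sum[of j "{..<m n}" "\<lambda>j. \<bar>Inf' (p i) (F n i) (ev j) - \<tau> i j\<bar>"] by simp
    qed
  qed
  then have "(\<lambda>n. Inf' (p i) (F n i) (ev j) - \<tau> i j) \<longlonglongrightarrow> 0" using tau_lim[of i] by (rule Lim_null_comparison)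
  then show ?thesis by (rule LIM_zero_cancel)
qed

lemma tau_gauss: assumes "d < p i" shows "\<tau> i j = 0"
proof -
  have g: "(\<lambda>n. Cn (p i - 1) 1 (F n i)) \<longlonglongrightarrow> 0" using gauss[OF assms, of "p i - 1"] assms d1 by simp
  have "(\<lambda>n. (real (p i))\<^sup>2 * Cn (p i - 1) 1 (F n i)) \<longlonglongrightarrow> (real (p i))\<^sup>2 * 0" by (intro tendsto_intros g)
  then have "(\<lambda>n. (Inf' (p i) (F n i) (ev j))\<^sup>2) \<longlonglongrightarrow> 0"
    by (intro tendsto0I[OF _ zero_le_power2 Inf_ev_le_Cn]) simp
  from LIMSEQ_unique[OF this tendsto_power[OF influence_lim]] show ?thesis by simp
qed

text \<open>For p i <= d this is the tail of a convergent series; for p i > d the cutoff stays at 0,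
  but there all limiting influences are zero.\<close>

lemma FM_error_tendsto:
  "(\<lambda>M. \<Sum>i\<in>supp v. \<bar>coord v i\<bar> * sqrt (fact (p i) * (\<Sum>j. \<tau> i (j + Mi i M)))) \<longlonglongrightarrow> 0"
proof -
  have "(\<lambda>M. \<Sum>j. \<tau> i (j + Mi i M)) \<longlonglongrightarrow> 0" for i
    using tail_tendsto[OF tau_sum[of i]] tau_gauss[of i] by (cases "p i \<le> d") (auto simp: Mi_def)
  then have "(\<lambda>M. \<Sum>i\<in>supp v. \<bar>coord v i\<bar> * sqrt (fact (p i) * (\<Sum>j. \<tau> i (j + Mi i M)))) \<longlonglongrightarrow> (\<Sum>i\<in>supp v. \<bar>coord v i\<bar> * sqrt (fact (p i) * 0))"
    by (intro tendsto_intros)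
  then show ?thesis by simp
qed

lemma FM_approx:
  assumes "M \<le> m n"
  shows "\<bar>(\<integral>x. cos (X v (\<lambda>i. Ik (p i) (F n i) x) + \<theta>) \<partial>Gam) - (\<integral>x. cos (X v (\<lambda>i. FM n i M x) + \<theta>) \<partial>Gam)\<bar>
    \<le> (\<Sum>i\<in>supp v. \<bar>coord v i\<bar> * sqrt (fact (p i) * (\<Sum>j\<in>{Mi i M..<m n}. Inf' (p i) (F n i) (ev j))))"
proof -
  have Mm: "Mi i M \<le> m n" for i using Mi_le[of i M] assms by simp
  have "\<bar>(\<integral>x. cos (X v (\<lambda>i. Ik (p i) (F n i) x) + \<theta>) \<partial>Gam) - (\<integral>x. cos (X v (\<lambda>i. FM n i M x) + \<theta>) \<partial>Gam)\<bar>
    \<le> (\<Sum>i\<in>supp v. \<bar>coord v i\<bar> * sqrt (\<integral>x. (Ik (p i) (F n i) x - FM n i M x)\<^sup>2 \<partial>Gam))"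
    unfolding FM_def
    by (rule cos_L2_le[OF Gam.prob_space_axioms Ik_measurable Ik_measurable])
      (intro Lall_integrable Lall_power Lall_diff Ik_Lall Gam_finite)
  also have "\<dots> \<le> (\<Sum>i\<in>supp v. \<bar>coord v i\<bar> * sqrt (fact (p i) * (\<Sum>j\<in>{Mi i M..<m n}. Inf' (p i) (F n i) (ev j))))"
    unfolding FM_def by (intro sum_mono mult_left_mono real_sqrt_le_mono Ik_cutl_error Mm abs_ge_zero)
  finally show ?thesis .
qed

lemma N_Lall[simp, intro!]: "N a \<in> Lall Gam" unfolding N_def[abs_def] by (intro Lall_add X_Lall Lall_const Gam_finite)

lemma Yr_Lall[simp, intro!]: "Yr i r M \<in> Lall Gam"
  unfolding Yr_def[abs_def] by (intro Lall_cmult Lall_sum Lall_mult hJ_Lall N_Lall Gam_finite)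

lemma E_N: "(\<integral>z. N a z * N a' z \<partial>Gam) = \<sigma> a a' + \<alpha> a * \<alpha> a'"
proof -
  have X0: "(\<integral>z. X v z \<partial>Gam) = 0" for v using E_wk[of "Suc 0" v] by simp
  have XX: "(\<integral>z. X v z * X w z \<partial>Gam) = inner v w" for v w using E2[of "Suc 0" v "Suc 0" w] by simp
  have i: "integrable Gam (X v)" "integrable Gam (\<lambda>z. X v z * X w z)" for v w by (intro Lall_integrable Lall_mult X_Lall)+
  show ?thesis using i by (simp add: N_def distrib_left distrib_right X0 XX inner_b Gam.prob_space[unfolded space_Gam])
qed

text \<open>Below the top order only the covariance contributes, at the top order only the product
  of the coefficients.\<close>

lemma T_lim:
  assumes "length J = r" "length J' = r" "r \<le> p i"
  shows "(\<lambda>n. \<integral>x. (Z n (i, J) x + al n (i, J)) * (Z n (i, J') x + al n (i, J')) \<partial>Gam) \<longlonglongrightarrow> \<sigma> (i, J) (i, J') + \<alpha> (i, J) * \<alpha> (i, J')"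
proof (cases "r < p i")
  case True
  then have a0: "al n (i, J) = 0" "al n (i, J') = 0" for n using assms by (auto simp: top_coeff_def)
  have "\<alpha> (i, J) = 0" using top_lim[of "(i, J)"] a0 by (simp add: LIMSEQ_const_iff)
  then show ?thesis using cov_lim[of "(i, J)" "(i, J')"] by (simp add: a0)
next
  case False
  then have "Z n (i, J) x = 0" "Z n (i, J') x = 0" for n x using assms by (auto simp: rem_def)
  moreover have "\<sigma> (i, J) (i, J') = 0" using False assms by (intro sigma_0) auto
  ultimately show ?thesis using tendsto_mult[OF top_lim top_lim, of "(i, J)" "(i, J')"]
    by (simp add: Gam.prob_space[unfolded space_Gam])
qed

lemma indep_comb_sq:
  assumes "finite D" and h: "\<And>J. J \<in> D \<Longrightarrow> dep A (h J)" "\<And>J. h J \<in> Lall Gam" and t: "\<And>J. dep B (t J)" "\<And>J. t J \<in> Lall Gam" and AB: "A \<inter> B = {}"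
  shows "(\<integral>x. (\<Sum>J\<in>D. h J x * t J x)\<^sup>2 \<partial>Gam) = (\<Sum>J\<in>D. \<Sum>J'\<in>D. (\<integral>x. h J x * h J' x \<partial>Gam) * (\<integral>x. t J x * t J' x \<partial>Gam))"
proof -
  have "(\<integral>x. (\<Sum>J\<in>D. h J x * t J x)\<^sup>2 \<partial>Gam) = (\<Sum>J\<in>D. \<Sum>J'\<in>D. \<integral>x. h J x * t J x * (h J' x * t J' x) \<partial>Gam)"
    using integral_comb_sq[OF assms(1), of "\<lambda>J x. h J x * t J x" "\<lambda>_. 1"] Lall_mult[OF h(2) t(2)] by simp
  also have "\<dots> = (\<Sum>J\<in>D. \<Sum>J'\<in>D. (\<integral>x. h J x * h J' x \<partial>Gam) * (\<integral>x. t J x * t J' x \<partial>Gam))"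
  proof (intro sum.cong refl)
    fix J J' assume J: "J \<in> D" "J' \<in> D"
    have "dep A (\<lambda>x. h J x * h J' x)" unfolding dep_def
    proof (intro allI impI)
      fix x y :: "nat \<Rightarrow> real" assume "\<forall>k\<in>A. x k = y k"
      then show "h J x * h J' x = h J y * h J' y" using depD[OF h(1)[OF J(1)], of x y] depD[OF h(1)[OF J(2)], of x y] by simp
    qed
    moreover have "dep B (\<lambda>x. t J x * t J' x)" unfolding dep_def
    proof (intro allI impI)
      fix x y :: "nat \<Rightarrow> real" assume "\<forall>k\<in>B. x k = y k"
      then show "t J x * t J' x = t J y * t J' y" using depD[OF t(1)[of J], of x y] depD[OF t(1)[of J'], of x y] by simp
    qed
    ultimately have "(\<integral>x. (h J x * h J' x) * (t J x * t J' x) \<partial>Gam) = (\<integral>x. h J x * h J' x \<partial>Gam) * (\<integral>x. t J x * t J' x \<partial>Gam)"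
      by (rule indep_integral[OF _ _ AB Lall_mult[OF h(2) h(2)] Lall_mult[OF t(2) t(2)]])
    moreover have "(\<lambda>x. h J x * t J x * (h J' x * t J' x)) = (\<lambda>x. (h J x * h J' x) * (t J x * t J' x))" by (simp add: fun_eq_iff)
    ultimately show "(\<integral>x. h J x * t J x * (h J' x * t J' x) \<partial>Gam) = (\<integral>x. h J x * h J' x \<partial>Gam) * (\<integral>x. t J x * t J' x \<partial>Gam)"
      by (simp only:)
  qed
  finally show ?thesis .
qed

text \<open>Both sides of the Cauchy estimate are quadratic forms in the same Hermite moments, so the
  bound for the prelimit increments passes to the limit.\<close>

lemma Yr_increment:
  assumes "p i \<le> d" "r \<le> p i" "M \<le> M'"
  shows "(\<integral>z. (Yr i r M' z - Yr i r M z)\<^sup>2 \<partial>Gam) \<le> (real (p i choose r))\<^sup>2 * (fact r * fact (p i - r) * real r * (\<Sum>j\<in>{M..<M'}. \<tau> i j))"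
proof -
  define D where "D = LJ M' r - LJ M r"
  have fD: "finite D" by (simp add: D_def)
  have DJ: "length J = r" "set J \<subseteq> {..<M'}" if "J \<in> D" for J using that by (auto simp: D_def LJ_def)
  have sub: "LJ M r \<subseteq> LJ M' r" by (rule LJ_mono[OF assms(3)])
  define H where "H J J' = (\<integral>x. hJ J x * hJ J' x \<partial>Gam)" for J J'
  define T where "T n J x = Z n (i, J) x + al n (i, J)" for n J x
  have TL: "T n J \<in> Lall Gam" for n J unfolding T_def[abs_def] by (intro Lall_add rem_Lall Lall_const Gam_finite)
  have dT: "dep {m n..} (T n J)" for n J using dep_rem[of m n p F "(i, J)"] unfolding dep_def T_def by metis
  have Mi: "Mi i M = M" "Mi i M' = M'" using assms(1) by (auto simp: Mi_def)
  have dm: "dep {k. even k} (hJ (map ((*) 2) J))" for J by (rule dep_mono[OF dep_hJ]) auto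
  have "(\<integral>z. (\<Sum>J\<in>D. hJ (map ((*) 2) J) z * N (i, J) z)\<^sup>2 \<partial>Gam)
    = (\<Sum>J\<in>D. \<Sum>J'\<in>D. (\<integral>x. hJ (map ((*) 2) J) x * hJ (map ((*) 2) J') x \<partial>Gam) * (\<sigma> (i, J) (i, J') + \<alpha> (i, J) * \<alpha> (i, J')))"
    unfolding E_N[symmetric] by (rule indep_comb_sq[OF fD dm hJ_Lall dep_N N_Lall]) auto
  also have "\<dots> = (\<Sum>J\<in>D. \<Sum>J'\<in>D. H J J' * (\<sigma> (i, J) (i, J') + \<alpha> (i, J) * \<alpha> (i, J')))"
  proof -
    \<comment> \<open>Moving the tuples to even coordinates leaves the Hermite moments unchanged, so
      both sides of the comparison have the same matrix H.\<close>
    have "(\<integral>x. hJ (map ((*) 2) J) x * hJ (map ((*) 2) J') x \<partial>Gam) = H J J'" for J J'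
      unfolding hJ_even[symmetric] H_def by (rule integral_even) measurable
    then show ?thesis by simp
  qed
  finally have lim_eq: "(\<integral>z. (\<Sum>J\<in>D. hJ (map ((*) 2) J) z * N (i, J) z)\<^sup>2 \<partial>Gam) = (\<Sum>J\<in>D. \<Sum>J'\<in>D. H J J' * (\<sigma> (i, J) (i, J') + \<alpha> (i, J) * \<alpha> (i, J')))" .
  define E where "E n = (\<Sum>J\<in>D. \<Sum>J'\<in>D. H J J' * (\<integral>x. T n J x * T n J' x \<partial>Gam))" for n
  have Elim: "E \<longlonglongrightarrow> (\<Sum>J\<in>D. \<Sum>J'\<in>D. H J J' * (\<sigma> (i, J) (i, J') + \<alpha> (i, J) * \<alpha> (i, J')))"
    unfolding E_def[abs_def] T_def
    by (intro tendsto_sum tendsto_mult tendsto_const T_lim[where r = r] DJ assms)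
  have Ebound: "E n \<le> fact r * fact (p i - r) * real r * (\<Sum>j\<in>{M..<M'}. Inf' (p i) (F n i) (ev j))" if n: "M' \<le> m n" for n
  proof -
    have dh: "dep {..<M'} (hJ J)" if "J \<in> D" for J using DJ(2)[OF that] by (intro dep_mono[OF dep_hJ]) auto
    have "E n = (\<integral>x. (\<Sum>J\<in>D. hJ J x * T n J x)\<^sup>2 \<partial>Gam)"
      unfolding E_def H_def using n by (intro indep_comb_sq[OF fD dh hJ_Lall dT TL, symmetric]) auto
    \<comment> \<open>D consists of the tuples that use a coordinate between M and M'; their
      contributions recombine into an increment of Wick powers.\<close>
    also have "(\<lambda>x. \<Sum>J\<in>D. hJ J x * T n J x) = (\<lambda>x. S (F n i) (\<lambda>v. (wk r (cut {..<M'} v) x - wk r (cut {..<M} v) x) * wk (p i - r) (cut {m n..} v) x))"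
    proof
      fix x
      have "wk r (cut {..<M'} v) x - wk r (cut {..<M} v) x = (\<Sum>J\<in>D. cJ J v * hJ J x)" for v
        unfolding wk_cut_expand D_def using sub by (subst sum_diff) auto
      then have "S (F n i) (\<lambda>v. (wk r (cut {..<M'} v) x - wk r (cut {..<M} v) x) * wk (p i - r) (cut {m n..} v) x)
        = (\<Sum>J\<in>D. S (F n i) (\<lambda>v. hJ J x * (cJ J v * wk (p i - r) (cut {m n..} v) x)))"
        by (simp add: sum_distrib_right S_sum[symmetric] ac_simps)
      also have "\<dots> = (\<Sum>J\<in>D. hJ J x * T n J x)"
      proof (rule sum.cong[OF refl])
        fix J assume "J \<in> D"
        then have "Ik (p i - r) (Rl (F n i) (m n) J) x = T n J x"
          using Z_add_al[of "(i, J)" n x] DJ(1)[of J] assms by (simp add: T_def)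
        then show "S (F n i) (\<lambda>v. hJ J x * (cJ J v * wk (p i - r) (cut {m n..} v) x)) = hJ J x * T n J x"
          by (simp add: S_mult_left Ik_def S_Rl)
      qed
      finally show "(\<Sum>J\<in>D. hJ J x * T n J x) = S (F n i) (\<lambda>v. (wk r (cut {..<M'} v) x - wk r (cut {..<M} v) x) * wk (p i - r) (cut {m n..} v) x)" by simp
    qed
    finally show ?thesis using cut_increment_bound[OF assms(3) n assms(2), of "F n i"] by (simp add: fun_eq_iff)
  qed
  have "(\<integral>z. (\<Sum>J\<in>D. hJ (map ((*) 2) J) z * N (i, J) z)\<^sup>2 \<partial>Gam) \<le> fact r * fact (p i - r) * real r * (\<Sum>j\<in>{M..<M'}. \<tau> i j)"
    unfolding lim_eq
  proof (rule tendsto_le[OF sequentially_bot _ Elim])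
    show "(\<lambda>n. fact r * fact (p i - r) * real r * (\<Sum>j\<in>{M..<M'}. Inf' (p i) (F n i) (ev j))) \<longlonglongrightarrow> fact r * fact (p i - r) * real r * (\<Sum>j\<in>{M..<M'}. \<tau> i j)"
      by (intro tendsto_intros influence_lim)
    have "\<forall>\<^sub>F n in sequentially. M' \<le> m n" using m by (simp add: filterlim_at_top)
    then show "\<forall>\<^sub>F n in sequentially. E n \<le> fact r * fact (p i - r) * real r * (\<Sum>j\<in>{M..<M'}. Inf' (p i) (F n i) (ev j))"
      by eventually_elim (rule Ebound)
  qed
  moreover have "Yr i r M' z - Yr i r M z = real (p i choose r) * (\<Sum>J\<in>D. hJ (map ((*) 2) J) z * N (i, J) z)" for z
    unfolding Yr_def Mi D_def right_diff_distrib[symmetric] using sub by (subst sum_diff) auto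
  ultimately show ?thesis by (simp add: power_mult_distrib mult_left_mono)
qed

text \<open>The increments are controlled by tails of the summable \<tau>; for p i > d the sequence
  in M is constant.\<close>

lemma Y_ex:
  assumes "r \<le> p i"
  shows "\<exists>Y. Y \<in> borel_measurable Gam \<and> integrable Gam (\<lambda>x. (Y x)\<^sup>2) \<and> (\<lambda>M. \<integral>x. (Yr i r M x - Y x)\<^sup>2 \<partial>Gam) \<longlonglongrightarrow> 0"
proof -
  define K where "K = (real (p i choose r))\<^sup>2 * (fact r * fact (p i - r) * real r)"
  define e where "e M = (if p i \<le> d then K * (\<Sum>j. \<tau> i (j + M)) else 0)" for M
  have "(\<lambda>M. K * (\<Sum>j. \<tau> i (j + M))) \<longlonglongrightarrow> K * 0" by (intro tendsto_intros tail_tendsto tau_sum)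
  then have e0: "e \<longlonglongrightarrow> 0" unfolding e_def[abs_def] by (cases "p i \<le> d") auto
  have c: "(\<integral>z. (Yr i r M' z - Yr i r M z)\<^sup>2 \<partial>Gam) \<le> e M" if "M \<le> M'" for M M'
  proof (cases "p i \<le> d")
    case True
    have s: "summable (\<lambda>j. \<tau> i (j + M))" using tau_sum[of i] by (simp add: summable_iff_shift)
    have "(\<Sum>j\<in>{M..<M'}. \<tau> i j) = (\<Sum>j<M' - M. \<tau> i (j + M))"
      by (simp add: sum.atLeastLessThan_shift_0[of _ M] atLeast0LessThan add.commute)
    also have "\<dots> \<le> (\<Sum>j. \<tau> i (j + M))" by (rule sum_le_suminf[OF s]) (auto simp: tau0)
    finally have "K * (\<Sum>j\<in>{M..<M'}. \<tau> i j) \<le> K * (\<Sum>j. \<tau> i (j + M))" by (rule mult_left_mono) (simp add: K_def)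
    with Yr_increment[OF True assms that] True show ?thesis by (simp add: e_def K_def mult.assoc)
  next
    case False then show ?thesis by (simp add: e_def Yr_def Mi_def)
  qed
  have i2: "integrable Gam (\<lambda>x. (Yr i r M x)\<^sup>2)" for M by (intro Lall_integrable Lall_power Yr_Lall Gam_finite)
  obtain Y where "Y \<in> borel_measurable Gam" "integrable Gam (\<lambda>x. (Y x)\<^sup>2)" "(\<lambda>M. \<integral>x. (Yr i r M x - Y x)\<^sup>2 \<partial>Gam) \<longlonglongrightarrow> 0"
    using L2_complete[OF Gam.prob_space_axioms Yr_measurable i2 e0 c] by blast
  then show ?thesis by blast
qed

text \<open>First n tends to infinity at a fixed cutoff M, then M. The blocks \<open>Y i r\<close>
  are kept apart because they belong to chaoses of different orders.\<close>

theorem limit_vector: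
  obtains Y where "\<And>i r. r \<le> p i \<Longrightarrow> Y i r \<in> borel_measurable Gam" "\<And>i r. r \<le> p i \<Longrightarrow> integrable Gam (\<lambda>x. (Y i r x)\<^sup>2)"
    "\<And>i r. r \<le> p i \<Longrightarrow> (\<lambda>M. \<integral>x. (Yr i r M x - Y i r x)\<^sup>2 \<partial>Gam) \<longlonglongrightarrow> 0"
    "\<And>v \<theta>. (\<lambda>n. \<integral>x. cos (X v (\<lambda>i. Ik (p i) (F n i) x) + \<theta>) \<partial>Gam) \<longlonglongrightarrow> (\<integral>z. cos (X v (\<lambda>i. \<Sum>r\<le>p i. Y i r z) + \<theta>) \<partial>Gam)"
proof -
  have "\<forall>i r. \<exists>Y. r \<le> p i \<longrightarrow> Y \<in> borel_measurable Gam \<and> integrable Gam (\<lambda>x. (Y x)\<^sup>2) \<and> (\<lambda>M. \<integral>x. (Yr i r M x - Y x)\<^sup>2 \<partial>Gam) \<longlonglongrightarrow> 0"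
    using Y_ex by blast
  then obtain Y where Y: "\<And>i r. r \<le> p i \<Longrightarrow> Y i r \<in> borel_measurable Gam" "\<And>i r. r \<le> p i \<Longrightarrow> integrable Gam (\<lambda>x. (Y i r x)\<^sup>2)"
    "\<And>i r. r \<le> p i \<Longrightarrow> (\<lambda>M. \<integral>x. (Yr i r M x - Y i r x)\<^sup>2 \<partial>Gam) \<longlonglongrightarrow> 0"
    unfolding choice_iff by blast
  have Ym: "(\<lambda>z. \<Sum>r\<le>p i. Y i r z) \<in> borel_measurable Gam" for i by (intro borel_measurable_sum Y) auto
  have iY: "integrable Gam (\<lambda>x. (Yr i r M x - Y i r x)\<^sup>2)" if "r \<le> p i" for i r M
  proof (rule Bochner_Integration.integrable_bound[of _ "\<lambda>x. 2 * (Yr i r M x)\<^sup>2 + 2 * (Y i r x)\<^sup>2"])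
    note [measurable] = Y(1)[OF that]
    show "(\<lambda>x. (Yr i r M x - Y i r x)\<^sup>2) \<in> borel_measurable Gam" by measurable
    show "integrable Gam (\<lambda>x. 2 * (Yr i r M x)\<^sup>2 + 2 * (Y i r x)\<^sup>2)"
      using Y(2)[OF that] Lall_integrable[OF Lall_power[OF Gam_finite Yr_Lall, of i r M 2]] by simp
    have "(s - t)\<^sup>2 \<le> 2 * s\<^sup>2 + 2 * t\<^sup>2" for s t :: real
      using zero_le_power2[of "s + t"] by (simp add: power2_eq_square algebra_simps)
    then show "AE x in Gam. norm ((Yr i r M x - Y i r x)\<^sup>2) \<le> norm (2 * (Yr i r M x)\<^sup>2 + 2 * (Y i r x)\<^sup>2)" by auto
  qed
  \<comment> \<open>The factor \<open>Suc (p i)\<close> is the number of blocks, from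
    Cauchy-Schwarz.\<close>
  define c where "c i M = (\<Sum>r\<le>p i. \<integral>x. (Yr i r M x - Y i r x)\<^sup>2 \<partial>Gam) * real (Suc (p i))" for i M
  have c0: "c i \<longlonglongrightarrow> 0" for i
  proof -
    have "(\<lambda>M. (\<Sum>r\<le>p i. \<integral>x. (Yr i r M x - Y i r x)\<^sup>2 \<partial>Gam) * real (Suc (p i))) \<longlonglongrightarrow> (\<Sum>r\<le>p i. 0) * real (Suc (p i))"
      by (intro tendsto_intros Y(3)) auto
    then show ?thesis by (simp add: c_def[abs_def])
  qed
  have sq: "((\<Sum>r\<le>p i. Yr i r M x) - (\<Sum>r\<le>p i. Y i r x))\<^sup>2 \<le> (\<Sum>r\<le>p i. (Yr i r M x - Y i r x)\<^sup>2) * real (Suc (p i))" for i M x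
    using sum_squared_le_sum_of_squares[of "\<lambda>r. Yr i r M x - Y i r x" "{..p i}"] by (simp add: sum_subtractf)
  have ib: "integrable Gam (\<lambda>x. (\<Sum>r\<le>p i. (Yr i r M x - Y i r x)\<^sup>2) * real (Suc (p i)))" for i M
    by (intro integrable_mult_left Bochner_Integration.integrable_sum iY) auto
  have id: "integrable Gam (\<lambda>x. ((\<Sum>r\<le>p i. Yr i r M x) - (\<Sum>r\<le>p i. Y i r x))\<^sup>2)" for i M
  proof (rule Bochner_Integration.integrable_bound[OF ib[of i M]])
    note [measurable] = Ym
    show "(\<lambda>x. ((\<Sum>r\<le>p i. Yr i r M x) - (\<Sum>r\<le>p i. Y i r x))\<^sup>2) \<in> borel_measurable Gam" by measurable
    show "AE x in Gam. norm (((\<Sum>r\<le>p i. Yr i r M x) - (\<Sum>r\<le>p i. Y i r x))\<^sup>2) \<le> norm ((\<Sum>r\<le>p i. (Yr i r M x - Y i r x)\<^sup>2) * real (Suc (p i)))"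
      using sq[of i M] by (intro AE_I2) (auto intro: order_trans[OF _ abs_ge_self])
  qed
  have ic: "(\<integral>x. ((\<Sum>r\<le>p i. Yr i r M x) - (\<Sum>r\<le>p i. Y i r x))\<^sup>2 \<partial>Gam) \<le> c i M" for i M
  proof -
    have "(\<integral>x. ((\<Sum>r\<le>p i. Yr i r M x) - (\<Sum>r\<le>p i. Y i r x))\<^sup>2 \<partial>Gam) \<le> (\<integral>x. (\<Sum>r\<le>p i. (Yr i r M x - Y i r x)\<^sup>2) * real (Suc (p i)) \<partial>Gam)"
      by (rule integral_mono[OF id ib sq])
    also have "\<dots> = c i M" unfolding c_def
      by (subst integral_mult_left_zero, subst Bochner_Integration.integral_sum) (auto intro: iY)
    finally show ?thesis .
  qed
  have Ylim: "(\<lambda>M. \<integral>z. cos (X v (\<lambda>i. \<Sum>r\<le>p i. Yr i r M z) + \<theta>) \<partial>Gam) \<longlonglongrightarrow> (\<integral>z. cos (X v (\<lambda>i. \<Sum>r\<le>p i. Y i r z) + \<theta>) \<partial>Gam)" for v \<theta>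
  proof (rule LIM_zero_cancel, rule Lim_null_comparison[OF always_eventually], rule allI)
    have "(\<lambda>M. \<Sum>i\<in>supp v. \<bar>coord v i\<bar> * sqrt (c i M)) \<longlonglongrightarrow> (\<Sum>i\<in>supp v. \<bar>coord v i\<bar> * sqrt 0)"
      by (intro tendsto_intros c0)
    then show "(\<lambda>M. \<Sum>i\<in>supp v. \<bar>coord v i\<bar> * sqrt (c i M)) \<longlonglongrightarrow> 0" by simp
    fix M
    have "\<bar>(\<integral>z. cos (X v (\<lambda>i. \<Sum>r\<le>p i. Yr i r M z) + \<theta>) \<partial>Gam) - (\<integral>z. cos (X v (\<lambda>i. \<Sum>r\<le>p i. Y i r z) + \<theta>) \<partial>Gam)\<bar>
      \<le> (\<Sum>i\<in>supp v. \<bar>coord v i\<bar> * sqrt (\<integral>x. ((\<Sum>r\<le>p i. Yr i r M x) - (\<Sum>r\<le>p i. Y i r x))\<^sup>2 \<partial>Gam))"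
      by (rule cos_L2_le[OF Gam.prob_space_axioms _ Ym id]) measurable
    also have "\<dots> \<le> (\<Sum>i\<in>supp v. \<bar>coord v i\<bar> * sqrt (c i M))"
      by (intro sum_mono mult_left_mono real_sqrt_le_mono ic abs_ge_zero)
    finally show "norm ((\<integral>z. cos (X v (\<lambda>i. \<Sum>r\<le>p i. Yr i r M z) + \<theta>) \<partial>Gam) - (\<integral>z. cos (X v (\<lambda>i. \<Sum>r\<le>p i. Y i r z) + \<theta>) \<partial>Gam)) \<le> (\<Sum>i\<in>supp v. \<bar>coord v i\<bar> * sqrt (c i M))"
      by simp
  qed
  have fin: "(\<lambda>n. \<integral>x. cos (X v (\<lambda>i. Ik (p i) (F n i) x) + \<theta>) \<partial>Gam) \<longlonglongrightarrow> (\<integral>z. cos (X v (\<lambda>i. \<Sum>r\<le>p i. Y i r z) + \<theta>) \<partial>Gam)" for v \<theta>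
  proof (rule tendsto_approx[OF _ _ FM_error_tendsto[of v] cutoff_limit Ylim])
    fix M
    have "\<forall>\<^sub>F n in sequentially. M \<le> m n" using m by (simp add: filterlim_at_top)
    then show "\<forall>\<^sub>F n in sequentially. \<bar>(\<integral>x. cos (X v (\<lambda>i. Ik (p i) (F n i) x) + \<theta>) \<partial>Gam) - (\<integral>x. cos (X v (\<lambda>i. FM n i M x) + \<theta>) \<partial>Gam)\<bar>
      \<le> (\<Sum>i\<in>supp v. \<bar>coord v i\<bar> * sqrt (fact (p i) * (\<Sum>j\<in>{Mi i M..<m n}. Inf' (p i) (F n i) (ev j))))"
      by eventually_elim (rule FM_approx)
    show "(\<lambda>n. \<Sum>i\<in>supp v. \<bar>coord v i\<bar> * sqrt (fact (p i) * (\<Sum>j\<in>{Mi i M..<m n}. Inf' (p i) (F n i) (ev j))))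
      \<longlonglongrightarrow> (\<Sum>i\<in>supp v. \<bar>coord v i\<bar> * sqrt (fact (p i) * (\<Sum>j. \<tau> i (j + Mi i M))))"
      by (intro tendsto_intros influence_tail)
  qed
  show thesis by (rule that[OF Y fin])
qed

end

section \<open>Membership in the chaos\<close>

lemma fun_span_base: assumes "f \<in> B" shows "f \<in> fun_span B"
proof -
  have "f = (\<lambda>\<omega>. \<Sum>b\<in>{f}. 1 * b \<omega>)" by simp
  then show ?thesis unfolding fun_span_def using assms by (intro CollectI exI[of _ "{f}"] exI[of _ "\<lambda>_. 1"]) auto
qed

lemma fun_span_zero: "(\<lambda>_. 0) \<in> fun_span B"
  unfolding fun_span_def by (intro CollectI exI[of _ "{}"] exI[of _ "\<lambda>_. 0"]) auto

lemma fun_span_add: assumes "f \<in> fun_span B" "g \<in> fun_span B" shows "(\<lambda>\<omega>. f \<omega> + g \<omega>) \<in> fun_span B"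
proof -
  obtain S c where S: "f = (\<lambda>\<omega>. \<Sum>b\<in>S. c b * b \<omega>)" "finite S" "S \<subseteq> B" using assms(1) by (auto simp: fun_span_def)
  obtain T e where T: "g = (\<lambda>\<omega>. \<Sum>b\<in>T. e b * b \<omega>)" "finite T" "T \<subseteq> B" using assms(2) by (auto simp: fun_span_def)
  let ?c = "\<lambda>b. (if b \<in> S then c b else 0) + (if b \<in> T then e b else 0)"
  have "f \<omega> + g \<omega> = (\<Sum>b\<in>S \<union> T. ?c b * b \<omega>)" for \<omega>
  proof -
    have "f \<omega> = (\<Sum>b\<in>S \<union> T. (if b \<in> S then c b else 0) * b \<omega>)"
      unfolding S(1) using S(2) T(2) by (intro sum.mono_neutral_cong_left) auto
    moreover have "g \<omega> = (\<Sum>b\<in>S \<union> T. (if b \<in> T then e b else 0) * b \<omega>)"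
      unfolding T(1) using S(2) T(2) by (intro sum.mono_neutral_cong_left) auto
    ultimately show ?thesis by (simp only: sum.distrib[symmetric] distrib_right)
  qed
  then show ?thesis unfolding fun_span_def
    using S(2,3) T(2,3) by (intro CollectI exI[of _ "S \<union> T"] exI[of _ ?c]) auto
qed

lemma fun_span_scale: assumes "f \<in> fun_span B" shows "(\<lambda>\<omega>. r * f \<omega>) \<in> fun_span B"
proof -
  obtain S c where S: "f = (\<lambda>\<omega>. \<Sum>b\<in>S. c b * b \<omega>)" "finite S" "S \<subseteq> B" using assms by (auto simp: fun_span_def)
  have "(\<lambda>\<omega>. r * f \<omega>) = (\<lambda>\<omega>. \<Sum>b\<in>S. (r * c b) * b \<omega>)" unfolding S(1) by (simp add: sum_distrib_left mult.assoc)
  then show ?thesis unfolding fun_span_def using S(2,3) by (intro CollectI exI[of _ S] exI[of _ "\<lambda>b. r * c b"]) auto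
qed

lemma fun_span_sum: "(\<And>i. i \<in> A \<Longrightarrow> f i \<in> fun_span B) \<Longrightarrow> (\<lambda>\<omega>. \<Sum>i\<in>A. f i \<omega>) \<in> fun_span B"
  by (induction A rule: infinite_finite_induct) (auto intro: fun_span_zero fun_span_add)

lemma L2_diff_le:
  assumes "f \<in> L2 M" "g \<in> L2 M" "f' \<in> L2 M" "g' \<in> L2 M"
  shows "integrable M (\<lambda>\<omega>. (f \<omega> - g \<omega>)\<^sup>2)"
    "(\<integral>\<omega>. (f \<omega> + f' \<omega> - (g \<omega> + g' \<omega>))\<^sup>2 \<partial>M) \<le> 2 * (\<integral>\<omega>. (f \<omega> - g \<omega>)\<^sup>2 \<partial>M) + 2 * (\<integral>\<omega>. (f' \<omega> - g' \<omega>)\<^sup>2 \<partial>M)"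
    "(\<lambda>\<omega>. f \<omega> + g \<omega>) \<in> L2 M"
proof -
  have [measurable]: "f \<in> borel_measurable M" "g \<in> borel_measurable M" "f' \<in> borel_measurable M" "g' \<in> borel_measurable M"
    using assms by (auto simp: L2_def)
  have i: "integrable M (\<lambda>\<omega>. (h \<omega>)\<^sup>2)" if "h \<in> L2 M" for h using that by (auto simp: L2_def)
  have sq: "(s - t)\<^sup>2 \<le> 2 * s\<^sup>2 + 2 * t\<^sup>2" "(s + t)\<^sup>2 \<le> 2 * s\<^sup>2 + 2 * t\<^sup>2" for s t :: real
    using zero_le_power2[of "s + t"] zero_le_power2[of "s - t"] by (simp_all add: power2_eq_square algebra_simps)
  have dif: "integrable M (\<lambda>\<omega>. (h \<omega> - h' \<omega>)\<^sup>2)" if "h \<in> L2 M" "h' \<in> L2 M" for h h'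
  proof (rule Bochner_Integration.integrable_bound[of _ "\<lambda>\<omega>. 2 * (h \<omega>)\<^sup>2 + 2 * (h' \<omega>)\<^sup>2"])
    show "(\<lambda>\<omega>. (h \<omega> - h' \<omega>)\<^sup>2) \<in> borel_measurable M" using that unfolding L2_def by (auto intro!: borel_measurable_power borel_measurable_diff)
    show "integrable M (\<lambda>\<omega>. 2 * (h \<omega>)\<^sup>2 + 2 * (h' \<omega>)\<^sup>2)" using i that by auto
    show "AE x in M. norm ((h x - h' x)\<^sup>2) \<le> norm (2 * (h x)\<^sup>2 + 2 * (h' x)\<^sup>2)" using sq(1) by auto
  qed
  show "integrable M (\<lambda>\<omega>. (f \<omega> - g \<omega>)\<^sup>2)" using dif assms by blast
  have sum: "(\<lambda>\<omega>. h \<omega> + h' \<omega>) \<in> L2 M" if "h \<in> L2 M" "h' \<in> L2 M" for h h'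
    unfolding L2_def
  proof (intro CollectI conjI)
    show m: "(\<lambda>\<omega>. h \<omega> + h' \<omega>) \<in> borel_measurable M" using that by (auto simp: L2_def)
    show "integrable M (\<lambda>\<omega>. (h \<omega> + h' \<omega>)\<^sup>2)"
    proof (rule Bochner_Integration.integrable_bound[of _ "\<lambda>\<omega>. 2 * (h \<omega>)\<^sup>2 + 2 * (h' \<omega>)\<^sup>2"])
      show "(\<lambda>\<omega>. (h \<omega> + h' \<omega>)\<^sup>2) \<in> borel_measurable M" using m by (rule borel_measurable_power)
      show "integrable M (\<lambda>\<omega>. 2 * (h \<omega>)\<^sup>2 + 2 * (h' \<omega>)\<^sup>2)" using i that by auto
      show "AE x in M. norm ((h x + h' x)\<^sup>2) \<le> norm (2 * (h x)\<^sup>2 + 2 * (h' x)\<^sup>2)" using sq(2) by auto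
    qed
  qed
  then show "(\<lambda>\<omega>. f \<omega> + g \<omega>) \<in> L2 M" using assms by blast
  have "(\<integral>\<omega>. (f \<omega> + f' \<omega> - (g \<omega> + g' \<omega>))\<^sup>2 \<partial>M) \<le> (\<integral>\<omega>. 2 * (f \<omega> - g \<omega>)\<^sup>2 + 2 * (f' \<omega> - g' \<omega>)\<^sup>2 \<partial>M)"
  proof (rule integral_mono)
    show "integrable M (\<lambda>\<omega>. (f \<omega> + f' \<omega> - (g \<omega> + g' \<omega>))\<^sup>2)" by (rule dif[OF sum sum]) fact+
    show "integrable M (\<lambda>\<omega>. 2 * (f \<omega> - g \<omega>)\<^sup>2 + 2 * (f' \<omega> - g' \<omega>)\<^sup>2)" using dif assms by auto
    show "(f \<omega> + f' \<omega> - (g \<omega> + g' \<omega>))\<^sup>2 \<le> 2 * (f \<omega> - g \<omega>)\<^sup>2 + 2 * (f' \<omega> - g' \<omega>)\<^sup>2" for \<omega>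
      using sq(2)[of "f \<omega> - g \<omega>" "f' \<omega> - g' \<omega>"] by (simp add: algebra_simps)
  qed
  also have "\<dots> = 2 * (\<integral>\<omega>. (f \<omega> - g \<omega>)\<^sup>2 \<partial>M) + 2 * (\<integral>\<omega>. (f' \<omega> - g' \<omega>)\<^sup>2 \<partial>M)" using dif assms by simp
  finally show "(\<integral>\<omega>. (f \<omega> + f' \<omega> - (g \<omega> + g' \<omega>))\<^sup>2 \<partial>M) \<le> 2 * (\<integral>\<omega>. (f \<omega> - g \<omega>)\<^sup>2 \<partial>M) + 2 * (\<integral>\<omega>. (f' \<omega> - g' \<omega>)\<^sup>2 \<partial>M)" .
qed

lemma L2_closed_span_zero: "(\<lambda>_. 0) \<in> L2_closed_span M B"
proof -
  have "(\<lambda>_. 0) \<in> L2 M" by (simp add: L2_def)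
  then show ?thesis unfolding L2_closed_span_def using fun_span_zero[of B] by (auto intro!: bexI[of _ "\<lambda>_. 0"])
qed

lemma L2_closed_span_add:
  assumes f: "f \<in> L2_closed_span M B" and f': "f' \<in> L2_closed_span M B"
  shows "(\<lambda>\<omega>. f \<omega> + f' \<omega>) \<in> L2_closed_span M B"
  unfolding L2_closed_span_def
proof (intro CollectI conjI allI impI)
  have L: "f \<in> L2 M" "f' \<in> L2 M" using assms by (auto simp: L2_closed_span_def)
  then show "(\<lambda>\<omega>. f \<omega> + f' \<omega>) \<in> L2 M" using L2_diff_le(3) by blast
  fix e :: real assume e: "0 < e"
  then have "0 < e / 2" by simp
  then obtain g g' where g: "g \<in> fun_span B" "g \<in> L2 M" "sqrt (\<integral>\<omega>. (f \<omega> - g \<omega>)\<^sup>2 \<partial>M) < e / 2"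
    and g': "g' \<in> fun_span B" "g' \<in> L2 M" "sqrt (\<integral>\<omega>. (f' \<omega> - g' \<omega>)\<^sup>2 \<partial>M) < e / 2"
    using f f' unfolding L2_closed_span_def by blast
  have h: "a < (e / 2)\<^sup>2" if "sqrt a < e / 2" for a
    by (rule ccontr) (use that e real_sqrt_le_mono[of "(e / 2)\<^sup>2" a] in auto)
  have "(\<integral>\<omega>. (f \<omega> + f' \<omega> - (g \<omega> + g' \<omega>))\<^sup>2 \<partial>M) < 2 * (e / 2)\<^sup>2 + 2 * (e / 2)\<^sup>2"
    using L2_diff_le(2)[OF L(1) g(2) L(2) g'(2)] h[OF g(3)] h[OF g'(3)] by linarith
  also have "\<dots> = e\<^sup>2" by (simp add: power2_eq_square)
  finally have "sqrt (\<integral>\<omega>. (f \<omega> + f' \<omega> - (g \<omega> + g' \<omega>))\<^sup>2 \<partial>M) < e" using e by (metis real_sqrt_less_mono real_sqrt_unique less_imp_le)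
  moreover have "(\<lambda>\<omega>. g \<omega> + g' \<omega>) \<in> fun_span B \<inter> L2 M" using fun_span_add g g' L2_diff_le(3) by blast
  ultimately show "\<exists>h\<in>fun_span B \<inter> L2 M. sqrt (\<integral>\<omega>. (f \<omega> + f' \<omega> - h \<omega>)\<^sup>2 \<partial>M) < e"
    by (rule bexI[of _ "\<lambda>\<omega>. g \<omega> + g' \<omega>"])
qed

lemma L2_closed_span_sum:
  "(\<And>r. r \<in> A \<Longrightarrow> f r \<in> L2_closed_span M B) \<Longrightarrow> (\<lambda>\<omega>. \<Sum>r\<in>A. f r \<omega>) \<in> L2_closed_span M B"
  by (induction A rule: infinite_finite_induct) (auto intro: L2_closed_span_zero L2_closed_span_add)

lemma L2_closed_span_limit:
  assumes "Y \<in> L2 M" "\<And>n. f n \<in> fun_span B" "\<And>n. f n \<in> L2 M" and lim: "(\<lambda>n. \<integral>\<omega>. (f n \<omega> - Y \<omega>)\<^sup>2 \<partial>M) \<longlonglongrightarrow> 0"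
  shows "Y \<in> L2_closed_span M B"
  unfolding L2_closed_span_def
proof (intro CollectI conjI allI impI assms(1))
  fix e :: real assume "0 < e"
  moreover have "(\<lambda>n. sqrt (\<integral>\<omega>. (f n \<omega> - Y \<omega>)\<^sup>2 \<partial>M)) \<longlonglongrightarrow> 0" using tendsto_real_sqrt[OF lim] by simp
  ultimately have "\<forall>\<^sub>F n in sequentially. sqrt (\<integral>\<omega>. (f n \<omega> - Y \<omega>)\<^sup>2 \<partial>M) < e" using order_tendstoD(2) by blast
  then obtain n where "sqrt (\<integral>\<omega>. (f n \<omega> - Y \<omega>)\<^sup>2 \<partial>M) < e" using eventually_happens'[OF sequentially_bot] by blast
  then show "\<exists>g\<in>fun_span B \<inter> L2 M. sqrt (\<integral>\<omega>. (Y \<omega> - g \<omega>)\<^sup>2 \<partial>M) < e"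
    using assms(2,3) by (intro bexI[of _ "f n"]) (auto simp: power2_commute)
qed

text \<open>Several summands may share an order, whereas \<open>wiener_chaos_upto\<close> provides
  one summand for each, so they are grouped.\<close>

lemma wiener_chaos_upto_sum:
  assumes "finite A" "\<And>r. r \<in> A \<Longrightarrow> f r \<in> wiener_chaos M G (k r)" "\<And>r. r \<in> A \<Longrightarrow> k r \<le> d"
  shows "(\<lambda>\<omega>. \<Sum>r\<in>A. f r \<omega>) \<in> wiener_chaos_upto M G d"
proof -
  let ?f = "\<lambda>j \<omega>. \<Sum>r\<in>{r\<in>A. k r = j}. f r \<omega>"
  have "?f j \<in> wiener_chaos M G j" for j
    unfolding wiener_chaos_def by (rule L2_closed_span_sum) (use assms(2) in \<open>auto simp: wiener_chaos_def\<close>)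
  moreover have "(\<lambda>\<omega>. \<Sum>r\<in>A. f r \<omega>) = (\<lambda>\<omega>. \<Sum>j\<le>d. ?f j \<omega>)"
    using assms(1,3) by (intro ext sum.group[symmetric]) auto
  ultimately show ?thesis unfolding wiener_chaos_upto_def by (intro CollectI exI[of _ ?f]) simp
qed

lemma hJ_Cons_notin: assumes "k \<notin> set J" shows "hJ (k # J) z = z k * hJ J z"
proof -
  have "(\<Prod>j\<in>set J. wk (count_list (k # J) j) (ev j) z) = hJ J z"
    unfolding hJ_def using assms by (intro prod.cong refl) auto
  moreover have "count_list (k # J) k = Suc 0" using assms by (simp add: count_list_0_iff)
  ultimately show ?thesis using assms by (simp add: hJ_def X_ev)
qed

lemma hJ_hermite_products: "(\<lambda>\<omega>. hJ J (\<lambda>k. G k \<omega>)) \<in> hermite_products G (length J)"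
proof -
  have s: "{i. count_list J i \<noteq> 0} = set J" by (auto simp: count_list_0_iff)
  show ?thesis unfolding hermite_products_def
    by (intro CollectI exI[of _ "count_list J"] conjI; simp only: s hJ_def wk_ev) (simp_all add: sum_count_set)
qed

section \<open>Orders of the limiting blocks\<close>

context lim_family
begin

text \<open>A block of r leading factors gains one Gaussian factor unless r is the full order. For d
  < p i only r = 0 gives a nonzero block, a single Gaussian variable, and order 1 is recorded for
  all r.\<close>

definition od :: "nat \<Rightarrow> nat \<Rightarrow> nat" where
  "od i r = (if d < p i then 1 else if r < p i then Suc r else r)"

lemma od_le: "r \<le> p i \<Longrightarrow> od i r \<le> d" using d1 by (simp add: od_def)

lemma alpha_0: "length J < p i \<Longrightarrow> \<alpha> (i, J) = 0"
  using top_lim[of "(i, J)"] by (simp add: top_coeff_def LIMSEQ_const_iff)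

lemma b_0: "p i \<le> length J \<Longrightarrow> b (i, J) = 0"
  using inner_b[of "(i, J)" "(i, J)"] sigma_0[of "(i, J)" "(i, J)"] by simp

text \<open>The Hermite product uses even coordinates and N is linear in odd ones, so multiplying
  them creates no repeated coordinate: each term is again a Hermite product, of order one
  higher.\<close>

lemma Yr_span: assumes "r \<le> p i" shows "(\<lambda>\<omega>. Yr i r M (\<lambda>k. G k \<omega>)) \<in> fun_span (hermite_products G (od i r))"
proof -
  have "(\<lambda>\<omega>. hJ (map ((*) 2) J) (\<lambda>k. G k \<omega>) * N (i, J) (\<lambda>k. G k \<omega>)) \<in> fun_span (hermite_products G (od i r))"
    if J: "J \<in> LJ (Mi i M) r" for J
  proof (cases "r < p i")
    case True
    have l: "length J = r" using J by (simp add: LJ_def)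
    have o: "od i r = Suc r" using True J by (auto simp: od_def Mi_def LJ_00 split: if_splits)
    have hp: "(\<lambda>\<omega>. hJ (k # map ((*) 2) J) (\<lambda>k. G k \<omega>)) \<in> hermite_products G (Suc r)" for k
      using hJ_hermite_products[of "k # map ((*) 2) J" G] l by simp
    have e: "hJ (map ((*) 2) J) z * N (i, J) z = (\<Sum>k\<in>supp (b (i, J)). coord (b (i, J)) k * hJ (k # map ((*) 2) J) z)" for z
    proof -
      have "hJ (map ((*) 2) J) z * N (i, J) z = hJ (map ((*) 2) J) z * X (b (i, J)) z" using True l by (simp add: N_def alpha_0)
      also have "\<dots> = (\<Sum>k\<in>supp (b (i, J)). coord (b (i, J)) k * (z k * hJ (map ((*) 2) J) z))"
        by (simp add: X_def sum_distrib_left ac_simps)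
      also have "\<dots> = (\<Sum>k\<in>supp (b (i, J)). coord (b (i, J)) k * hJ (k # map ((*) 2) J) z)"
      proof (rule sum.cong[OF refl])
        fix k assume "k \<in> supp (b (i, J))"
        then have "odd k" using supp_b by blast
        then have "k \<notin> set (map ((*) 2) J)" by auto
        then show "coord (b (i, J)) k * (z k * hJ (map ((*) 2) J) z) = coord (b (i, J)) k * hJ (k # map ((*) 2) J) z" by (simp add: hJ_Cons_notin)
      qed
      finally show ?thesis .
    qed
    show ?thesis unfolding o e by (intro fun_span_sum fun_span_scale fun_span_base hp)
  next
    case False
    then have r: "r = p i" using assms by simp
    have l: "length J = r" using J by (simp add: LJ_def)
    have o: "od i r = r"
    proof (cases "d < p i")
      case True
      then have "r = 0" using J by (auto simp: Mi_def LJ_00 split: if_splits)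
      then show ?thesis using r True by simp
    qed (simp add: od_def r)
    have hp: "(\<lambda>\<omega>. hJ (map ((*) 2) J) (\<lambda>k. G k \<omega>)) \<in> hermite_products G r"
      using hJ_hermite_products[of "map ((*) 2) J" G] l by simp
    have e: "hJ (map ((*) 2) J) z * N (i, J) z = \<alpha> (i, J) * hJ (map ((*) 2) J) z" for z
      using l r by (simp add: N_def b_0 X_zero)
    show ?thesis unfolding o e by (intro fun_span_scale fun_span_base hp)
  qed
  then show ?thesis unfolding Yr_def by (intro fun_span_scale fun_span_sum)
qed

end

section \<open>From convergence in law to convergence of fourth moments\<close>

lemma E_coord4: "(\<integral>x. x 0 ^ 4 \<partial>Gam) = 3" "(\<integral>x. (x 0)\<^sup>2 \<partial>Gam) = 1"
proof -
  have L: "(\<lambda>x. x 0 ^ k) \<in> Lall Gam" for k using Lall_power[OF Gam_finite X_Lall[of "ev 0"], of k] by (simp add: X_ev)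
  show 2: "(\<integral>x. (x 0)\<^sup>2 \<partial>Gam) = 1" using E2[of "Suc 0" "ev 0" "Suc 0" "ev 0"] by (simp add: X_ev power2_eq_square)
  have "wk 2 (ev 0) x = (x 0)\<^sup>2 - 1" for x by (simp add: wk_ev numeral_2_eq_2 pderiv_pCons one_pCons)
  then have "(\<integral>x. ((x 0)\<^sup>2 - 1) * ((x 0)\<^sup>2 - 1) \<partial>Gam) = 2" using E2[of 2 "ev 0" 2 "ev 0"] by simp
  moreover have "((x 0)\<^sup>2 - 1) * ((x 0)\<^sup>2 - 1) = x 0 ^ 4 - 2 * (x 0)\<^sup>2 + 1" for x :: "nat \<Rightarrow> real"
    by (simp add: power2_eq_square power4_eq_xxxx algebra_simps)
  ultimately show "(\<integral>x. x 0 ^ 4 \<partial>Gam) = 3"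
    using Lall_integrable[OF L[of 4]] Lall_integrable[OF L[of 2]] 2 by (simp add: Gam.prob_space[unfolded space_Gam])
qed

lemma cos_taylor: "\<bar>cos y - (1 - y\<^sup>2 / 2 + y ^ 4 / 24)\<bar> \<le> y ^ 6 / 720" for y :: real
proof -
  obtain t where t: "cos y = (\<Sum>m<6. cos_coeff m * y ^ m) + (cos (t + 1 / 2 * real 6 * pi) / fact 6) * y ^ 6"
    using Maclaurin_cos_expansion[of y 6] by blast
  have "(\<Sum>m<6. cos_coeff m * y ^ m) = 1 - y\<^sup>2 / 2 + y ^ 4 / 24"
  proof -
    have "{..<6::nat} = {0, 1, 2, 3, 4, 5}" by auto
    then show ?thesis by (simp add: cos_coeff_def fact_numeral)
  qed
  then have "\<bar>cos y - (1 - y\<^sup>2 / 2 + y ^ 4 / 24)\<bar> = \<bar>cos (t + 1 / 2 * real 6 * pi)\<bar> * (y ^ 6 / 720)"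
    using t by (simp add: abs_mult fact_numeral)
  also have "\<dots> \<le> 1 * (y ^ 6 / 720)" by (intro mult_right_mono abs_cos_le_one) auto
  finally show ?thesis by simp
qed

text \<open>The fourth moment is read off from the Taylor expansion of the characteristic function
  at small t; the remainder of order six gives 24 / 720 = 1 / 30.\<close>

lemma fourth_from_cos:
  assumes x: "x \<in> Lall Gam" and t: "0 < t"
  shows "\<bar>(\<integral>z. x z ^ 4 \<partial>Gam) - 24 / t ^ 4 * ((\<integral>z. cos (t * x z) \<partial>Gam) - 1 + t\<^sup>2 / 2 * (\<integral>z. (x z)\<^sup>2 \<partial>Gam))\<bar> \<le> t\<^sup>2 / 30 * (\<integral>z. x z ^ 6 \<partial>Gam)"
proof -
  have [measurable]: "x \<in> borel_measurable Gam" using x by (rule Lall_measurable)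
  have i: "integrable Gam (\<lambda>z. x z ^ k)" for k by (intro Lall_integrable Lall_power Gam_finite x)
  have ic: "integrable Gam (\<lambda>z. cos (t * x z))" by (rule Gam.integrable_const_bound[of _ 1]) auto
  define R where "R z = cos (t * x z) - (1 - (t * x z)\<^sup>2 / 2 + (t * x z) ^ 4 / 24)" for z
  have iR: "integrable Gam R" unfolding R_def[abs_def] power_mult_distrib using i ic by simp
  have ER: "(\<integral>z. R z \<partial>Gam) = (\<integral>z. cos (t * x z) \<partial>Gam) - (1 - t\<^sup>2 / 2 * (\<integral>z. (x z)\<^sup>2 \<partial>Gam) + t ^ 4 / 24 * (\<integral>z. x z ^ 4 \<partial>Gam))"
    unfolding R_def power_mult_distrib using i ic by (simp add: Gam.prob_space[unfolded space_Gam])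
  then have e: "(\<integral>z. x z ^ 4 \<partial>Gam) - 24 / t ^ 4 * ((\<integral>z. cos (t * x z) \<partial>Gam) - 1 + t\<^sup>2 / 2 * (\<integral>z. (x z)\<^sup>2 \<partial>Gam)) = - (24 / t ^ 4) * (\<integral>z. R z \<partial>Gam)"
  proof -
    have gen: "k * c = e \<Longrightarrow> e - k * (a - 1 + b) = - k * (a - (1 - b + c))" for k c e a b :: real by (simp add: algebra_simps)
    show ?thesis unfolding ER by (rule gen) (use t in simp)
  qed
  have "\<bar>\<integral>z. R z \<partial>Gam\<bar> \<le> (\<integral>z. \<bar>R z\<bar> \<partial>Gam)" by (rule integral_abs_bound)
  also have "\<dots> \<le> (\<integral>z. (t * x z) ^ 6 / 720 \<partial>Gam)"
  proof (rule integral_mono)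
    show "integrable Gam (\<lambda>z. \<bar>R z\<bar>)" using iR by simp
    show "integrable Gam (\<lambda>z. (t * x z) ^ 6 / 720)" using i by (simp add: power_mult_distrib)
    show "\<bar>R z\<bar> \<le> (t * x z) ^ 6 / 720" for z unfolding R_def by (rule cos_taylor)
  qed
  also have "\<dots> = t ^ 6 / 720 * (\<integral>z. x z ^ 6 \<partial>Gam)" by (simp add: power_mult_distrib)
  finally have "24 / t ^ 4 * \<bar>\<integral>z. R z \<partial>Gam\<bar> \<le> 24 / t ^ 4 * (t ^ 6 / 720 * (\<integral>z. x z ^ 6 \<partial>Gam))" using t by (intro mult_left_mono) auto
  also have "\<dots> = t\<^sup>2 / 30 * (\<integral>z. x z ^ 6 \<partial>Gam)" using t by (simp add: field_simps eval_nat_numeral)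
  finally show ?thesis unfolding e using t by (simp add: abs_mult)
qed

text \<open>At fixed t the characteristic functions converge, and the bounded sixth moments make the
  error of \<open>fourth_from_cos\<close> uniform in n, so t can go to 0 afterwards.\<close>

lemma fourth_moment_tendsto:
  assumes x: "\<And>n. x n \<in> Lall Gam" and B: "\<And>n. (\<integral>z. x n z ^ 6 \<partial>Gam) \<le> B"
    and c: "\<And>t. (\<lambda>n. \<integral>z. cos (t * x n z) \<partial>Gam) \<longlonglongrightarrow> exp (- t\<^sup>2 / 2)" and v: "(\<lambda>n. \<integral>z. (x n z)\<^sup>2 \<partial>Gam) \<longlonglongrightarrow> 1"
  shows "(\<lambda>n. \<integral>z. x n z ^ 4 \<partial>Gam) \<longlonglongrightarrow> 3"
proof -
  define t where "t M = 1 / real (Suc M)" for M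
  have t0: "0 < t M" for M by (simp add: t_def)
  have tl: "t \<longlonglongrightarrow> 0" unfolding t_def[abs_def] by (rule LIMSEQ_Suc[OF lim_1_over_n])
  have t2: "(\<lambda>M. (t M)\<^sup>2 / 30 * K) \<longlonglongrightarrow> 0" for K using tendsto_mult_right[OF tendsto_divide[OF tendsto_power[OF tl, of 2] tendsto_const[of 30]], of K] by (simp add: mult.commute)
  have "X (ev 0) = (\<lambda>x. x 0)" by (auto simp: X_ev)
  then have xL: "(\<lambda>x. x 0) \<in> Lall Gam" using X_Lall[of "ev 0"] by simp
  have ecos: "(\<integral>x. cos (s * x 0) \<partial>Gam) = exp (- s\<^sup>2 / 2)" for s
    using E_cos_X[of "s *\<^sub>R ev 0" 0] by (simp add: X_scale X_ev power2_eq_square)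
  show ?thesis
  proof (rule tendsto_approx)
    show "\<forall>\<^sub>F n in sequentially. \<bar>(\<integral>z. x n z ^ 4 \<partial>Gam) - 24 / t M ^ 4 * ((\<integral>z. cos (t M * x n z) \<partial>Gam) - 1 + (t M)\<^sup>2 / 2 * (\<integral>z. (x n z)\<^sup>2 \<partial>Gam))\<bar> \<le> (t M)\<^sup>2 / 30 * B" for M
      by (intro always_eventually allI order_trans[OF fourth_from_cos[OF x t0]] mult_left_mono B) simp
    show "(\<lambda>n. (t M)\<^sup>2 / 30 * B) \<longlonglongrightarrow> (t M)\<^sup>2 / 30 * B" for M by simp
    show "(\<lambda>M. (t M)\<^sup>2 / 30 * B) \<longlonglongrightarrow> 0" by (rule t2)
    show "(\<lambda>n. 24 / t M ^ 4 * ((\<integral>z. cos (t M * x n z) \<partial>Gam) - 1 + (t M)\<^sup>2 / 2 * (\<integral>z. (x n z)\<^sup>2 \<partial>Gam))) \<longlonglongrightarrow> 24 / t M ^ 4 * (exp (- (t M)\<^sup>2 / 2) - 1 + (t M)\<^sup>2 / 2 * 1)" for M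
      by (intro tendsto_mult tendsto_add tendsto_diff tendsto_const c v)
    \<comment> \<open>The same estimate for a standard Gaussian coordinate identifies the
      limit.\<close>
    have "(\<lambda>M. 24 / t M ^ 4 * (exp (- (t M)\<^sup>2 / 2) - 1 + (t M)\<^sup>2 / 2 * 1) - 3) \<longlonglongrightarrow> 0"
    proof (rule Lim_null_comparison[OF always_eventually t2], rule allI)
      fix M
      show "norm (24 / t M ^ 4 * (exp (- (t M)\<^sup>2 / 2) - 1 + (t M)\<^sup>2 / 2 * 1) - 3) \<le> (t M)\<^sup>2 / 30 * (\<integral>x. x 0 ^ 6 \<partial>Gam)"
        using fourth_from_cos[OF xL t0[of M]] unfolding ecos E_coord4 real_norm_def by (simp only: abs_minus_commute)
    qed
    then show "(\<lambda>M. 24 / t M ^ 4 * (exp (- (t M)\<^sup>2 / 2) - 1 + (t M)\<^sup>2 / 2 * 1)) \<longlonglongrightarrow> 3" by (rule LIM_zero_cancel)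
  qed
qed

section \<open>The theorem\<close>

lemma rem_bound:
  assumes C: "\<And>n i. nn (p i) (F n i) (F n i) \<le> C i"
  shows "(\<integral>x. (rem p F m n a x)\<^sup>2 \<partial>Gam) \<le> fact (p (fst a)) * \<bar>C (fst a)\<bar>"
proof (cases "length (snd a) < p (fst a)")
  case True
  let ?q = "p (fst a) - length (snd a)" and ?R = "Rl (F n (fst a)) (m n) (snd a)"
  have "(\<integral>x. (rem p F m n a x)\<^sup>2 \<partial>Gam) = fact ?q * nn ?q ?R ?R"
    using True E_Ik_Ik[of ?q ?R ?q ?R] by (simp add: rem_def power2_eq_square)
  also have "\<dots> \<le> fact ?q * \<bar>C (fst a)\<bar>"
    using nn_Rl_le[of "snd a" ?q "p (fst a)" "F n (fst a)" "m n"] C[of "fst a" n] True by (intro mult_left_mono) auto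
  also have "\<dots> \<le> fact (p (fst a)) * \<bar>C (fst a)\<bar>" by (intro mult_right_mono fact_mono) auto
  finally show ?thesis .
qed (simp add: rem_def)

lemma top_bound:
  assumes C: "\<And>n i. nn (p i) (F n i) (F n i) \<le> C i"
  shows "\<bar>top_coeff p F n a\<bar> \<le> sqrt \<bar>C (fst a)\<bar>"
proof (cases "length (snd a) = p (fst a)")
  case True
  have "(S (F n (fst a)) (cJ (snd a)))\<^sup>2 = nn 0 (Rl (F n (fst a)) 0 (snd a)) (Rl (F n (fst a)) 0 (snd a))"
    by (simp add: nn_Rl power2_eq_square S_mult_S)
  also have "\<dots> \<le> \<bar>C (fst a)\<bar>" using nn_Rl_le[of "snd a" 0 "p (fst a)" "F n (fst a)" 0] C[of "fst a" n] True by simp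
  finally have "sqrt ((S (F n (fst a)) (cJ (snd a)))\<^sup>2) \<le> sqrt \<bar>C (fst a)\<bar>" by (rule real_sqrt_le_mono)
  then show ?thesis using True by (simp add: top_coeff_def)
qed (simp add: top_coeff_def)

text \<open>After the rotation, covariances and top coefficients are bounded for each index, so one
  further subsequence makes all of them converge; the limits of characteristic functions survive
  because the full sequence converges.\<close>

lemma ex_lim_family:
  fixes f :: "nat \<Rightarrow> nat \<Rightarrow> (real \<times> fvec) list"
  assumes d: "1 \<le> d" "d \<le> 3" and C: "\<And>n i. nn (p i) (f n i) (f n i) \<le> C i"
    and g: "\<And>i a. d < p i \<Longrightarrow> 0 < a \<Longrightarrow> a < p i \<Longrightarrow> (\<lambda>n. Cn a (p i - a) (f n i)) \<longlonglongrightarrow> 0"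
    and L: "\<And>v \<theta>. (\<lambda>n. \<integral>x. cos (X v (\<lambda>i. Ik (p i) (f n i) x) + \<theta>) \<partial>Gam) \<longlonglongrightarrow> L v \<theta>"
  obtains F m \<tau> \<epsilon> \<sigma> \<alpha> where "lim_family p d F m C \<tau> \<epsilon> \<sigma> \<alpha>"
    "\<And>v \<theta>. (\<lambda>n. \<integral>x. cos (X v (\<lambda>i. Ik (p i) (F n i) x) + \<theta>) \<partial>Gam) \<longlonglongrightarrow> L v \<theta>"
proof -
  obtain s F \<tau> \<epsilon> where s: "\<And>n. n \<le> s n"
    and F: "\<And>n i. nn (p i) (F n i) (F n i) \<le> C i"
    and Fc: "\<And>n v \<theta>. (\<integral>x. cos (X v (\<lambda>i. Ik (p i) (F n i) x) + \<theta>) \<partial>Gam) = (\<integral>x. cos (X v (\<lambda>i. Ik (p i) (f (s n) i) x) + \<theta>) \<partial>Gam)"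
    and FC: "\<And>n i a r. Cn a r (F n i) = Cn a r (f (s n) i)"
    and t: "\<And>i j. 0 \<le> \<tau> i j" "\<And>i. summable (\<tau> i)"
    "\<And>i. (\<lambda>n. \<Sum>j<n. \<bar>Inf' (p i) (F n i) (ev j) - \<tau> i j\<bar>) \<longlonglongrightarrow> 0"
    and e: "\<And>i. \<epsilon> i \<longlonglongrightarrow> 0"
    and inf: "\<And>i n h. (\<And>k. k < n \<Longrightarrow> coord h k = 0) \<Longrightarrow> Inf' (p i) (F n i) h \<le> \<epsilon> i n * inner h h"
    apply (rule rotated_family[where p=p and f=f and C=C, OF C])
    subgoal premises prems for s F \<tau> \<epsilon> by (rule prems(1)[OF prems(2-)])
    done
  let ?rem = "rem p F (\<lambda>n. n)"
  \<comment> \<open>The sum type lets a single diagonal extraction serve covariances and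
    coefficients.\<close>
  define G where "G n c = (case c of Inl (a, b) \<Rightarrow> \<integral>x. ?rem n a x * ?rem n b x \<partial>Gam | Inr a \<Rightarrow> top_coeff p F n a)"
    for n and c :: "((nat \<times> nat list) \<times> (nat \<times> nat list)) + (nat \<times> nat list)"
  have "\<exists>B. \<forall>n. \<bar>G n c\<bar> \<le> B" for c
  proof (cases c)
    case (Inl ab)
    obtain a b where ab: "ab = (a, b)" by (rule prod.exhaust)
    have "\<bar>G n c\<bar> \<le> sqrt ((fact (p (fst a)) * \<bar>C (fst a)\<bar>) * (fact (p (fst b)) * \<bar>C (fst b)\<bar>))" for n
    proof -
      have "(\<integral>x. ?rem n a x * ?rem n b x \<partial>Gam)\<^sup>2 \<le> (\<integral>x. (?rem n a x)\<^sup>2 \<partial>Gam) * (\<integral>x. (?rem n b x)\<^sup>2 \<partial>Gam)"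
        by (intro CS_integral rem_Lall)
      also have "\<dots> \<le> (fact (p (fst a)) * \<bar>C (fst a)\<bar>) * (fact (p (fst b)) * \<bar>C (fst b)\<bar>)"
        by (rule mult_mono[OF rem_bound[OF F] rem_bound[OF F]]) auto
      finally show ?thesis using real_sqrt_le_mono by (fastforce simp: G_def Inl ab)
    qed
    then show ?thesis by blast
  next
    case (Inr a)
    have "\<bar>top_coeff p F n a\<bar> \<le> sqrt \<bar>C (fst a)\<bar>" for n by (rule top_bound[of p F C, OF F])
    then show ?thesis unfolding G_def Inr sum.case by blast
  qed
  from subseq_all[of G, OF this] obtain r where r: "strict_mono r" and cv: "\<And>c. convergent (\<lambda>n. G (r n) c)" by blast
  have rl: "filterlim r at_top sequentially" using r by (rule filterlim_subseq)
  have sr: "filterlim (\<lambda>n. s (r n)) at_top sequentially"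
    by (rule filterlim_at_top_mono[OF rl]) (use s in auto)
  define \<sigma> where "\<sigma> a b = lim (\<lambda>n. G (r n) (Inl (a, b)))" for a b
  define \<alpha> where "\<alpha> a = lim (\<lambda>n. G (r n) (Inr a))" for a
  \<comment> \<open>The r n-th rotated family is controlled on its first r n coordinates, so r
    itself is the number of leading coordinates.\<close>
  have "lim_family p d (\<lambda>n. F (r n)) r C \<tau> (\<lambda>i n. \<epsilon> i (r n)) \<sigma> \<alpha>"
  proof
    show "(\<lambda>n. \<Sum>j<r n. \<bar>Inf' (p i) (F (r n) i) (ev j) - \<tau> i j\<bar>) \<longlonglongrightarrow> 0" for i
      by (rule filterlim_compose[OF t(3) rl])
    show "(\<lambda>n. \<epsilon> i (r n)) \<longlonglongrightarrow> 0" for i by (rule filterlim_compose[OF e rl])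
    show "(\<lambda>n. Cn a (p i - a) (F (r n) i)) \<longlonglongrightarrow> 0" if "d < p i" "0 < a" "a < p i" for i a
      unfolding FC by (rule filterlim_compose[OF g[OF that] sr])
    show "(\<lambda>n. \<integral>x. rem p (\<lambda>n. F (r n)) r n a x * rem p (\<lambda>n. F (r n)) r n b x \<partial>Gam) \<longlonglongrightarrow> \<sigma> a b" for a b
      using cv[of "Inl (a, b)"] by (simp add: convergent_LIMSEQ_iff G_def \<sigma>_def rem_def)
    show "(\<lambda>n. top_coeff p (\<lambda>n. F (r n)) n a) \<longlonglongrightarrow> \<alpha> a" for a
      using cv[of "Inr a"] by (simp add: convergent_LIMSEQ_iff G_def \<alpha>_def top_coeff_def)
  qed (use d rl F t inf in auto)
  moreover have "(\<lambda>n. \<integral>x. cos (X v (\<lambda>i. Ik (p i) (F (r n) i) x) + \<theta>) \<partial>Gam) \<longlonglongrightarrow> L v \<theta>" for v \<theta>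
    unfolding Fc by (rule filterlim_compose[OF L sr])
  ultimately show thesis by (rule that)
qed

lemma fun_span_Ik:
  assumes "g \<in> fun_span (hermite_products G p)"
  shows "\<exists>f. \<forall>\<omega>. g \<omega> = Ik p f (\<lambda>k. G k \<omega>)"
proof -
  obtain A c where A: "g = (\<lambda>\<omega>. \<Sum>b\<in>A. c b * b \<omega>)" "finite A" "A \<subseteq> hermite_products G p" using assms by (auto simp: fun_span_def)
  have "\<exists>f. \<forall>\<omega>. b \<omega> = Ik p f (\<lambda>k. G k \<omega>)" if "b \<in> A" for b
  proof -
    have "b \<in> hermite_products G p" using A(3) that by blast
    then obtain k where k: "b = (\<lambda>\<omega>. \<Prod>i | k i \<noteq> 0. poly (hermite (k i)) (G i \<omega>))" "finite {i. k i \<noteq> 0}" "(\<Sum>i | k i \<noteq> 0. k i) = p"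
      unfolding hermite_products_def by blast
    obtain f where "\<forall>x. (\<Prod>i | k i \<noteq> 0. poly (hermite (k i)) (x i)) = Ik (\<Sum>i | k i \<noteq> 0. k i) f x"
      using hermite_product_span[OF k(2), of k] by blast
    then show ?thesis using k by auto
  qed
  then obtain fs where fs: "\<And>b \<omega>. b \<in> A \<Longrightarrow> b \<omega> = Ik p (fs b) (\<lambda>k. G k \<omega>)" by metis
  obtain as where as: "set as = A" "distinct as" using finite_distinct_list[OF A(2)] by blast
  have "g \<omega> = Ik p (lc c fs as) (\<lambda>k. G k \<omega>)" for \<omega>
  proof -
    have "Ik p (lc c fs as) (\<lambda>k. G k \<omega>) = (\<Sum>a\<in>A. c a * Ik p (fs a) (\<lambda>k. G k \<omega>))"
      unfolding Ik_def S_lc using as by (simp add: sum_list_distinct_conv_sum_set)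
    also have "\<dots> = g \<omega>" unfolding A(1) using fs by (intro sum.cong refl) simp
    finally show ?thesis by simp
  qed
  then show ?thesis by blast
qed

text \<open>Through this joint law, every expectation of a function of G is computed under
  \<open>Gam\<close>.\<close>

lemma Gam_distr:
  assumes "prob_space M" "prob_space.indep_vars M (\<lambda>_. borel) G UNIV" "\<And>i. distributed M lborel (G i) std_normal_density"
  shows "(\<lambda>\<omega> k. G k \<omega>) \<in> measurable M Gam" "distr M Gam (\<lambda>\<omega> k. G k \<omega>) = Gam"
proof -
  interpret prob_space M by fact
  have [measurable]: "G i \<in> borel_measurable M" for i using distributed_measurable[OF assms(3), of i] by simp
  show m: "(\<lambda>\<omega> k. G k \<omega>) \<in> measurable M Gam" by (rule measurable_GamI) simp
  have d: "distr M borel (G i) = std_normal_distribution" for i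
  proof -
    have "distr M borel (G i) = distr M lborel (G i)" by (rule distr_cong) auto
    then show ?thesis using assms(3)[of i] by (simp add: distributed_def)
  qed
  have "distr M (\<Pi>\<^sub>M i\<in>UNIV. borel) (\<lambda>x. \<lambda>i\<in>UNIV. G i x) = (\<Pi>\<^sub>M i\<in>UNIV. distr M borel (G i))"
    using assms(2) by (subst indep_vars_iff_distr_eq_PiM[symmetric]) auto
  then have "distr M (\<Pi>\<^sub>M i\<in>UNIV. borel) (\<lambda>x i. G i x) = Gam" by (simp add: d Gam_def restrict_def)
  moreover have "distr M Gam (\<lambda>\<omega> k. G k \<omega>) = distr M (\<Pi>\<^sub>M i\<in>UNIV. borel) (\<lambda>x i. G i x)"
    by (rule distr_cong) (auto simp: Gam_def intro!: sets_PiM_cong)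
  ultimately show "distr M Gam (\<lambda>\<omega> k. G k \<omega>) = Gam" by simp
qed

theorem theorem1p7:
  fixes M :: "'a measure" and N :: "'b measure"
    and G :: "nat \<Rightarrow> 'a \<Rightarrow> real"
    and F :: "nat \<Rightarrow> nat \<Rightarrow> 'a \<Rightarrow> real"
    and F_inf :: "nat \<Rightarrow> 'b \<Rightarrow> real"
    and d :: nat
  assumes "prob_space M"
    and "prob_space.indep_vars M (\<lambda>_. borel) G UNIV"
    and "\<And>i. distributed M lborel (G i) std_normal_density"
    and "d \<in> {1, 2, 3}"
    and "admissible M G d F"
    and "prob_space N"
    and "\<And>i. F_inf i \<in> borel_measurable N"
    and "fdd_converges M F N F_inf"
  shows "\<exists>Y :: nat \<Rightarrow> 'a \<Rightarrow> real.
    (\<forall>i. Y i \<in> wiener_chaos_upto M G d) \<and> law N F_inf = law M Y"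
proof -
  interpret M: prob_space M by fact
  let ?G = "\<lambda>\<omega> k. G k \<omega>"
  note Gm[measurable] = Gam_distr(1)[OF assms(1-3)] and Gd = Gam_distr(2)[OF assms(1-3)]
  have push: "(\<integral>\<omega>. \<phi> (?G \<omega>) \<partial>M) = (\<integral>x. (\<phi> x :: real) \<partial>Gam)" if [measurable]: "\<phi> \<in> borel_measurable Gam" for \<phi>
    using integral_distr[OF Gm that] unfolding Gd by simp
  have pushi: "integrable M (\<lambda>\<omega>. \<phi> (?G \<omega>))" if "integrable Gam \<phi>" for \<phi> :: "_ \<Rightarrow> real"
  proof -
    have "integrable (distr M Gam ?G) \<phi>" unfolding Gd by fact
    then show ?thesis by (rule integrable_distr[OF Gm])
  qed
  have pushL2: "(\<lambda>\<omega>. \<phi> (?G \<omega>)) \<in> L2 M" if [measurable]: "\<phi> \<in> borel_measurable Gam" and "integrable Gam (\<lambda>x. (\<phi> x)\<^sup>2)" for \<phi>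
    using pushi[OF that(2)] by (simp add: L2_def)
  have d: "1 \<le> d" "d \<le> 3" using assms(4) by auto
  obtain p where FW: "\<And>n i. F n i \<in> wiener_chaos M G (p i)" and F1: "\<And>n i. (\<integral>\<omega>. (F n i \<omega>)\<^sup>2 \<partial>M) = 1"
    and Fg: "\<And>i. d < p i \<Longrightarrow> weak_conv_m (\<lambda>n. distr M borel (F n i)) std_normal_distribution"
    using assms(5) unfolding admissible_def by (metis not_le)
  have FL: "F n i \<in> L2 M" for n i using FW[of n i] by (simp add: wiener_chaos_def L2_closed_span_def)
  have Fm[measurable]: "F n i \<in> borel_measurable M" for n i using FL[of n i] by (simp add: L2_def)
  have iL2: "integrable M (\<lambda>\<omega>. (h \<omega>)\<^sup>2)" if "h \<in> L2 M" for h using that by (simp add: L2_def)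
  \<comment> \<open>An accuracy that vanishes with n, so that the approximating lists have the same
    limit in law as F.\<close>
  define e where "e n = 1 / real (Suc n)" for n
  have e0: "e \<longlonglongrightarrow> 0" unfolding e_def[abs_def] by (rule LIMSEQ_Suc[OF lim_1_over_n])
  have "\<exists>f. sqrt (\<integral>\<omega>. (F n i \<omega> - Ik (p i) f (?G \<omega>))\<^sup>2 \<partial>M) < e n" for n i
  proof -
    have "0 < e n" by (simp add: e_def)
    then obtain g where g: "g \<in> fun_span (hermite_products G (p i))" "sqrt (\<integral>\<omega>. (F n i \<omega> - g \<omega>)\<^sup>2 \<partial>M) < e n"
      using FW[of n i] unfolding wiener_chaos_def L2_closed_span_def by blast
    then show ?thesis using fun_span_Ik[OF g(1)] by auto
  qed
  then obtain f where f: "\<And>n i. sqrt (\<integral>\<omega>. (F n i \<omega> - Ik (p i) (f n i) (?G \<omega>))\<^sup>2 \<partial>M) < e n" by metis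
  define I where "I n i \<omega> = Ik (p i) (f n i) (?G \<omega>)" for n i \<omega>
  have IkL2: "integrable Gam (\<lambda>x. (Ik k g x)\<^sup>2)" for k g by (intro Lall_integrable Lall_power Ik_Lall Gam_finite)
  have IL: "I n i \<in> L2 M" for n i unfolding I_def[abs_def] by (rule pushL2[OF Ik_measurable IkL2])
  have Im[measurable]: "I n i \<in> borel_measurable M" for n i using IL[of n i] by (simp add: L2_def)
  have fe: "sqrt (\<integral>\<omega>. (F n i \<omega> - I n i \<omega>)\<^sup>2 \<partial>M) < e n" for n i using f by (simp add: I_def)
  have EI: "(\<integral>\<omega>. (I n i \<omega>)\<^sup>2 \<partial>M) = fact (p i) * nn (p i) (f n i) (f n i)" for n i
    unfolding I_def by (subst push) (simp_all add: E_Ik_Ik[of "p i" "f n i" "p i" "f n i", unfolded power2_eq_square[symmetric]])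
  have iFI: "integrable M (\<lambda>\<omega>. (F n i \<omega> - I n i \<omega>)\<^sup>2)" for n i by (rule L2_diff_le(1)[OF FL IL FL IL])
  have var: "\<bar>(\<integral>\<omega>. (I n i \<omega>)\<^sup>2 \<partial>M) - 1\<bar> \<le> 3 * e n" for n i
  proof -
    define D where "D = (\<integral>\<omega>. (F n i \<omega> - I n i \<omega>)\<^sup>2 \<partial>M)"
    have D0: "0 \<le> D" unfolding D_def by (rule Bochner_Integration.integral_nonneg) simp
    have e1: "0 < e n" "e n \<le> 1" by (auto simp: e_def)
    have De: "D < (e n)\<^sup>2" using fe[of n i] e1 D0 unfolding D_def[symmetric] by (metis real_sqrt_less_iff real_sqrt_unique less_imp_le)
    have "(e n)\<^sup>2 \<le> e n" using e1 mult_left_mono[of "e n" 1 "e n"] by (simp add: power2_eq_square)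
    have i1: "integrable M (\<lambda>\<omega>. F n i \<omega> * (F n i \<omega> - I n i \<omega>))"
    proof (rule Bochner_Integration.integrable_bound[of _ "\<lambda>\<omega>. (F n i \<omega>)\<^sup>2 + (F n i \<omega> - I n i \<omega>)\<^sup>2"])
      show "integrable M (\<lambda>\<omega>. (F n i \<omega>)\<^sup>2 + (F n i \<omega> - I n i \<omega>)\<^sup>2)" using iL2[OF FL] iFI by auto
      have "\<bar>s * t\<bar> \<le> s\<^sup>2 + t\<^sup>2" for s t :: real
        using sum_squares_bound[of "\<bar>s\<bar>" "\<bar>t\<bar>"] abs_ge_zero[of "s * t"] unfolding abs_mult mult.assoc power2_abs by linarith
      then show "AE \<omega> in M. norm (F n i \<omega> * (F n i \<omega> - I n i \<omega>)) \<le> norm ((F n i \<omega>)\<^sup>2 + (F n i \<omega> - I n i \<omega>)\<^sup>2)" by auto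
    qed measurable
    define B where "B = (\<integral>\<omega>. F n i \<omega> * (F n i \<omega> - I n i \<omega>) \<partial>M)"
    \<comment> \<open>The second moment of F + s (F - I) as a quadratic in s; the choices s = 1 / e
      n and s = - 1 / e n bound the mixed moment B by \<open>e n\<close>.\<close>
    have q: "0 \<le> 1 + 2 * s * B + s\<^sup>2 * D" for s
    proof -
      have "(\<integral>\<omega>. (F n i \<omega> + s * (F n i \<omega> - I n i \<omega>))\<^sup>2 \<partial>M) = (\<integral>\<omega>. (F n i \<omega>)\<^sup>2 + 2 * s * (F n i \<omega> * (F n i \<omega> - I n i \<omega>)) + s\<^sup>2 * (F n i \<omega> - I n i \<omega>)\<^sup>2 \<partial>M)"
        by (intro Bochner_Integration.integral_cong refl) (simp add: power2_eq_square algebra_simps)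
      also have "\<dots> = 1 + 2 * s * B + s\<^sup>2 * D" using iL2[OF FL, of n i] iFI[of n i] i1 by (simp add: F1 B_def D_def)
      finally show ?thesis using Bochner_Integration.integral_nonneg[of M "\<lambda>\<omega>. (F n i \<omega> + s * (F n i \<omega> - I n i \<omega>))\<^sup>2"] by simp
    qed
    have Be: "\<bar>B\<bar> \<le> e n"
    proof -
      have D': "(1 / e n)\<^sup>2 * D \<le> 1"
      proof -
        have "(1 / e n)\<^sup>2 * D \<le> (1 / e n)\<^sup>2 * (e n)\<^sup>2" using De by (intro mult_left_mono) auto
        also have "\<dots> = 1" using e1 by (simp add: power2_eq_square)
        finally show ?thesis .
      qed
      have "- 1 \<le> 1 / e n * B" "1 / e n * B \<le> 1" using q[of "1 / e n"] q[of "- (1 / e n)"] D' by auto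
      then show ?thesis using e1 by (simp add: field_simps abs_le_iff)
    qed
    have "(\<integral>\<omega>. (I n i \<omega>)\<^sup>2 \<partial>M) = (\<integral>\<omega>. (F n i \<omega>)\<^sup>2 - 2 * (F n i \<omega> * (F n i \<omega> - I n i \<omega>)) + (F n i \<omega> - I n i \<omega>)\<^sup>2 \<partial>M)"
      by (intro Bochner_Integration.integral_cong refl) (simp add: power2_eq_square algebra_simps)
    also have "\<dots> = 1 - 2 * B + D" using iL2[OF FL, of n i] iFI[of n i] i1 by (simp add: F1 B_def D_def)
    finally show ?thesis using Be De D0 \<open>(e n)\<^sup>2 \<le> e n\<close> by simp
  qed
  have e1: "e n \<le> 1" for n by (simp add: e_def)
  \<comment> \<open>The variance of the approximant is at most 1 + 3 e n <= 4, and p! >= 1.\<close>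
  have C: "nn (p i) (f n i) (f n i) \<le> 4" for n i
  proof -
    have "fact (p i) * nn (p i) (f n i) (f n i) \<le> 4" using var[of n i] e1[of n] unfolding EI by linarith
    moreover have "1 * nn (p i) (f n i) (f n i) \<le> fact (p i) * nn (p i) (f n i) (f n i)"
      by (intro mult_right_mono fact_ge_1 nn_nonneg)
    ultimately show ?thesis by simp
  qed
  have cosdiff: "(\<lambda>n. (\<integral>\<omega>. cos (X v (\<lambda>i. F n i \<omega>) + \<theta>) \<partial>M) - (\<integral>x. cos (X v (\<lambda>i. Ik (p i) (f n i) x) + \<theta>) \<partial>Gam)) \<longlonglongrightarrow> 0" for v \<theta>
  proof (rule Lim_null_comparison[OF always_eventually], rule allI)
    have "(\<lambda>n. \<Sum>i\<in>supp v. \<bar>coord v i\<bar> * e n) \<longlonglongrightarrow> (\<Sum>i\<in>supp v. \<bar>coord v i\<bar> * 0)" by (intro tendsto_intros e0)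
    then show "(\<lambda>n. \<Sum>i\<in>supp v. \<bar>coord v i\<bar> * e n) \<longlonglongrightarrow> 0" by simp
    fix n
    have "(\<integral>x. cos (X v (\<lambda>i. Ik (p i) (f n i) x) + \<theta>) \<partial>Gam) = (\<integral>\<omega>. cos (X v (\<lambda>i. I n i \<omega>) + \<theta>) \<partial>M)"
      unfolding I_def by (rule push[symmetric]) (simp add: X_def)
    moreover have "\<bar>(\<integral>\<omega>. cos (X v (\<lambda>i. F n i \<omega>) + \<theta>) \<partial>M) - (\<integral>\<omega>. cos (X v (\<lambda>i. I n i \<omega>) + \<theta>) \<partial>M)\<bar> \<le> (\<Sum>i\<in>supp v. \<bar>coord v i\<bar> * sqrt (\<integral>\<omega>. (F n i \<omega> - I n i \<omega>)\<^sup>2 \<partial>M))"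
      by (rule cos_L2_le[OF assms(1) Fm Im iFI])
    moreover have "\<dots> \<le> (\<Sum>i\<in>supp v. \<bar>coord v i\<bar> * e n)" by (intro sum_mono mult_left_mono less_imp_le[OF fe]) auto
    ultimately show "norm ((\<integral>\<omega>. cos (X v (\<lambda>i. F n i \<omega>) + \<theta>) \<partial>M) - (\<integral>x. cos (X v (\<lambda>i. Ik (p i) (f n i) x) + \<theta>) \<partial>Gam)) \<le> (\<Sum>i\<in>supp v. \<bar>coord v i\<bar> * e n)" by simp
  qed
  \<comment> \<open>Convergence in law to a standard Gaussian, together with bounded higher moments,
    makes the fourth cumulant vanish; \<open>fourth_moment_lower\<close> bounds the contractions by
    it.\<close>
  have gauss: "(\<lambda>n. Cn a (p i - a) (f n i)) \<longlonglongrightarrow> 0" if i: "d < p i" and a: "0 < a" "a < p i" for i a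
  proof -
    have EIG: "(\<integral>x. (Ik (p i) (f n i) x)\<^sup>2 \<partial>Gam) = (\<integral>\<omega>. (I n i \<omega>)\<^sup>2 \<partial>M)" for n
      unfolding I_def by (rule push[symmetric]) measurable
    have v: "(\<lambda>n. \<integral>x. (Ik (p i) (f n i) x)\<^sup>2 \<partial>Gam) \<longlonglongrightarrow> 1"
    proof (rule LIM_zero_cancel, rule Lim_null_comparison[OF always_eventually], rule allI)
      show "(\<lambda>n. 3 * e n) \<longlonglongrightarrow> 0" using tendsto_mult_left[OF e0, of 3] by simp
      show "norm ((\<integral>x. (Ik (p i) (f n i) x)\<^sup>2 \<partial>Gam) - 1) \<le> 3 * e n" for n unfolding EIG using var[of n i] by simp
    qed
    have c: "(\<lambda>n. \<integral>x. cos (t * Ik (p i) (f n i) x) \<partial>Gam) \<longlonglongrightarrow> exp (- t\<^sup>2 / 2)" for t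
    proof -
      have Xv: "X (t *\<^sub>R ev i) g = t * g i" for g by (simp add: X_scale X_ev)
      have "(\<lambda>n. integral\<^sup>L (distr M borel (F n i)) (\<lambda>x. cos (t * x))) \<longlonglongrightarrow> integral\<^sup>L std_normal_distribution (\<lambda>x. cos (t * x))"
      proof (rule weak_conv_imp_integral_bdd_continuous_conv[OF _ _ Fg[OF i], where B=1])
        show "real_distribution (distr M borel (F n i))" for n by (rule M.real_distribution_distr) simp
        show "real_distribution std_normal_distribution" by (rule real_dist_normal_dist)
      qed auto
      moreover have "integral\<^sup>L std_normal_distribution (\<lambda>x. cos (t * x)) = exp (- t\<^sup>2 / 2)"
        using integral_coord[of "\<lambda>x. cos (t * x)" 0] E_cos_X[of "t *\<^sub>R ev 0" 0] by (simp add: X_scale X_ev power2_eq_square)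
      ultimately have "(\<lambda>n. \<integral>\<omega>. cos (X (t *\<^sub>R ev i) (\<lambda>i. F n i \<omega>) + 0) \<partial>M) \<longlonglongrightarrow> exp (- t\<^sup>2 / 2)"
        unfolding Xv by (simp add: integral_distr)
      from tendsto_diff[OF this cosdiff[of "t *\<^sub>R ev i" 0]] show ?thesis unfolding Xv by simp
    qed
    obtain K where K: "\<And>g. (\<integral>x. Ik (p i) g x ^ 8 \<partial>Gam) \<le> K * (\<integral>x. (Ik (p i) g x)\<^sup>2 \<partial>Gam) ^ 4" using Ik_eighth[of "p i"] by blast
    have ip: "integrable Gam (\<lambda>x. Ik (p i) g x ^ k)" for g k by (intro Lall_integrable Lall_power Ik_Lall Gam_finite)
    have B: "(\<integral>x. Ik (p i) (f n i) x ^ 6 \<partial>Gam) \<le> 1 + \<bar>K\<bar> * 4 ^ 4" for n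
    proof -
      \<comment> \<open>The sixth moment is bounded through the eighth, the one that
        hypercontractivity applied twice delivers.\<close>
      have "y ^ 6 \<le> 1 + y ^ 8" for y :: real
      proof (cases "\<bar>y\<bar> \<le> 1")
        case True
        then have "\<bar>y\<bar> ^ 6 \<le> 1" by (intro power_le_one) auto
        moreover have "0 \<le> y ^ 8" by simp
        ultimately show ?thesis unfolding power_even_abs[of 6 y, OF even_numeral] by linarith
      next
        case False
        then have "\<bar>y\<bar> ^ 6 \<le> \<bar>y\<bar> ^ 8" by (intro power_increasing) auto
        then show ?thesis by (simp add: power_even_abs)
      qed
      then have "(\<integral>x. Ik (p i) (f n i) x ^ 6 \<partial>Gam) \<le> (\<integral>x. 1 + Ik (p i) (f n i) x ^ 8 \<partial>Gam)"
        by (intro integral_mono) (use ip in auto)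
      also have "\<dots> = 1 + (\<integral>x. Ik (p i) (f n i) x ^ 8 \<partial>Gam)" using ip by (simp add: Gam.prob_space[unfolded space_Gam])
      also have "\<dots> \<le> 1 + \<bar>K\<bar> * 4 ^ 4"
      proof -
        define V where "V = (\<integral>x. (Ik (p i) (f n i) x)\<^sup>2 \<partial>Gam)"
        have V: "0 \<le> V" unfolding V_def by (intro Bochner_Integration.integral_nonneg) simp
        have V4: "V \<le> 4" using var[of n i] e1[of n] unfolding V_def EIG by linarith
        have "K * V ^ 4 \<le> \<bar>K\<bar> * V ^ 4" by (intro mult_right_mono) auto
        also have "\<dots> \<le> \<bar>K\<bar> * 4 ^ 4" by (intro mult_left_mono power_mono V V4) auto
        finally show ?thesis using K[of "f n i"] by (simp add: V_def)
      qed
      finally show ?thesis .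
    qed
    have 4: "(\<lambda>n. \<integral>x. Ik (p i) (f n i) x ^ 4 \<partial>Gam) \<longlonglongrightarrow> 3" by (rule fourth_moment_tendsto[OF Ik_Lall B c v])
    have "(\<lambda>n. (\<integral>x. Ik (p i) (f n i) x ^ 4 \<partial>Gam) - 3 * (\<integral>x. (Ik (p i) (f n i) x)\<^sup>2 \<partial>Gam)\<^sup>2) \<longlonglongrightarrow> 3 - 3 * 1\<^sup>2"
      by (intro tendsto_intros 4 v)
    moreover have "Cn a (p i - a) (f n i) \<le> (\<integral>x. Ik (p i) (f n i) x ^ 4 \<partial>Gam) - 3 * (\<integral>x. (Ik (p i) (f n i) x)\<^sup>2 \<partial>Gam)\<^sup>2" for n
      using fourth_moment_lower[OF a, of "f n i"] by (simp only: EIG EI)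
    ultimately show ?thesis by (intro tendsto0I[OF _ Cn_nonneg]) auto
  qed
  define L where "L v \<theta> = (\<integral>\<omega>. cos (X v (\<lambda>i. F_inf i \<omega>) + \<theta>) \<partial>N)" for v \<theta>
  have lim: "(\<lambda>n. \<integral>x. cos (X v (\<lambda>i. Ik (p i) (f n i) x) + \<theta>) \<partial>Gam) \<longlonglongrightarrow> L v \<theta>" for v \<theta>
  proof -
    \<comment> \<open>A bounded continuous test function of the finitely many components in
      \<open>supp v\<close>, as the notion of convergence demands.\<close>
    let ?\<phi> = "\<lambda>z. cos ((\<Sum>i\<in>supp v. coord v i * z i) + \<theta>)"
    have c: "continuous_map (powertop_real (supp v)) euclideanreal ?\<phi>"
    proof -
      have "continuous_map (powertop_real (supp v)) euclideanreal (\<lambda>z. (\<Sum>i\<in>supp v. coord v i * z i) + \<theta>)"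
        by (intro continuous_map_add continuous_map_sum continuous_map_real_mult_left continuous_map_product_projection) auto
      then have "continuous_map (powertop_real (supp v)) euclideanreal (cos \<circ> (\<lambda>z. (\<Sum>i\<in>supp v. coord v i * z i) + \<theta>))"
        by (rule continuous_map_compose) (simp add: continuous_on_cos)
      then show ?thesis unfolding comp_def .
    qed
    have bd: "bounded (?\<phi> ` topspace (powertop_real (supp v)))"
      by (rule boundedI[of _ 1]) auto
    have "(\<lambda>n. \<integral>\<omega>. ?\<phi> (\<lambda>i\<in>supp v. F n i \<omega>) \<partial>M) \<longlonglongrightarrow> (\<integral>\<omega>. ?\<phi> (\<lambda>i\<in>supp v. F_inf i \<omega>) \<partial>N)"
      by (rule assms(8)[unfolded fdd_converges_def, rule_format, OF conjI[OF finite_supp conjI[OF c bd]]])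
    moreover have "(\<Sum>i\<in>supp v. coord v i * (\<lambda>i\<in>supp v. g i) i) = X v g" for g unfolding X_def by (rule sum.cong) auto
    ultimately have "(\<lambda>n. \<integral>\<omega>. cos (X v (\<lambda>i. F n i \<omega>) + \<theta>) \<partial>M) \<longlonglongrightarrow> L v \<theta>"
      unfolding L_def by (simp only:)
    from tendsto_diff[OF this cosdiff[of v \<theta>]] show ?thesis by simp
  qed
  obtain H m \<tau> \<epsilon> \<sigma> \<alpha> where H: "lim_family p d H m (\<lambda>_. 4) \<tau> \<epsilon> \<sigma> \<alpha>"
    and HL: "\<And>v \<theta>. (\<lambda>n. \<integral>x. cos (X v (\<lambda>i. Ik (p i) (H n i) x) + \<theta>) \<partial>Gam) \<longlonglongrightarrow> L v \<theta>"
    apply (rule ex_lim_family[of d p f "\<lambda>_. 4" L, OF d C _ lim])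
    subgoal by (rule gauss; assumption)
    subgoal premises prems by (rule prems(1)[OF prems(2-)])
    done
  interpret lim_family p d H m "\<lambda>_. 4" \<tau> \<epsilon> \<sigma> \<alpha> by (rule H)
  obtain Y where Y: "\<And>i r. r \<le> p i \<Longrightarrow> Y i r \<in> borel_measurable Gam" "\<And>i r. r \<le> p i \<Longrightarrow> integrable Gam (\<lambda>x. (Y i r x)\<^sup>2)"
    "\<And>i r. r \<le> p i \<Longrightarrow> (\<lambda>M. \<integral>x. (Yr i r M x - Y i r x)\<^sup>2 \<partial>Gam) \<longlonglongrightarrow> 0"
    and YL: "\<And>v \<theta>. (\<lambda>n. \<integral>x. cos (X v (\<lambda>i. Ik (p i) (H n i) x) + \<theta>) \<partial>Gam) \<longlonglongrightarrow> (\<integral>z. cos (X v (\<lambda>i. \<Sum>r\<le>p i. Y i r z) + \<theta>) \<partial>Gam)"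
    apply (rule limit_vector)
    subgoal premises prems by (rule prems(1)[OF prems(2-)])
    done
  define W where "W i \<omega> = (\<Sum>r\<le>p i. Y i r (?G \<omega>))" for i \<omega>
  have W: "W i \<in> wiener_chaos_upto M G d" for i
    unfolding W_def[abs_def]
  proof (rule wiener_chaos_upto_sum[where k = "od i"])
    fix r assume "r \<in> {..p i}"
    then have r: "r \<le> p i" by simp
    show "od i r \<le> d" by (rule od_le[OF r])
    show "(\<lambda>\<omega>. Y i r (?G \<omega>)) \<in> wiener_chaos M G (od i r)"
      unfolding wiener_chaos_def
    proof (rule L2_closed_span_limit[where f = "\<lambda>M' \<omega>. Yr i r M' (?G \<omega>)"])
      show "(\<lambda>\<omega>. Y i r (?G \<omega>)) \<in> L2 M" by (rule pushL2[OF Y(1,2)[OF r]])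
      show "(\<lambda>\<omega>. Yr i r n (?G \<omega>)) \<in> fun_span (hermite_products G (od i r))" for n by (rule Yr_span[OF r])
      show "(\<lambda>\<omega>. Yr i r n (?G \<omega>)) \<in> L2 M" for n
        by (rule pushL2[OF Yr_measurable]) (intro Lall_integrable Lall_power Yr_Lall Gam_finite)
      note [measurable] = Y(1)[OF r]
      have "(\<integral>\<omega>. (Yr i r n (?G \<omega>) - Y i r (?G \<omega>))\<^sup>2 \<partial>M) = (\<integral>x. (Yr i r n x - Y i r x)\<^sup>2 \<partial>Gam)" for n
        by (rule push) measurable
      then show "(\<lambda>n. \<integral>\<omega>. (Yr i r n (?G \<omega>) - Y i r (?G \<omega>))\<^sup>2 \<partial>M) \<longlonglongrightarrow> 0" using Y(3)[OF r] by simp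
    qed
  qed simp
  have Ym: "(\<lambda>z. \<Sum>r\<le>p i. Y i r z) \<in> borel_measurable Gam" for i by (intro borel_measurable_sum Y) auto
  have "law N F_inf = law M W"
  proof (rule law_eqI[OF assms(6,7,1)])
    show "W i \<in> borel_measurable M" for i unfolding W_def[abs_def] by (rule measurable_compose[OF Gm Ym])
    fix v \<theta>
    \<comment> \<open>Uniqueness of the limit along H: its characteristic functions converge both to
      those of the given limit and to those of the constructed vector.\<close>
    have "L v \<theta> = (\<integral>z. cos (X v (\<lambda>i. \<Sum>r\<le>p i. Y i r z) + \<theta>) \<partial>Gam)" by (rule LIMSEQ_unique[OF HL YL])
    also have "\<dots> = (\<integral>\<omega>. cos (X v (\<lambda>i. W i \<omega>) + \<theta>) \<partial>M)"
      unfolding W_def using Ym by (intro push[symmetric]) (simp add: X_def)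
    finally show "(\<integral>\<omega>. cos (X v (\<lambda>i. F_inf i \<omega>) + \<theta>) \<partial>N) = (\<integral>\<omega>. cos (X v (\<lambda>i. W i \<omega>) + \<theta>) \<partial>M)" by (simp add: L_def)
  qed
  then show ?thesis using W by blast
qed

end
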